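(* Let $m>0$, $q\in\mathbf{R}\setminus\{0\}$, $T>0$, and let $B\in L^\infty(\mathbf{R})$ be real-valued with $B(t+T)=B(t)$. Let $\zeta_1,\zeta_2$ be the solutions of Hill's equation $\zeta_j''(t)+\left(\frac{qB(t)}{2m}\right)^2\zeta_j(t)=0$ with $\zeta_1(0)=1,\ \zeta_1'(0)=0,\ \zeta_2(0)=0,\ \zeta_2'(0)=1$. Assume that $\zeta_1,\zeta_1',\zeta_2,\zeta_2'$ are continuous on $[0,T)$; that for every $N\in\mathbf{Z}$ there are numbers $A_{1,N},A_{2,N},A_{3,N},A_{4,N}$ such that for all $t\in[0,T)$ $$\zeta_1(t+NT)=A_{1,N}\zeta_1(t)+A_{2,N}\zeta_2(t),\qquad \zeta_2(t+NT)=A_{3,N}\zeta_1(t)+A_{4,N}\zeta_2(t);$$ and that there are $\lambda_0>0$, $\tilde\lambda\le\lambda_0$, $0<c_3<C_3$, $0<c_4<C_4$ such that, for all sufficiently large $N\in\mathbf{N}$, $$c_3e^{\lambda_0N}\le|A_{3,N}|\le C_3e^{\lambda_0N},\qquad c_4e^{\tilde\lambda N}\le|A_{4,N}|\le C_4e^{\tilde\lambda N}.$$ Let $V:\mathbf{R}^2\to\mathbf{R}$ be continuous and bounded, and assume there is $p>4$ such that $\rho_1:=|V|^{1/2}$ and $\rho_2:=\mathrm{sign}(V)|V|^{1/2}$ belong to $L^p(\mathbf{R}^2)$. Then the singular continuous spectrum of the monodromy operator $U(T,0)$ (a unitary operator on $L^2(\mathbf{R}^2)$) is empty, where $U(t,s)$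 is the propagator for $H(t)=H_0(t)+V$.
   Context: For $x=(x_1,x_2)\in\mathbf{R}^2$ and $p=-i(\partial_1,\partial_2)$, the free Hamiltonian is $H_0(t)=\frac{1}{2m}(p-qA(t,x))^2$ on $L^2(\mathbf{R}^2)$, with $A(t,x)=\frac12(-B(t)x_2,B(t)x_1)$. $V$ also denotes the operator of multiplication by $V(x)$, and $H(t)=H_0(t)+V$. The propagator $U(t,s)$, $(t,s)\in\mathbf{R}^2$, for $H(t)$ is the strongly continuous family of unitary operators on $L^2(\mathbf{R}^2)$ with $i\partial_tU(t,s)=H(t)U(t,s)$, $i\partial_sU(t,s)=-U(t,s)H(s)$, $U(t,\theta)U(\theta,s)=U(t,s)$, $U(s,s)=\mathrm{Id}$; its unique existence is known. *)

theory Defs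
  imports "HOL-Analysis.Analysis"
begin

section \<open>The complex Hilbert space of square-integrable functions on the plane\<close>

definition square_integrable :: "(real^2 \<Rightarrow> complex) \<Rightarrow> bool" where
  "square_integrable f \<longleftrightarrow>
     f \<in> borel_measurable lborel \<and> integrable lborel (\<lambda>x. (cmod (f x))\<^sup>2)"

definition ae_equal :: "(real^2 \<Rightarrow> complex) \<Rightarrow> (real^2 \<Rightarrow> complex) \<Rightarrow> bool" where
  "ae_equal f g \<longleftrightarrow>
     square_integrable f \<and> square_integrable g \<and> (AE x in lborel. f x = g x)"

lemma square_integrable_zero: "square_integrable (\<lambda>x. 0)"
  by (simp add: square_integrable_def)

quotient_type L2 = "real^2 \<Rightarrow> complex" / partial: ae_equal
proof (rule part_equivpI)
  show "\<exists>f. ae_equal f f"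
    using square_integrable_zero by (auto simp: ae_equal_def)
  show "symp ae_equal"
    by (rule sympI) (simp add: ae_equal_def eq_commute)
  show "transp ae_equal"
  proof (rule transpI)
    fix f g h assume "ae_equal f g" "ae_equal g h"
    then have "AE x in lborel. f x = g x" "AE x in lborel. g x = h x"
      by (simp_all add: ae_equal_def)
    then have "AE x in lborel. f x = h x"
      by eventually_elim simp
    with \<open>ae_equal f g\<close> \<open>ae_equal g h\<close> show "ae_equal f h"
      by (simp add: ae_equal_def)
  qed
qed

lemma square_integrable_mult:
  assumes "square_integrable f" "square_integrable g"
  shows "integrable lborel (\<lambda>x. cnj (f x) * g x)"
proof (rule Bochner_Integration.integrable_bound)
  show "integrable lborel (\<lambda>x. (cmod (f x))\<^sup>2 + (cmod (g x))\<^sup>2)"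
    using assms by (auto simp: square_integrable_def)
  show "(\<lambda>x. cnj (f x) * g x) \<in> borel_measurable lborel"
  proof -
    have "f \<in> borel_measurable lborel" "g \<in> borel_measurable lborel"
      using assms by (auto simp: square_integrable_def)
    moreover have "cnj \<in> borel_measurable borel"
      by (intro borel_measurable_continuous_onI continuous_intros)
    ultimately show ?thesis by (auto intro!: borel_measurable_times measurable_compose[of f _ _ cnj])
  qed
  have "a * b \<le> a\<^sup>2 + b\<^sup>2" if "0 \<le> a" "0 \<le> b" for a b :: real
  proof -
    have "2 * (a * b) \<le> a\<^sup>2 + b\<^sup>2" using sum_squares_bound[of a b] by simp
    moreover have "0 \<le> a * b" using that by simp
    ultimately show ?thesis by linarith
  qed
  then show "AE x in lborel. norm (cnj (f x) * g x) \<le> norm ((cmod (f x))\<^sup>2 + (cmod (g x))\<^sup>2)"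
    by (simp add: norm_mult)
qed

lemma square_integrable_scale:
  "square_integrable f \<Longrightarrow> square_integrable (\<lambda>x. c * f x)"
  by (auto simp: square_integrable_def norm_mult power_mult_distrib)

lemma square_integrable_add:
  assumes "square_integrable f" "square_integrable g"
  shows "square_integrable (\<lambda>x. f x + g x)"
proof -
  have m: "f \<in> borel_measurable lborel" "g \<in> borel_measurable lborel"
    using assms by (auto simp: square_integrable_def)
  have "integrable lborel (\<lambda>x. (cmod (f x + g x))\<^sup>2)"
  proof (rule Bochner_Integration.integrable_bound)
    show "integrable lborel (\<lambda>x. 2 * (cmod (f x))\<^sup>2 + 2 * (cmod (g x))\<^sup>2)"
      using assms by (auto simp: square_integrable_def)
    have "(cmod (a + b))\<^sup>2 \<le> 2 * (cmod a)\<^sup>2 + 2 * (cmod b)\<^sup>2" for a b :: complex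
    proof -
      have "(cmod (a + b))\<^sup>2 \<le> (cmod a + cmod b)\<^sup>2"
        by (intro power_mono norm_triangle_ineq) auto
      then show ?thesis
        using sum_squares_bound[of "cmod a" "cmod b"] by (simp add: power2_sum)
    qed
    then show "AE x in lborel. norm ((cmod (f x + g x))\<^sup>2)
                 \<le> norm (2 * (cmod (f x))\<^sup>2 + 2 * (cmod (g x))\<^sup>2)"
      by simp
  qed (use m in measurable)
  then show ?thesis using m by (simp add: square_integrable_def)
qed

lift_definition scaleC :: "complex \<Rightarrow> L2 \<Rightarrow> L2" (infixr "*\<^sub>C" 75) is "\<lambda>c f x. c * f x"
proof -
  fix c f g assume a: "ae_equal f g"
  then have "AE x in lborel. f x = g x" by (simp add: ae_equal_def)
  then have "AE x in lborel. c * f x = c * g x" by eventually_elim simp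
  with a show "ae_equal (\<lambda>x. c * f x) (\<lambda>x. c * g x)"
    by (simp add: ae_equal_def square_integrable_scale)
qed

text \<open>The inner product is antilinear in the first argument.\<close>

lift_definition cinner :: "L2 \<Rightarrow> L2 \<Rightarrow> complex" is "\<lambda>f g. LINT x|lborel. cnj (f x) * g x"
proof -
  fix f f' g g' assume a: "ae_equal f f'" "ae_equal g g'"
  show "(LINT x|lborel. cnj (f x) * g x) = (LINT x|lborel. cnj (f' x) * g' x)"
  proof (rule integral_cong_AE)
    show "(\<lambda>x. cnj (f x) * g x) \<in> borel_measurable lborel"
      using a by (intro borel_measurable_integrable square_integrable_mult) (auto simp: ae_equal_def)
    show "(\<lambda>x. cnj (f' x) * g' x) \<in> borel_measurable lborel"
      using a by (intro borel_measurable_integrable square_integrable_mult) (auto simp: ae_equal_def)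
    have "AE x in lborel. f x = f' x" "AE x in lborel. g x = g' x"
      using a by (auto simp: ae_equal_def)
    then show "AE x in lborel. cnj (f x) * g x = cnj (f' x) * g' x"
      by eventually_elim simp
  qed
qed

instantiation L2 :: real_inner
begin

lift_definition zero_L2 :: L2 is "\<lambda>x. 0"
  by (simp add: ae_equal_def square_integrable_zero)

lift_definition plus_L2 :: "L2 \<Rightarrow> L2 \<Rightarrow> L2" is "\<lambda>f g x. f x + g x"
proof -
  fix f f' g g' assume a: "ae_equal f f'" "ae_equal g g'"
  then have "AE x in lborel. f x = f' x" "AE x in lborel. g x = g' x"
    by (simp_all add: ae_equal_def)
  then have "AE x in lborel. f x + g x = f' x + g' x" by eventually_elim simp
  with a show "ae_equal (\<lambda>x. f x + g x) (\<lambda>x. f' x + g' x)"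
    by (simp add: ae_equal_def square_integrable_add)
qed

definition uminus_L2 :: "L2 \<Rightarrow> L2" where "uminus_L2 f = (- 1) *\<^sub>C f"

definition minus_L2 :: "L2 \<Rightarrow> L2 \<Rightarrow> L2" where "minus_L2 f g = f + - g"

definition scaleR_L2 :: "real \<Rightarrow> L2 \<Rightarrow> L2" where "scaleR_L2 r f = complex_of_real r *\<^sub>C f"

definition inner_L2 :: "L2 \<Rightarrow> L2 \<Rightarrow> real" where "inner_L2 f g = Re (cinner f g)"

definition norm_L2 :: "L2 \<Rightarrow> real" where "norm_L2 f = sqrt (inner f f)"

definition dist_L2 :: "L2 \<Rightarrow> L2 \<Rightarrow> real" where "dist_L2 f g = norm (f - g)"

definition sgn_L2 :: "L2 \<Rightarrow> L2" where "sgn_L2 f = inverse (norm f) *\<^sub>R f"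

definition uniformity_L2 :: "(L2 \<times> L2) filter" where
  "uniformity_L2 = (INF e\<in>{0<..}. principal {(x, y). dist x y < e})"

definition open_L2 :: "L2 set \<Rightarrow> bool" where
  "open_L2 S = (\<forall>x\<in>S. \<forall>\<^sub>F (x', y) in uniformity. x' = x \<longrightarrow> y \<in> S)"

instance
proof
  fix f g h :: L2 and r s :: real
  show "f + g + h = f + (g + h)"
    by transfer (auto simp: ae_equal_def add.assoc intro!: square_integrable_add)
  show "f + g = g + f"
    by transfer (auto simp: ae_equal_def add.commute intro!: square_integrable_add)
  show "0 + f = f"
    by transfer (auto simp: ae_equal_def)
  show "- f + f = 0"
    unfolding uminus_L2_def
    by transfer (auto simp: ae_equal_def square_integrable_zero)
  show "f - g = f + - g" by (simp add: minus_L2_def)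
  show "r *\<^sub>R (f + g) = r *\<^sub>R f + r *\<^sub>R g"
    unfolding scaleR_L2_def
    by transfer (auto simp: ae_equal_def distrib_left distrib_right mult.assoc
        intro!: square_integrable_add square_integrable_scale)
  show "(r + s) *\<^sub>R f = r *\<^sub>R f + s *\<^sub>R f"
    unfolding scaleR_L2_def
    by transfer (auto simp: ae_equal_def distrib_left distrib_right mult.assoc
        intro!: square_integrable_add square_integrable_scale)
  show "r *\<^sub>R s *\<^sub>R f = (r * s) *\<^sub>R f"
    unfolding scaleR_L2_def
    by transfer (auto simp: ae_equal_def distrib_left distrib_right mult.assoc intro!: square_integrable_scale)
  show "1 *\<^sub>R f = f"
    unfolding scaleR_L2_def
    by transfer (auto simp: ae_equal_def)
  show "dist f g = norm (f - g)" by (simp add: dist_L2_def)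
  show "sgn f = inverse (norm f) *\<^sub>R f" by (simp add: sgn_L2_def)
  show "uniformity = (INF e\<in>{0<..}. principal {(x::L2, y). dist x y < e})"
    by (simp add: uniformity_L2_def)
  show "open U = (\<forall>x\<in>U. \<forall>\<^sub>F (x', y) in uniformity. x' = x \<longrightarrow> y \<in> U)" for U :: "L2 set"
    by (simp add: open_L2_def)
  show "norm f = sqrt (inner f f)" by (simp add: norm_L2_def)
  show "inner f g = inner g f"
    unfolding inner_L2_def
  proof transfer
    fix f g assume "ae_equal f f" "ae_equal g g"
    then have i: "integrable lborel (\<lambda>x. cnj (f x) * g x)" "integrable lborel (\<lambda>x. cnj (g x) * f x)"
      by (auto simp: ae_equal_def square_integrable_mult)
    have "Re (LINT x|lborel. cnj (f x) * g x) = (LINT x|lborel. Re (cnj (f x) * g x))"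
      using i(1) by (simp only: integral_Re)
    also have "\<dots> = (LINT x|lborel. Re (cnj (g x) * f x))"
      by (simp add: mult.commute)
    also have "\<dots> = Re (LINT x|lborel. cnj (g x) * f x)"
      using i(2) by (simp only: integral_Re)
    finally show "Re (LINT x|lborel. cnj (f x) * g x) = Re (LINT x|lborel. cnj (g x) * f x)" .
  qed
  show "inner (f + g) h = inner f h + inner g h"
    unfolding inner_L2_def
  proof transfer
    fix f g h assume "ae_equal f f" "ae_equal g g" "ae_equal h h"
    then have i: "integrable lborel (\<lambda>x. cnj (f x) * h x)" "integrable lborel (\<lambda>x. cnj (g x) * h x)"
      by (auto simp: ae_equal_def square_integrable_mult)
    show "Re (LINT x|lborel. cnj (f x + g x) * h x) =
          Re (LINT x|lborel. cnj (f x) * h x) + Re (LINT x|lborel. cnj (g x) * h x)"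
      using i by (simp add: distrib_right)
  qed
  show "inner (r *\<^sub>R f) g = r * inner f g"
    unfolding inner_L2_def scaleR_L2_def
    by transfer (simp add: mult.assoc)
  have ii: "(LINT x|lborel. cnj (f x) * f x) = of_real (LINT x|lborel. (cmod (f x))\<^sup>2)"
    for f :: "real^2 \<Rightarrow> complex"
  proof -
    have "cnj (f x) * f x = of_real ((cmod (f x))\<^sup>2)" for x
      using complex_norm_square[of "f x"] by (simp add: mult.commute)
    then show ?thesis by (simp only: integral_complex_of_real)
  qed
  show "0 \<le> inner f f"
    unfolding inner_L2_def
    by transfer (simp add: ii)
  show "inner f f = 0 \<longleftrightarrow> f = 0"
    unfolding inner_L2_def
  proof transfer
    fix f assume f: "ae_equal f f"
    then have "integrable lborel (\<lambda>x. (cmod (f x))\<^sup>2)"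
      by (auto simp: ae_equal_def square_integrable_def)
    then have "(LINT x|lborel. (cmod (f x))\<^sup>2) = 0 \<longleftrightarrow> (AE x in lborel. (cmod (f x))\<^sup>2 = 0)"
      by (intro integral_nonneg_eq_0_iff_AE) auto
    with f show "Re (LINT x|lborel. cnj (f x) * f x) = 0 \<longleftrightarrow> ae_equal f (\<lambda>x. 0)"
      by (simp only: ii) (simp add: ae_equal_def square_integrable_zero)
  qed
qed

end

abbreviation to_L2 :: "(real^2 \<Rightarrow> complex) \<Rightarrow> L2" where
  "to_L2 \<equiv> abs_L2"

definition complex_linear :: "(L2 \<Rightarrow> L2) \<Rightarrow> bool" where
  "complex_linear S \<longleftrightarrow> (\<forall>f g. S (f + g) = S f + S g) \<and> (\<forall>c f. S (c *\<^sub>C f) = c *\<^sub>C S f)"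

definition unitary :: "(L2 \<Rightarrow> L2) \<Rightarrow> bool" where
  "unitary S \<longleftrightarrow> complex_linear S \<and> surj S \<and> (\<forall>f g. cinner (S f) (S g) = cinner f g)"

section \<open>Singular continuous spectrum of a unitary operator\<close>

definition orthogonal_projection :: "(L2 \<Rightarrow> L2) \<Rightarrow> bool" where
  "orthogonal_projection P \<longleftrightarrow>
     complex_linear P \<and> P \<circ> P = P \<and> (\<forall>f g. cinner (P f) g = cinner f (P g))"

definition projection_valued_measure :: "(complex set \<Rightarrow> L2 \<Rightarrow> L2) \<Rightarrow> bool" where
  "projection_valued_measure E \<longleftrightarrow>
     (\<forall>D\<in>sets borel. orthogonal_projection (E D)) \<and> E UNIV = id \<and>
     (\<forall>D :: nat \<Rightarrow> complex set. range D \<subseteq> sets borel \<longrightarrow> disjoint_family D \<longrightarrow>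
        (\<forall>f. (\<lambda>n. E (D n) f) sums E (\<Union>n. D n) f))"

definition vector_measure :: "(complex set \<Rightarrow> L2 \<Rightarrow> L2) \<Rightarrow> L2 \<Rightarrow> complex measure" where
  "vector_measure E f =
     measure_of UNIV (sets borel) (\<lambda>D. ennreal (Re (cinner f (E D f))))"

text \<open>
  \<open>spectral_resolution S E\<close> says that \<open>S = \<integral> z dE(z)\<close>.  By polarization, it is enough to
  require this identity for the quadratic forms.
\<close>

definition spectral_resolution :: "(L2 \<Rightarrow> L2) \<Rightarrow> (complex set \<Rightarrow> L2 \<Rightarrow> L2) \<Rightarrow> bool" where
  "spectral_resolution S E \<longleftrightarrow>
     projection_valued_measure E \<and> E (sphere 0 1) = id \<and>
     (\<forall>f. cinner f (S f) = (LINT z|vector_measure E f. z))"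

definition arc_length :: "complex measure" where
  "arc_length = distr (restrict_space lborel {0..<2 * pi}) borel cis"

definition singular_continuous :: "complex measure \<Rightarrow> bool" where
  "singular_continuous \<mu> \<longleftrightarrow>
     (\<forall>z. emeasure \<mu> {z} = 0) \<and>
     (\<exists>N\<in>sets borel. emeasure arc_length N = 0 \<and> emeasure \<mu> (- N) = 0)"

text \<open>
  By the spectral theorem, a unitary operator has exactly one spectral resolution (up to the
  values of \<open>E\<close> on non-Borel sets), so the existential quantifier only serves to name it.
\<close>

definition sc_subspace :: "(L2 \<Rightarrow> L2) \<Rightarrow> L2 set" where
  "sc_subspace S =
     {f. \<exists>E. spectral_resolution S E \<and> singular_continuous (vector_measure E f)}"

text \<open>The spectrum of the restriction of \<open>S\<close> to an invariant closed subspace \<open>M\<close>.\<close>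

definition spectrum_on :: "L2 set \<Rightarrow> (L2 \<Rightarrow> L2) \<Rightarrow> complex set" where
  "spectrum_on M S =
     {z. \<not> (bij_betw (\<lambda>f. S f - z *\<^sub>C f) M M \<and>
            (\<exists>C. \<forall>f\<in>M. norm f \<le> C * norm (S f - z *\<^sub>C f)))}"

definition sc_spectrum :: "(L2 \<Rightarrow> L2) \<Rightarrow> complex set" where
  "sc_spectrum S = spectrum_on (sc_subspace S) S"

section \<open>Functions on the line\<close>

definition absolutely_continuous_on :: "real set \<Rightarrow> (real \<Rightarrow> 'a::metric_space) \<Rightarrow> bool" where
  "absolutely_continuous_on I u \<longleftrightarrow>
     (\<forall>\<epsilon>>0. \<exists>\<delta>>0. \<forall>(n::nat) a b.
        (\<forall>i<n. a i \<le> b i \<and> {a i..b i} \<subseteq> I) \<longrightarrow>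
        disjoint_family_on (\<lambda>i. {a i<..<b i}) {..<n} \<longrightarrow>
        (\<Sum>i<n. b i - a i) < \<delta> \<longrightarrow> (\<Sum>i<n. dist (u (a i)) (u (b i))) < \<epsilon>)"

text \<open>The magnetic field is only measurable in time, so evolution equations hold in the sense
  of Caratheodory: the unknown is locally absolutely continuous, and the equation holds almost
  everywhere.\<close>

definition has_ae_derivative :: "(real \<Rightarrow> 'a::real_normed_vector) \<Rightarrow> (real \<Rightarrow> 'a) \<Rightarrow> bool" where
  "has_ae_derivative u v \<longleftrightarrow>
     (\<forall>a b. absolutely_continuous_on {a..b} u) \<and>
     (AE t in lebesgue. (u has_vector_derivative v t) (at t))"

definition L_infinity :: "(real \<Rightarrow> real) \<Rightarrow> bool" where
  "L_infinity B \<longleftrightarrow>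
     B \<in> borel_measurable lebesgue \<and> (\<exists>C. AE t in lebesgue. \<bar>B t\<bar> \<le> C)"

definition hill_solution :: "(real \<Rightarrow> real) \<Rightarrow> (real \<Rightarrow> real) \<Rightarrow> bool" where
  "hill_solution k \<zeta> \<longleftrightarrow>
     (\<forall>t. \<zeta> differentiable (at t)) \<and> has_ae_derivative (deriv \<zeta>) (\<lambda>t. - (k t)\<^sup>2 * \<zeta> t)"

section \<open>The Hamiltonian and its propagator\<close>

definition partial_deriv :: "2 \<Rightarrow> (real^2 \<Rightarrow> complex) \<Rightarrow> real^2 \<Rightarrow> complex" where
  "partial_deriv j f x = frechet_derivative f (at x) (axis j 1)"

primrec C_k :: "nat \<Rightarrow> (real^2 \<Rightarrow> complex) \<Rightarrow> bool" where
  "C_k 0 f \<longleftrightarrow> continuous_on UNIV f"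
| "C_k (Suc k) f \<longleftrightarrow> (\<forall>x. f differentiable (at x)) \<and> (\<forall>j. C_k k (partial_deriv j f))"

definition test_function :: "(real^2 \<Rightarrow> complex) \<Rightarrow> bool" where
  "test_function \<phi> \<longleftrightarrow> (\<forall>k. C_k k \<phi>) \<and> bounded {x. \<phi> x \<noteq> 0}"

definition vector_potential :: "(real \<Rightarrow> real) \<Rightarrow> real \<Rightarrow> real^2 \<Rightarrow> real^2" where
  "vector_potential B t x = (1 / 2) *\<^sub>R vector [- B t * x $ 2, B t * x $ 1]"

text \<open>\<open>kinetic_momentum q B t j\<close> is the \<open>j\<close>-th component of \<open>p - q A(t, x)\<close>.\<close>

definition kinetic_momentum ::
    "real \<Rightarrow> (real \<Rightarrow> real) \<Rightarrow> real \<Rightarrow> 2 \<Rightarrow> (real^2 \<Rightarrow> complex) \<Rightarrow> real^2 \<Rightarrow> complex" where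
  "kinetic_momentum q B t j \<phi> x =
     - \<i> * partial_deriv j \<phi> x - of_real (q * vector_potential B t x $ j) * \<phi> x"

definition free_hamiltonian ::
    "real \<Rightarrow> real \<Rightarrow> (real \<Rightarrow> real) \<Rightarrow> real \<Rightarrow> (real^2 \<Rightarrow> complex) \<Rightarrow> real^2 \<Rightarrow> complex" where
  "free_hamiltonian m q B t \<phi> x =
     of_real (1 / (2 * m)) *
       (\<Sum>j\<in>UNIV. kinetic_momentum q B t j (kinetic_momentum q B t j \<phi>) x)"

definition hamiltonian ::
    "real \<Rightarrow> real \<Rightarrow> (real \<Rightarrow> real) \<Rightarrow> (real^2 \<Rightarrow> real) \<Rightarrow> real \<Rightarrow>
     (real^2 \<Rightarrow> complex) \<Rightarrow> real^2 \<Rightarrow> complex" where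
  "hamiltonian m q B V t \<phi> x = free_hamiltonian m q B t \<phi> x + of_real (V x) * \<phi> x"

text \<open>
  Here \<open>H t\<close> is a symmetric operator given on the core of test functions.  The orbit
  \<open>U t s \<psi>\<close> need not lie in the operator domain of \<open>H t\<close> (which depends on \<open>t\<close>), so
  \<open>\<i> \<partial>\<^sub>t U(t,s) = H(t) U(t,s)\<close> is understood weakly, with \<open>H t\<close> moved to the test function.
  The equation \<open>\<i> \<partial>\<^sub>s U(t,s) = - U(t,s) H(s)\<close> holds in the norm of \<open>L2\<close> on the core.
\<close>

definition propagator ::
    "(real \<Rightarrow> (real^2 \<Rightarrow> complex) \<Rightarrow> real^2 \<Rightarrow> complex) \<Rightarrow> (real \<Rightarrow> real \<Rightarrow> L2 \<Rightarrow> L2) \<Rightarrow> bool" where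
  "propagator H U \<longleftrightarrow>
     (\<forall>t s. unitary (U t s)) \<and>
     (\<forall>\<psi>. continuous_on UNIV (\<lambda>(t, s). U t s \<psi>)) \<and>
     (\<forall>t \<theta> s. U t \<theta> \<circ> U \<theta> s = U t s) \<and>
     (\<forall>s. U s s = id) \<and>
     (\<forall>s \<psi> \<phi>. test_function \<phi> \<longrightarrow>
        has_ae_derivative (\<lambda>t. cinner (to_L2 \<phi>) (U t s \<psi>))
          (\<lambda>t. - \<i> * cinner (to_L2 (H t \<phi>)) (U t s \<psi>))) \<and>
     (\<forall>t \<phi>. test_function \<phi> \<longrightarrow>
        has_ae_derivative (\<lambda>s. U t s (to_L2 \<phi>))
          (\<lambda>s. \<i> *\<^sub>C U t s (to_L2 (H s \<phi>))))"

section \<open>Lebesgue spaces on the plane\<close>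

definition in_Lp :: "real \<Rightarrow> (real^2 \<Rightarrow> real) \<Rightarrow> bool" where
  "in_Lp p f \<longleftrightarrow> f \<in> borel_measurable lborel \<and> integrable lborel (\<lambda>x. \<bar>f x\<bar> powr p)"

end

theory Submission
imports Defs "HOL-Probability.Probability" "HOL-Complex_Analysis.Complex_Analysis" "HOL-Real_Asymp.Real_Asymp"
begin

text \<open>The growth of \<open>A3\<close> forces exponential growth of \<open>z2(t + NT)\<close>, so \<open>rho U0(t + NT, s) rho\<close> decays exponentially in an
integrated sense. With \<open>S = U(T,0)\<close> and \<open>S0 = U0(T,0)\<close>, Duhamel's formula writes \<open>S^N g\<close> as \<open>S0^N g\<close> plus a convolution with
operators \<open>T_n\<close> of size \<open>O(r^n)\<close>, \<open>r < 1\<close>, approximable by finite ranks. Fredholm theory for power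
series then continues the generating function of \<open><g, S^n g>\<close> meromorphically past the unit circle for
Gaussians \<open>g\<close>. Hence the spectral measure of \<open>g\<close> is absolutely continuous off the countable zero set of the denominator.\<close>

text \<open>\<open>U0\<close> is unitary, so nothing decays in the norm of \<open>L2\<close>. The
  T_n are measured in the seminorm \<open>gn\<close>, the size of \<open>rho U0(t,0) f\<close> over
  one period; no completeness is at hand for it, so the Fredholm step is carried out on coefficients
  of power series. The decay is integrated because the dispersive bound
  \<open>1 / |zeta(t + NT, s)|\<close> blows up at zeros of \<open>zeta\<close>; these come from
  simple zeros of two Floquet solutions, near which negative powers of exponent 2/p < 1 stay
  integrable. A second obstacle is that B is only measurable, so evolution equations hold only
  almost everywhere. Derivatives are replaced by expansions in the primitives of \<open>k\<close>
  and \<open>k^2\<close> (\<open>expands\<close>), valid at every time; whenever the k-terms cancel,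
  an ordinary derivative remains. \<open>U0\<close> is built without an integral kernel: explicit
  Gaussian orbits have Gram matrices constant in time, and this determines a unitary map. For
  absolute continuity, the denominator D makes only the Fourier coefficients of nonnegative order of
  D mu decay. The positive measure |D|^2 mu has decay on both sides, and a Fejer sum then bounds its
  mass on arcs by their length.\<close>

notation scaleC (infixr "*C" 75) and scaleR (infixr "*R" 75) and LIMSEQ (infix "---->" 60) and tendsto (infixr "--->" 55)
abbreviation (input) cor where "cor == complex_of_real"
abbreviation (input) sqint where "sqint == square_integrable"
abbreviation (input) bmf where "bmf == borel_measurable"
abbreviation (input) itg where "itg T == integral {0..T::real}"
lemmas ici = integrable_continuous_interval
lemmas bmci = borel_measurable_continuous_onI
lemmas int_bound = Bochner_Integration.integrable_bound
lemmas pmd = power_mult_distrib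
lemmas p2es = power2_eq_square

section \<open>Complex Hilbert space structure of \<open>L2\<close>\<close>

lemma cmod_power2_cnj: "cnj z * z = cor ((cmod z)^2)"
using complex_norm_square[of z] by (simp add: mult.commute)

lemma scaleR_L2_eq: "r *R f = cor r *C (f :: L2)"
by (simp add: scaleR_L2_def)

lemma scaleC_add_right: "c *C (f + g) = c *C f + c *C g"
by transfer (auto simp: ae_equal_def distrib_left intro!: square_integrable_add square_integrable_scale)

lemma scaleC_add_left: "(c + d) *C f = c *C f + d *C f"
by transfer (auto simp: ae_equal_def distrib_right intro!: square_integrable_add square_integrable_scale)

lemma scaleC_scaleC [simp]: "c *C d *C f = (c * d) *C f"
by transfer (auto simp: ae_equal_def mult.assoc intro!: square_integrable_scale)

lemma scaleC_one [simp]: "1 *C f = f"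
by transfer (auto simp: ae_equal_def)

lemma cinner_commute: "cinner g f = cnj (cinner f g)"
proof transfer
fix f g assume "ae_equal f f" "ae_equal g g"
hence i: "integrable lborel (%x. cnj (f x) * g x)"
 by (auto simp: ae_equal_def square_integrable_mult)
have "cnj (LINT x|lborel. cnj (f x) * g x) = (LINT x|lborel. cnj (cnj (f x) * g x))"
 using integral_bounded_linear[OF bounded_linear_cnj i] by simp
thus "(LINT x|lborel. cnj (g x) * f x) = cnj (LINT x|lborel. cnj (f x) * g x)"
 by (simp add: mult.commute)
qed

lemma cinner_add_right: "cinner f (g + h) = cinner f g + cinner f h"
proof transfer
fix f g h assume "ae_equal f f" "ae_equal g g" "ae_equal h h"
hence i: "integrable lborel (%x. cnj (f x) * g x)" "integrable lborel (%x. cnj (f x) * h x)"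
 by (auto simp: ae_equal_def square_integrable_mult)
show "(LINT x|lborel. cnj (f x) * (g x + h x)) =
  (LINT x|lborel. cnj (f x) * g x) + (LINT x|lborel. cnj (f x) * h x)"
 using i by (simp add: distrib_left)
qed

lemma cinner_scaleC_right [simp]: "cinner f (c *C g) = c * cinner f g"
proof transfer
fix c :: complex and f g :: "real^2 => complex"
have "(%x. cnj (f x) * (c * g x)) = (%x. c * (cnj (f x) * g x))" by (auto simp: mult_ac)
thus "(LINT x|lborel. cnj (f x) * (c * g x)) = c * (LINT x|lborel. cnj (f x) * g x)"
 by simp
qed

lemma cinner_scaleC_left [simp]: "cinner (c *C f) g = cnj c * cinner f g"
by (subst (1 2) cinner_commute) simp

lemma cinner_add_left: "cinner (f + g) h = cinner f h + cinner g h"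
by (subst (1 2 3) cinner_commute) (simp add: cinner_add_right)

lemma norm_L2_sq: "(norm (f::L2))^2 = Re (cinner f f)"
by (metis inner_L2_def power2_norm_eq_inner)

lemma cinner_self: "cinner f f = cor ((norm f)^2)"
proof -
have "Im (cinner f f) = - Im (cinner f f)" by (subst cinner_commute) simp
thus ?thesis by (simp add: complex_eq_iff norm_L2_sq)
qed

lemma norm_scaleC [simp]: "norm (c *C f) = cmod c * norm f"
proof -
have "cor ((norm (c *C f))^2) = (cnj c * c) * cinner f f"
 by (simp only: cinner_self[symmetric] cinner_scaleC_left cinner_scaleC_right mult_ac)
also have "... = cor ((cmod c * norm f)^2)"
 by (simp only: cmod_power2_cnj cinner_self pmd of_real_mult)
finally have "(norm (c *C f))^2 = (cmod c * norm f)^2"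
 by (simp only: of_real_eq_iff)
thus ?thesis by (simp add: power2_eq_iff_nonneg)
qed

text \<open>Multiplying by the phase \<open>c\<close> makes the product real and nonnegative, and
  then the Cauchy-Schwarz inequality of the class \<open>real_inner\<close> applies, which sees only
  real parts.\<close>

lemma cinner_Cauchy_Schwarz: "cmod (cinner f g) <= norm f * norm g"
proof -
define c where "c = cis (- Arg (cinner f g))"
have "cinner f g = cor (cmod (cinner f g)) * cis (Arg (cinner f g))"
 by (metis rcis_cmod_Arg rcis_def)
hence "c * cinner f g = cor (cmod (cinner f g)) * (cis (Arg (cinner f g)) * c)"
 by (metis mult.commute mult.assoc)
hence "c * cinner f g = cor (cmod (cinner f g))"
 by (simp add: c_def cis_mult)
hence "cmod (cinner f g) = inner f (c *C g)"
 unfolding inner_L2_def by simp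
also have "... <= norm f * norm (c *C g)" by (rule norm_cauchy_schwarz)
finally show ?thesis by (simp add: c_def)
qed

lemma bounded_bilinear_cinner: "bounded_bilinear cinner"
proof
show "EX K. ALL a b. norm (cinner a b) <= norm a * norm b * K"
 using cinner_Cauchy_Schwarz by (intro exI[of _ 1]) simp
qed (simp_all add: cinner_add_left cinner_add_right scaleR_L2_eq scaleR_conv_of_real)

interpretation cinner: bounded_bilinear cinner by (rule bounded_bilinear_cinner)

lemma bounded_bilinear_scaleC: "bounded_bilinear (*C)"
proof
show "EX K. ALL a b. norm (a *C b) <= norm a * norm b * K" by (intro exI[of _ 1]) simp
qed (simp_all add: scaleC_add_left scaleC_add_right scaleR_L2_eq scaleR_conv_of_real mult_ac)

interpretation scaleC: bounded_bilinear "(*C)" by (rule bounded_bilinear_scaleC)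

lemma cinner_eq_zeroI: "cinner f f = 0 ==> f = 0"
by (simp add: cinner_self)

lemma cinner_extI: "(!!x. cinner x f = cinner x g) ==> f = g"
proof -
assume "!!x. cinner x f = cinner x g"
hence "cinner (f - g) (f - g) = 0" by (simp add: cinner.diff_right)
thus "f = g" using cinner_eq_zeroI by force
qed

lemma norm_le_cinnerI:
assumes "0 <= C" "!!x. cmod (cinner x f) <= C * norm x"
shows "norm f <= C"
proof (cases "f = 0")
case False
have "norm f * norm f <= C * norm f"
 using assms(2)[of f] by (simp add: cinner_self p2es norm_mult)
thus ?thesis using False by simp
qed (use assms in simp)

lemma obtain_rep:
obtains f where "sqint f" "F = to_L2 f"
by (metis Quotient3_L2 Quotient3_def ae_equal_def)

lemma to_L2_eq_iff:
"sqint f ==> sqint g ==> to_L2 f = to_L2 g \<longleftrightarrow> (AE x in lborel. f x = g x)"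
using Quotient3_rel[OF Quotient3_L2, of f g] by (auto simp: ae_equal_def)

lemma to_L2_add:
"sqint f ==> sqint g ==> to_L2 f + to_L2 g = to_L2 (%x. f x + g x)"
by (rule plus_L2.abs_eq) (auto simp: ae_equal_def)

lemma to_L2_scale: "sqint f ==> c *C to_L2 f = to_L2 (%x. c * f x)"
by (rule scaleC.abs_eq) (auto simp: ae_equal_def)

lemma square_integrable_diff:
"sqint f ==> sqint g ==> sqint (%x. f x - g x)"
using square_integrable_add[of f "%x. - 1 * g x"] square_integrable_scale[of g "-1"] by simp

lemma to_L2_diff:
"sqint f ==> sqint g ==> to_L2 f - to_L2 g = to_L2 (%x. f x - g x)"
using to_L2_add[of f "%x. - 1 * g x"] to_L2_scale[of g "-1"] square_integrable_scale[of g "-1"]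
by (simp add: minus_L2_def uminus_L2_def)

lemma cinner_to_L2:
"sqint f ==> sqint g ==>
 cinner (to_L2 f) (to_L2 g) = (LINT x|lborel. cnj (f x) * g x)"
by (rule cinner.abs_eq) (auto simp: ae_equal_def)

lemma norm_to_L2_sq:
assumes "sqint f"
shows "(norm (to_L2 f))^2 = (LINT x|lborel. (cmod (f x))^2)"
unfolding norm_L2_sq cinner_to_L2[OF assms assms] cmod_power2_cnj integral_complex_of_real by simp

lemma norm_to_L2_nn:
assumes "sqint f"
shows "ennreal ((norm (to_L2 f))^2) = (\<integral>\<^sup>+x. ennreal ((cmod (f x))^2) \<partial>lborel)"
using assms unfolding norm_to_L2_sq[OF assms]
by (subst nn_integral_eq_integral) (auto simp: square_integrable_def)

lemma square_integrable_nn: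
"sqint f \<longleftrightarrow>
  f : bmf lborel & (\<integral>\<^sup>+x. ennreal ((cmod (f x))^2) \<partial>lborel) < \<infinity>"
unfolding square_integrable_def
by (auto simp: integrable_iff_bounded)

section \<open>Completeness of \<open>L2\<close> and dominated convergence\<close>

lemma AE_finite_of_nn_integral:
fixes h :: "'a => ennreal"
assumes "h : bmf M" "(\<integral>\<^sup>+x. h x \<partial>M) < \<infinity>"
shows "AE x in M. h x < \<infinity>"
using nn_integral_PInf_AE[OF assms(1)] assms(2) by (auto simp: less_top)

text \<open>Weighted by \<open>2^n\<close>, the squared increments still have summable integrals.
  Hence almost everywhere they are O(2^-n), and the increments themselves are dominated by a
  geometric series.\<close>

lemma Cauchy_AE_of_fast:
fixes f :: "nat => 'a => complex"
assumes m[measurable]: "!!n. f n : bmf M"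
 and d: "!!n. (\<integral>\<^sup>+x. ennreal ((cmod (f (Suc n) x - f n x))^2) \<partial>M) <= ennreal ((1/4)^n)"
shows "AE x in M. convergent (%n. f n x)"
proof -
let ?h = "%x. \<Sum>n. ennreal (2^n) * ennreal ((cmod (f (Suc n) x - f n x))^2)"
have "(\<integral>\<^sup>+x. ?h x \<partial>M) = (\<Sum>n. ennreal (2^n) * (\<integral>\<^sup>+x. ennreal ((cmod (f (Suc n) x - f n x))^2) \<partial>M))"
 by (subst nn_integral_suminf) (auto simp: nn_integral_cmult)
also have "... <= (\<Sum>n. ennreal ((1/2)^n))"
proof (intro suminf_le allI)
 fix n
 have "ennreal (2^n) * (\<integral>\<^sup>+x. ennreal ((cmod (f (Suc n) x - f n x))^2) \<partial>M) <= ennreal (2^n) * ennreal ((1/4)^n)"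
  by (intro mult_left_mono d) auto
 also have "... = ennreal (2^n * (1/4)^n)" by (rule ennreal_mult[symmetric]) auto
 also have "2^n * (1/4)^n = (1/2::real)^n" by (simp flip: pmd)
 finally show "ennreal (2^n) * (\<integral>\<^sup>+x. ennreal ((cmod (f (Suc n) x - f n x))^2) \<partial>M) <= ennreal ((1/2)^n)" .
qed auto
also have "... < \<infinity>"
 by (subst suminf_ennreal2) (auto simp: summable_geometric_iff)
finally have "AE x in M. ?h x < \<infinity>" by (intro AE_finite_of_nn_integral) auto
thus ?thesis
proof eventually_elim
 case (elim x)
 let ?a = "%n. 2^n * (cmod (f (Suc n) x - f n x))^2"
 have "(\<Sum>n. ennreal (?a n)) < \<infinity>" using elim by (simp add: ennreal_mult)
 hence "summable ?a"
  by (intro summable_suminf_not_top) auto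
 hence "?a ----> 0" by (rule summable_LIMSEQ_zero)
 hence "Bseq ?a" by (intro convergent_imp_Bseq convergentI)
 then obtain K where K: "K > 0" "!!n. norm (?a n) <= K" by (auto simp: Bseq_def)
 have b: "norm (f (Suc n) x - f n x) <= sqrt K * (1 / sqrt 2)^n" for n
 proof (rule power2_le_imp_le)
  have "(cmod (f (Suc n) x - f n x))^2 <= K * (1/2)^n"
   using K(2)[of n] by (simp add: field_simps power_one_over)
  also have "... = (sqrt K * (1 / sqrt 2)^n)^2"
   using K(1) by (simp add: pmd power_mult[symmetric] mult.commute[of _ 2] power_mult power_divide)
  finally show "(norm (f (Suc n) x - f n x))^2 <= (sqrt K * (1 / sqrt 2)^n)^2" .
 qed (use K in auto)
 have "summable (%n. sqrt K * (1 / sqrt 2)^n)"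
  by (intro summable_mult summable_geometric) (auto simp: real_sqrt_gt_1_iff)
 hence "summable (%n. f (Suc n) x - f n x)"
  by (rule summable_comparison_test') (use b in auto)
 hence "convergent (%n. f n x - f 0 x)"
  by (simp add: summable_iff_convergent sum_lessThan_telescope[of "%n. f n x"])
 hence "convergent (%n. (f n x - f 0 x) + f 0 x)"
  by (intro convergent_add convergent_const)
 thus ?case by simp
qed
qed

text \<open>Riesz-Fischer: a fast subsequence converges almost everywhere, and Fatou's lemma turns
  the pointwise limit into a limit in norm.\<close>

instance L2 :: complete_space
proof
fix X :: "nat => L2" assume "Cauchy X"
have "EX r. strict_mono r & (ALL n m. m >= r n --> norm (X m - X (r n)) <= (1/2)^n)"
proof -
 have ex: "EX N. ALL m>=N. ALL k>=N. norm (X m - X k) < (1/2)^n" for n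
  using `Cauchy X` unfolding Cauchy_def dist_norm by (meson zero_less_divide_1_iff zero_less_numeral zero_less_power)
 define N where "N n = (SOME N. ALL m>=N. ALL k>=N. norm (X m - X k) < (1/2)^n)" for n
 have N: "ALL m>=N n. ALL k>=N n. norm (X m - X k) < (1/2)^n" for n
  unfolding N_def using ex by (rule someI_ex)
 define r where "r n = (SUM k<=n. N k) + n" for n
 have "strict_mono r" by (rule strict_mono_Suc_iff[THEN iffD2]) (simp add: r_def)
 moreover have "N n <= r n" for n
  unfolding r_def by (intro trans_le_add1 member_le_sum) auto
 ultimately show ?thesis using N by (meson less_imp_le order_trans order_refl)
qed
then obtain r where r: "strict_mono r" "!!n m. m >= r n ==> norm (X m - X (r n)) <= (1/2)^n" by blast
have "EX f. sqint f & X (r n) = to_L2 f" for n using obtain_rep by metis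
then obtain f where f: "!!n. sqint (f n)" "!!n. X (r n) = to_L2 (f n)" by metis
have m[measurable]: "f n : bmf lborel" for n using f(1) by (auto simp: square_integrable_def)
have D: "(\<integral>\<^sup>+x. ennreal ((cmod (f j x - f n x))^2) \<partial>lborel) <= ennreal ((1/4)^n)" if "j >= n" for j n
proof -
 have "(\<integral>\<^sup>+x. ennreal ((cmod (f j x - f n x))^2) \<partial>lborel) = ennreal ((norm (X (r j) - X (r n)))^2)"
  using f by (simp add: to_L2_diff norm_to_L2_nn square_integrable_diff)
 also have "(norm (X (r j) - X (r n)))^2 <= ((1/2)^n)^2"
  using r that by (intro power_mono) (auto simp: strict_mono_less_eq)
 also have "((1/2)^n)^2 = (1/4::real)^n" by (simp add: p2es flip: pmd)
 finally show ?thesis by (simp add: ennreal_leI)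
qed
have "AE x in lborel. convergent (%n. f n x)"
 by (rule Cauchy_AE_of_fast) (use D in auto)
define g where "g x = lim (%n. f n x)" for x
have conv: "AE x in lborel. (%n. f n x) ----> g x"
 using `AE x in lborel. convergent (%n. f n x)`
 by eventually_elim (simp add: g_def convergent_LIMSEQ_iff)
have [measurable]: "g : bmf lborel" unfolding g_def by measurable
have E: "(\<integral>\<^sup>+x. ennreal ((cmod (g x - f n x))^2) \<partial>lborel) <= ennreal ((1/4)^n)" for n
proof -
 have "(\<integral>\<^sup>+x. ennreal ((cmod (g x - f n x))^2) \<partial>lborel)
   = (\<integral>\<^sup>+x. liminf (%j. ennreal ((cmod (f j x - f n x))^2)) \<partial>lborel)"
 proof (rule nn_integral_cong_AE)
  show "AE x in lborel. ennreal ((cmod (g x - f n x))^2) = liminf (%j. ennreal ((cmod (f j x - f n x))^2))"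
   using conv
  proof eventually_elim
   case (elim x)
   have "(%j. ennreal ((cmod (f j x - f n x))^2)) ----> ennreal ((cmod (g x - f n x))^2)"
    by (intro tendsto_ennrealI tendsto_intros elim)
   thus ?case by (intro lim_imp_Liminf[symmetric]) auto
  qed
 qed
 also have "... <= liminf (%j. \<integral>\<^sup>+x. ennreal ((cmod (f j x - f n x))^2) \<partial>lborel)"
  by (intro nn_integral_liminf) auto
 also have "... <= ennreal ((1/4)^n)"
 proof (rule Liminf_le)
  show "\<forall>\<^sub>F j in sequentially. (\<integral>\<^sup>+x. ennreal ((cmod (f j x - f n x))^2) \<partial>lborel) <= ennreal ((1/4)^n)"
   using eventually_ge_at_top[of n] by (rule eventually_mono) (rule D)
 qed simp
 finally show ?thesis .
qed
have "sqint (%x. g x - f 0 x)"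
 unfolding square_integrable_nn using E[of 0] by (auto simp: less_top[symmetric] top_unique)
from square_integrable_add[OF this f(1)[of 0]] have g: "sqint g" by simp
have "norm (X (r n) - to_L2 g) <= (1/2)^n" for n
proof (rule power2_le_imp_le)
 have "ennreal ((norm (to_L2 g - X (r n)))^2) <= ennreal ((1/4)^n)"
  using E[of n] g f by (simp add: to_L2_diff norm_to_L2_nn square_integrable_diff)
 hence "(norm (to_L2 g - X (r n)))^2 <= (1/4)^n" by (subst (asm) ennreal_le_iff) auto
 also have "(1/4::real)^n = ((1/2)^n)^2" by (simp add: p2es flip: pmd)
 finally show "(norm (X (r n) - to_L2 g))^2 <= ((1/2)^n)^2" by (simp add: norm_minus_commute)
qed auto
moreover have "(%n. (1/2::real)^n) ----> 0" by (intro LIMSEQ_realpow_zero) auto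
ultimately have "(%n. X (r n) - to_L2 g) ----> 0"
 by (intro Lim_null_comparison[of "%n. X (r n) - to_L2 g"]) auto
hence "(X \<circ> r) ----> to_L2 g" by (simp add: LIM_zero_iff o_def)
hence "X ----> to_L2 g"
 by (rule Cauchy_converges_subseq[OF `Cauchy X` r(1)])
thus "convergent X" by (rule convergentI)
qed

instance L2 :: banach ..

lemma L2_dominated_convergence:
assumes g: "integrable lborel (%x. (g x)^2)"
 and m: "!!n. f n : bmf lborel" "F : bmf lborel"
 and b: "!!n. AE x in lborel. cmod (f n x) <= g x"
 and l: "AE x in lborel. (%n. f n x) ----> F x"
shows "sqint F" "!!n. sqint (f n)" "(%n. to_L2 (f n)) ----> to_L2 F"
proof -
note [measurable] = m
have bF: "AE x in lborel. cmod (F x) <= g x"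
proof -
 have "AE x in lborel. ALL n. cmod (f n x) <= g x" using b by (simp add: AE_all_countable)
 thus ?thesis using l
  by eventually_elim (rule LIMSEQ_le_const2[OF tendsto_norm], auto)
qed
have sq: "sqint h" if [measurable]: "h : bmf lborel" and h: "AE x in lborel. cmod (h x) <= g x" for h
 unfolding square_integrable_def
proof
 show "integrable lborel (%x. (cmod (h x))^2)"
 proof (rule int_bound[OF g])
  show "AE x in lborel. norm ((cmod (h x))^2) <= norm ((g x)^2)"
   using h by eventually_elim (simp add: power_mono)
 qed measurable
qed fact
show sF: "sqint F" using m(2) bF by (rule sq)
show sf: "sqint (f n)" for n using m(1) b by (rule sq)
have "(%n. LINT x|lborel. (cmod (f n x - F x))^2) ----> (LINT x|(lborel::(real^2) measure). 0)"
proof (rule integral_dominated_convergence[where w="%x. 4 * (g x)^2"])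
 show "AE x in lborel. (%n. (cmod (f n x - F x))^2) ----> 0"
  using l
 proof eventually_elim
  case (elim x)
  have "(%n. (cmod (f n x - F x))^2) ----> (cmod (F x - F x))^2"
   by (intro tendsto_intros elim)
  thus ?case by simp
 qed
 show "AE x in lborel. norm ((cmod (f n x - F x))^2) <= 4 * (g x)^2" for n
  using b[of n] bF
 proof eventually_elim
  case (elim x)
  have "cmod (f n x - F x) <= 2 * g x"
   using norm_triangle_ineq4[of "f n x" "F x"] elim by linarith
  hence "(cmod (f n x - F x))^2 <= (2 * g x)^2" by (intro power_mono) auto
  thus ?case by (simp add: pmd)
 qed
qed (use g in auto)
hence "(%n. (norm (to_L2 (f n) - to_L2 F))^2) ----> 0"
 using sf sF by (simp add: to_L2_diff norm_to_L2_sq square_integrable_diff)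
hence "(%n. sqrt ((norm (to_L2 (f n) - to_L2 F))^2)) ----> sqrt 0"
 by (rule tendsto_real_sqrt)
hence "(%n. norm (to_L2 (f n) - to_L2 F)) ----> 0" by simp
thus "(%n. to_L2 (f n)) ----> to_L2 F"
 by (simp add: tendsto_norm_zero_iff LIM_zero_iff)
qed

section \<open>Bounded multiplication operators and unitary maps\<close>

definition bdd_borel :: "(real^2 => complex) => bool" where
"bdd_borel w \<longleftrightarrow> w : bmf borel & bounded (range w)"

text \<open>It acts on the representative picked by \<open>rep_L2\<close>; that the choice does not
  matter for bounded Borel \<open>w\<close> is the content of \<open>mulop_to_L2\<close>.\<close>

definition mulop :: "(real^2 => complex) => L2 => L2" where
"mulop w F = to_L2 (%x. w x * rep_L2 F x)"

lemma square_integrable_rep: "sqint (rep_L2 F)"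
using Quotient3_rep_reflp[OF Quotient3_L2] by (auto simp: ae_equal_def)

lemma to_L2_rep: "to_L2 (rep_L2 F) = F"
by (rule Quotient3_abs_rep[OF Quotient3_L2])

lemma square_integrable_bdd:
assumes "bdd_borel w" "sqint f"
shows "sqint (%x. w x * f x)"
proof -
obtain C where C: "!!x. cmod (w x) <= C" using assms(1) by (auto simp: bdd_borel_def bounded_iff)
have [measurable]: "f : bmf borel" "w : bmf borel"
 using assms by (auto simp: square_integrable_def bdd_borel_def)
have "integrable lborel (%x. (cmod (w x * f x))^2)"
proof (rule int_bound)
 show "integrable lborel (%x. C^2 * (cmod (f x))^2)"
  using assms by (auto simp: square_integrable_def)
 show "AE x in lborel. norm ((cmod (w x * f x))^2) <= norm (C^2 * (cmod (f x))^2)"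
  using C by (intro always_eventually allI) (simp add: norm_mult pmd mult_right_mono power_mono)
qed measurable
thus ?thesis by (simp add: square_integrable_def)
qed

lemma mulop_to_L2:
assumes "bdd_borel w" "sqint f"
shows "mulop w (to_L2 f) = to_L2 (%x. w x * f x)"
proof -
have "AE x in lborel. rep_L2 (to_L2 f) x = f x"
 using to_L2_eq_iff[OF square_integrable_rep assms(2), of "to_L2 f"] unfolding to_L2_rep by simp
hence "AE x in lborel. w x * rep_L2 (to_L2 f) x = w x * f x" by eventually_elim simp
thus ?thesis unfolding mulop_def
 by (subst to_L2_eq_iff) (auto intro!: square_integrable_bdd assms square_integrable_rep)
qed

lemma mulop_add:
assumes "bdd_borel w" shows "mulop w (F + G) = mulop w F + mulop w G"
proof -
obtain f g where "sqint f" "F = to_L2 f" "sqint g" "G = to_L2 g"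
 by (metis obtain_rep)
thus ?thesis using assms
 by (simp add: to_L2_add mulop_to_L2 square_integrable_add square_integrable_bdd distrib_left)
qed

lemma mulop_scaleC:
assumes "bdd_borel w" shows "mulop w (c *C F) = c *C mulop w F"
proof -
obtain f where "sqint f" "F = to_L2 f" by (metis obtain_rep)
thus ?thesis using assms
 by (simp add: to_L2_scale mulop_to_L2 square_integrable_scale square_integrable_bdd mult.left_commute)
qed

lemma bdd_borel_mult:
assumes "bdd_borel v" "bdd_borel w" shows "bdd_borel (%x. v x * w x)"
proof -
obtain C D where "!!x. cmod (v x) <= C" "!!x. cmod (w x) <= D"
 using assms by (auto simp: bdd_borel_def bounded_iff)
hence "!!x. cmod (v x * w x) <= C * D"
 by (auto simp: norm_mult intro!: mult_mono intro: order_trans[OF norm_ge_zero])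
thus ?thesis using assms by (auto simp: bdd_borel_def bounded_iff)
qed

lemma mulop_mulop:
assumes "bdd_borel v" "bdd_borel w" shows "mulop v (mulop w F) = mulop (%x. v x * w x) F"
proof -
obtain f where "sqint f" "F = to_L2 f" by (metis obtain_rep)
thus ?thesis using assms
 by (simp add: mulop_to_L2 square_integrable_bdd bdd_borel_mult mult.assoc)
qed

lemma mulop_cinner:
assumes "bdd_borel w" shows "cinner (mulop w F) G = cinner F (mulop (%x. cnj (w x)) G)"
proof -
obtain f g where fg: "sqint f" "F = to_L2 f" "sqint g" "G = to_L2 g"
 by (metis obtain_rep)
have "cnj : bmf borel"
 by (intro bmci continuous_intros)
hence "(%x. cnj (w x)) : bmf borel"
 using assms unfolding bdd_borel_def by (metis measurable_compose)
hence "bdd_borel (%x. cnj (w x))" using assms by (auto simp: bdd_borel_def bounded_iff)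
with fg assms show ?thesis
 by (simp add: mulop_to_L2 square_integrable_bdd cinner_to_L2 mult.assoc mult.left_commute)
qed

lemma norm_mulop_le:
assumes "bdd_borel w" "!!x. cmod (w x) <= C"
shows "norm (mulop w F) <= C * norm F"
proof -
obtain f where f: "sqint f" "F = to_L2 f" by (metis obtain_rep)
have C: "0 <= C" using assms(2)[of 0] norm_ge_zero order_trans by blast
have "(norm (mulop w F))^2 = (LINT x|lborel. (cmod (w x * f x))^2)"
 using assms f by (simp add: mulop_to_L2 norm_to_L2_sq square_integrable_bdd)
also have "... <= (LINT x|lborel. C^2 * (cmod (f x))^2)"
 using square_integrable_bdd[OF assms(1) f(1)] f(1) assms(2)
 by (intro integral_mono) (auto simp: square_integrable_def norm_mult pmd intro!: mult_right_mono power_mono)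
also have "... = (C * norm F)^2"
 using f by (simp add: norm_to_L2_sq pmd)
finally show ?thesis using C by (simp add: power2_le_iff_abs_le)
qed

lemma clinD:
assumes "complex_linear S"
shows "S (f + g) = S f + S g" "S (c *C f) = c *C S f" "S 0 = 0" "S (- f) = - S f" "S (f - g) = S f - S g"
 "S (r *R f) = r *R S f" "S (SUM i:I. h i) = (SUM i:I. S (h i))"
proof -
show a: "S (f + g) = S f + S g" "S (c *C f) = c *C S f" for f g c using assms by (auto simp: complex_linear_def)
show r: "S (r *R f) = r *R S f" for r f by (simp add: scaleR_L2_eq a)
interpret linear S by standard (auto simp: a r)
show "S 0 = 0" "S (- f) = - S f" "S (f - g) = S f - S g" "S (SUM i:I. h i) = (SUM i:I. S (h i))"
 by (auto simp: zero neg diff sum)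
qed

lemma bounded_linearI_complex:
assumes "complex_linear S" "!!f. norm (S f) <= C * norm f"
shows "bounded_linear S"
by (rule bounded_linear_intro[where K=C]) (use assms in "auto simp: clinD mult.commute")

lemma unitary_clin: "unitary S ==> complex_linear S" by (simp add: unitary_def)

lemma unitary_cinner: "unitary S ==> cinner (S f) (S g) = cinner f g" by (simp add: unitary_def)

lemma unitary_norm: assumes "unitary S" shows "norm (S f) = norm f"
proof -
have "(norm (S f))^2 = (norm f)^2" by (simp add: norm_L2_sq unitary_cinner assms)
thus ?thesis by simp
qed

lemma complex_linear_mulop: "bdd_borel w ==> complex_linear (mulop w)"
by (simp add: complex_linear_def mulop_add mulop_scaleC)

lemma bounded_linear_mulop: assumes "bdd_borel w" shows "bounded_linear (mulop w)"
proof -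
obtain C where "!!x. cmod (w x) <= C" using assms(1) by (auto simp: bdd_borel_def bounded_iff)
thus ?thesis using norm_mulop_le[OF assms] complex_linear_mulop[OF assms] bounded_linearI_complex by blast
qed

lemma bounded_linear_unitary: "unitary S ==> bounded_linear S"
by (rule bounded_linearI_complex[where C=1]) (auto simp: unitary_clin unitary_norm)

section \<open>Total families, and unitary maps determined by Gram matrices\<close>

lemma subspace_closure:
fixes M :: "'a::real_normed_vector set"
assumes "subspace M" shows "subspace (closure M)"
unfolding subspace_def
proof (intro conjI ballI allI)
show "0 : closure M" using subspace_0[OF assms] closure_subset by blast
next
fix x y assume "x : closure M" "y : closure M"
then obtain X Y where "!!n. X n : M" "X ----> x" "!!n. Y n : M" "Y ----> y"
 by (auto simp: closure_sequential)
thus "x + y : closure M"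
 unfolding closure_sequential
 by (intro exI[of _ "%n. X n + Y n"]) (auto intro!: tendsto_add subspace_add[OF assms])
next
fix c x assume "x : closure M"
then obtain X where "!!n. X n : M" "X ----> x"
 by (auto simp: closure_sequential)
thus "c *R x : closure M"
 unfolding closure_sequential
 by (intro exI[of _ "%n. c *R X n"]) (auto intro!: tendsto_scaleR subspace_scale[OF assms])
qed

text \<open>A minimising sequence for the distance is Cauchy by the parallelogram law, and varying
  the minimiser along \<open>z\<close> gives orthogonality. Only the real inner product is involved;
  complex orthogonality is recovered later by testing with \<i> multiples.\<close>

lemma closed_subspace_nearest:
fixes M :: "'a::{real_inner,complete_space} set"
assumes "subspace M" "closed M"
obtains y where "y : M" "!!z. z : M ==> inner (x - y) z = 0"
proof -
define d where "d = infdist x M"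
have ne: "M ~= {}" using subspace_0[OF assms(1)] by auto
have dle: "d <= norm (x - z)" if "z : M" for z
 using infdist_le[OF that, of x] by (simp add: d_def dist_norm)
have "EX z:M. norm (x - z) < d + 1 / Suc n" for n
proof -
 have "(INF z\<in>M. dist x z) < d + 1 / Suc n" using ne by (simp add: d_def infdist_notempty)
 thus ?thesis
  by (subst (asm) cINF_less_iff) (use ne in "auto simp: dist_norm intro!: bdd_belowI2[of _ 0]")
qed
then obtain Y where Y: "!!n. Y n : M" "!!n. norm (x - Y n) < d + 1 / Suc n" by metis
have d0: "0 <= d" by (simp add: d_def infdist_nonneg)
have par: "(norm (Y m - Y n))^2 <= 2 * ((norm (x - Y m))^2 - d^2) + 2 * ((norm (x - Y n))^2 - d^2)" for m n
proof -
 have "(1/2) *R (Y m + Y n) : M" using assms(1) Y(1) by (simp add: subspace_add subspace_scale)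
 from dle[OF this] have "d^2 <= (norm (x - (1/2) *R (Y m + Y n)))^2" using d0 by (intro power_mono) auto
 also have "x - (1/2) *R (Y m + Y n) = (1/2) *R ((x - Y m) + (x - Y n))"
  by (simp add: algebra_simps flip: scaleR_left.add)
 also have "(norm ...)^2 = (norm ((x - Y m) + (x - Y n)))^2 / 4" by (simp add: pmd power_divide)
 finally have "4 * d^2 <= (norm ((x - Y m) + (x - Y n)))^2" by simp
 moreover have "(norm ((x - Y m) + (x - Y n)))^2 + (norm ((x - Y n) - (x - Y m)))^2
   = 2 * (norm (x - Y m))^2 + 2 * (norm (x - Y n))^2"
  unfolding power2_norm_eq_inner by (simp add: inner_add_left inner_add_right inner_diff_left inner_diff_right inner_commute)
 moreover have "(x - Y n) - (x - Y m) = Y m - Y n" by simp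
 ultimately show ?thesis by (simp add: algebra_simps)
qed
have lim: "(%n. norm (x - Y n)) ----> d"
proof (rule tendsto_sandwich[of "%_. d" _ _ "%n. d + 1 / Suc n"])
 show "(%n. d + 1 / real (Suc n)) ----> d"
  using tendsto_add[OF tendsto_const LIMSEQ_inverse_real_of_nat, of d] by (simp add: inverse_eq_divide)
qed (use dle[OF Y(1)] Y(2) in "auto intro!: always_eventually less_imp_le")
hence l2: "(%n. (norm (x - Y n))^2 - d^2) ----> d^2 - d^2" by (intro tendsto_intros)
have "Cauchy Y"
proof (rule metric_CauchyI)
 fix e :: real assume "e > 0"
 hence "\<forall>\<^sub>F n in sequentially. (norm (x - Y n))^2 - d^2 < e^2 / 4"
  using order_tendstoD(2)[OF l2, of "e^2/4"] by simp
 then obtain N where N: "!!n. n >= N ==> (norm (x - Y n))^2 - d^2 < e^2 / 4"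
  by (auto simp: eventually_sequentially)
 have "dist (Y m) (Y n) < e" if "m >= N" "n >= N" for m n
 proof -
  have "(norm (Y m - Y n))^2 < e^2" using par[of m n] N[OF that(1)] N[OF that(2)] by argo
  thus ?thesis using `e > 0` by (simp add: dist_norm power2_less_imp_less)
 qed
 thus "EX M. ALL m>=M. ALL n>=M. dist (Y m) (Y n) < e" by blast
qed
then obtain y where y: "Y ----> y" using Cauchy_convergent convergent_def by blast
hence yM: "y : M" using assms(2) Y(1) by (meson closed_sequentially)
have "(%n. norm (x - Y n)) ----> norm (x - y)" by (intro tendsto_intros y)
hence nd: "norm (x - y) = d" using lim LIMSEQ_unique by blast
have "inner (x - y) z = 0" if "z : M" for z
proof (cases "z = 0")
 case False
 \<comment> \<open>The coefficient of the projection of \<open>x - y\<close> on \<open>z\<close>: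
   subtracting it lowers the squared distance by \<open>(inner (x - y) z)^2 / inner z z\<close>,
   which minimality forbids unless this is 0.\<close>
 define t where "t = inner (x - y) z / inner z z"
 have "y + t *R z : M" using yM that assms(1) by (simp add: subspace_add subspace_scale)
 from dle[OF this] have "d^2 <= (norm ((x - y) - t *R z))^2" using d0 by (intro power_mono) (auto simp: algebra_simps)
 also have "... = d^2 - (inner (x - y) z)^2 / inner z z"
 proof -
  have "(norm (w - (inner w z / inner z z) *R z))^2 = (norm w)^2 - (inner w z)^2 / inner z z" for w
   unfolding power2_norm_eq_inner using False
   by (simp add: inner_diff_left inner_diff_right inner_commute p2es field_simps)
  thus ?thesis by (simp add: nd[symmetric] t_def)
 qed
 finally have "(inner (x - y) z)^2 / inner z z <= 0" by simp
 moreover have "inner z z > 0" using False by simp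
 ultimately show ?thesis by (simp add: divide_le_0_iff)
qed simp
with yM that show ?thesis by blast
qed

definition total :: "('i => L2) => bool" where
"total u \<longleftrightarrow> (ALL f. (ALL i. cinner (u i) f = 0) --> f = 0)"

text \<open>\<open>span\<close> is the real span; including all complex multiples of the
  \<open>u i\<close> among the generators makes it the complex one.\<close>

definition cspan :: "('i => L2) => L2 set" where
"cspan u = span (range (%(c, i). c *C u i))"

lemma cspan_scaleC_base: "c *C u i : cspan u"
unfolding cspan_def by (rule span_base) (auto simp: image_iff)

lemma total_closure_cspan:
assumes "total u"
shows "closure (cspan u) = UNIV"
proof -
have sub: "subspace (closure (cspan u))"
 unfolding cspan_def by (simp add: subspace_closure subspace_span)
have "x : closure (cspan u)" for x
proof -
 obtain y where y: "y : closure (cspan u)" "!!z. z : closure (cspan u) ==> inner (x - y) z = 0"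
  using closed_subspace_nearest[OF sub closed_closure] by blast
 have "cinner (u i) (x - y) = 0" for i
 proof -
  have *: "inner (x - y) (c *C u i) = 0" for c
   by (intro y(2) closure_subset[THEN subsetD] cspan_scaleC_base)
  have "Re (cinner (x - y) (u i)) = 0" using *[of 1] by (simp add: inner_L2_def)
  moreover have "Im (cinner (x - y) (u i)) = 0" using *[of \<i>] by (simp add: inner_L2_def)
  ultimately have "cinner (x - y) (u i) = 0" by (simp add: complex_eq_iff)
  thus ?thesis by (subst cinner_commute) simp
 qed
 hence "x - y = 0" using assms unfolding total_def by blast
 thus ?thesis using y(1) by simp
qed
thus ?thesis by auto
qed

text \<open>A closed set that is stable under sums and complex multiples and contains a total family
  is everything. Later, statements about all vectors are checked on Gaussian orbits by this
  rule.\<close>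

lemma total_induct [consumes 1, case_names closed add scale base]:
assumes "total u"
 and cl: "closed {f. P f}"
 and add: "!!f g. P f ==> P g ==> P (f + g)"
 and sc: "!!c f. P f ==> P (c *C f)"
 and base: "!!i. P (u i)"
shows "P f"
proof -
have "cspan u <= {f. P f}"
proof
 fix x assume "x : cspan u"
 thus "x : {f. P f}" unfolding cspan_def
 proof (induction rule: span_induct_alt)
  case base
  show ?case using sc[of "u undefined" 0] assms(5) by (simp add: scaleC.zero_left)
 next
  case (step c x y)
  thus ?case by (auto simp: scaleR_L2_eq intro!: add sc assms(5))
 qed
qed
hence "closure (cspan u) <= {f. P f}" using cl by (rule closure_minimal)
thus ?thesis using total_closure_cspan[OF assms(1)] by blast
qed

text \<open>Defining \<open>W\<close> on linear combinations would call for well-definedness.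
  Instead the closed graph \<open>G\<close> is formed: equal Gram matrices force the two coordinates
  of each point of \<open>G\<close> to have equal norm, so \<open>G\<close> is single valued in both
  directions, and totality of \<open>u\<close> and of \<open>v\<close> makes its domain and its
  range full.\<close>

lemma gram_unitary:
assumes u: "total u" and v: "total v"
 and gram: "!!i j. cinner (u i) (u j) = cinner (v i) (v j)"
shows "EX W. unitary W & (ALL i. W (u i) = v i)"
proof -
define G where "G = closure (span (range (%(c, i). (c *C u i, c *C v i))))"
have subG: "subspace G" unfolding G_def by (intro subspace_closure subspace_span)
have ind: "P p" if "p : G" and "closed {p. P p}" and "!!p q. P p ==> P q ==> P (p + q)"
 and "P 0" and "!!c i. P (c *C u i, c *C v i)" for P p
proof -
 have "span (range (%(c, i). (c *C u i, c *C v i))) <= {p. P p}"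
 proof
  fix x assume "x : span (range (%(c, i). (c *C u i, c *C v i)))"
  thus "x : {p. P p}"
  proof (induction rule: span_induct_alt)
   case (step c x y)
   then obtain a b where "x = (a *C u b, a *C v b)" by auto
   hence "c *R x = ((c * a) *C u b, (c * a) *C v b)" by (simp add: scaleR_L2_eq)
   thus ?case using that(3)[OF that(5)[of "c * a" b], of y] step(2) by simp
  qed (use that in auto)
 qed
 hence "G <= {p. P p}" unfolding G_def using that(2) by (rule closure_minimal)
 thus ?thesis using that(1) by blast
qed
have base: "(c *C u i, c *C v i) : G" for c i
 unfolding G_def by (intro closure_subset[THEN subsetD] span_base) (auto simp: image_iff)
have c1: "continuous_on UNIV (%p::L2\<times>L2. cinner (c *C w) (fst p))" for c w
 by (intro cinner.continuous_on continuous_intros)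
have g1: "ALL c i. cinner (fst p) (c *C u i) = cinner (snd p) (c *C v i)" if "p : G" for p
 using that
proof (rule ind)
 show "closed {p. ALL c i. cinner (fst p) (c *C u i) = cinner (snd p) (c *C v i)}"
  by (intro closed_Collect_all closed_Collect_eq cinner.continuous_on continuous_intros)
qed (auto simp: cinner_add_left cinner.zero_left gram)
have g2: "cinner (fst p) (fst q) = cinner (snd p) (snd q)" if "p : G" "q : G" for p q
 using that(2)
proof (rule ind)
 show "closed {q. cinner (fst p) (fst q) = cinner (snd p) (snd q)}"
  by (intro closed_Collect_eq cinner.continuous_on continuous_intros)
 show "cinner (fst p) (fst (c *C u i, c *C v i)) = cinner (snd p) (snd (c *C u i, c *C v i))" for c i
  using g1[OF that(1), rule_format, of c i] by simp
qed (auto simp: cinner_add_right cinner.zero_right)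
have scG: "(c *C fst p, c *C snd p) : G" if "p : G" for c p
 using that
proof (rule ind)
 show "closed {p. (c *C fst p, c *C snd p) : G}"
 proof -
  have "isCont (%p::L2\<times>L2. (c *C fst p, c *C snd p)) p" for p
   by (intro continuous_intros scaleC.continuous)
  thus ?thesis using continuous_closed_vimage[of G "%p. (c *C fst p, c *C snd p)"]
   by (simp add: vimage_def G_def)
 qed
 show "(c *C fst (p + q), c *C snd (p + q)) : G"
  if "(c *C fst p, c *C snd p) : G" "(c *C fst q, c *C snd q) : G" for p q
  using subspace_add[OF subG that] by (simp add: scaleC_add_right)
qed (use base subspace_0[OF subG] in "auto simp: scaleC.zero_right zero_prod_def")
have nrm: "norm (fst p) = norm (snd p)" if "p : G" for p
proof -
 have "(norm (fst p))^2 = (norm (snd p))^2" using g2[OF that that] by (simp add: norm_L2_sq)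
 thus ?thesis by simp
qed
have dom: "EX y. (x, y) : G" for x
 using u
proof (induction x rule: total_induct)
 case closed
 show ?case
 proof (unfold closed_sequential_limits, intro allI impI)
  fix X l assume "(ALL n. X n : {f. EX y. (f, y) : G}) & X ----> l"
  then obtain Y where Y: "!!n. (X n, Y n) : G" and X: "X ----> l" by simp metis
  \<comment> \<open>Equality of norms on \<open>G\<close> carries the Cauchy property from the first
    coordinates to the second, which makes the domain closed.\<close>
  have d: "dist (Y m) (Y n) = dist (X m) (X n)" for m n
   using nrm[OF subspace_diff[OF subG Y[of m] Y[of n]]] by (simp add: dist_norm)
  have "Cauchy X" using X LIMSEQ_imp_Cauchy by blast
  hence "Cauchy Y" unfolding Cauchy_def d .
  then obtain y where "Y ----> y" using Cauchy_convergent convergent_def by blast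
  hence "(%n. (X n, Y n)) ----> (l, y)" using X by (intro tendsto_intros)
  hence "(l, y) : G" using Y closed_closure unfolding G_def by (meson closed_sequentially)
  thus "l : {f. EX y. (f, y) : G}" by blast
 qed
next
 case (add f g)
 thus ?case using subspace_add[OF subG] by fastforce
next
 case (scale c f)
 thus ?case using scG by fastforce
next
 case (base i)
 thus ?case using `!!c i. (c *C u i, c *C v i) : G`[of 1 i] by auto
qed
have ran: "EX x. (x, y) : G" for y
 using v
proof (induction y rule: total_induct)
 case closed
 show ?case
 proof (unfold closed_sequential_limits, intro allI impI)
  fix X l assume "(ALL n. X n : {f. EX x. (x, f) : G}) & X ----> l"
  then obtain Y where Y: "!!n. (Y n, X n) : G" and X: "X ----> l" by simp metis
  have d: "dist (Y m) (Y n) = dist (X m) (X n)" for m n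
   using nrm[OF subspace_diff[OF subG Y[of m] Y[of n]]] by (simp add: dist_norm)
  have "Cauchy X" using X LIMSEQ_imp_Cauchy by blast
  hence "Cauchy Y" unfolding Cauchy_def d .
  then obtain y where "Y ----> y" using Cauchy_convergent convergent_def by blast
  hence "(%n. (Y n, X n)) ----> (y, l)" using X by (intro tendsto_intros)
  hence "(y, l) : G" using Y closed_closure unfolding G_def by (meson closed_sequentially)
  thus "l : {f. EX y. (y, f) : G}" by blast
 qed
next
 case (add f g)
 thus ?case using subspace_add[OF subG] by fastforce
next
 case (scale c f)
 thus ?case using scG by fastforce
next
 case (base i)
 thus ?case using `!!c i. (c *C u i, c *C v i) : G`[of 1 i] by auto
qed
have uniq: "y = y'" if "(x, y) : G" "(x, y') : G" for x y y'
 using nrm[OF subspace_diff[OF subG that]] by simp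
from dom obtain W where W: "!!x. (x, W x) : G" by metis
have "complex_linear W"
 unfolding complex_linear_def
 using uniq[OF W subspace_add[OF subG W W, simplified]] uniq[OF W scG[OF W, simplified]] by auto
moreover have "surj W" using ran uniq[OF W] by (metis surjI)
moreover have "cinner (W f) (W g) = cinner f g" for f g using g2[OF W W, of f g] by simp
moreover have "W (u i) = v i" for i using uniq[OF W, of "u i" "v i"] base[of 1 i] by simp
ultimately show ?thesis unfolding unitary_def by blast
qed

text \<open>\<open>c\<close> clips values at radius r and \<open>th\<close> cuts the support. This
  is applied to \<open>f\<close> with r growing, and then, with r fixed, to continuous functions
  converging to \<open>f\<close> off a negligible set. The clipping supplies the dominating function
  for the second limit.\<close>

lemma L2_approx_bounded_continuous:
assumes "e > 0"
obtains g where "sqint g" "continuous_on UNIV g" "bounded (range g)" "norm (F - to_L2 g) < e"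
proof -
obtain f where f: "sqint f" "F = to_L2 f" by (metis obtain_rep)
have fm[measurable]: "f : bmf borel" using f(1) by (simp add: square_integrable_def)
define c where "c r z = (r / max r (cmod z)) *R z" for r and z :: complex
define th where "th r x = max 0 (min 1 (r + 1 - norm x))" for r and x :: "real^2"
define H where "H r u x = of_real (th r x) * c r (u x)" for r u x
define L where "L n = 1 + real n" for n
have c: "cmod (c r z) <= r" "cmod (c r z) <= cmod z" if "r > 0" for r z
 using that by (auto simp: c_def divide_simps max_def mult_left_mono)
have cc: "continuous_on UNIV (c r)" "continuous_on UNIV (th r)" if "r > 0" for r
 unfolding c_def th_def using that by (auto intro!: continuous_intros)
have Hb: "cmod (H r u x) <= r * indicator (cball 0 (r + 1)) x" "cmod (H r u x) <= cmod (u x)" if "r > 0" for r u x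
 using c[OF that, of "u x"] mult_mono[of "abs (th r x)" 1 "cmod (c r (u x))"] that
 by (auto simp: H_def norm_mult th_def indicator_def)
have Hm: "H r u : bmf borel" if "u : bmf borel" "r > 0" for r u
 unfolding H_def using that cc[OF that(2), THEN bmci] by measurable
note ev = order_tendstoD(2)[OF tendsto_norm_zero[OF LIM_zero], of _ _ _ "e / 2", THEN eventually_happens]
have "(%n. to_L2 (H (L n) f)) ----> to_L2 f"
proof (rule L2_dominated_convergence(3)[where g="%x. cmod (f x)"])
 have "(%n. H (L n) f x) ----> f x" for x
 proof (rule tendsto_eventually)
  obtain N where N: "max (cmod (f x)) (norm x) <= real N" using real_arch_simple by blast
  show "\<forall>\<^sub>F n in sequentially. H (L n) f x = f x"
   using eventually_ge_at_top[of N]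
  proof eventually_elim
   case (elim n)
   hence "th (L n) x = 1" "max (L n) (cmod (f x)) = L n" "L n ~= 0" using N by (auto simp: th_def L_def)
   thus ?case by (simp add: H_def c_def)
  qed
 qed
 thus "AE x in lborel. (%n. H (L n) f x) ----> f x" by simp
qed (use f Hb Hm L_def in "auto simp: square_integrable_def")
then obtain M where M: "norm (to_L2 (H (L M) f) - F) < e / 2" using ev assms f(2) by force
define r where "r = L M"
have r: "r > 0" by (simp add: r_def L_def)
have "f measurable_on UNIV" by (simp add: measurable_on_iff_borel_measurable lebesgue_on_UNIV_eq measurable_completion)
then obtain N g where N: "negligible N" and g: "!!n. continuous_on UNIV (g n)" "!!x. x \<notin> N ==> (%n. g n x) ----> f x"
 unfolding measurable_on_def by auto
have Gc: "continuous_on UNIV (H r (g n))" for n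
 unfolding H_def by (intro continuous_intros cc r continuous_on_compose2[OF cc(1)[OF r] g(1)]) auto
have "integrable lborel (%x::real^2. (r * indicator (cball 0 (r + 1)) x)^2)"
proof -
 have "(%x::real^2. (r * indicator (cball 0 (r + 1)) x)^2) = (%x. r^2 * indicator (cball 0 (r + 1)) x)" by (auto simp: indicator_def)
 thus ?thesis using emeasure_lborel_cball_finite[of "0::real^2" "r + 1"] by simp
qed
moreover have "AE x in lborel. (%n. H r (g n) x) ----> H r f x"
proof -
 have "AE x in lebesgue. x \<notin> N" using N by (simp add: negligible_iff_null_sets AE_not_in)
 hence "AE x in lborel. x \<notin> N" by (simp add: AE_completion_iff)
 thus ?thesis
  by eventually_elim (unfold H_def, intro tendsto_intros continuous_on_tendsto_compose[OF cc(1)[OF r]] g(2), auto)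
qed
ultimately have G: "(%n. to_L2 (H r (g n))) ----> to_L2 (H r f)" "!!n. sqint (H r (g n))"
 using L2_dominated_convergence[of "%x. r * indicator (cball 0 (r + 1)) x" "%n. H r (g n)" "H r f"] Hb[OF r] Hm[OF fm r]
  bmci[OF Gc] by auto
obtain n where n: "norm (to_L2 (H r (g n)) - to_L2 (H r f)) < e / 2" using ev[OF G(1)] assms by force
show thesis
proof (rule that[OF G(2) Gc])
 have "cmod (H r (g n) x) <= r" for x using Hb(1)[OF r, of "g n" x] r by (cases "norm x <= r + 1") auto
 thus "bounded (range (H r (g n)))" unfolding bounded_iff by blast
 show "norm (F - to_L2 (H r (g n))) < e"
  using norm_triangle_ineq[of "to_L2 (H r (g n)) - to_L2 (H r f)" "to_L2 (H r f) - F"] M n by (simp add: r_def norm_minus_commute)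
qed
qed

section \<open>Projection-valued measures and the moments of a spectral measure\<close>

lemma orthogonal_projectionD:
assumes "orthogonal_projection P"
shows "complex_linear P" "P (P f) = P f" "cinner (P f) g = cinner f (P g)"
 "cinner f (P f) = cor ((norm (P f))^2)"
proof -
show "complex_linear P" and b: "P (P f) = P f" and c: "cinner (P f) g = cinner f (P g)" for f g
 using assms unfolding orthogonal_projection_def by (auto simp: fun_eq_iff)
show "cinner f (P f) = cor ((norm (P f))^2)"
 by (metis b c cinner_self)
qed

context
fixes E assumes pvm: "projection_valued_measure E"
begin

lemma pvm_proj: "D : sets borel ==> orthogonal_projection (E D)"
using pvm by (simp add: projection_valued_measure_def)

lemma pvm_UNIV: "E UNIV f = f" using pvm by (simp add: projection_valued_measure_def)

lemma pvm_sums: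
fixes D :: "nat => complex set"
shows "range D <= sets borel ==> disjoint_family D ==> (%n. E (D n) f) sums E (\<Union>n. D n) f"
using pvm by (simp add: projection_valued_measure_def)

lemma pvm_empty: "E {} f = 0"
proof -
have "(%n::nat. E {} f) sums E {} f" using pvm_sums[of "%_. {}"] by (simp add: disjoint_family_on_def)
hence "(%n::nat. E {} f) ----> 0" by (intro summable_LIMSEQ_zero) (simp add: sums_iff)
thus ?thesis by (simp add: LIMSEQ_const_iff)
qed

lemma pvm_finite:
fixes D :: "nat => complex set"
assumes "range D <= sets borel" "disjoint_family D" "!!n. n >= K ==> D n = {}"
shows "E (\<Union>n. D n) f = (SUM n<K. E (D n) f)"
proof -
have "(%n. E (D n) f) sums (SUM n<K. E (D n) f)"
 by (rule sums_finite) (use assms(3) pvm_empty in "auto simp: not_less")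
thus ?thesis using pvm_sums[OF assms(1,2), of f] sums_unique2 by blast
qed

lemma pvm_compl: assumes "D : sets borel" shows "E D f + E (- D) f = f"
proof -
have "- D : sets borel" using assms by (auto simp: Compl_eq_Diff_UNIV)
hence "E (\<Union>n. (%n. if n = 0 then D else if n = Suc 0 then - D else {}) n) f
  = (SUM n<2. E ((%n. if n = 0 then D else if n = Suc 0 then - D else {}) n) f)"
 by (intro pvm_finite) (use assms in "auto simp: disjoint_family_on_def")
moreover have "(\<Union>n. (%n::nat. if n = 0 then D else if n = Suc 0 then - D else {}) n) = UNIV"
proof -
 have "x : (\<Union>n. (%n::nat. if n = 0 then D else if n = Suc 0 then - D else {}) n)" for x
  by (cases "x : D") (auto intro!: exI[of _ 0] exI[of _ "Suc 0"])
 thus ?thesis by blast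
qed
ultimately show ?thesis by (simp add: pvm_UNIV numeral_2_eq_2)
qed

lemma sets_vm [simp, measurable_cong]: "sets (vector_measure E f) = sets borel"
unfolding vector_measure_def using sets.sigma_sets_eq[of "borel :: complex measure"]
by (subst sets_measure_of) auto

lemma space_vm [simp]: "space (vector_measure E f) = UNIV"
unfolding vector_measure_def by (rule space_measure_of) auto

text \<open>\<open>measure_of\<close> returns the intended values only for a countably additive
  function. Additivity comes from the strong additivity of \<open>E\<close>, nonnegativity from
  \<open>cinner f (E D f)\<close> being the squared norm of \<open>E D f\<close>.\<close>

lemma emeasure_vm:
assumes "D : sets borel"
shows "emeasure (vector_measure E f) D = ennreal ((norm (E D f))^2)"
proof -
have sq: "Re (cinner f (E D f)) = (norm (E D f))^2" if "D : sets borel" for D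
 using orthogonal_projectionD(4)[OF pvm_proj[OF that]] by simp
have "emeasure (vector_measure E f) D = ennreal (Re (cinner f (E D f)))"
proof (rule emeasure_measure_of[OF vector_measure_def])
 show "positive (sets (vector_measure E f)) (%D. ennreal (Re (cinner f (E D f))))"
  by (simp add: positive_def pvm_empty cinner.zero_right)
 show "countably_additive (sets (vector_measure E f)) (%D. ennreal (Re (cinner f (E D f))))"
  unfolding countably_additive_def
 proof (intro allI impI)
  fix A :: "nat => complex set" assume A: "range A <= sets (vector_measure E f)" "disjoint_family A"
  have "(%n. cinner f (E (A n) f)) sums cinner f (E (\<Union>n. A n) f)"
   using A by (intro bounded_linear.sums[OF cinner.bounded_linear_right] pvm_sums) auto
  hence "(%n. Re (cinner f (E (A n) f))) sums Re (cinner f (E (\<Union>n. A n) f))"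
   by (rule sums_Re)
  thus "(\<Sum>n. ennreal (Re (cinner f (E (A n) f)))) = ennreal (Re (cinner f (E (\<Union>n. A n) f)))"
   using A by (intro suminf_ennreal_eq) (auto simp: sq)
 qed
qed (use assms in auto)
thus ?thesis by (simp add: sq assms)
qed

lemma finite_vm: "finite_measure (vector_measure E f)"
by standard (simp add: emeasure_vm)

lemma measure_vm: "D : sets borel ==> measure (vector_measure E f) D = (norm (E D f))^2"
by (simp add: measure_def emeasure_vm)

lemma pvm_idem_compl: assumes "D : sets borel" "E D x = x" shows "E (- D) x = 0"
using pvm_compl[OF assms(1), of x] assms(2) by simp

end

context
fixes S E assumes S: "unitary S" and res: "spectral_resolution S E"
begin

lemma res_pvm: "projection_valued_measure E" using res by (simp add: spectral_resolution_def)

lemma AE_sphere: "AE z in vector_measure E f. cmod z = 1"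
proof -
have b: "sphere 0 1 : sets (borel :: complex measure)" by auto
have "E (- sphere 0 1) f = 0"
 using res by (intro pvm_idem_compl[OF res_pvm b]) (simp add: spectral_resolution_def)
hence "emeasure (vector_measure E f) (- sphere 0 1) = 0"
 using b by (subst emeasure_vm[OF res_pvm]) auto
thus ?thesis by (intro AE_I[of _ _ "- sphere 0 1"]) (auto simp: sets_vm[OF res_pvm])
qed

lemma integrable_vm:
fixes h :: "complex => 'b::{banach, second_countable_topology}"
assumes "h : bmf borel" "!!z. cmod z = 1 ==> norm (h z) <= C"
shows "integrable (vector_measure E f) h"
proof -
interpret finite_measure "vector_measure E f" by (rule finite_vm[OF res_pvm])
show ?thesis
 using AE_sphere[of f] assms by (intro integrable_const_bound[of _ C]) (auto simp: measurable_cong_sets[OF sets_vm[OF res_pvm] refl])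
qed

lemma measure_vm_UNIV: "measure (vector_measure E f) UNIV = (norm f)^2"
by (simp add: measure_vm[OF res_pvm] pvm_UNIV[OF res_pvm])

text \<open>A spectral resolution gives only the first moment of the measure. That is enough here:
  for unitary \<open>S\<close> the square of the left side is affine in
  \<open>cinner x (S x)\<close>, and on the unit circle
  \<open>|z - w|^2 = 2 - 2 * Re (cnj w * z)\<close> is affine in \<open>z\<close>.\<close>

lemma near_eigenvector:
assumes D: "D : sets borel" "E D x = x" and w: "cmod w = 1" and e: "0 <= e"
 and near: "!!z. z : D ==> cmod z = 1 ==> cmod (z - w) <= e"
shows "norm (S x - w *C x) <= e * norm x"
proof -
interpret finite_measure "vector_measure E x" by (rule finite_vm[OF res_pvm])
let ?M = "vector_measure E x"
have "emeasure ?M (- D) = 0" using D pvm_idem_compl[OF res_pvm D]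
 by (subst emeasure_vm[OF res_pvm]) (auto simp: Compl_eq_Diff_UNIV)
hence "AE z in ?M. z : D"
 using D by (intro AE_I[of _ _ "- D"]) (auto simp: sets_vm[OF res_pvm] Compl_eq_Diff_UNIV)
have iz: "integrable ?M (%z. z)" by (rule integrable_vm[of _ 1]) auto
have "cor ((norm (S x - w *C x))^2) = cinner (S x - w *C x) (S x - w *C x)"
 by (simp only: cinner_self)
also have "... = cinner (S x) (S x) + (cnj w * w) * cinner x x - (cnj w * cinner x (S x) + w * cnj (cinner x (S x)))"
 using cinner_commute[of "S x" x] by (simp add: cinner.diff_left cinner.diff_right algebra_simps)
also have "... = cor (2 * (norm x)^2 - 2 * Re (cnj w * cinner x (S x)))"
 using w by (simp add: cmod_power2_cnj unitary_cinner[OF S] unitary_norm[OF S] cinner_self complex_eq_iff)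
finally have "(norm (S x - w *C x))^2 = 2 * (norm x)^2 - 2 * Re (cnj w * cinner x (S x))"
 by (simp only: of_real_eq_iff)
also have "... = (LINT z|?M. 2 - 2 * Re (cnj w * z))"
proof -
 have "cinner x (S x) = (LINT z|?M. z)" using res by (simp add: spectral_resolution_def)
 hence "Re (cnj w * cinner x (S x)) = (LINT z|?M. Re (cnj w * z))"
  using iz by (subst integral_Re) auto
 moreover have "integrable ?M (%z. Re (cnj w * z))" using iz by auto
 ultimately show ?thesis using measure_vm_UNIV[of x] iz by (simp add: space_vm[OF res_pvm])
qed
also have "... <= (LINT z|?M. e^2)"
proof (rule integral_mono_AE)
 show "AE z in ?M. 2 - 2 * Re (cnj w * z) <= e^2"
  using `AE z in ?M. z : D` AE_sphere
 proof eventually_elim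
  case (elim z)
  have "cor ((cmod (z - w))^2) = cnj z * z + cnj w * w - (cnj w * z + cnj (cnj w * z))"
   by (simp only: cmod_power2_cnj[symmetric]) (simp add: algebra_simps)
  also have "... = cor (2 - 2 * Re (cnj w * z))"
   unfolding cmod_power2_cnj complex_add_cnj using elim w by simp
  finally have "(cmod (z - w))^2 = 2 - 2 * Re (cnj w * z)" by (simp only: of_real_eq_iff)
  moreover have "(cmod (z - w))^2 <= e^2" using near elim by (intro power_mono) auto
  ultimately show ?case by simp
 qed
qed (use iz in auto)
also have "... = (e * norm x)^2" by (simp add: measure_vm_UNIV space_vm[OF res_pvm] pmd)
finally show ?thesis by (rule power2_le_imp_le) (use e in auto)
qed

lemma near_eigenvector_power:
assumes "cmod w = 1" "norm (S x - w *C x) <= e"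
shows "norm ((S ^^ n) x - (w ^ n) *C x) <= n * e"
proof (induction n)
case (Suc n)
have "(S ^^ Suc n) x - (w ^ Suc n) *C x = S ((S ^^ n) x - (w ^ n) *C x) + (w ^ n) *C (S x - w *C x)"
 by (simp add: clinD[OF unitary_clin[OF S]] scaleC.diff_right mult.commute)
also have "norm ... <= norm ((S ^^ n) x - (w ^ n) *C x) + norm (S x - w *C x)"
 by (rule order_trans[OF norm_triangle_ineq]) (simp add: unitary_norm[OF S] norm_power assms)
finally show ?case using Suc assms by (simp add: algebra_simps)
qed (simp add: assms)

end

lemma cmod_cis_diff: "cmod (cis a - cis b) <= abs (a - b)"
proof -
have "cis a - cis b = cis b * (cis (a - b) - 1)" by (simp add: algebra_simps cis_mult)
hence "cmod (cis a - cis b) = cmod (exp (\<i> * of_real (a - b)) - 1)"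
 by (simp only: norm_mult norm_cis cis_conv_exp) simp
also have "... = 2 * abs (sin ((a - b) / 2))"
 using dist_exp_i_1[of "a - b"] by simp
also have "... <= 2 * abs ((a - b) / 2)" by (intro mult_left_mono abs_sin_x_le_abs_x) auto
finally show ?thesis by simp
qed

text \<open>An argument of points on the unit circle. Clipping the real part keeps
  \<open>arccos\<close> inside its domain for every \<open>z\<close>, so that the function is Borel
  on the whole plane.\<close>

definition ang :: "complex => real" where
"ang z = (if Im z >= 0 then 1 else -1) * arccos (max (-1) (min 1 (Re z)))"

lemma cis_ang: assumes "cmod z = 1" shows "cis (ang z) = z"
proof -
have 1: "(Re z)^2 + (Im z)^2 = 1" using assms by (simp add: cmod_def)
hence "(Re z)^2 <= 1^2" by (smt (verit) zero_le_power2 one_power2)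
hence r: "abs (Re z) <= 1" by (simp add: abs_square_le_1)
hence e: "max (-1) (min 1 (Re z)) = Re z" by auto
have "sin (arccos (Re z)) = sqrt (1 - (Re z)^2)" using r by (intro sin_arccos_abs) auto
also have "... = abs (Im z)" using 1 by (metis add_diff_cancel_left' real_sqrt_abs)
finally have "sin (arccos (Re z)) = abs (Im z)" .
moreover have "cos (arccos (Re z)) = Re z" using r by (intro cos_arccos) auto
ultimately show ?thesis unfolding ang_def e by (auto simp: complex_eq_iff)
qed

lemma ang_bound: "abs (ang z) <= 4"
proof -
have "0 <= arccos (max (-1) (min 1 (Re z)))" "arccos (max (-1) (min 1 (Re z))) <= pi"
 by (auto intro!: arccos_lbound arccos_ubound)
thus ?thesis using pi_less_4 by (auto simp: ang_def)
qed

lemma ang_measurable [measurable]: "ang : bmf borel"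
proof -
have "continuous_on UNIV (%z::complex. arccos (max (-1) (min 1 (Re z))))"
 by (intro continuous_intros) auto
hence [measurable]: "(%z::complex. arccos (max (-1) (min 1 (Re z)))) : bmf borel"
 by (rule bmci)
have [measurable]: "Im : bmf borel"
 by (intro bmci continuous_intros)
show ?thesis unfolding ang_def[abs_def] by measurable
qed

text \<open>Higher moments have to be derived from the first one. The circle is cut into arcs of
  length \<open>1 / K\<close>; the part of \<open>f\<close> in an arc is an approximate eigenvector
  with error \<open>1 / K\<close>, so its n-th power is controlled up to \<open>n / K\<close>, and
  \<open>K\<close> tends to infinity.\<close>

lemma spectral_moment:
assumes S: "unitary S" and res: "spectral_resolution S E"
shows "cinner f ((S ^^ n) f) = (LINT z|vector_measure E f. z ^ n)"
proof -
let ?M = "vector_measure E f"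
note pvm = res_pvm[OF S res]
interpret finite_measure ?M by (rule finite_vm[OF pvm])
have bound: "cmod (cinner f ((S ^^ n) f) - (LINT z|?M. z ^ n)) <= (norm f)^2 * (4 * real n / sqrt (real K))"
 if K: "K > 0" for K :: nat
proof -
 \<comment> \<open>The shift by \<open>4 * K\<close> makes the arc indices natural numbers, since
   the angles lie in [-4, 4]; \<open>L\<close> counts all indices that occur, both end values
   included.\<close>
 define D where "D i = {z. \<lfloor>K * ang z\<rfloor> = int i - 4 * int K}" for i :: nat
 define w where "w i = cis (real_of_int (int i - 4 * int K) / K)" for i :: nat
 define L where "L = 8 * K + 1"
 have Db: "D i : sets borel" for i unfolding D_def by measurable
 have fl: "- 4 * int K <= \<lfloor>K * ang z\<rfloor>" "\<lfloor>K * ang z\<rfloor> <= 4 * int K" for z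
 proof -
  have "abs (K * ang z) <= K * 4" using ang_bound[of z] by (simp add: abs_mult mult_left_mono)
  hence "- (4 * real K) <= K * ang z" "K * ang z <= 4 * real K" by linarith+
  thus "- 4 * int K <= \<lfloor>K * ang z\<rfloor>" "\<lfloor>K * ang z\<rfloor> <= 4 * int K"
   by (simp_all add: le_floor_iff floor_le_iff)
 qed
 have dis: "disjoint_family D" by (auto simp: disjoint_family_on_def D_def)
 have emp: "D i = {}" if "i >= L" for i proof -
  have "\<lfloor>K * ang z\<rfloor> ~= int i - 4 * int K" for z using fl(2)[of z] that unfolding L_def by linarith
  thus ?thesis by (auto simp: D_def)
 qed
 have un: "(\<Union>i. D i) = UNIV"
 proof -
  have "z : D (nat (\<lfloor>K * ang z\<rfloor> + 4 * int K))" for z using fl(1)[of z] by (auto simp: D_def)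
  thus ?thesis by blast
 qed
 have near: "cmod (z - w i) <= 1 / K" if "z : D i" "cmod z = 1" for z i
 proof -
  have "cmod (z - w i) <= abs (ang z - real_of_int (int i - 4 * int K) / K)"
   using cmod_cis_diff[of "ang z"] by (simp add: cis_ang that w_def)
  also have "int i - 4 * int K = \<lfloor>K * ang z\<rfloor>" using that by (simp add: D_def)
  also have "abs (ang z - real_of_int \<lfloor>K * ang z\<rfloor> / K) = abs ((K * ang z - real_of_int \<lfloor>K * ang z\<rfloor>) / K)"
   using K by (simp add: field_simps)
  also have "... = abs (K * ang z - real_of_int \<lfloor>K * ang z\<rfloor>) / K" by (simp add: abs_divide)
  also have "... <= 1 / K" by (intro divide_right_mono) (simp_all, linarith)
  finally show ?thesis .
 qed
 have wn: "cmod (w i) = 1" for i by (simp add: w_def)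
 define x where "x i = E (D i) f" for i
 have Ex: "E (D i) (x i) = x i" for i unfolding x_def
  by (rule orthogonal_projectionD(2)[OF pvm_proj[OF pvm Db]])
 have f_eq: "f = (SUM i<L. x i)"
  using pvm_finite[OF pvm, of D L f] Db dis emp un by (auto simp: x_def pvm_UNIV[OF pvm])
 have mD: "measure ?M (D i) = (norm (x i))^2" for i by (simp add: x_def measure_vm[OF pvm] Db)
 have sumx: "(SUM i<L. (norm (x i))^2) = (norm f)^2"
 proof -
  have "(SUM i<L. measure ?M (D i)) = measure ?M (\<Union>i<L. D i)"
   by (rule finite_measure_finite_Union[symmetric])
    (use Db dis in "auto simp: sets_vm[OF pvm] disjoint_family_on_def")
  also have "(\<Union>i<L. D i) = UNIV" using un emp by (auto, metis UN_iff UNIV_I empty_iff lessThan_iff not_less)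
  finally show ?thesis by (simp add: mD measure_vm_UNIV[OF S res])
 qed
 have near': "norm ((S ^^ n) (x i) - (w i ^ n) *C x i) <= n * (1 / K * norm (x i))" for i
  by (intro near_eigenvector_power[OF S res] near_eigenvector[OF S res Db Ex] near wn) (use K in auto)
 have linS: "complex_linear (S ^^ n)"
  by (induction n) (use unitary_clin[OF S] in "auto simp: complex_linear_def")
 let ?A = "SUM i<L. w i ^ n * cor ((norm (x i))^2)"
 have "cinner f ((S ^^ n) f) - ?A = (SUM i<L. cinner f ((S ^^ n) (x i) - (w i ^ n) *C x i))"
 proof -
  have "cinner f (x i) = cor ((norm (x i))^2)" for i
   unfolding x_def by (rule orthogonal_projectionD(4)[OF pvm_proj[OF pvm Db]])
  moreover have "(S ^^ n) f = (SUM i<L. (S ^^ n) (x i))"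
   by (subst f_eq) (rule clinD(7)[OF linS])
  ultimately show ?thesis by (simp add: cinner.sum_right cinner.diff_right cinner_add_right sum_subtractf)
 qed
 also have "cmod ... <= (SUM i<L. norm f * (n * (1 / K * norm (x i))))"
  by (intro sum_norm_le order_trans[OF cinner_Cauchy_Schwarz] mult_left_mono near') auto
 also have "... = norm f * (n / K) * (SUM i<L. norm (x i))" by (simp add: sum_distrib_left sum_divide_distrib mult_ac)
 \<comment> \<open>Summing the errors over \<open>L <= 9 * K\<close> pieces by Cauchy-Schwarz costs
   a factor \<open>sqrt L\<close>, which is still beaten by the factor \<open>1 / K\<close>.\<close>
 also have "... <= norm f * (n / K) * (sqrt L * norm f)"
 proof (intro mult_left_mono)
  have "(SUM i<L. norm (x i) * 1) <= L2_set (%i. norm (x i)) {..<L} * L2_set (%i. 1) {..<L}"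
   using L2_set_mult_ineq[of "%i. norm (x i)" "%i. 1" "{..<L}"] by simp
  also have "L2_set (%i. norm (x i)) {..<L} = norm f" by (simp add: L2_set_def sumx del: of_nat_add)
  finally show "(SUM i<L. norm (x i)) <= sqrt L * norm f" by (simp add: L2_set_def mult.commute)
 qed auto
 also have "... <= norm f * (n / K) * (sqrt (9 * K) * norm f)"
  using K by (intro mult_left_mono mult_right_mono) (auto simp: L_def)
 also have "... = (norm f)^2 * (3 * real n / sqrt K)"
  using K by (simp add: real_sqrt_mult p2es field_simps)
 finally have 1: "cmod (cinner f ((S ^^ n) f) - ?A) <= (norm f)^2 * (3 * real n / sqrt K)" .
 let ?W = "%z. SUM i<L. w i ^ n * cor (indicator (D i) z)"
 have iW: "integrable ?M ?W"
  by (intro Bochner_Integration.integrable_sum integrable_mult_right integrable_of_real integrable_real_indicator)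
   (auto simp: sets_vm[OF pvm] Db emeasure_eq_measure)
 have "(LINT z|?M. ?W z) = ?A"
 proof -
  have "integrable ?M (%z. w i ^ n * cor (indicator (D i) z))" for i
   by (intro integrable_mult_right integrable_of_real integrable_real_indicator)
    (auto simp: sets_vm[OF pvm] Db emeasure_eq_measure)
  thus ?thesis
   by (simp add: Bochner_Integration.integral_sum mD sets_vm[OF pvm] Db space_vm[OF pvm] del: of_real_power)
 qed
 moreover have iz: "integrable ?M (%z. z ^ n)"
  by (rule integrable_vm[OF S res, of _ 1]) (auto simp: norm_power)
 ultimately have "?A - (LINT z|?M. z ^ n) = (LINT z|?M. ?W z - z ^ n)" using iW by simp
 also have "cmod ... <= (LINT z|?M. cmod (?W z - z ^ n))" by (rule integral_norm_bound)
 also have "... <= (LINT z|?M. n / K)"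
 proof (rule integral_mono_AE)
  show "AE z in ?M. cmod (?W z - z ^ n) <= n / K"
   using AE_sphere[OF S res]
  proof eventually_elim
   case (elim z)
   obtain i where i: "z : D i" using un by blast
   hence "i < L" using emp by (metis empty_iff not_less)
   have "?W z = (SUM i'<L. if i' = i then w i ^ n else 0)"
    by (intro sum.cong) (use dis i in "auto simp: disjoint_family_on_def indicator_def")
   hence "?W z = w i ^ n" using `i < L` by simp
   moreover have "cmod (w i ^ n - z ^ n) <= n * cmod (w i - z)"
    by (intro norm_power_diff) (use wn elim in auto)
   moreover have "n * cmod (w i - z) <= n * (1 / K)"
    using near[OF i elim] by (intro mult_left_mono) (auto simp: norm_minus_commute)
   ultimately show ?case by simp
  qed
 qed (use iW iz in auto)
 also have "... = (norm f)^2 * (n / K)" by (simp add: measure_vm_UNIV[OF S res] space_vm[OF pvm])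
 also have "... <= (norm f)^2 * (n / sqrt K)"
 proof (intro mult_left_mono divide_left_mono)
  show "sqrt K <= K" using K by (simp add: real_le_lsqrt self_le_power)
 qed (use K in auto)
 finally have 2: "cmod (?A - (LINT z|?M. z ^ n)) <= (norm f)^2 * (real n / sqrt K)" .
 have "cmod (cinner f ((S ^^ n) f) - (LINT z|?M. z ^ n)) <= (norm f)^2 * (3 * real n / sqrt K) + (norm f)^2 * (real n / sqrt K)"
  using norm_triangle_ineq[of "cinner f ((S ^^ n) f) - ?A" "?A - (LINT z|?M. z ^ n)"] 1 2
  unfolding diff_add_cancel add_diff_eq by linarith
 also have "... = (norm f)^2 * (4 * real n / sqrt K)" by (simp add: field_simps)
 finally show ?thesis .
qed
have "(%K. (norm f)^2 * (4 * real n / sqrt (real (Suc K)))) ----> 0"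
 by real_asymp
hence "cmod (cinner f ((S ^^ n) f) - (LINT z|?M. z ^ n)) <= 0"
 by (rule LIMSEQ_le_const) (use bound[of "Suc _"] in blast)
thus ?thesis by simp
qed

section \<open>Absolute continuity from a denominator for the moments\<close>

lemma geometric_bound_convolution:
fixes d e :: "nat => complex"
assumes r: "0 < r" "r < 1" and d: "!!n. cmod (d n) <= C * r ^ n"
shows "summable (%k. cmod (d k))" "(\<Sum>k. cmod (d (k + n))) <= C / (1 - r) * r ^ n"
proof -
have g: "summable (%k. C * r ^ (k + n))" for n
proof -
 have "summable (%k. (C * r ^ n) * r ^ k)"
  by (intro summable_mult summable_geometric) (use r in auto)
 thus ?thesis by (simp add: power_add mult_ac)
qed
show s: "summable (%k. cmod (d k))"
 by (rule summable_comparison_test'[OF g[of 0]]) (use d in auto)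
have "(\<Sum>k. cmod (d (k + n))) <= (\<Sum>k. C * r ^ (k + n))"
 by (intro suminf_le d g) (use summable_ignore_initial_segment[OF s, of n] in auto)
also have "... = (\<Sum>k. (C * r ^ n) * r ^ k)" by (simp add: power_add mult_ac)
also have "... = (C * r ^ n) * (1 / (1 - r))"
 by (subst suminf_mult) (use r in "auto simp: suminf_geometric summable_geometric")
finally show "(\<Sum>k. cmod (d (k + n))) <= C / (1 - r) * r ^ n" by simp
qed

context
fixes S E assumes S: "unitary S" and res: "spectral_resolution S E"
fixes g d h r C
assumes r: "0 < r" "r < 1" and C: "0 <= C"
 and d: "!!n. cmod (d n) <= C * r ^ n" and h: "!!n. cmod (h n) <= C * r ^ n"
 and conv: "!!n. h n = (SUM k<=n. d k * cinner g ((S ^^ (n - k)) g))"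
begin

abbreviation "mu \<equiv> vector_measure E g"
text \<open>On the circle \<open>cnj z = 1 / z\<close>, so this is the denominator evaluated at
  \<open>1 / z\<close>. Multiplying the measure by it convolves the moments with
  \<open>d\<close>.\<close>

abbreviation "Dt z \<equiv> \<Sum>k. d k * cnj z ^ k"

lemma Dt_summable: "cmod z = 1 ==> summable (%k. norm (d k * cnj z ^ k))"
using geometric_bound_convolution(1)[OF r d] by (simp add: norm_mult norm_power)

lemma cnj_measurable [measurable]: "cnj : bmf borel"
by (intro bmci continuous_intros)

lemma Dt_measurable [measurable]: "(%z. Dt z) : bmf borel"
by measurable

lemma Dt_power_measurable:
"(%z. z ^ N * Dt z) : bmf borel"
"(%z. z ^ N * (cnj (Dt z) * Dt z)) : bmf borel"
"(%z. \<Sum>k. d k * (z ^ N * cnj z ^ k)) : bmf borel"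
"(%z. \<Sum>k. cnj (d k) * (z ^ (N + k) * Dt z)) : bmf borel"
"(%z. z ^ j * cnj z ^ l * (cnj (Dt z) * Dt z)) : bmf borel"
proof -
note [measurable del] = cnj_measurable Dt_measurable
have p: "(%z::complex. z ^ n) : bmf borel" "(%z. cnj z ^ n) : bmf borel" for n
 by (intro bmci continuous_intros)+
have c: "(%z. cnj (Dt z)) : bmf borel"
 by (rule measurable_compose[OF Dt_measurable cnj_measurable])
show "(%z. z ^ N * Dt z) : bmf borel"
 by (intro borel_measurable_times p Dt_measurable)
show "(%z. z ^ N * (cnj (Dt z) * Dt z)) : bmf borel"
 by (intro borel_measurable_times p Dt_measurable c)
show "(%z. \<Sum>k. d k * (z ^ N * cnj z ^ k)) : bmf borel"
 by (intro borel_measurable_suminf borel_measurable_times p borel_measurable_const)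
show "(%z. \<Sum>k. cnj (d k) * (z ^ (N + k) * Dt z)) : bmf borel"
 by (intro borel_measurable_suminf borel_measurable_times p borel_measurable_const Dt_measurable)
show "(%z. z ^ j * cnj z ^ l * (cnj (Dt z) * Dt z)) : bmf borel"
 by (intro borel_measurable_times p Dt_measurable c)
qed

lemma Dt_bound: "cmod z = 1 ==> cmod (Dt z) <= C / (1 - r)"
proof -
assume z: "cmod z = 1"
have "cmod (Dt z) <= (\<Sum>k. norm (d k * cnj z ^ k))" by (rule summable_norm[OF Dt_summable[OF z]])
also have "... <= C / (1 - r)" using geometric_bound_convolution(2)[OF r d, of 0] z by (simp add: norm_mult norm_power)
finally show ?thesis .
qed

lemma moment: "(LINT z|mu. z ^ n) = cinner g ((S ^^ n) g)"
using spectral_moment[OF S res] by simp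

lemma borel_mu: "f : bmf borel ==> f : bmf mu"
by (simp add: measurable_cong_sets[OF sets_vm[OF res_pvm[OF S res]] refl])

lemma AE_muI: "(!!z. cmod z = 1 ==> P z) ==> AE z in mu. P z"
using AE_sphere[OF S res, of g] by (rule eventually_mono) auto

lemma integral_mu_cong:
fixes f f' :: "complex => complex"
assumes "f : bmf borel" "f' : bmf borel" "!!z. cmod z = 1 ==> f z = f' z"
shows "(LINT z|mu. f z) = (LINT z|mu. f' z)"
by (intro integral_cong_AE borel_mu AE_muI assms)

lemma moment_shift:
"(LINT z|mu. z ^ N * cnj z ^ k) = (if k <= N then cinner g ((S ^^ (N - k)) g) else cnj (cinner g ((S ^^ (k - N)) g)))"
proof -
have *: "z ^ a * cnj z ^ a = 1" if "cmod z = 1" for z :: complex and a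
 using cmod_power2_cnj[of z] that by (simp add: pmd[symmetric] mult.commute)
have m1: "z ^ N * cnj z ^ k = z ^ (N - k)" if "cmod z = 1" "k <= N" for z
 using *[OF that(1), of k] that(2) power_add[of z "N - k" k] by (simp add: mult.assoc)
have m2: "z ^ N * cnj z ^ k = cnj (z ^ (k - N))" if "cmod z = 1" "N <= k" for z
 using *[OF that(1), of N] that(2) power_add[of "cnj z" N "k - N"] by (simp add: mult.assoc[symmetric])
show ?thesis
proof (cases "k <= N")
 case True
 have "(LINT z|mu. z ^ N * cnj z ^ k) = (LINT z|mu. z ^ (N - k))"
  by (rule integral_mu_cong) (use m1 True in auto)
 thus ?thesis using True by (simp add: moment)
next
 case False
 have "(LINT z|mu. z ^ N * cnj z ^ k) = (LINT z|mu. cnj (z ^ (k - N)))"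
  by (rule integral_mu_cong) (use m2 False in "auto simp del: complex_cnj_power")
 thus ?thesis using False moment by (simp del: complex_cnj_power)
qed
qed

lemma integrable_mu:
fixes f :: "complex => complex"
assumes "f : bmf borel" "!!z. cmod z = 1 ==> norm (f z) <= B"
shows "integrable mu f"
using integrable_vm[OF S res assms] .

lemma suminf_integral_mu:
fixes c :: "nat => complex"
assumes c: "summable (%k. cmod (c k))"
 and f: "!!k. f k : bmf borel" "!!z k. cmod z = 1 ==> norm (f k z) <= B"
shows "(LINT z|mu. (\<Sum>k. c k * f k z)) = (\<Sum>k. c k * (LINT z|mu. f k z))"
proof -
have B: "0 <= B" using order_trans[OF norm_ge_zero f(2)[of 1 0]] by simp
have i: "integrable mu (f k)" for k by (rule integrable_mu[OF f])
have "(LINT z|mu. (\<Sum>k. c k * f k z)) = (\<Sum>k. (LINT z|mu. c k * f k z))"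
proof (rule integral_suminf)
 show "integrable mu (%z. c k * f k z)" for k using i by simp
 show "AE z in mu. summable (%k. norm (c k * f k z))"
 proof (rule AE_muI)
  fix z :: complex assume elim: "cmod z = 1"
  show "summable (%k. norm (c k * f k z))"
   by (rule summable_comparison_test'[OF summable_mult2[OF c, of B]])
    (use f(2)[OF elim] in "auto simp: norm_mult intro!: mult_left_mono")
 qed
 have n: "(LINT z|mu. norm (c k * f k z)) <= cmod (c k) * (B * (norm g)^2)" for k
 proof -
  interpret finite_measure mu by (rule finite_vm[OF res_pvm[OF S res]])
  have "(LINT z|mu. norm (c k * f k z)) <= (LINT z|mu. cmod (c k) * B)"
  proof (rule integral_mono_AE)
   show "AE z in mu. norm (c k * f k z) <= cmod (c k) * B"
    by (rule AE_muI) (auto simp: norm_mult f(2) intro!: mult_left_mono)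
  qed (use i in auto)
  also have "... = cmod (c k) * (B * (norm g)^2)"
   by (simp add: measure_vm_UNIV[OF S res] space_vm[OF res_pvm[OF S res]])
  finally show ?thesis .
 qed
 show "summable (%k. LINT z|mu. norm (c k * f k z))"
  by (rule summable_comparison_test'[OF summable_mult2[OF c, of "B * (norm g)^2"]]) (use n in auto)
qed
thus ?thesis using i by simp
qed

definition "en N = (LINT z|mu. z ^ N * Dt z)"
definition "cn N = (LINT z|mu. z ^ N * (cnj (Dt z) * Dt z))"

lemma inner_power_bound: "cmod (cinner g ((S ^^ n) g)) <= (norm g)^2"
proof -
have "norm ((S ^^ n) g) = norm g" by (induction n) (auto simp: unitary_norm[OF S])
thus ?thesis using cinner_Cauchy_Schwarz[of g "(S ^^ n) g"] by (simp add: p2es)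
qed

text \<open>Expanding \<open>Dt\<close> gives the sum over k of \<open>d k\<close> times the moment
  of order \<open>N - k\<close>. The terms with \<open>k <= N\<close> add up to \<open>h N\<close>,
  the others form a tail of \<open>d\<close>, and both are O(r^N). Only coefficients of nonnegative
  order are controlled in this way.\<close>

lemma en_bound: "EX K>=0. ALL N. cmod (en N) <= K * r ^ N"
proof (intro exI[of _ "C + C / (1 - r) * r * (norm g)^2"] conjI allI)
show "0 <= C + C / (1 - r) * r * (norm g)^2" using C r by auto
fix N
define m where "m k = (LINT z|mu. z ^ N * cnj z ^ k)" for k
have s: "summable (%k. cmod (d k))" by (rule geometric_bound_convolution(1)[OF r d])
have mb: "cmod (m k) <= (norm g)^2" for k using inner_power_bound by (auto simp: m_def moment_shift)
have mb': "norm (cmod (d k * m k)) <= cmod (d k) * (norm g)^2" for k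
proof -
 have "norm (cmod (d k * m k)) = cmod (d k) * cmod (m k)" by (simp only: norm_mult real_norm_def abs_mult abs_norm_cancel)
 also have "... <= cmod (d k) * (norm g)^2" by (intro mult_left_mono mb norm_ge_zero)
 finally show ?thesis .
qed
have sm: "summable (%k. cmod (d k * m k))"
 by (rule summable_comparison_test'[OF summable_mult2[OF s, of "(norm g)^2"]]) (rule mb')
note sm' = summable_ignore_initial_segment[OF sm, of "Suc N"]
note s' = summable_ignore_initial_segment[OF s, of "Suc N"]
have "en N = (LINT z|mu. (\<Sum>k. d k * (z ^ N * cnj z ^ k)))"
 unfolding en_def
proof (rule integral_mu_cong)
 fix z :: complex assume z: "cmod z = 1"
 have "summable (%k. d k * cnj z ^ k)" by (rule summable_norm_cancel[OF Dt_summable[OF z]])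
 from suminf_mult[OF this, of "z ^ N"]
 show "z ^ N * Dt z = (\<Sum>k. d k * (z ^ N * cnj z ^ k))" by (simp add: mult_ac)
qed (rule Dt_power_measurable)+
also have "... = (\<Sum>k. d k * m k)"
 unfolding m_def by (rule suminf_integral_mu[OF s, where B=1]) (auto simp: norm_mult norm_power)
also have "... = (\<Sum>k. d (k + Suc N) * m (k + Suc N)) + (SUM k<Suc N. d k * m k)"
 by (rule suminf_split_initial_segment[OF summable_norm_cancel[OF sm]])
also have "(SUM k<Suc N. d k * m k) = h N"
 unfolding conv by (intro sum.cong) (auto simp: m_def moment_shift)
finally have "cmod (en N) <= cmod (h N) + cmod (\<Sum>k. d (k + Suc N) * m (k + Suc N))"
 using norm_triangle_ineq by (metis add.commute)
also have "cmod (\<Sum>k. d (k + Suc N) * m (k + Suc N)) <= (\<Sum>k. cmod (d (k + Suc N) * m (k + Suc N)))"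
 by (rule summable_norm[OF sm'])
also have "... <= (\<Sum>k. cmod (d (k + Suc N)) * (norm g)^2)"
proof (rule suminf_le)
 show "cmod (d (k + Suc N) * m (k + Suc N)) <= cmod (d (k + Suc N)) * (norm g)^2" for k
  unfolding norm_mult by (intro mult_left_mono mb) auto
 show "summable (%k. cmod (d (k + Suc N) * m (k + Suc N)))"
  by (rule sm')
 show "summable (%k. cmod (d (k + Suc N)) * (norm g)^2)"
  by (rule summable_mult2[OF s'])
qed
also have "... = (\<Sum>k. cmod (d (k + Suc N))) * (norm g)^2"
 by (rule suminf_mult2[OF s', symmetric])
also have "... <= C / (1 - r) * r ^ Suc N * (norm g)^2"
 by (intro mult_right_mono geometric_bound_convolution(2)[OF r d]) auto
also have "cmod (h N) <= C * r ^ N" by (rule h)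
finally show "cmod (en N) <= (C + C / (1 - r) * r * (norm g)^2) * r ^ N" by (simp add: algebra_simps)
qed

text \<open>The extra factor \<open>cnj (Dt z)\<close> brings in only coefficients
  \<open>en (N + k)\<close> of higher order. What is gained is a real density: the coefficients of
  negative order are conjugates of these and therefore decay as well.\<close>

lemma cn_bound: "EX K>=0. ALL N. cmod (cn N) <= K * r ^ N"
proof -
obtain K where K: "K >= 0" "!!N. cmod (en N) <= K * r ^ N" using en_bound by blast
have s: "summable (%k. cmod (d k))" by (rule geometric_bound_convolution(1)[OF r d])
have "cmod (cn N) <= K * (\<Sum>k. cmod (d k)) * r ^ N" for N
proof -
 have "cn N = (LINT z|mu. (\<Sum>k. cnj (d k) * (z ^ (N + k) * Dt z)))"
  unfolding cn_def
 proof (rule integral_mu_cong)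
   fix z :: complex assume elim: "cmod z = 1"
   have s1: "summable (%k. d k * cnj z ^ k)" by (rule summable_norm_cancel[OF Dt_summable[OF elim]])
   hence "(%k. cnj (d k * cnj z ^ k)) sums cnj (Dt z)" unfolding sums_cnj by (rule summable_sums)
   hence "(%k. z ^ N * Dt z * cnj (d k * cnj z ^ k)) sums (z ^ N * Dt z * cnj (Dt z))" by (rule sums_mult)
   thus "z ^ N * (cnj (Dt z) * Dt z) = (\<Sum>k. cnj (d k) * (z ^ (N + k) * Dt z))"
    by (simp add: sums_iff power_add mult_ac)
 qed (rule Dt_power_measurable)+
 also have "... = (\<Sum>k. cnj (d k) * en (N + k))"
  unfolding en_def
  by (rule suminf_integral_mu[where B="C / (1 - r)"])
   (use s in "auto simp: norm_mult norm_power intro!: Dt_bound")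
 also have "cmod ... <= (\<Sum>k. cmod (d k) * (K * r ^ N))"
 proof -
  have b: "cmod (cnj (d k) * en (N + k)) <= cmod (d k) * (K * r ^ N)" for k
  proof -
   have "K * r ^ (N + k) <= K * r ^ N"
    using K(1) r by (intro mult_left_mono power_decreasing) auto
   thus ?thesis using K(2)[of "N + k"] by (auto simp: norm_mult intro!: mult_left_mono)
  qed
  have s2: "summable (%k. cmod (cnj (d k) * en (N + k)))"
   by (rule summable_comparison_test'[OF summable_mult2[OF s, of "K * r ^ N"]]) (use b in auto)
  show ?thesis
   by (rule order_trans[OF summable_norm[OF s2] suminf_le[OF b s2 summable_mult2[OF s]]])
 qed
 also have "... = K * (\<Sum>k. cmod (d k)) * r ^ N"
  by (subst suminf_mult2[symmetric, OF s]) simp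
 finally show ?thesis .
qed
moreover have "0 <= K * (\<Sum>k. cmod (d k))" using K(1) s by (intro mult_nonneg_nonneg suminf_nonneg) auto
ultimately show ?thesis by blast
qed

text \<open>The squared Dirichlet sum expands into coefficients of order \<open>j - l\<close>,
  bounded by \<open>K * r^|j - l|\<close>. Each row of this Toeplitz matrix is dominated by two
  geometric series, hence \<open>2 * K / (1 - r)\<close>, so the double sum grows like
  \<open>M\<close> instead of \<open>M^2\<close>.\<close>

lemma fejer_bound:
"EX B>=0. ALL w M. cmod w = 1 --> M > 0 -->
  (LINT z|mu. (cmod (SUM j<M. (z * cnj w) ^ j))^2 * (cmod (Dt z))^2) <= B * real M"
proof -
obtain K where K: "K >= 0" "!!N. cmod (cn N) <= K * r ^ N" using cn_bound by blast
have main: "(LINT z|mu. (cmod (SUM j<M. (z * cnj w) ^ j))^2 * (cmod (Dt z))^2) <= (2 * K / (1 - r)) * real M"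
 if w: "cmod w = 1" and M: "M > 0" for w M
proof -
 let ?I = "%j l. (LINT z|mu. z ^ j * cnj z ^ l * (cnj (Dt z) * Dt z))"
 have bb: "norm (z ^ j * cnj z ^ l * (cnj (Dt z) * Dt z)) <= (C / (1 - r)) * (C / (1 - r))" if "cmod z = 1" for z j l
 proof -
  have "norm (z ^ j * cnj z ^ l * (cnj (Dt z) * Dt z)) = cmod (Dt z) * cmod (Dt z)"
   by (simp only: norm_mult norm_power complex_mod_cnj that) simp
  also have "... <= (C / (1 - r)) * (C / (1 - r))"
   by (intro mult_mono Dt_bound that) (use C r in auto)
  finally show ?thesis .
 qed
 have int: "integrable mu (%z. z ^ j * cnj z ^ l * (cnj (Dt z) * Dt z))" for j l
  by (rule integrable_mu[where B="(C / (1 - r)) * (C / (1 - r))"]) (use bb in auto)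
 have zz: "z ^ a * cnj z ^ a = 1" if "cmod z = 1" for z :: complex and a
  using cmod_power2_cnj[of z] that by (simp add: pmd[symmetric] mult.commute)
 have I1: "?I j l = cn (j - l)" if "l <= j" for j l
  unfolding cn_def
 proof (rule integral_mu_cong)
  fix z :: complex assume "cmod z = 1"
  from zz[OF this, of l] have "z ^ j * cnj z ^ l = z ^ (j - l)"
   using power_add[of z "j - l" l] that by (simp add: mult.assoc)
  thus "z ^ j * cnj z ^ l * (cnj (Dt z) * Dt z) = z ^ (j - l) * (cnj (Dt z) * Dt z)" by simp
 qed (rule Dt_power_measurable)+
 have I2: "?I j l = cnj (?I l j)" for j l
 proof -
  have "(%z. z ^ j * cnj z ^ l * (cnj (Dt z) * Dt z)) = (%z. cnj (z ^ l * cnj z ^ j * (cnj (Dt z) * Dt z)))"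
   by (simp add: mult_ac)
  thus ?thesis by (simp only: Bochner_Integration.integral_cnj)
 qed
 have Ib: "cmod (?I j l) <= K * r ^ (j - l + (l - j))" for j l
 proof (cases "l <= j")
  case True thus ?thesis using K(2)[of "j - l"] by (simp add: I1)
 next
  case False thus ?thesis using K(2)[of "l - j"] by (subst I2) (simp add: I1)
 qed
 have eq: "cor ((cmod (SUM j<M. (z * cnj w) ^ j))^2 * (cmod (Dt z))^2)
   = (SUM j<M. SUM l<M. (cnj w ^ j * w ^ l) * (z ^ j * cnj z ^ l * (cnj (Dt z) * Dt z)))" for z
 proof -
  have "cor ((cmod (SUM j<M. (z * cnj w) ^ j))^2 * (cmod (Dt z))^2)
   = (cnj (SUM j<M. (z * cnj w) ^ j) * (SUM j<M. (z * cnj w) ^ j)) * (cnj (Dt z) * Dt z)"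
   by (simp only: of_real_mult cmod_power2_cnj)
  also have "... = (SUM j<M. (z * cnj w) ^ j) * (SUM l<M. (cnj z * w) ^ l) * (cnj (Dt z) * Dt z)"
   by (simp add: mult_ac)
  finally show ?thesis
   by (simp add: sum_product sum_distrib_right sum_distrib_left pmd mult_ac)
 qed
 have "cor (LINT z|mu. (cmod (SUM j<M. (z * cnj w) ^ j))^2 * (cmod (Dt z))^2)
   = (SUM j<M. SUM l<M. (cnj w ^ j * w ^ l) * ?I j l)"
  unfolding integral_complex_of_real[symmetric] eq
  using int by (simp add: Bochner_Integration.integral_sum)
 hence "cmod (cor (LINT z|mu. (cmod (SUM j<M. (z * cnj w) ^ j))^2 * (cmod (Dt z))^2))
   <= (SUM j<M. SUM l<M. K * r ^ (j - l + (l - j)))"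
  using Ib w by (auto simp: norm_mult norm_power intro!: sum_norm_le)
 also have "... <= (SUM j<M. 2 * K / (1 - r))"
 proof (rule sum_mono)
  fix j assume "j : {..<M}"
  have geo: "(SUM l<n. r ^ l) <= 1 / (1 - r)" for n
   using r by (simp add: sum_gp_strict divide_right_mono)
  have "(SUM l<M. r ^ (j - l + (l - j))) <= (SUM l<M. r ^ (j - l) * of_bool (l <= j) + r ^ (l - j) * of_bool (j <= l))"
   using r by (intro sum_mono) (auto simp: of_bool_def not_le)
  also have "... = (SUM l:{l. l < M & l <= j}. r ^ (j - l)) + (SUM l:{l. l < M & j <= l}. r ^ (l - j))"
   by (simp add: sum.distrib of_bool_def sum.inter_filter[symmetric] if_distrib[of "%x. _ * x"] cong: if_cong)
  also have "(SUM l:{l. l < M & l <= j}. r ^ (j - l)) <= (SUM l<Suc j. r ^ l)"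
  proof -
   have "(SUM l:{l. l < M & l <= j}. r ^ (j - l)) = (SUM i:(%l. j - l) ` {l. l < M & l <= j}. r ^ i)"
    by (subst sum.reindex) (auto simp: inj_on_def)
   also have "... <= (SUM l<Suc j. r ^ l)" using r by (intro sum_mono2) auto
   finally show ?thesis .
  qed
  also have "(SUM l:{l. l < M & j <= l}. r ^ (l - j)) <= (SUM l<M. r ^ l)"
  proof -
   have "(SUM l:{l. l < M & j <= l}. r ^ (l - j)) = (SUM i:(%l. l - j) ` {l. l < M & j <= l}. r ^ i)"
    by (subst sum.reindex) (auto simp: inj_on_def)
   also have "... <= (SUM l<M. r ^ l)" using r by (intro sum_mono2) auto
   finally show ?thesis .
  qed
  finally have "(SUM l<M. r ^ (j - l + (l - j))) <= 1 / (1 - r) + 1 / (1 - r)"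
   using geo[of "Suc j"] geo[of M] by linarith
  hence "K * (SUM l<M. r ^ (j - l + (l - j))) <= K * (1 / (1 - r) + 1 / (1 - r))"
   using K(1) by (intro mult_left_mono)
  also have "K * (1 / (1 - r) + 1 / (1 - r)) = 2 * K / (1 - r)" by simp
  finally show "(SUM l<M. K * r ^ (j - l + (l - j))) <= 2 * K / (1 - r)" by (simp only: sum_distrib_left)
 qed
 finally show ?thesis unfolding norm_of_real by (simp add: mult.commute)
qed
show ?thesis using main K(1) r by (intro exI[of _ "2 * K / (1 - r)"]) auto
qed

end

text \<open>Within distance \<open>1 / M\<close> of 1 the power \<open>u^j\<close> deviates from 1
  by at most \<open>j / M\<close>, in total by at most \<open>M / 2\<close>. The Dirichlet sum thus
  detects mass at scale \<open>1 / M\<close>.\<close>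

lemma sum_roots_lower_bound:
fixes u :: complex
assumes u: "cmod u = 1" "cmod (u - 1) <= 1 / real M" and M: "M > 0"
shows "real M / 2 <= cmod (SUM j<M. u ^ j)"
proof -
have "cmod (SUM j<M. u ^ j - 1) <= (SUM j<M. real j * (1 / real M))"
proof (rule sum_norm_le)
 fix j
 have "cmod (u ^ j - 1 ^ j) <= real j * cmod (u - 1)" by (rule norm_power_diff) (use u in auto)
 also have "... <= real j * (1 / real M)" by (intro mult_left_mono u) auto
 finally show "cmod (u ^ j - 1) <= real j * (1 / real M)" by simp
qed
also have "... = (SUM j<M. real j) * (1 / real M)" by (simp only: sum_distrib_right)
also have "(SUM j<M. real j) = real M * (real M - 1) / 2"
 by (induction M) (auto simp: field_simps)
also have "real M * (real M - 1) / 2 * (1 / real M) <= real M / 2" using M by (simp add: field_simps)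
finally have "cmod ((SUM j<M. u ^ j) - of_nat M) <= real M / 2" by (simp add: sum_subtractf)
thus ?thesis
 using norm_triangle_ineq3[of "SUM j<M. u ^ j" "of_nat M"] by (simp only: norm_of_nat)
qed

lemma arc_length_null:
assumes "N : sets borel" "emeasure arc_length N = 0"
shows "{t : {0..<2*pi}. cis t : N} : null_sets lborel"
proof -
have [measurable]: "cis : bmf borel"
 by (intro bmci continuous_intros)
have m: "cis : measurable (restrict_space lborel {0..<2*pi}) borel"
 by (intro measurable_restrict_space1) simp
have "emeasure arc_length N = emeasure (restrict_space lborel {0..<2*pi}) (cis -` N \<inter> space (restrict_space lborel {0..<2*pi}))"
 unfolding arc_length_def by (rule emeasure_distr[OF m assms(1)])
also have "cis -` N \<inter> space (restrict_space lborel {0..<2*pi}) = {t : {0..<2*pi}. cis t : N}"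
 by (auto simp: space_restrict_space)
also have "emeasure (restrict_space lborel {0..<2*pi}) {t : {0..<2*pi}. cis t : N} = emeasure lborel {t : {0..<2*pi}. cis t : N}"
 by (rule emeasure_restrict_space) auto
finally have z: "emeasure lborel {t : {0..<2*pi}. cis t : N} = 0" using assms(2) by simp
have "{t : {0..<2*pi}. cis t : N} = cis -` N \<inter> {0..<2*pi}" by auto
moreover have "cis -` N : sets borel" using measurable_sets[OF `cis : bmf borel` assms(1)] by simp
ultimately have "{t : {0..<2*pi}. cis t : N} : sets lborel" by simp
with z show ?thesis by (auto simp: null_sets_def)
qed

lemma null_set_interval_cover:
fixes L :: "real set"
assumes "L : null_sets lborel" "L <= {a..b}" "a < b" "0 < e"
obtains u v :: "nat => real" where "L <= (\<Union>n. {u n..v n})" "!!n. u n <= v n"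
 "!!n. (SUM i<n. v i - u i) <= e"
proof -
have "negligible L" using assms(1) by (simp add: negligible_iff_null_sets null_sets_completionI)
hence Lm: "L : lmeasurable" and L0: "measure lebesgue L = 0"
 using negligible_imp_measurable negligible_imp_measure0 by blast+
obtain D where D: "countable D" "!!K. K : D ==> K <= cbox a b & K ~= {} & (EX c d. K = cbox c d)"
 "pairwise (%A B. interior A \<inter> interior B = {}) D" "L <= \<Union>D" "\<Union>D : lmeasurable"
 "measure lebesgue (\<Union>D) <= measure lebesgue L + e"
 using measurable_outer_intervals_bounded[OF Lm, of a b e] assms by (metis cbox_interval)
have fin: "(SUM K:F. measure lebesgue K) <= e" if F: "finite F" "F <= D" for F
proof -
 have "F division_of \<Union>F"
  unfolding division_of_def using F D(2,3) by (auto simp: pairwise_def) blast+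
 hence "(SUM K:F. measure lebesgue K) = measure lebesgue (\<Union>F)" by (rule content_division)
 also have "... <= measure lebesgue (\<Union>D)"
 proof (rule measure_mono_fmeasurable)
  show "\<Union>F : sets lebesgue" using F D(2) by (metis lmeasurable_cbox fmeasurableD sets.finite_Union subset_iff)
 qed (use F D in auto)
 finally show ?thesis using D(6) L0 by simp
qed
show ?thesis
proof (cases "D = {}")
 case True
 show ?thesis
  by (rule that[of "%_. 0" "%_. 0"]) (use D(4) True assms in auto)
next
 case False
 define N where "N = (if finite D then {..<card D} else UNIV)"
 obtain f :: "nat => real set" where f: "bij_betw f N D"
 proof (cases "finite D")
  case True
  thus ?thesis using that ex_bij_betw_nat_finite[OF True] by (auto simp: N_def atLeast0LessThan)
 next
  case False
  thus ?thesis using that bij_betw_from_nat_into[OF D(1) False] by (auto simp: N_def)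
 qed
 have ex: "EX c d. c <= d & f n = {c..d}" if "n : N" for n
 proof -
  have "f n : D" using bij_betwE[OF f] that by blast
  then obtain c d where "f n = {c..d}" "f n ~= {}" using D(2)[of "f n"] by (auto simp: cbox_interval)
  thus ?thesis by (intro exI[of _ c] exI[of _ d]) auto
 qed
 \<comment> \<open>Indices outside \<open>N\<close> receive a degenerate interval at 0, so that a
   finite cover also becomes a sequence.\<close>
 define u where "u n = (if n : N then Inf (f n) else 0)" for n
 define v where "v n = (if n : N then Sup (f n) else 0)" for n
 have uv: "f n = {u n..v n}" "u n <= v n" if nN: "n : N" for n
 proof -
  obtain c d where cd: "c <= d" "f n = {c..d}" using ex[OF nN] by blast
  have "u n = c" "v n = d" using nN cd by (simp_all add: u_def v_def)
  thus "f n = {u n..v n}" "u n <= v n" using cd by simp_all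
 qed
 have uv0: "u n <= v n" for n
 proof (cases "n : N")
  case False
  thus ?thesis by (simp add: u_def v_def)
 qed (rule uv)
 show ?thesis
 proof (rule that[OF _ uv0])
  show "L <= (\<Union>n. {u n..v n})"
  proof
   fix x assume "x : L"
   then obtain K where "K : D" "x : K" using D(4) by blast
   then obtain n where "n : N" "K = f n" using f by (metis bij_betw_iff_bijections)
   thus "x : (\<Union>n. {u n..v n})" using uv(1) `x : K` by blast
  qed
  fix n
  have "(SUM i<n. v i - u i) = (SUM i:{..<n} \<inter> N. v i - u i)"
   by (rule sum.mono_neutral_right) (auto simp: u_def v_def)
  also have "... = (SUM i:{..<n} \<inter> N. measure lebesgue (f i))"
   by (intro sum.cong) (auto simp: uv)
  also have "... = (SUM K:f ` ({..<n} \<inter> N). measure lebesgue K)"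
   using f by (subst sum.reindex) (auto simp: bij_betw_def intro: inj_on_subset)
  also have "... <= e" by (rule fin) (use f in "auto simp: bij_betw_def")
  finally show "(SUM i<n. v i - u i) <= e" .
 qed
qed
qed

context
fixes S E assumes S: "unitary S" and res: "spectral_resolution S E"
fixes g d h r C
assumes r: "0 < r" "r < 1" and C: "0 <= C"
 and d: "!!n. cmod (d n) <= C * r ^ n" and h: "!!n. cmod (h n) <= C * r ^ n"
 and conv: "!!n. h n = (SUM k<=n. d k * cinner g ((S ^^ (n - k)) g))"
begin

abbreviation "mu2 \<equiv> vector_measure E g"
abbreviation "D2 z \<equiv> \<Sum>k. d k * cnj z ^ k"

lemmas facts = S res r C d h conv

text \<open>The measure with density \<open>|D2|^2\<close> gives an arc of length l at most the mass
  \<open>4 * B * l\<close>: the Dirichlet sum is at least \<open>M / 2\<close> there, while its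
  square has integral O(M). Covering a null set by arcs of small total length shows that this
  measure is absolutely continuous.\<close>

lemma null_set_zero:
assumes N: "N : sets borel" "emeasure arc_length N = 0"
shows "AE z in mu2. z : N --> D2 z = 0"
proof -
note pvm = res_pvm[OF S res]
interpret finite_measure mu2 by (rule finite_vm[OF pvm])
have [measurable]: "D2 : bmf borel" by (rule Dt_measurable[OF facts])
have mc: "measurable mu2 (borel :: 'x::topological_space measure) = measurable borel borel"
 by (rule measurable_cong_sets[OF sets_vm[OF pvm] refl])
define nu where "nu = density mu2 (%z. ennreal ((cmod (D2 z))^2))"
have snu: "sets nu = sets borel" by (simp add: nu_def sets_vm[OF pvm])
have enu: "emeasure nu A = (\<integral>\<^sup>+z. ennreal ((cmod (D2 z))^2) * indicator A z \<partial>mu2)" if "A : sets borel" for A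
 unfolding nu_def by (rule emeasure_density) (use that in "auto simp: sets_vm[OF pvm] mc")
obtain B where B: "B >= 0" "!!w M. cmod w = 1 ==> M > 0 ==>
  (LINT z|mu2. (cmod (SUM j<M. (z * cnj w) ^ j))^2 * (cmod (D2 z))^2) <= B * real M"
 using fejer_bound[OF facts] by blast
have ball: "emeasure nu (cball w (1 / real M)) <= ennreal (4 * B / real M)" if w: "cmod w = 1" and M: "M > 0" for w M
proof -
 let ?F = "%z. (4 / (real M)^2) * ((cmod (SUM j<M. (z * cnj w) ^ j))^2 * (cmod (D2 z))^2)"
 have pm: "(%z. cmod (SUM j<M. (z * cnj w) ^ j)) : bmf borel"
  by (intro bmci continuous_intros)
 have Fm: "?F : bmf borel" using pm by measurable
 have iF: "integrable mu2 ?F"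
 proof (rule integrable_vm[OF S res Fm])
  fix z :: complex assume z: "cmod z = 1"
  have "cmod (SUM j<M. (z * cnj w) ^ j) <= (SUM j<M. 1)"
   by (rule sum_norm_le) (simp add: norm_power norm_mult z w)
  hence "(cmod (SUM j<M. (z * cnj w) ^ j))^2 <= (real M)^2" by (intro power_mono) auto
  moreover have "(cmod (D2 z))^2 <= (C / (1 - r))^2"
   by (intro power_mono Dt_bound[OF facts z]) auto
  ultimately have "(cmod (SUM j<M. (z * cnj w) ^ j))^2 * (cmod (D2 z))^2 <= (real M)^2 * (C / (1 - r))^2"
   by (rule mult_mono) auto
  hence "?F z <= (4 / (real M)^2) * ((real M)^2 * (C / (1 - r))^2)" by (rule mult_left_mono) simp
  moreover have "0 <= ?F z" by (intro mult_nonneg_nonneg divide_nonneg_nonneg) auto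
  ultimately show "norm (?F z) <= (4 / (real M)^2) * ((real M)^2 * (C / (1 - r))^2)"
   unfolding real_norm_def by (simp only: abs_of_nonneg)
 qed
 have "emeasure nu (cball w (1 / real M)) = (\<integral>\<^sup>+z. ennreal ((cmod (D2 z))^2) * indicator (cball w (1 / real M)) z \<partial>mu2)"
  by (rule enu) auto
 also have "... <= (\<integral>\<^sup>+z. ennreal (?F z) \<partial>mu2)"
 proof (rule nn_integral_mono_AE)
  show "AE z in mu2. ennreal ((cmod (D2 z))^2) * indicator (cball w (1 / real M)) z <= ennreal (?F z)"
   using AE_sphere[OF S res]
  proof eventually_elim
   case (elim z)
   show ?case
   proof (cases "z : cball w (1 / real M)")
    case True
    have ww: "w * cnj w = 1" using cmod_power2_cnj[of w] w by (simp add: mult.commute)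
    have "z * cnj w - 1 = (z - w) * cnj w" using ww by (simp add: algebra_simps)
    hence "cmod (z * cnj w - 1) <= 1 / real M"
     using True w by (simp add: norm_mult dist_norm norm_minus_commute)
    hence "real M / 2 <= cmod (SUM j<M. (z * cnj w) ^ j)"
     using M elim w by (intro sum_roots_lower_bound) (auto simp: norm_mult)
    hence "(real M / 2)^2 <= (cmod (SUM j<M. (z * cnj w) ^ j))^2" by (intro power_mono) auto
    hence "(4 / (real M)^2) * (real M / 2)^2 <= (4 / (real M)^2) * (cmod (SUM j<M. (z * cnj w) ^ j))^2"
     by (intro mult_left_mono) auto
    moreover have "(4 / (real M)^2) * (real M / 2)^2 = 1" using M by (simp add: power_divide)
    ultimately have "1 * (cmod (D2 z))^2 <= ((4 / (real M)^2) * (cmod (SUM j<M. (z * cnj w) ^ j))^2) * (cmod (D2 z))^2"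
     by (intro mult_right_mono) auto
    thus ?thesis using True by (simp add: ennreal_leI mult.assoc)
   qed simp
  qed
 qed
 also have "... = ennreal (LINT z|mu2. ?F z)" by (rule nn_integral_eq_integral[OF iF]) simp
 also have "... <= ennreal (4 * B / real M)"
 proof (rule ennreal_leI)
  have "(LINT z|mu2. ?F z) = (4 / (real M)^2) * (LINT z|mu2. (cmod (SUM j<M. (z * cnj w) ^ j))^2 * (cmod (D2 z))^2)"
   by (rule integral_mult_right_zero)
  also have "... <= (4 / (real M)^2) * (B * real M)" by (intro mult_left_mono B w M) auto
  also have "... = 4 * B / real M" using M by (simp add: p2es)
  finally show "(LINT z|mu2. ?F z) <= 4 * B / real M" .
 qed
 finally show ?thesis .
qed
have arc: "emeasure nu (cis ` {u..v}) <= ennreal (4 * B * (v - u))" if uv: "u <= v" "v - u <= 1" for u v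
proof -
 have cm: "cis ` {u..v} : sets borel"
  by (intro borel_closed compact_imp_closed compact_continuous_image continuous_intros) auto
 have sub: "emeasure nu (cis ` {u..v}) <= ennreal (4 * B / real M)" if "M > 0" "v - u <= 2 / real M" for M
 proof -
  have "cis ` {u..v} <= cball (cis ((u + v) / 2)) (1 / real M)"
  proof
   fix z assume "z : cis ` {u..v}"
   then obtain t where t: "u <= t" "t <= v" "z = cis t" by auto
   have "cmod (cis ((u + v) / 2) - cis t) <= abs ((u + v) / 2 - t)" by (rule cmod_cis_diff)
   also have "... <= (v - u) / 2" using t by (simp add: abs_le_iff field_simps)
   also have "... <= 1 / real M" using that by simp
   finally show "z : cball (cis ((u + v) / 2)) (1 / real M)" by (simp add: t dist_norm)
  qed
  hence "emeasure nu (cis ` {u..v}) <= emeasure nu (cball (cis ((u + v) / 2)) (1 / real M))"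
   by (intro emeasure_mono) (auto simp: snu)
  also have "... <= ennreal (4 * B / real M)" using that by (intro ball) auto
  finally show ?thesis .
 qed
 show ?thesis
 proof (cases "u = v")
  case True
  have "emeasure nu (cis ` {u..v}) <= ennreal (4 * B / real (Suc n))" for n using True by (intro sub) auto
  moreover have lim: "(%n. ennreal (4 * B / real (Suc n))) ----> ennreal 0" by (rule tendsto_ennrealI) real_asymp
  ultimately have "emeasure nu (cis ` {u..v}) <= ennreal 0" by (intro LIMSEQ_le_const[OF lim] exI allI impI)
  thus ?thesis using True by simp
 next
  case False
  hence l: "v - u > 0" using uv by simp
  \<comment> \<open>The largest \<open>M\<close> with \<open>(v - u) / 2 <= 1 / M\<close>, so that a
    ball of radius \<open>1 / M\<close> about the midpoint contains the arc;
    \<open>v - u <= 1\<close> ensures that rounding down still leaves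
    \<open>1 / M <= v - u\<close>.\<close>
  define M where "M = nat \<lfloor>2 / (v - u)\<rfloor>"
  have ge: "2 / (v - u) >= 2" using l uv by (simp add: field_simps)
  hence fl: "real M <= 2 / (v - u)" "real M > 2 / (v - u) - 1" unfolding M_def by linarith+
  hence M: "M > 0" using ge by (simp add: M_def)
  have "v - u <= 2 / real M" using fl(1) l M by (simp add: field_simps)
  hence "emeasure nu (cis ` {u..v}) <= ennreal (4 * B / real M)" by (rule sub[OF M])
  also have "... <= ennreal (4 * B * (v - u))"
  proof (rule ennreal_leI)
   have "1 / (v - u) <= real M" using fl(2) ge by (simp add: field_simps)
   hence "1 / real M <= v - u" using l M by (simp add: field_simps)
   hence "4 * B * (1 / real M) <= 4 * B * (v - u)" using B(1) by (intro mult_left_mono) auto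
   thus "4 * B / real M <= 4 * B * (v - u)" by simp
  qed
  finally show ?thesis .
 qed
qed
let ?L = "{t : {0..<2*pi}. cis t : N}"
have Lnull: "?L : null_sets lborel" by (rule arc_length_null[OF N])
have small: "emeasure nu (N \<inter> sphere 0 1) <= ennreal (4 * B * e)" if e: "0 < e" "e <= 1" for e
proof -
 have sub: "?L <= {0..2*pi}" and tp: "0 < 2*pi" by auto
 obtain u v :: "nat => real" where uv: "?L <= (\<Union>n. {u n..v n})" "!!n. u n <= v n" "!!n. (SUM i<n. v i - u i) <= e"
 proof (rule null_set_interval_cover[OF Lnull sub tp e(1)])
  fix u v :: "nat => real"
  assume a: "?L <= (\<Union>n. {u n..v n})" "!!n. u n <= v n" "!!n. (SUM i<n. v i - u i) <= e"
  show thesis by (rule that[OF a])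
 qed
 have le1: "v n - u n <= 1" for n
 proof -
  have "v n - u n <= (SUM i<Suc n. v i - u i)" by (rule member_le_sum) (auto simp: uv)
  thus ?thesis using uv(3)[of "Suc n"] e by linarith
 qed
 have cm: "cis ` {u n..v n} : sets borel" for n
  by (intro borel_closed compact_imp_closed compact_continuous_image continuous_intros) auto
 have "N \<inter> sphere 0 1 <= (\<Union>n. cis ` {u n..v n})"
 proof
  fix z assume z: "z : N \<inter> sphere 0 1"
  hence "cmod z = 1" by simp
  then obtain t where t: "0 <= t" "t < 2 * pi" "z = cis t"
   using Arg2pi[of z] by (auto simp: is_Arg_def cis_conv_exp)
  hence "t : ?L" using z by auto
  thus "z : (\<Union>n. cis ` {u n..v n})" using uv(1) t by blast
 qed
 hence "emeasure nu (N \<inter> sphere 0 1) <= emeasure nu (\<Union>n. cis ` {u n..v n})"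
  by (intro emeasure_mono) (use cm in "auto simp: snu")
 also have "... <= (\<Sum>n. emeasure nu (cis ` {u n..v n}))"
  by (intro emeasure_subadditive_countably) (use cm in "auto simp: snu")
 also have "... <= (\<Sum>n. ennreal (4 * B * (v n - u n)))"
  by (intro suminf_le arc uv le1) auto
 also have "... <= ennreal (4 * B * e)"
 proof (rule suminf_le_const)
  fix n
  have "(SUM i<n. ennreal (4 * B * (v i - u i))) = ennreal (SUM i<n. 4 * B * (v i - u i))"
   by (rule sum_ennreal) (use B(1) uv(2) in auto)
  also have "... <= ennreal (4 * B * e)"
   unfolding sum_distrib_left[symmetric] by (intro ennreal_leI mult_left_mono uv) (use B(1) in auto)
  finally show "(SUM i<n. ennreal (4 * B * (v i - u i))) <= ennreal (4 * B * e)" .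
 qed auto
 finally show ?thesis .
qed
have "emeasure nu (N \<inter> sphere 0 1) <= ennreal (4 * B * (1 / real (Suc n)))" for n by (intro small) auto
moreover have lim: "(%n. ennreal (4 * B * (1 / real (Suc n)))) ----> ennreal 0" by (rule tendsto_ennrealI) real_asymp
ultimately have "emeasure nu (N \<inter> sphere 0 1) <= ennreal 0" by (intro LIMSEQ_le_const[OF lim] exI allI impI)
moreover have Nb: "N \<inter> sphere 0 1 : sets borel" using N by auto
ultimately have "(\<integral>\<^sup>+z. ennreal ((cmod (D2 z))^2) * indicator (N \<inter> sphere 0 1) z \<partial>mu2) = 0"
 by (simp add: enu)
hence "AE z in mu2. ennreal ((cmod (D2 z))^2) * indicator (N \<inter> sphere 0 1) z = 0"
 using Nb by (subst (asm) nn_integral_0_iff_AE) (auto simp: mc)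
thus ?thesis using AE_sphere[OF S res, of g]
 by eventually_elim (auto simp: indicator_def split: if_splits)
qed

text \<open>\<open>D2 z\<close> is the power series of \<open>d\<close> at \<open>cnj z\<close>. It
  is holomorphic in a disc of radius \<open>1 / r > 1\<close> and takes the value \<open>d 0\<close>
  at the origin, so the compact circle carries only finitely many zeros unless it is a nonzero
  constant.\<close>

lemma countable_zeros:
assumes d0: "d 0 ~= 0"
shows "countable {z. cmod z = 1 & D2 z = 0}"
proof -
let ?f = "%z. \<Sum>k. d k * z ^ k"
let ?R = "1 / r"
have sm: "summable (%k. d k * z ^ k)" if z: "z : ball 0 ?R" for z
proof -
 have z1: "cmod z * r < 1" using z r by (simp add: field_simps)
 have "summable (%k. C * (cmod z * r) ^ k)"
  using z1 r by (intro summable_mult summable_geometric) auto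
 thus ?thesis
 proof (rule summable_comparison_test'[where N=0])
  fix k
  have "norm (d k * z ^ k) <= (C * r ^ k) * cmod z ^ k"
   unfolding norm_mult norm_power by (intro mult_right_mono d) auto
  thus "norm (d k * z ^ k) <= C * (cmod z * r) ^ k" by (simp add: pmd mult_ac)
 qed
qed
have hol: "?f holomorphic_on ball 0 ?R"
proof (rule power_series_holomorphic[where a=d and z=0])
 fix w :: complex assume "w : ball 0 ?R"
 thus "(%n. d n * (w - 0) ^ n) sums (\<Sum>k. d k * w ^ k)" using sm by (simp add: summable_sums)
qed
have f0: "?f 0 = d 0" using powser_zero[of d] by simp
have cnt: "finite {z : sphere 0 1. ?f z = 0}"
proof (cases "?f constant_on ball 0 ?R")
 case True
 have "0 : ball 0 ?R" using r by simp
 hence "?f z = ?f 0" if "z : ball 0 ?R" for z using True that unfolding constant_on_def by metis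
 moreover have "z : ball 0 ?R" if "z : sphere 0 1" for z :: complex using that r by simp
 ultimately have "{z : sphere 0 1. ?f z = 0} = {}" using f0 d0 by auto
 thus ?thesis by (simp only: finite.emptyI)
next
 case False
 show ?thesis
  by (rule holomorphic_compact_finite_zeros[OF hol _ _ _ _ False]) (use r in auto)
qed
have "{z. cmod z = 1 & D2 z = 0} <= cnj ` {z : sphere 0 1. ?f z = 0}"
proof
 fix z assume "z : {z. cmod z = 1 & D2 z = 0}"
 hence "cnj z : {z : sphere 0 1. ?f z = 0}" by simp
 thus "z : cnj ` {z : sphere 0 1. ?f z = 0}" by (rule image_eqI[rotated]) simp
qed
thus ?thesis by (rule countable_subset) (rule countable_image[OF countable_finite[OF cnt]])
qed

text \<open>The measure of \<open>f\<close> lives on a null set \<open>N\<close>, and being free of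
  atoms on \<open>N - Z\<close> with the countable zero set \<open>Z\<close> removed. The measure of
  \<open>g\<close> does not charge \<open>N - Z\<close>. Hence \<open>E (N - Z)\<close> fixes
  \<open>f\<close> and annihilates \<open>g\<close>.\<close>

lemma sc_orthogonal:
assumes d0: "d 0 ~= 0" and sc: "singular_continuous (vector_measure E f)"
shows "cinner g f = 0"
proof -
note pvm = res_pvm[OF S res]
obtain N where at: "!!z. emeasure (vector_measure E f) {z} = 0"
 and N: "N : sets borel" "emeasure arc_length N = 0" "emeasure (vector_measure E f) (- N) = 0"
 using sc unfolding singular_continuous_def by blast
define Z where "Z = {z. cmod z = 1 & D2 z = 0}"
have cZ: "countable Z" unfolding Z_def by (rule countable_zeros[OF d0])
hence bZ: "Z : sets borel" by (rule sets.countable[rotated]) simp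
have "Z : null_sets (vector_measure E f)"
proof -
 have "(\<Union>z\<in>Z. {z}) : null_sets (vector_measure E f)"
  by (rule null_sets_UN'[OF cZ]) (auto simp: null_sets_def at sets_vm[OF pvm])
 thus ?thesis by simp
qed
moreover have "- N : null_sets (vector_measure E f)"
 using N by (auto simp: null_sets_def sets_vm[OF pvm] Compl_eq_Diff_UNIV)
ultimately have nz: "- N \<union> Z : null_sets (vector_measure E f)" by (intro null_sets.Un)
have NZ: "N - Z : sets borel" using N(1) bZ by (rule sets.Diff)
have "- N \<union> Z = - (N - Z)" by auto
with nz have "emeasure (vector_measure E f) (- (N - Z)) = 0" by (simp only: null_setsD1)
hence "E (- (N - Z)) f = 0"
 unfolding emeasure_vm[OF pvm borel_comp[OF NZ]] by (simp del: Compl_Diff_eq)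
hence Ef: "E (N - Z) f = f" using pvm_compl[OF pvm NZ, of f] by simp
have "AE z in mu2. \<not> (z : N - Z)"
 using null_set_zero[OF N(1,2)] AE_sphere[OF S res, of g] by eventually_elim (auto simp: Z_def)
hence "emeasure mu2 (N - Z) = 0"
 by (rule AE_iff_measurable[of "N - Z", THEN iffD1, rotated 2]) (use NZ in "auto simp: sets_vm[OF pvm] space_vm[OF pvm]")
hence "E (N - Z) g = 0" using NZ by (simp add: emeasure_vm[OF pvm])
hence "cinner (E (N - Z) g) f = 0" by (simp add: cinner.zero_left)
thus ?thesis using orthogonal_projectionD(3)[OF pvm_proj[OF pvm NZ], of g f] Ef by simp
qed

end

lemma sc_spectrum_empty:
assumes S: "unitary S" and tot: "total u"
 and gen: "!!i. EX r C d h. 0 < r & r < 1 & d 0 ~= 0 & (ALL n. cmod (d n) <= C * r ^ n) &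
   (ALL n. cmod (h n) <= C * r ^ n) &
   (ALL n. h n = (SUM k<=n. d k * cinner (u i) ((S ^^ (n - k)) (u i))))"
shows "sc_spectrum S = {}"
proof -
have "f = 0" if f: "f : sc_subspace S" for f
proof -
 obtain E where E: "spectral_resolution S E" "singular_continuous (vector_measure E f)"
  using f unfolding sc_subspace_def by blast
 have "cinner (u i) f = 0" for i
 proof -
  obtain r C d h where *: "0 < r" "r < 1" "d 0 ~= 0" "!!n. cmod (d n) <= C * r ^ n"
   "!!n. cmod (h n) <= C * r ^ n" "!!n. h n = (SUM k<=n. d k * cinner (u i) ((S ^^ (n - k)) (u i)))"
   using gen[of i] by blast
  have "0 <= C" using order_trans[OF norm_ge_zero *(4)[of 0]] by simp
  from sc_orthogonal[OF S E(1) *(1,2) this *(4-6) *(3) E(2)] show ?thesis .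
 qed
 thus ?thesis using tot unfolding total_def by blast
qed
\<comment> \<open>Membership in \<open>sc_subspace\<close> asks for a resolution, which explains the
  case of the empty set. On both sets \<open>S - z\<close> is trivially bijective with bounded
  inverse, for every \<open>z\<close>.\<close>
hence sub: "sc_subspace S = {} | sc_subspace S = {0}" by blast
have "S 0 - z *C 0 = 0" for z
 by (simp add: scaleC.zero_right clinD[OF unitary_clin[OF S]])
hence "bij_betw (%f. S f - z *C f) (sc_subspace S) (sc_subspace S) &
  (EX C. ALL f:sc_subspace S. norm f <= C * norm (S f - z *C f))" for z
 using sub by (elim disjE) (simp_all add: bij_betw_def)
thus ?thesis unfolding sc_spectrum_def spectrum_on_def by blast
qed

section \<open>Fredholm theory for power series\<close>

text \<open>The Wiener algebra of radius \<open>R\<close>: closed under Cauchy products, and for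
  \<open>R > 1\<close> its members are holomorphic beyond the unit circle.\<close>

definition wsummable :: "real => complex fps => bool" where
"wsummable R f \<longleftrightarrow> summable (%n. cmod (fps_nth f n) * R ^ n)"

context
fixes R :: real assumes R: "0 < R"
begin

lemma wsummableI:
assumes "summable g" "!!n. cmod (fps_nth f n) * R ^ n <= g n"
shows "wsummable R f"
unfolding wsummable_def
by (rule summable_comparison_test'[OF assms(1), where N=0])
 (use assms(2) R in "auto simp: abs_mult")

lemma wsummable_add:
assumes "wsummable R f" "wsummable R g"
shows "wsummable R (f + g)"
proof (rule wsummableI)
show "summable (%n. cmod (fps_nth f n) * R ^ n + cmod (fps_nth g n) * R ^ n)"
 using assms unfolding wsummable_def by (rule summable_add)
show "cmod (fps_nth (f + g) n) * R ^ n <= cmod (fps_nth f n) * R ^ n + cmod (fps_nth g n) * R ^ n" for n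
 using mult_right_mono[OF norm_triangle_ineq[of "fps_nth f n" "fps_nth g n"], of "R ^ n"] R
 by (simp add: distrib_right)
qed

lemma wsummable_mult:
assumes "wsummable R f" "wsummable R g"
shows "wsummable R (f * g)"
proof (rule wsummableI)
let ?a = "%n. cmod (fps_nth f n) * R ^ n" and ?b = "%n. cmod (fps_nth g n) * R ^ n"
show "summable (%n. SUM i<=n. ?a i * ?b (n - i))"
 by (rule summable_Cauchy_product)
  (use assms R in "auto simp: wsummable_def abs_mult")
fix n
have "cmod (fps_nth (f * g) n) <= (SUM i=0..n. cmod (fps_nth f i) * cmod (fps_nth g (n - i)))"
 unfolding fps_mult_nth by (rule sum_norm_le) (simp add: norm_mult)
hence "cmod (fps_nth (f * g) n) * R ^ n <= (SUM i=0..n. cmod (fps_nth f i) * cmod (fps_nth g (n - i))) * R ^ n"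
 using R by (intro mult_right_mono) auto
also have "... = (SUM i<=n. ?a i * ?b (n - i))"
 unfolding sum_distrib_right atLeast0AtMost
 by (rule sum.cong) (auto simp: mult_ac simp flip: power_add)
finally show "cmod (fps_nth (f * g) n) * R ^ n <= (SUM i<=n. ?a i * ?b (n - i))" .
qed

lemma wsummable_finite:
assumes "!!n. n >= m ==> fps_nth f n = 0"
shows "wsummable R f"
unfolding wsummable_def
by (rule summable_finite[of "{..<m}"]) (use assms in "auto simp: not_less")

lemma wsummable_0: "wsummable R 0" by (rule wsummable_finite[of 0]) auto
lemma wsummable_1: "wsummable R 1" by (rule wsummable_finite[of 1]) auto
lemma wsummable_X_power: "wsummable R (fps_X ^ k)"
by (rule wsummable_finite[of "Suc k"]) (auto simp: fps_X_power_nth)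

lemma wsummable_uminus: "wsummable R f ==> wsummable R (- f)"
by (simp add: wsummable_def)

lemma wsummable_diff:
"wsummable R f ==> wsummable R g ==> wsummable R (f - g)"
using wsummable_add[of f "- g"] wsummable_uminus[of g] by simp

lemma wsummable_sum:
"(!!i. i : I ==> wsummable R (f i)) ==> wsummable R (SUM i:I. f i)"
by (induction I rule: infinite_finite_induct) (auto intro: wsummable_0 wsummable_add)

text \<open>Gaussian elimination without division. Eliminating the unknown \<open>c k\<close>
  multiplies the system by the pivot \<open>u = 1 - N k k\<close>, whose constant coefficient is 1;
  the product of all pivots is the denominator \<open>d\<close>, and it cannot vanish since its
  constant coefficient stays 1.\<close>

lemma fps_linear_system:
assumes "finite I"
 and "!!a b. a : I ==> b : I ==> wsummable R (N a b)"
 and "!!a b. a : I ==> b : I ==> fps_nth (N a b) 0 = 0"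
 and "!!a. a : I ==> wsummable R (be a)"
 and "!!a. a : I ==> c a = be a + (SUM b:I. N a b * c b)"
shows "EX d. wsummable R d & fps_nth d 0 = 1 & (ALL a:I. wsummable R (d * c a))"
using assms
proof (induction I arbitrary: N be rule: finite_induct)
case empty
thus ?case by (intro exI[of _ 1]) (auto intro: wsummable_1)
next
case (insert k I)
define u where "u = 1 - N k k"
\<comment> \<open>Row a is multiplied by \<open>u\<close>, and \<open>u * c k\<close> is replaced
  through equation k. Since \<open>u * c a = c a - N k k * c a\<close>, the diagonal correction
  \<open>N k k\<close> restores the form of the system, and all constant coefficients of
  \<open>N'\<close> are again 0.\<close>
define N' where "N' a b = u * N a b + N a k * N k b + (if a = b then N k k else 0)" for a b
define be' where "be' a = u * be a + N a k * be k" for a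
have uR: "wsummable R u" unfolding u_def
 by (intro wsummable_diff wsummable_1 insert.prems) auto
have u0: "fps_nth u 0 = 1" unfolding u_def using insert.prems(2)[of k k] by simp
have uck: "u * c k = be k + (SUM b:I. N k b * c b)"
proof -
 have "c k = be k + (N k k * c k + (SUM b:I. N k b * c b))"
  using insert.prems(4)[of k] insert.hyps by simp
 hence "c k = (be k + (SUM b:I. N k b * c b)) + N k k * c k"
  by (metis add.assoc add.commute)
 thus ?thesis unfolding u_def left_diff_distrib mult_1_left diff_eq_eq .
qed
have "EX d. wsummable R d & fps_nth d 0 = 1 & (ALL a:I. wsummable R (d * c a))"
proof (rule insert.IH[of N' be'])
 show "wsummable R (N' a b)" if "a : I" "b : I" for a b
  unfolding N'_def using that insert.prems
  by (intro wsummable_add wsummable_mult uR) (auto intro: wsummable_0)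
 show "fps_nth (N' a b) 0 = 0" if "a : I" "b : I" for a b
  unfolding N'_def using that insert.prems by auto
 show "wsummable R (be' a)" if "a : I" for a
  unfolding be'_def using that insert.prems
  by (intro wsummable_add wsummable_mult uR) auto
 show "c a = be' a + (SUM b:I. N' a b * c b)" if a: "a : I" for a
 proof -
  have ca: "c a = be a + (N a k * c k + (SUM b:I. N a b * c b))"
   using insert.prems(4)[of a] a insert.hyps by simp
  have "u * c a = u * be a + N a k * (u * c k) + (SUM b:I. u * N a b * c b)"
   by (subst ca) (simp add: algebra_simps sum_distrib_left)
  also have "... = be' a + (SUM b:I. (u * N a b + N a k * N k b) * c b)"
   unfolding uck be'_def by (simp add: algebra_simps sum_distrib_left sum.distrib)
  finally have uca: "u * c a = be' a + (SUM b:I. (u * N a b + N a k * N k b) * c b)" .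
  have "(SUM b:I. N' a b * c b) = (SUM b:I. (u * N a b + N a k * N k b) * c b) + (SUM b:I. if a = b then N k k * c b else 0)"
   unfolding sum.distrib[symmetric] N'_def by (rule sum.cong) (auto simp: distrib_right)
  also have "(SUM b:I. if a = b then N k k * c b else 0) = N k k * c a"
   using a insert.hyps(1) by (simp add: sum.delta')
  finally have "be' a + (SUM b:I. N' a b * c b) = u * c a + N k k * c a" by (simp add: uca add.assoc)
  thus ?thesis by (simp add: u_def algebra_simps)
 qed
qed
then obtain d where d: "wsummable R d" "fps_nth d 0 = 1" "!!a. a : I ==> wsummable R (d * c a)" by blast
have "wsummable R (u * d * c a)" if "a : insert k I" for a
proof (cases "a = k")
 case True
 have "u * d * c k = d * be k + (SUM b:I. N k b * (d * c b))"
  using arg_cong[OF uck, of "%x. d * x"] by (simp add: algebra_simps sum_distrib_left)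
 moreover have "wsummable R ..."
  by (intro wsummable_add wsummable_mult wsummable_sum d insert.prems(1,3)) auto
 ultimately show ?thesis using True by (simp only:)
next
 case False
 thus ?thesis using wsummable_mult[OF uR d(3)[of a]] that by (simp add: mult.assoc)
qed
thus ?case
 using d u0 by (intro exI[of _ "u * d"]) (auto intro: wsummable_mult uR)
qed

end

text \<open>Solution of a discrete Volterra equation. Only lags \<open>N - j >= 1\<close> enter, so
  the equation determines the sequence step by step, with no inverse and no convergence
  involved.\<close>

fun volterra :: "(nat => L2 => L2) => (nat => L2) => nat => L2" where
"volterra E x N = x N + (SUM j<N. E (N - j) (volterra E x j))"

declare volterra.simps [simp del]

definition clin_fun :: "(L2 => complex) => bool" where
"clin_fun f \<longleftrightarrow> (ALL x y. f (x + y) = f x + f y) & (ALL c x. f (c *C x) = c * f x)"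

lemma clin_funD:
assumes "clin_fun f"
shows "f (x + y) = f x + f y" "f (c *C x) = c * f x" "f 0 = 0" "f (SUM i:I. h i) = (SUM i:I. f (h i))"
 "f (x - y) = f x - f y"
proof -
show a: "f (x + y) = f x + f y" "f (c *C x) = c * f x" for x y c using assms by (auto simp: clin_fun_def)
show z: "f 0 = 0" using a(2)[of 0 0] by (simp add: scaleC.zero_left)
show "f (SUM i:I. h i) = (SUM i:I. f (h i))"
 by (induction I rule: infinite_finite_induct) (auto simp: a z)
show "f (x - y) = f x - f y" using a(1)[of "x - y" y] by simp
qed

text \<open>The product of the functional-valued series \<open>et\<close> with the vector-valued
  series \<open>v\<close>.\<close>

definition star :: "(nat => L2 => complex) => (nat => L2) => complex fps" where
"star et v = Abs_fps (%N. SUM j<=N. et (N - j) (v j))"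

lemma volterra_unique:
assumes "!!N. w N = x N + (SUM j<N. E (N - j) (w j))"
shows "w N = volterra E x N"
proof (induction N rule: less_induct)
case (less N)
thus ?case by (subst assms, subst volterra.simps) simp
qed

lemma volterra_add:
assumes "!!n. complex_linear (E n)"
shows "volterra E (%N. x N + y N) N = volterra E x N + volterra E y N"
proof (rule volterra_unique[symmetric])
show "volterra E x N + volterra E y N = x N + y N + (SUM j<N. E (N - j) (volterra E x j + volterra E y j))" for N
 by (subst (1 2) volterra.simps) (simp add: clinD[OF assms] sum.distrib)
qed

lemma volterra_zero:
assumes "!!n. complex_linear (E n)"
shows "volterra E (%N. 0) N = 0"
by (rule volterra_unique[symmetric]) (simp add: clinD[OF assms])

lemma volterra_sum:
assumes "!!n. complex_linear (E n)"
shows "volterra E (%N. SUM i:I. x i N) N = (SUM i:I. volterra E (x i) N)"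
proof (induction I rule: infinite_finite_induct)
case (insert a F)
thus ?case by (simp add: volterra_add[OF assms])
qed (simp_all add: volterra_zero[OF assms])

abbreviation impulse :: "L2 => nat => L2" where
"impulse xph \<equiv> (%N. if N = 0 then xph else 0)"

text \<open>The equation is invariant under shifts of \<open>N\<close>, so the response to an input
  with scalar profile \<open>s\<close> is the convolution of \<open>s\<close> with the impulse
  response. This extracts the unknown scalars from the solution operator.\<close>

lemma volterra_convolution:
assumes E: "!!n. complex_linear (E n)"
shows "volterra E (%N. s N *C xph) N = (SUM j<=N. s j *C volterra E (impulse xph) (N - j))"
proof (rule volterra_unique[symmetric])
fix N
let ?g = "volterra E (impulse xph)"
have g: "?g n = (SUM k<n. E (n - k) (?g k))" if "n > 0" for n
 using that by (subst volterra.simps) simp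
have g0: "?g 0 = xph" by (subst volterra.simps) simp
have "(SUM k<N. E (N - k) (SUM j<=k. s j *C ?g (k - j))) = (SUM k<N. SUM j<=k. s j *C E (N - k) (?g (k - j)))"
 by (simp add: clinD[OF E])
also have "... = (SUM (k, j):(SIGMA k:{..<N}. {..k}). s j *C E (N - k) (?g (k - j)))"
 by (rule sum.Sigma) auto
also have "... = (SUM (j, i):(SIGMA j:{..<N}. {..<N - j}). s j *C E (N - j - i) (?g i))"
 by (rule sum.reindex_bij_witness[of _ "%(j, i). (j + i, j)" "%(k, j). (j, k - j)"]) auto
also have "... = (SUM j<N. SUM i<N - j. s j *C E (N - j - i) (?g i))"
 by (rule sum.Sigma[symmetric]) auto
also have "... = (SUM j<N. s j *C ?g (N - j))"
 by (rule sum.cong) (auto simp: g scaleC.sum_right)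
finally have "(SUM k<N. E (N - k) (SUM j<=k. s j *C ?g (k - j))) = (SUM j<N. s j *C ?g (N - j))" .
moreover have "(SUM j<=N. s j *C ?g (N - j)) = s N *C xph + (SUM j<N. s j *C ?g (N - j))"
 by (simp add: lessThan_Suc_atMost[symmetric] g0 add.commute)
ultimately show "(SUM j<=N. s j *C ?g (N - j)) = s N *C xph + (SUM k<N. E (N - k) (SUM j<=k. s j *C ?g (k - j)))"
 by simp
qed

lemma star_convolution:
assumes "!!n. clin_fun (et n)"
shows "star et (%N. SUM j<=N. s j *C g (N - j)) = Abs_fps s * star et g"
proof (rule fps_ext)
fix N
have "fps_nth (star et (%N. SUM j<=N. s j *C g (N - j))) N = (SUM k<=N. SUM j<=k. s j * et (N - k) (g (k - j)))"
 by (simp add: star_def clin_funD[OF assms])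
also have "... = (SUM (k, j):(SIGMA k:{..N}. {..k}). s j * et (N - k) (g (k - j)))"
 by (rule sum.Sigma) auto
also have "... = (SUM (j, i):(SIGMA j:{..N}. {..N - j}). s j * et (N - j - i) (g i))"
 by (rule sum.reindex_bij_witness[of _ "%(j, i). (j + i, j)" "%(k, j). (j, k - j)"]) auto
also have "... = (SUM j<=N. SUM i<=N - j. s j * et (N - j - i) (g i))"
 by (rule sum.Sigma[symmetric]) auto
also have "... = fps_nth (Abs_fps s * star et g) N"
 by (simp add: fps_mult_nth star_def sum_distrib_left atLeast0AtMost)
finally show "fps_nth (star et (%N. SUM j<=N. s j *C g (N - j))) N = fps_nth (Abs_fps s * star et g) N" .
qed

lemma star_add:
assumes "!!n. clin_fun (et n)"
shows "star et (%N. v N + w N) = star et v + star et w"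
by (rule fps_ext) (simp add: star_def clin_funD[OF assms] sum.distrib)

lemma star_sum:
assumes "!!n. clin_fun (et n)"
shows "star et (%N. SUM i:I. v i N) = (SUM i:I. star et (v i))"
proof (induction I rule: infinite_finite_induct)
case (insert a F)
thus ?case by (simp add: star_add[OF assms])
qed (auto intro!: fps_ext simp: star_def clin_funD[OF assms])

text \<open>After the sums are exchanged, the convolution is bounded by the mass of \<open>e\<close>
  times the sum of \<open>X\<close>; mass at most 1/2 lets it be absorbed by the left side.\<close>

lemma discrete_gronwall:
fixes X y e :: "nat => real"
assumes X: "!!N. 0 <= X N" "!!N. X N <= y N + (SUM j<N. e (N - j) * X j)"
 and e: "!!n. 0 <= e n" "!!m. (SUM n<m. e n) <= 1/2"
shows "(SUM N<m. X N) <= 2 * (SUM N<m. y N)"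
proof -
have "(SUM N<m. X N) <= (SUM N<m. y N) + (SUM N<m. SUM j<N. e (N - j) * X j)"
 using sum_mono[of "{..<m}" X "%N. y N + (SUM j<N. e (N - j) * X j)"] X(2) by (simp add: sum.distrib)
also have "(SUM N<m. SUM j<N. e (N - j) * X j) = (SUM (N, j):(SIGMA N:{..<m}. {..<N}). e (N - j) * X j)"
 by (rule sum.Sigma) auto
also have "... = (SUM (j, i):(SIGMA j:{..<m}. {1..<m - j}). e i * X j)"
 by (rule sum.reindex_bij_witness[of _ "%(j, i). (j + i, j)" "%(N, j). (j, N - j)"]) auto
also have "... = (SUM j<m. SUM i:{1..<m - j}. e i * X j)"
 by (rule sum.Sigma[symmetric]) auto
also have "... <= (SUM j<m. 1/2 * X j)"
proof (rule sum_mono)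
 fix j
 have "(SUM i:{1..<m - j}. e i) <= (SUM i<m - j. e i)" using e by (intro sum_mono2) auto
 hence "(SUM i:{1..<m - j}. e i) <= 1/2" using e(2)[of "m - j"] by simp
 thus "(SUM i:{1..<m - j}. e i * X j) <= 1/2 * X j"
  unfolding sum_distrib_right[symmetric] using X(1) by (intro mult_right_mono) auto
qed
finally show ?thesis by (simp add: sum_distrib_left[symmetric] sum_divide_distrib[symmetric])
qed

lemma wsummable_star:
assumes R: "0 < R" and r: "0 < r" "r * R < 1" and K: "0 <= K"
 and et: "!!n h. cmod (et n h) <= K * r ^ n * p h"
 and p: "!!x. 0 <= p x" and v: "summable (%n. p (v n) * R ^ n)"
shows "wsummable R (star et v)"
proof (rule wsummableI[OF R])
let ?a = "%n. K * (r * R) ^ n" and ?b = "%n. p (v n) * R ^ n"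
show "summable (%N. SUM j<=N. ?b j * ?a (N - j))"
proof (rule summable_Cauchy_product)
 show "summable (%k. norm (?b k))" using v p R by (simp add: abs_mult)
 have "summable (%k. ?a k)" using r R by (intro summable_mult summable_geometric) auto
 thus "summable (%k. norm (?a k))" using K r R by (simp add: abs_mult)
qed
fix N
have "cmod (fps_nth (star et v) N) <= (SUM j<=N. K * r ^ (N - j) * p (v j))"
 unfolding star_def fps_nth_Abs_fps by (rule sum_norm_le) (rule et)
hence "cmod (fps_nth (star et v) N) * R ^ N <= (SUM j<=N. K * r ^ (N - j) * p (v j)) * R ^ N"
 using R by (intro mult_right_mono) auto
also have "... = (SUM j<=N. ?b j * ?a (N - j))"
 unfolding sum_distrib_right
 by (rule sum.cong) (auto simp: mult_ac pmd simp flip: power_add)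
finally show "cmod (fps_nth (star et v) N) * R ^ N <= (SUM j<=N. ?b j * ?a (N - j))" .
qed

text \<open>Each \<open>T n\<close> with \<open>1 <= n <= M\<close> is split into a finite-rank part
  and a remainder, so that all remainders together have mass at most 1/2 at a radius
  \<open>R > 1\<close>. The remainders are inverted by \<open>volterra\<close>. What is left is a
  finite linear system for the scalar series \<open>c x\<close>, the functionals of the finite-rank
  parts applied to \<open>w\<close>, over the algebra \<open>wsummable R\<close>.\<close>

lemma meromorphic_continuation:
fixes p :: "L2 => real" and T :: "nat => L2 => L2"
assumes p: "!!x. 0 <= p x" "!!x y. p (x + y) <= p x + p y" "!!c x. p (c *C x) = cmod c * p x"
 and r: "0 < r" "r < 1" and C: "0 <= C"
 and T: "!!n. complex_linear (T n)" "!!n h. n >= 1 ==> p (T n h) <= C * r ^ n * p h"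
 and fr: "!!n e. n >= 1 ==> 0 < e ==> EX k (l :: nat => L2 => complex) xph K.
   (ALL i. clin_fun (l i)) & (ALL i h. cmod (l i h) <= K * p h) &
   (ALL h. p (T n h - (SUM i<k. l i h *C xph i)) <= e * p h)"
 and b: "!!n. p (b n) <= C * r ^ n"
 and w: "!!N. w N = b N + (SUM j<N. T (N - j) (w j))"
 and et: "!!n. clin_fun (et n)" "!!n h. cmod (et n h) <= C * r ^ n * p h"
 and al: "!!n. cmod (al n) <= C * r ^ n"
 and a: "!!N. a N = al N + (SUM j<=N. et (N - j) (w j))"
shows "EX R>1. EX d. fps_nth d 0 = 1 & wsummable R d & wsummable R (d * Abs_fps a)"
proof -
\<comment> \<open>Halfway between 1 and \<open>1 / r\<close>, which gives
  \<open>q = r * R = (1 + r) / 2 < 1\<close>.\<close>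
define R where "R = (1 + 1 / r) / 2"
define q where "q = r * R"
have R1: "1 < R" using r by (simp add: R_def field_simps)
hence R0: "0 < R" by simp
have "q = (r + 1) / 2" using r by (simp add: q_def R_def field_simps)
hence q: "0 < q" "q < 1" using r by auto
have pz: "p 0 = 0" using p(3)[of 0 0] by (simp add: scaleC.zero_left)
have psum: "p (SUM i:I. x i) <= (SUM i:I. p (x i))" for I and x :: "nat => L2"
proof (induction I rule: infinite_finite_induct)
 case (insert i F)
 thus ?case using p(2)[of "x i" "sum x F"] by simp
qed (simp_all add: pz)
\<comment> \<open>From here on the operators themselves are small: their weighted mass beyond
  \<open>M\<close> is at most 1/4, and finite-rank parts are taken off only up to
  \<open>M\<close>.\<close>
obtain M where M: "C * q ^ M / (1 - q) <= 1/4"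
proof -
 have "(%M. C * q ^ M / (1 - q)) ----> C * 0 / (1 - q)"
  by (intro tendsto_intros LIMSEQ_realpow_zero) (use q in auto)
 hence "\<forall>\<^sub>F M in sequentially. C * q ^ M / (1 - q) < 1/4"
  by (intro order_tendstoD(2)) auto
 thus ?thesis using that by (auto simp: eventually_sequentially intro: less_imp_le)
qed
\<comment> \<open>The factor \<open>R ^ n\<close> cancels the weight, so that the at most
  \<open>M\<close> approximation errors contribute no more than 1/4 altogether.\<close>
define xep where "xep n = 1 / (4 * (real M + 1) * R ^ n)" for n :: nat
have eps: "xep n > 0" for n using R0 by (simp add: xep_def)
have "ALL n. EX k (l :: nat => L2 => complex) xph K. n >= 1 -->
   (ALL i. clin_fun (l i)) & (ALL i h. cmod (l i h) <= K * p h) &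
   (ALL h. p (T n h - (SUM i<k. l i h *C xph i)) <= xep n * p h)"
 (is "ALL n. ?P n")
proof
 fix n
 show "?P n"
 proof (cases "n >= 1")
  case True
  thus ?thesis using fr[OF True eps[of n]] by (simp only: simp_thms)
 qed simp
qed
then obtain k and l :: "nat => nat => L2 => complex" and xph K where
 P: "ALL n. n >= 1 --> (ALL i. clin_fun (l n i)) & (ALL i h. cmod (l n i h) <= K n * p h) &
   (ALL h. p (T n h - (SUM i<k n. l n i h *C xph n i)) <= xep n * p h)"
 unfolding choice_iff by (elim exE) (rule that)
have F: "clin_fun (l n i)" "cmod (l n i h) <= K n * p h"
  "p (T n h - (SUM i<k n. l n i h *C xph n i)) <= xep n * p h" if n: "n >= 1" for n i h
 using P[rule_format, OF n] by simp_all
define Fop where "Fop n h = (if 1 <= n & n <= M then (SUM i<k n. l n i h *C xph n i) else 0)" for n h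
define E where "E n h = T n h - Fop n h" for n h
have Flin: "complex_linear (Fop n)" for n
 unfolding complex_linear_def Fop_def
 by (auto simp: clin_funD[OF F(1)] scaleC_add_left sum.distrib scaleC.sum_right scaleC.zero_right)
have Elin: "complex_linear (E n)" for n
 unfolding complex_linear_def E_def
 by (simp add: clinD[OF Flin] clinD[OF T(1)] scaleC.diff_right)
define e where "e n = (if n = 0 then 0 else if n <= M then xep n else C * r ^ n)" for n
have e0: "0 <= e n" for n using eps[of n] C r by (auto simp: e_def less_imp_le)
have Ebound: "p (E n h) <= e n * p h" if "n >= 1" for n h
 using that F(3)[of n h] T(2)[of n h] by (auto simp: E_def Fop_def e_def)
have esum: "(SUM n<m. e n * R ^ n) <= 1/2" for m
proof -
 have "(SUM n<m. e n * R ^ n) <= (SUM n<m. (if n : {1..M} then 1 / (4 * (real M + 1)) else 0) + (if M < n then C * q ^ n else 0))"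
  by (rule sum_mono) (use R0 C r in "auto simp: e_def xep_def q_def pmd")
 also have "... <= 1/4 + 1/4"
  unfolding sum.distrib
 proof (rule add_mono)
  have "(SUM n<m. if n : {1..M} then 1 / (4 * (real M + 1)) else 0) = (SUM n:{..<m} \<inter> {1..M}. 1 / (4 * (real M + 1)))"
   by (rule sum.inter_restrict[symmetric]) simp
  also have "... <= (SUM n:{1..M}. 1 / (4 * (real M + 1)))"
   by (rule sum_mono2) auto
  also have "... <= 1/4" by (simp add: field_simps)
  finally show "(SUM n<m. if n : {1..M} then 1 / (4 * (real M + 1)) else 0) <= 1/4" .
  have "(SUM n<m. if M < n then C * q ^ n else 0) <= (SUM n<M + m. if M < n then C * q ^ n else 0)"
   by (rule sum_mono2) (use C q in auto)
  also have "... = (SUM n:{M<..<M + m}. C * q ^ n)"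
   by (simp add: sum.inter_filter[symmetric] greaterThanLessThan_def lessThan_def greaterThan_def Int_def conj_commute)
  also have "... <= (SUM n:{M..<M + m}. C * q ^ n)"
   by (rule sum_mono2) (use C q in auto)
  also have "... = (SUM i<m. C * q ^ (M + i))"
   by (rule sum.reindex_bij_witness[of _ "%i. M + i" "%n. n - M"]) auto
  also have "... = C * q ^ M * (SUM i<m. q ^ i)" by (simp add: power_add sum_distrib_left mult_ac)
  also have "... <= C * q ^ M * (1 / (1 - q))"
   using q C by (intro mult_left_mono) (auto simp: sum_gp_strict divide_right_mono)
  also have "... <= 1/4" using M by simp
  finally show "(SUM n<m. if M < n then C * q ^ n else 0) <= 1/4" .
 qed
 finally show ?thesis by simp
qed
have Vsum: "summable (%N. p (volterra E x N) * R ^ N)" if x: "summable (%N. p (x N) * R ^ N)" for x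
proof (rule bounded_imp_summable)
 show "0 <= p (volterra E x N) * R ^ N" for N using p R0 by simp
 fix m
 have "(SUM N<Suc m. p (volterra E x N) * R ^ N) <= 2 * (SUM N<Suc m. p (x N) * R ^ N)"
 proof (rule discrete_gronwall[where e="%n. e n * R ^ n"])
  show "0 <= p (volterra E x N) * R ^ N" for N using p R0 by simp
  show "p (volterra E x N) * R ^ N <= p (x N) * R ^ N + (SUM j<N. e (N - j) * R ^ (N - j) * (p (volterra E x j) * R ^ j))" for N
  proof -
   have "p (volterra E x N) <= p (x N) + (SUM j<N. p (E (N - j) (volterra E x j)))"
    by (subst volterra.simps) (intro order_trans[OF p(2)] add_left_mono psum)
   also have "... <= p (x N) + (SUM j<N. e (N - j) * p (volterra E x j))"
    by (intro add_left_mono sum_mono Ebound) auto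
   finally have "p (volterra E x N) * R ^ N <= (p (x N) + (SUM j<N. e (N - j) * p (volterra E x j))) * R ^ N"
    using R0 by (intro mult_right_mono) auto
   also have "... = p (x N) * R ^ N + (SUM j<N. e (N - j) * R ^ (N - j) * (p (volterra E x j) * R ^ j))"
    unfolding distrib_right sum_distrib_right
    by (intro arg_cong2[where f="(+)"] refl sum.cong) (auto simp: mult_ac simp flip: power_add)
   finally show ?thesis .
  qed
 qed (use e0 R0 esum in auto)
 also have "... <= 2 * (\<Sum>N. p (x N) * R ^ N)"
  by (intro mult_left_mono sum_le_suminf x) (use p R0 in auto)
 finally show "(SUM N<=m. p (volterra E x N) * R ^ N) <= 2 * (\<Sum>N. p (x N) * R ^ N)"
  by (simp only: lessThan_Suc_atMost)
qed
have geo: "summable (%n. C * q ^ n)" using q by (intro summable_mult summable_geometric) auto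
have bsum: "summable (%N. p (b N) * R ^ N)"
proof (rule summable_comparison_test'[OF geo, where N=0])
 fix n
 have "p (b n) * R ^ n <= C * r ^ n * R ^ n" using b R0 by (intro mult_right_mono) auto
 thus "norm (p (b n) * R ^ n) <= C * q ^ n" using p R0 by (simp add: q_def pmd abs_mult)
qed
have isum: "summable (%N. p (impulse ps N) * R ^ N)" for ps
 by (rule summable_finite[of "{0}"]) (auto simp: pz)
define I where "I = (SIGMA n:{1..M}. {..<k n})"
have finI: "finite I" by (simp add: I_def)
have In: "n >= 1" "n <= M" "i < k n" if "(n, i) : I" for n i using that by (auto simp: I_def)
\<comment> \<open>The single functional is placed at index 0 of a sequence, so that
  \<open>star (lhat x) w\<close> just has the coefficients \<open>l (w N)\<close> and the lemmas on
  \<open>star\<close> apply to it.\<close>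
define lhat where "lhat x n = (if n = 0 then l (fst x) (snd x) else (%h. 0))" for x :: "nat \<times> nat" and n :: nat
have lhat_lin: "clin_fun (lhat x n)" if "x : I" for x n
 using F(1)[of "fst x" "snd x"] In[of "fst x" "snd x"] that by (auto simp: lhat_def clin_fun_def)
define c where "c x = star (lhat x) w" for x
have c_nth: "fps_nth (c x) N = l (fst x) (snd x) (w N)" for x N
proof -
 have "(SUM j<=N. lhat x (N - j) (w j)) = (SUM j:{N}. lhat x (N - j) (w j))"
  by (rule sum.mono_neutral_right) (auto simp: lhat_def)
 thus ?thesis by (simp add: c_def star_def lhat_def)
qed
\<comment> \<open>\<open>T n\<close> acts on \<open>w (N - n)\<close>, hence the shift by
  \<open>fps_X ^ n\<close>. As \<open>n >= 1\<close>, it also gives the coefficients of the linear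
  system their constant term 0.\<close>
let ?s = "%x N. fps_nth (fps_X ^ fst x * c x) N"
let ?g = "%x. volterra E (impulse (xph (fst x) (snd x)))"
have w_eq: "w N = volterra E b N + (SUM x:I. SUM j<=N. ?s x j *C ?g x (N - j))" for N
proof -
 have "w N = volterra E (%N. b N + (SUM x:I. ?s x N *C xph (fst x) (snd x))) N"
 proof (rule volterra_unique)
  fix N
  have "(SUM j<N. T (N - j) (w j)) = (SUM j<N. E (N - j) (w j)) + (SUM j<N. Fop (N - j) (w j))"
   by (simp add: E_def sum_subtractf)
  also have "(SUM j<N. Fop (N - j) (w j)) = (SUM n:{1..N}. Fop n (w (N - n)))"
   by (rule sum.reindex_bij_witness[of _ "%n. N - n" "%j. N - j"]) auto
  also have "... = (SUM n:{1..M}. if n <= N then Fop n (w (N - n)) else 0)"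
   unfolding sum.inter_filter[symmetric, OF finite_atLeastAtMost]
   by (rule sum.mono_neutral_cong) (auto simp: Fop_def)
  also have "... = (SUM n:{1..M}. SUM i<k n. ?s (n, i) N *C xph n i)"
   by (rule sum.cong) (auto simp: fps_X_power_mult_nth c_nth Fop_def scaleC.zero_left)
  also have "... = (SUM x:I. ?s x N *C xph (fst x) (snd x))"
   unfolding I_def by (subst sum.Sigma) (auto simp: case_prod_beta)
  finally show "w N = (b N + (SUM x:I. ?s x N *C xph (fst x) (snd x))) + (SUM j<N. E (N - j) (w j))"
   by (subst w) (simp add: add_ac)
 qed
 also have "... = volterra E b N + (SUM x:I. volterra E (%N. ?s x N *C xph (fst x) (snd x)) N)"
  by (simp only: volterra_add[OF Elin] volterra_sum[OF Elin])
 also have "... = volterra E b N + (SUM x:I. SUM j<=N. ?s x j *C ?g x (N - j))"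
  by (simp only: volterra_convolution[OF Elin])
 finally show ?thesis .
qed
have star_w: "star th0 w = star th0 (volterra E b) + (SUM x:I. (fps_X ^ fst x * star th0 (?g x)) * c x)"
 if th0: "!!n. clin_fun (th0 n)" for th0
proof -
 have "star th0 w = star th0 (%N. volterra E b N + (SUM x:I. SUM j<=N. ?s x j *C ?g x (N - j)))"
  by (rule arg_cong[where f="star th0"]) (rule ext, rule w_eq)
 also have "... = star th0 (volterra E b) + (SUM x:I. star th0 (%N. SUM j<=N. ?s x j *C ?g x (N - j)))"
  by (simp only: star_add[OF th0] star_sum[OF th0])
 also have "... = star th0 (volterra E b) + (SUM x:I. (fps_X ^ fst x * c x) * star th0 (?g x))"
 proof (intro arg_cong2[where f="(+)"] refl sum.cong)
  fix x
  show "star th0 (%N. SUM j<=N. ?s x j *C ?g x (N - j)) = (fps_X ^ fst x * c x) * star th0 (?g x)"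
   using star_convolution[OF th0, where s="fps_nth (fps_X ^ fst x * c x)" and g="?g x"]
   by (simp only: fps_nth_inverse)
 qed
 finally show ?thesis by (simp add: mult_ac)
qed
have lw: "wsummable R (star (lhat x) v)" if x: "x : I" and v: "summable (%n. p (v n) * R ^ n)" for x v
proof (rule wsummable_star[OF R0 r(1) _ _ _ p(1) v, of "max 0 (K (fst x))"])
 have n1: "fst x >= 1" using In[of "fst x" "snd x"] x by simp
 show "cmod (lhat x n h) <= max 0 (K (fst x)) * r ^ n * p h" for n h
 proof (cases "n = 0")
  case True
  have "cmod (lhat x n h) <= K (fst x) * p h" using F(2)[OF n1] True by (simp add: lhat_def)
  also have "... <= max 0 (K (fst x)) * p h" using p by (intro mult_right_mono) auto
  finally show ?thesis using True by simp
 qed (use p r in "simp add: lhat_def")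
qed (use q in "auto simp: q_def")
have "EX d. wsummable R d & fps_nth d 0 = 1 & (ALL x:I. wsummable R (d * c x))"
proof (rule fps_linear_system[OF R0 finI])
 show "c x = star (lhat x) (volterra E b) + (SUM y:I. (fps_X ^ fst y * star (lhat x) (?g y)) * c y)" if "x : I" for x
  using star_w[OF lhat_lin[OF that]] unfolding c_def .
 show "wsummable R (star (lhat x) (volterra E b))" if "x : I" for x
  using that by (intro lw Vsum bsum)
 show "wsummable R (fps_X ^ fst y * star (lhat x) (?g y))" if "x : I" "y : I" for x y
  using that by (intro wsummable_mult[OF R0] wsummable_X_power[OF R0] lw Vsum isum)
 show "fps_nth (fps_X ^ fst y * star (lhat x) (?g y)) 0 = 0" if "x : I" "y : I" for x y
  using In[of "fst y" "snd y"] that by (simp add: fps_X_power_mult_nth)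
qed
then obtain d where d: "wsummable R d" "fps_nth d 0 = 1" "!!x. x : I ==> wsummable R (d * c x)" by blast
have etw: "wsummable R (star et v)" if v: "summable (%n. p (v n) * R ^ n)" for v
 by (rule wsummable_star[OF R0 r(1) _ C et(2) p(1) v]) (use q in "simp add: q_def")
have alw: "wsummable R (Abs_fps al)"
proof (rule wsummableI[OF R0 geo])
 fix n
 have "cmod (al n) * R ^ n <= C * r ^ n * R ^ n" using al R0 by (intro mult_right_mono) auto
 thus "cmod (fps_nth (Abs_fps al) n) * R ^ n <= C * q ^ n" by (simp add: q_def pmd)
qed
have "Abs_fps a = Abs_fps al + star et w" by (rule fps_ext) (simp add: a star_def)
hence "d * Abs_fps a = d * (Abs_fps al + star et (volterra E b)) + (SUM x:I. (fps_X ^ fst x * star et (?g x)) * (d * c x))"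
 unfolding star_w[OF et(1)] by (simp add: algebra_simps sum_distrib_left)
moreover have "wsummable R ..."
 by (intro wsummable_add[OF R0] wsummable_mult[OF R0] wsummable_sum[OF R0] d alw etw Vsum bsum isum
   wsummable_X_power[OF R0])
ultimately have "wsummable R (d * Abs_fps a)" by simp
thus ?thesis using d R1 by blast
qed

section \<open>Finite-rank approximation in a semi-inner product\<close>

locale semi_inner_product =
fixes B :: "L2 => L2 => complex"
assumes add_right: "B x (y + z) = B x y + B x z"
 and scale_right: "B x (c *C y) = c * B x y"
 and hermitian: "B y x = cnj (B x y)"
 and nonneg: "0 <= Re (B x x)"
begin

definition seminorm :: "L2 => real" where "seminorm x = sqrt (Re (B x x))"

lemma B_self: "B x x = cor ((seminorm x)^2)"
proof -
have "Im (B x x) = - Im (B x x)" by (subst hermitian) simp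
thus ?thesis using nonneg[of x] by (simp add: complex_eq_iff seminorm_def)
qed

lemma add_left: "B (x + y) z = B x z + B y z"
by (subst (1 2 3) hermitian) (simp add: add_right)

lemma scale_left: "B (c *C x) y = cnj c * B x y"
by (subst (1 2) hermitian) (simp add: scale_right)

lemma clin_fun_B: "clin_fun (B x)"
by (simp add: clin_fun_def add_right scale_right)

lemma seminorm_nonneg: "0 <= seminorm x" using nonneg by (simp add: seminorm_def)

lemma seminorm_scale: "seminorm (c *C x) = cmod c * seminorm x"
proof -
have "cor ((seminorm (c *C x))^2) = cor ((cmod c * seminorm x)^2)"
 unfolding B_self[symmetric] pmd of_real_mult cmod_power2_cnj[symmetric]
 by (simp add: scale_left scale_right mult.assoc)
hence "(seminorm (c *C x))^2 = (cmod c * seminorm x)^2" by (simp only: of_real_eq_iff)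
thus ?thesis by (simp add: power2_eq_iff_nonneg seminorm_nonneg)
qed

lemma diff_right: "B x (y - z) = B x y - B x z"
by (rule clin_funD(5)[OF clin_fun_B])

lemma sum_right: "B x (SUM i:I. h i) = (SUM i:I. B x (h i))"
by (rule clin_funD(4)[OF clin_fun_B])

text \<open>The form may be degenerate. If \<open>seminorm y > 0\<close> the usual optimal
  \<open>t\<close> works; if \<open>seminorm y = 0\<close> the quadratic \<open>q\<close> is affine
  in \<open>t\<close> and would become negative for a nonzero \<open>b\<close>.\<close>

lemma Cauchy_Schwarz: "cmod (B x y) <= seminorm x * seminorm y"
proof -
define c where "c = cis (- Arg (B x y))"
have "B x y = cor (cmod (B x y)) * cis (Arg (B x y))" by (metis rcis_cmod_Arg rcis_def)
hence "c * B x y = cor (cmod (B x y)) * (cis (Arg (B x y)) * c)"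
 by (metis mult.commute mult.assoc)
hence c: "c * B x y = cor (cmod (B x y))" by (simp add: c_def cis_mult)
have cc: "cnj c * c = 1" by (simp add: cmod_power2_cnj c_def)
define b where "b = cmod (B x y)"
have q: "0 <= (seminorm x)^2 + 2 * t * b + t^2 * (seminorm y)^2" for t :: real
proof -
 let ?z = "cor t * c"
 have "B (x + ?z *C y) (x + ?z *C y) =
   B x x + ?z * B x y + cnj (?z * B x y) + (cor t)^2 * (cnj c * c) * B y y"
  using hermitian[of x y] by (simp add: add_left add_right scale_left scale_right algebra_simps p2es)
 also have "... = cor ((seminorm x)^2 + 2 * t * b + t^2 * (seminorm y)^2)"
  unfolding cc B_self mult.assoc c by (simp add: b_def)
 finally show ?thesis using nonneg[of "x + ?z *C y"] by (simp only: Re_complex_of_real)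
qed
have "b^2 <= (seminorm x)^2 * (seminorm y)^2"
proof (cases "seminorm y = 0")
 case True
 have "b = 0"
 proof (rule ccontr)
  assume "b ~= 0"
  hence "b > 0" by (simp add: b_def)
  have "0 <= (seminorm x)^2 + 2 * (- ((seminorm x)^2 + 1) / (2 * b)) * b"
   using q[of "- ((seminorm x)^2 + 1) / (2 * b)"] True by simp
  also have "... = - 1" using `b > 0` by (simp add: field_simps)
  finally show False by simp
 qed
 thus ?thesis by simp
next
 case False
 define Y where "Y = (seminorm y)^2"
 have y: "Y > 0" using False by (simp add: Y_def)
 have "(seminorm x)^2 + 2 * (- b / Y) * b + (- b / Y)^2 * Y = (seminorm x)^2 - b^2 / Y"
  using y by (simp add: p2es field_simps)
 hence "0 <= (seminorm x)^2 - b^2 / Y"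
  using q[of "- b / Y"] by (simp only: Y_def)
 thus ?thesis using y by (simp add: field_simps Y_def[symmetric])
qed
hence "b^2 <= (seminorm x * seminorm y)^2" by (simp add: pmd)
thus ?thesis unfolding b_def[symmetric]
 by (rule power2_le_imp_le) (simp add: seminorm_nonneg)
qed

lemma seminorm_triangle: "seminorm (x + y) <= seminorm x + seminorm y"
proof (rule power2_le_imp_le)
have "cor ((seminorm (x + y))^2) = B x x + B y y + (B x y + cnj (B x y))"
 unfolding B_self[symmetric] using hermitian[of x y] by (simp add: add_left add_right)
also have "... = cor ((seminorm x)^2 + (seminorm y)^2 + 2 * Re (B x y))"
 unfolding B_self complex_add_cnj by simp
finally have "(seminorm (x + y))^2 = (seminorm x)^2 + (seminorm y)^2 + 2 * Re (B x y)"
 by (simp only: of_real_eq_iff)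
also have "... <= (seminorm x)^2 + (seminorm y)^2 + 2 * (seminorm x * seminorm y)"
 using complex_Re_le_cmod[of "B x y"] Cauchy_Schwarz[of x y] by simp
finally show "(seminorm (x + y))^2 <= (seminorm x + seminorm y)^2" by (simp add: power2_sum)
qed (simp add: seminorm_nonneg)

definition orthonormal :: "nat => (nat => L2) => bool" where
"orthonormal k f \<longleftrightarrow> (ALL i<k. ALL j<k. B (f i) (f j) = of_bool (i = j))"

lemma orthonormal_combination:
assumes "orthonormal k f"
shows "(seminorm (SUM i<k. c i *C f i))^2 = (SUM i<k. (cmod (c i))^2)"
proof -
let ?s = "SUM i<k. c i *C f i"
have "B (f j) ?s = c j" if "j < k" for j
proof -
 have "B (f j) ?s = (SUM i<k. if i = j then c i else 0)"
  unfolding sum_right scale_right using assms that by (intro sum.cong) (auto simp: orthonormal_def)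
 thus ?thesis using that by simp
qed
hence j: "B ?s (f j) = cnj (c j)" if "j < k" for j using that by (subst hermitian) simp
have "B ?s ?s = (SUM j<k. c j * B ?s (f j))" by (subst sum_right) (simp add: scale_right)
also have "... = (SUM j<k. cor ((cmod (c j))^2))"
 by (rule sum.cong) (auto simp: j cmod_power2_cnj[symmetric] mult.commute simp del: of_real_power)
finally have "cor ((seminorm ?s)^2) = cor (SUM j<k. (cmod (c j))^2)"
 by (simp only: B_self of_real_sum)
thus ?thesis by (simp only: of_real_eq_iff)
qed

text \<open>Instead of an orthonormal basis, a finite orthonormal system is chosen whose sum of
  squares of \<open>q\<close> comes within \<open>e^2\<close> of the supremum. A unit vector
  orthogonal to it can be adjoined, hence has \<open>q\<close> at most \<open>e\<close>, and so
  \<open>T\<close> has size at most \<open>2 * e\<close> on the orthogonal complement.\<close>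

lemma finite_rank_approximation:
assumes T: "complex_linear T" and M: "!!f. seminorm (T f) <= M * seminorm f"
 and q: "!!f. 0 <= q f" "!!f. seminorm (T f) <= q f + e * seminorm f"
 and HS: "!!k f. orthonormal k f ==> (SUM i<k. (q (f i))^2) <= K"
 and e: "0 < e"
shows "EX k (l :: nat => L2 => complex) xph K. (ALL i. clin_fun (l i)) &
  (ALL i h. cmod (l i h) <= K * seminorm h) &
  (ALL h. seminorm (T h - (SUM i<k. l i h *C xph i)) <= (2 * e) * seminorm h)"
proof -
define S where "S = {(SUM i<k. (q (f i))^2) | k f. orthonormal k f}"
have bdd: "bdd_above S" unfolding S_def bdd_above_def using HS by blast
have "0 : S" unfolding S_def by (rule CollectI, rule exI[of _ 0]) (simp add: orthonormal_def)
hence "S ~= {}" by blast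
moreover have "Sup S - e^2 < Sup S" using e by simp
ultimately have "EX x:S. Sup S - e^2 < x" by (subst (asm) less_cSup_iff) (use bdd in auto)
then obtain k f where f: "orthonormal k f" "Sup S - e^2 < (SUM i<k. (q (f i))^2)"
 unfolding S_def by blast
have on: "B (f i) (f j) = of_bool (i = j)" if "i < k" "j < k" for i j using f(1) that by (simp add: orthonormal_def)
define P where "P h = (SUM i<k. B (f i) h *C f i)" for h
have orth: "B (f j) (h - P h) = 0" if "j < k" for j h
proof -
 have "B (f j) (P h) = (SUM i<k. if i = j then B (f i) h else 0)"
  unfolding P_def sum_right scale_right using that by (intro sum.cong) (auto simp: on)
 thus ?thesis using that by (simp add: diff_right)
qed
have pyth: "(seminorm h)^2 = (seminorm (h - P h))^2 + (SUM i<k. (cmod (B (f i) h))^2)" for h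
proof -
 have "B (h - P h) (f i) = 0" if "i < k" for i using orth[OF that, of h] hermitian[of "h - P h" "f i"] by simp
 hence z: "B (h - P h) (P h) = 0" unfolding P_def sum_right scale_right by simp
 hence z': "B (P h) (h - P h) = 0" by (subst hermitian) simp
 have "B h h = B ((h - P h) + P h) ((h - P h) + P h)" by simp
 also have "... = B (h - P h) (h - P h) + B (P h) (P h)"
  unfolding add_left add_right z z' by simp
 finally have "cor ((seminorm h)^2) = cor ((seminorm (h - P h))^2 + (seminorm (P h))^2)"
  by (simp only: B_self of_real_add)
 hence "(seminorm h)^2 = (seminorm (h - P h))^2 + (seminorm (P h))^2" by (simp only: of_real_eq_iff)
 thus ?thesis unfolding P_def orthonormal_combination[OF f(1)] .
qed
have ph: "seminorm (h - P h) <= seminorm h" for h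
proof (rule power2_le_imp_le)
 show "(seminorm (h - P h))^2 <= (seminorm h)^2" by (subst (2) pyth) (simp add: sum_nonneg)
qed (rule seminorm_nonneg)
have main: "seminorm (T (h - P h)) <= (2 * e) * seminorm h" for h
proof (cases "seminorm (h - P h) = 0")
 case True
 have "0 <= (2 * e) * seminorm h" using e seminorm_nonneg[of h] by simp
 moreover have "seminorm (T (h - P h)) <= 0" using M[of "h - P h"] True by simp
 ultimately show ?thesis by linarith
next
 case False
 define s where "s = seminorm (h - P h)"
 have s: "s > 0" using False seminorm_nonneg[of "h - P h"] by (simp add: s_def)
 define g where "g = cor (1 / s) *C (h - P h)"
 have ng: "seminorm g = 1" using s by (simp add: g_def seminorm_scale s_def norm_divide)
 define f' where "f' i = (if i < k then f i else g)" for i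
 have gf: "B (f i) g = 0" if "i < k" for i unfolding g_def scale_right orth[OF that] by simp
 hence fg: "B g (f i) = 0" if "i < k" for i using that by (subst hermitian) simp
 have gg: "B g g = 1" by (simp add: B_self ng)
 have "orthonormal (Suc k) f'"
  unfolding orthonormal_def f'_def by (auto simp: less_Suc_eq on gf fg gg)
 hence "(SUM i<Suc k. (q (f' i))^2) : S" unfolding S_def by blast
 hence "(SUM i<Suc k. (q (f' i))^2) <= Sup S" using bdd by (rule cSup_upper)
 hence "(SUM i<k. (q (f i))^2) + (q g)^2 <= Sup S" by (simp add: f'_def)
 hence "(q g)^2 <= e^2" using f(2) by linarith
 hence "q g <= e" using e by (simp add: power2_le_iff_abs_le)
 hence "seminorm (T g) <= 2 * e" using q(2)[of g] ng by simp
 moreover have "h - P h = cor s *C g" using s by (simp add: g_def)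
 hence "seminorm (T (h - P h)) = s * seminorm (T g)"
  using s by (simp add: clinD[OF T] seminorm_scale)
 ultimately have "seminorm (T (h - P h)) <= s * (2 * e)" using s by simp
 also have "... <= seminorm h * (2 * e)" using ph[of h] e by (intro mult_right_mono) (auto simp: s_def)
 finally show ?thesis by (simp add: mult.commute)
qed
define l where "l i h = (if i < k then B (f i) h else 0)" for i h
have "clin_fun (l i)" for i
 using clin_fun_B by (auto simp: l_def clin_fun_def)
moreover have "cmod (l i h) <= 1 * seminorm h" for i h
proof (cases "i < k")
 case True
 have "seminorm (f i) = 1" using on[OF True True] seminorm_nonneg[of "f i"] by (simp add: seminorm_def)
 thus ?thesis using True Cauchy_Schwarz[of "f i" h] by (simp add: l_def)
qed (simp add: l_def seminorm_nonneg)
moreover have "seminorm (T h - (SUM i<k. l i h *C T (f i))) <= (2 * e) * seminorm h" for h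
proof -
 have "T (h - P h) = T h - (SUM i<k. l i h *C T (f i))"
  by (simp add: clinD[OF T] P_def l_def)
 thus ?thesis using main[of h] by simp
qed
ultimately show ?thesis by (intro exI[of _ k] exI[of _ l] exI[of _ "%i. T (f i)"] exI[of _ 1]) blast
qed

end

section \<open>Equations with measurable coefficients in time\<close>

text \<open>The fundamental theorem for absolutely continuous functions with values in a Banach
  space, proved with the gauge integral: only values of \<open>u\<close> are compared with Riemann
  sums, so \<open>v\<close> is not assumed to be integrable beforehand.\<close>

lemma has_ae_derivative_has_integral:
fixes u :: "real => 'a::banach"
assumes d: "has_ae_derivative u v" and ab: "a <= b"
shows "(v has_integral (u b - u a)) {a..b}"
proof (cases "a = b")
case False
hence ab: "a < b" using ab by simp
define E where "E = {t. \<not> (u has_vector_derivative v t) (at t)}"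
have "AE t in lebesgue. t \<notin> E"
 using d by (auto simp: has_ae_derivative_def E_def)
hence nE: "negligible E"
 unfolding eventually_ae_filter_negligible by (elim exE conjE negligible_subset) auto
define w where "w t = (if t : E then 0 else v t)" for t
have "(w has_integral (u b - u a)) (cbox a b)"
 unfolding has_integral
proof (intro allI impI)
 fix e :: real assume e: "0 < e"
 define e1 where "e1 = e / 4 / (b - a)"
 have e1: "e1 > 0" using e ab by (simp add: e1_def)
 have ac0: "absolutely_continuous_on {a..b} u" using d by (simp add: has_ae_derivative_def)
 have h: "0 < e / 2" using e by simp
 obtain de where de: "de > 0" and ac1: "ALL (n::nat) p q. (ALL i<n. p i <= q i & {p i..q i} <= {a..b}) -->
   disjoint_family_on (%i. {p i<..<q i}) {..<n} --> (SUM i<n. q i - p i) < de -->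
   (SUM i<n. dist (u (p i)) (u (q i))) < e / 2"
  using ac0[unfolded absolutely_continuous_on_def, THEN spec, THEN mp, OF h] by (elim exE conjE) (rule that)
 have ac: "(SUM i<n. dist (u (p i)) (u (q i))) < e / 2"
  if "!!i. i < n ==> p i <= q i & {p i..q i} <= {a..b}" "disjoint_family_on (%i. {p i<..<q i}) {..<n}"
   "(SUM i<n. q i - p i) < de" for n :: nat and p q
  using ac1[THEN spec, THEN spec, THEN spec, THEN mp, THEN mp, THEN mp, of n p q] that by simp
 have Em: "E : sets lebesgue" using nE by (simp add: negligible_imp_sets)
 obtain U where U: "open U" "E <= U" "U - E : lmeasurable" "emeasure lebesgue (U - E) < ennreal de"
  using sets_lebesgue_outer_open[OF Em de] .
 have Ueq: "U = E \<union> (U - E)" using U(2) by blast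
 have Um: "U : lmeasurable"
  by (subst Ueq) (intro fmeasurable.Un negligible_imp_measurable nE U(3))
 have mU: "measure lebesgue U < de"
 proof -
  have "measure lebesgue U <= measure lebesgue E + measure lebesgue (U - E)"
   by (subst Ueq) (intro measure_Un_le Em fmeasurableD U(3))
  also have "... = measure lebesgue (U - E)" using negligible_imp_measure0[OF nE] by simp
  also have "... < de"
   using U(3,4) de by (simp add: emeasure_eq_measure2 ennreal_less_iff)
  finally show ?thesis .
 qed
 have "EX r>0. ALL y. abs (y - x) < r --> norm (u y - u x - (y - x) *R v x) <= e1 * abs (y - x)" if "x \<notin> E" for x
 proof -
  have "(u has_derivative (%h. h *R v x)) (at x)" using that by (simp add: E_def has_vector_derivative_def)
  thus ?thesis using e1 unfolding has_derivative_at_alt by (auto simp: norm_scaleR)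
 qed
 then obtain r where r: "!!x. x \<notin> E ==> r x > 0"
  "!!x y. x \<notin> E ==> (abs (y - x)) < r x ==> norm (u y - u x - (y - x) *R v x) <= e1 * abs (y - x)"
  by metis
 \<comment> \<open>At an exceptional tag the interval lies in \<open>U\<close>, whose measure is
   below the modulus \<open>de\<close> of absolute continuity; at the other tags the difference
   quotient is accurate to \<open>e1\<close>. The two kinds contribute less than
   \<open>e / 2\<close> and at most \<open>e / 4\<close>.\<close>
 define ga where "ga x = (if x : E then U else ball x (r x))" for x
 have g1: "gauge ga" unfolding gauge_def ga_def using U r by auto
 have g2: "norm ((SUM (x, k):D. measure lborel k *R w x) - (u b - u a)) < e"
  if D: "D tagged_division_of cbox a b" "ga fine D" for D
 proof -
  let ?De = "%k. u (Sup k) - u (Inf k)"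
  have D': "finite D" using D(1) by blast
  have iv: "EX c d. k = {c..d} & c <= x & x <= d & a <= c & d <= b" if xkD: "(x, k) : D" for x k
  proof -
   obtain c d where "k = cbox c d" using tagged_division_ofD(4)[OF D(1) xkD] by blast
   hence k: "k = {c..d}" by (simp add: cbox_interval)
   have x: "x : k" by (rule tagged_division_ofD(2)[OF D(1) that])
   have sub: "k <= cbox a b" by (rule tagged_division_ofD(3)[OF D(1) that])
   have "c : k" "d : k" using k x by auto
   hence "a <= c" "d <= b" using sub by auto
   thus ?thesis using k x by auto
  qed
  have tel: "(SUM (x, k):D. ?De k) = u b - u a"
   by (rule additive_tagged_division_1) (use ab D(1) in auto)
  have "(SUM (x, k):D. measure lborel k *R w x) - (u b - u a) = (SUM (x, k):D. measure lborel k *R w x - ?De k)"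
   unfolding tel[symmetric] sum_subtractf[symmetric] by (rule sum.cong) auto
  also have "norm ... <= (SUM (x, k):D. norm (measure lborel k *R w x - ?De k))"
   by (rule order_trans[OF norm_sum]) (auto intro!: sum_mono)
  also have "... = (SUM (x, k):{p:D. fst p : E}. norm (measure lborel k *R w x - ?De k))
         + (SUM (x, k):{p:D. fst p \<notin> E}. norm (measure lborel k *R w x - ?De k))"
   by (subst sum.union_disjoint[symmetric]) (use D' in "auto intro!: sum.cong")
  also have "(SUM (x, k):{p:D. fst p \<notin> E}. norm (measure lborel k *R w x - ?De k)) <= (SUM (x, k):{p:D. fst p \<notin> E}. e1 * measure lborel k)"
  proof (rule sum_mono, clarsimp)
   fix x k assume xk: "(x, k) : D" "x \<notin> E"
   obtain c d where k: "k = {c..d}" "c <= x" "x <= d" using iv[OF xk(1)] by blast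
   have "k <= ball x (r x)" using fineD[OF D(2) xk(1)] xk(2) by (simp add: ga_def)
   moreover have "c : k" "d : k" using k by auto
   ultimately have "c : ball x (r x)" "d : ball x (r x)" by blast+
   hence cd: "abs (c - x) < r x" "abs (d - x) < r x" by (auto simp: dist_real_def abs_minus_commute)
   have "measure lborel k *R w x - ?De k = (u c - u x - (c - x) *R v x) - (u d - u x - (d - x) *R v x)"
    using k xk by (simp add: w_def algebra_simps)
   also have "norm ... <= e1 * abs (c - x) + e1 * abs (d - x)"
    by (intro order_trans[OF norm_triangle_ineq4] add_mono r xk cd)
   also have "... = e1 * measure lborel k" using k by (simp add: algebra_simps)
   finally show "norm (measure lborel k *R w x - ?De k) <= e1 * measure lborel k" .
  qed
  also have "... <= (SUM (x, k):D. e1 * measure lborel k)"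
   by (rule sum_mono2) (use D' e1 in auto)
  also have "... = e1 * (b - a)"
   using additive_content_tagged_division[OF D(1)] ab by (simp add: sum_distrib_left[symmetric] split_def)
  also have "... = e / 4" proof -
   have "b - a ~= 0" using ab by simp
   thus ?thesis unfolding e1_def by (metis nonzero_divide_eq_eq)
  qed
  also have "(SUM (x, k):{p:D. fst p : E}. norm (measure lborel k *R w x - ?De k)) < e / 2"
  proof -
   define F where "F = {p:D. fst p : E & interior (snd p) ~= {}}"
   have finF: "finite F" using D' by (simp add: F_def)
   have "(SUM (x, k):{p:D. fst p : E}. norm (measure lborel k *R w x - ?De k)) = (SUM p:F. dist (u (Inf (snd p))) (u (Sup (snd p))))"
   proof (rule sum.mono_neutral_cong_right)
    show "ALL p:{p:D. fst p : E} - F. (case p of (x, k) => norm (measure lborel k *R w x - ?De k)) = 0"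
    proof
     fix pr assume pr: "pr : {p:D. fst p : E} - F"
     obtain x k where xk0: "pr = (x, k)" by (cases pr)
     have xk: "(x, k) : D" "x : E" "interior k = {}" using pr xk0 by (auto simp: F_def)
     obtain c d where k: "k = {c..d}" "c <= x" "x <= d" using iv[OF xk(1)] by blast
     hence "c = d" using xk(3) by (auto simp: interior_atLeastAtMost_real)
     thus "(case pr of (x, k) => norm (measure lborel k *R w x - ?De k)) = 0"
      using k xk0 by simp
    qed
   qed (use D' in "auto simp: F_def w_def dist_norm norm_minus_commute")
   also have "... < e / 2"
   proof -
    obtain f where f: "bij_betw f {..<card F} F"
     using ex_bij_betw_nat_finite[OF finF] by (auto simp: atLeast0LessThan)
    define p where "p i = Inf (snd (f i))" for i
    define q where "q i = Sup (snd (f i))" for i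
    have fF: "f i : F" if "i < card F" for i using bij_betwE[OF f] that by blast
    have fi: "snd (f i) = {p i..q i} & p i <= q i & a <= p i & q i <= b" if "i < card F" for i
    proof -
     have "(fst (f i), snd (f i)) : D" using fF[OF that] by (simp add: F_def)
     then obtain c d where cd: "snd (f i) = {c..d}" "c <= fst (f i)" "fst (f i) <= d" "a <= c" "d <= b"
      using iv by metis
     hence "p i = c" "q i = d" by (simp_all add: p_def q_def)
     thus ?thesis using cd by simp
    qed
    have "(SUM i<card F. dist (u (p i)) (u (q i))) < e / 2"
    proof (rule ac)
     show "p i <= q i & {p i..q i} <= {a..b}" if "i < card F" for i using fi[OF that] by auto
     have disj: "{p i<..<q i} \<inter> {p j<..<q j} = {}" if "i < card F" "j < card F" "i ~= j" for i j
     proof -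
      have "f i ~= f j" using f that by (auto simp: bij_betw_def inj_on_def)
      hence "interior (snd (f i)) \<inter> interior (snd (f j)) = {}"
       using tagged_division_ofD(5)[OF D(1), of "fst (f i)" "snd (f i)" "fst (f j)" "snd (f j)"] fF that
       by (auto simp: F_def prod_eq_iff)
      thus ?thesis using fi[OF that(1)] fi[OF that(2)] by (simp add: interior_atLeastAtMost_real)
     qed
     thus "disjoint_family_on (%i. {p i<..<q i}) {..<card F}" by (auto simp: disjoint_family_on_def)
     have "(SUM i<card F. q i - p i) = (SUM i<card F. measure lebesgue {p i<..<q i})"
      by (rule sum.cong) (auto simp: fi)
     also have "... = measure lebesgue (\<Union>i<card F. {p i<..<q i})"
      by (rule measure_UNION'[symmetric]) (use disj in "auto simp: pairwise_def disjnt_def")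
     also have "... <= measure lebesgue U"
     proof (rule measure_mono_fmeasurable[OF _ _ Um])
      show "(\<Union>i<card F. {p i<..<q i}) <= U"
      proof
       fix x assume "x : (\<Union>i<card F. {p i<..<q i})"
       then obtain i where i: "i < card F" "x : {p i<..<q i}" by blast
       have fD: "(fst (f i), snd (f i)) : D" "fst (f i) : E" using fF[OF i(1)] by (auto simp: F_def)
       have "snd (f i) <= U" using fineD[OF D(2) fD(1)] fD(2) by (simp add: ga_def)
       thus "x : U" using fi[OF i(1)] i(2) by auto
      qed
     qed auto
     also have "... < de" by (rule mU)
     finally show "(SUM i<card F. q i - p i) < de" .
    qed
    also have "(SUM i<card F. dist (u (p i)) (u (q i))) = (SUM p:F. dist (u (Inf (snd p))) (u (Sup (snd p))))"
     using sum.reindex_bij_betw[OF f, of "%p. dist (u (Inf (snd p))) (u (Sup (snd p)))"] by (simp add: p_def q_def)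
    finally show ?thesis .
   qed
   finally show ?thesis .
  qed
  finally show ?thesis using e by linarith
 qed
 show "EX ga. gauge ga & (ALL D. D tagged_division_of cbox a b & ga fine D -->
   norm ((SUM (x, k):D. measure lborel k *R w x) - (u b - u a)) < e)"
  by (rule exI[of _ ga]) (use g1 g2 in simp)
qed
hence "(w has_integral (u b - u a)) {a..b}" by (simp add: cbox_interval)
thus ?thesis
 by (rule has_integral_spike[OF nE, rotated]) (auto simp: w_def)
qed (use has_integral_refl in simp)

lemma ae_bounded_has_integral:
fixes F :: "real => 'a::banach"
assumes F: "(F has_integral I) {a..b}" and ab: "a <= b" and M: "0 <= M"
 and ae: "AE t in lebesgue. t : {a..b} --> norm (F t) <= M"
shows "norm I <= M * (b - a)"
proof -
obtain N where N: "negligible N" "{t. \<not> (t : {a..b} --> norm (F t) <= M)} <= N"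
 using ae unfolding eventually_ae_filter_negligible by blast
define G where "G t = (if norm (F t) <= M then F t else 0)" for t
have "(G has_integral I) {a..b}"
 by (rule has_integral_spike[OF N(1) _ F]) (use N(2) in "auto simp: G_def")
hence "norm I <= M * measure lborel (cbox a b)"
 by (intro has_integral_bound[OF M]) (use M in "auto simp: G_def cbox_interval")
thus ?thesis using ab by simp
qed

definition primitive :: "(real => real) => real => real" where
"primitive f t = (if 0 <= t then integral {0..t} f else - integral {t..0} f)"

lemma primitive_diff:
assumes f: "!!a b. f integrable_on {a..b}" and ab: "a <= b"
shows "(f has_integral (primitive f b - primitive f a)) {a..b}"
proof -
have c: "integral {x..y} f + integral {y..z} f = integral {x..z} f" if "x <= y" "y <= z" for x y z
 using that f by (intro Henstock_Kurzweil_Integration.integral_combine)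
have "primitive f b - primitive f a = integral {a..b} f"
 using c[of 0 a b] c[of a 0 b] c[of a b 0] ab by (auto simp: primitive_def)
thus ?thesis using f by (simp add: integrable_integral)
qed

lemma ae_bound_nonneg:
fixes f :: "real => real"
assumes "AE t in lebesgue. abs (f t) <= C"
shows "0 <= C"
proof (rule ccontr)
assume C: "\<not> 0 <= C"
obtain N where N: "negligible N" "{t. \<not> (abs (f t)) <= C} <= N"
 using assms unfolding eventually_ae_filter_negligible by blast
have "{t. \<not> (abs (f t)) <= C} = UNIV" using C by auto
hence "negligible (UNIV :: real set)" using N negligible_subset by metis
thus False by simp
qed

lemma ae_bounded_integrable:
fixes f :: "real => real"
assumes f: "f : bmf lebesgue" "AE t in lebesgue. abs (f t) <= C"
shows "f integrable_on {a..b}"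
proof -
have "integrable lebesgue (%x. indicator {a..b} x *R f x)"
proof (rule integrableI_bounded_set_indicator[where B=C])
 show "AE x in lebesgue. x : {a..b} --> norm (f x) <= C" using f(2) by eventually_elim simp
 show "emeasure lebesgue {a..b} < \<infinity>" by (cases "a <= b") auto
qed (use f in auto)
hence "set_integrable lebesgue {a..b} f" by (simp add: set_integrable_def)
thus ?thesis by (rule set_lebesgue_integral_eq_integral(1))
qed

lemma has_vector_derivative_zeroI:
fixes h :: "real => 'a::real_normed_vector"
assumes "!!e. e > 0 ==> EX d>0. ALL s. abs (s - t) < d --> norm (h s - h t) <= e * abs (s - t)"
shows "(h has_vector_derivative 0) (at t)"
unfolding has_vector_derivative_def has_derivative_at_alt
using assms by (auto intro!: bounded_linear_intros)

lemma has_vector_derivative_bound: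
fixes h :: "real => 'a::real_normed_vector"
assumes "(h has_vector_derivative D) (at t)" "e > 0"
shows "EX d>0. ALL s. abs (s - t) < d --> norm (h s - h t - (s - t) *R D) <= e * abs (s - t)"
using assms unfolding has_vector_derivative_def has_derivative_at_alt by auto

lemma vector_derivative_zero_constant:
fixes f :: "real => 'a::real_normed_vector"
assumes "!!t. (f has_vector_derivative 0) (at t)"
shows "f a = f b"
by (rule has_derivative_zero_unique[of UNIV f])
 (use assms in "auto simp: has_vector_derivative_def")

locale bounded_field =
fixes k :: "real => real" and Kb :: real
assumes k_measurable: "k : bmf lebesgue"
 and k_bound: "AE t in lebesgue. abs (k t) <= Kb"
begin

lemma Kb_nonneg: "0 <= Kb"
by (rule ae_bound_nonneg[OF k_bound])

definition "J1 = primitive k"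
definition "J2 = primitive (%t. (k t)^2)"

lemma k2_measurable: "(%t. (k t)^2) : bmf lebesgue" using k_measurable by (rule borel_measurable_power)

lemma k2_bound: "AE t in lebesgue. abs ((k t)^2) <= Kb^2"
using k_bound by eventually_elim (use power_mono[of "abs _" Kb 2] in auto)

lemma J1_diff: "a <= b ==> (k has_integral (J1 b - J1 a)) {a..b}"
unfolding J1_def by (rule primitive_diff) (rule ae_bounded_integrable[OF k_measurable k_bound])

lemma J2_diff: "a <= b ==> ((%t. (k t)^2) has_integral (J2 b - J2 a)) {a..b}"
unfolding J2_def by (rule primitive_diff) (rule ae_bounded_integrable[OF k2_measurable k2_bound])

lemma J1_lipschitz: "abs (J1 b - J1 a) <= Kb * abs (b - a)"
proof (induction a b rule: linorder_wlog)
case (le a b)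
have "AE t in lebesgue. t : {a..b} --> norm (k t) <= Kb" using k_bound by eventually_elim auto
thus ?case using ae_bounded_has_integral[OF J1_diff[OF le] le Kb_nonneg] le by simp
qed (simp add: abs_minus_commute)

lemma J2_lipschitz: "abs (J2 b - J2 a) <= Kb^2 * abs (b - a)"
proof (induction a b rule: linorder_wlog)
case (le a b)
have "AE t in lebesgue. t : {a..b} --> norm ((k t)^2) <= Kb^2" using k2_bound by eventually_elim auto
thus ?case using ae_bounded_has_integral[OF J2_diff[OF le] le, of "Kb^2"] le by simp
qed (simp add: abs_minus_commute)

text \<open>Reads as \<open>f' = al + k * be + k^2 * ga\<close> at the single time \<open>t\<close>,
  although \<open>k\<close> is only determined almost everywhere: the primitives \<open>J1\<close>
  and \<open>J2\<close> stand in for \<open>k\<close> and \<open>k^2\<close>. With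
  \<open>be = ga = 0\<close> it is an ordinary derivative, so cancellation of these two coefficients
  proves differentiability.\<close>

definition expands :: "(real => 'a::real_normed_vector) => real => 'a => 'a => 'a => bool" where
"expands f t al be ga \<longleftrightarrow>
  ((%s. f s - J1 s *R be - J2 s *R ga) has_vector_derivative al) (at t)"

lemma expands_derivative: "(f has_vector_derivative D) (at t) ==> expands f t D 0 0"
by (simp add: expands_def)

lemma expands_zero: "expands f t D 0 0 ==> (f has_vector_derivative D) (at t)"
by (simp add: expands_def)

lemma expands_add:
assumes "expands f t al be ga" "expands g t al' be' ga'"
shows "expands (%s. f s + g s) t (al + al') (be + be') (ga + ga')"
using has_vector_derivative_add[OF assms[unfolded expands_def]]
by (simp add: expands_def algebra_simps)

lemma expands_linear:
assumes "bounded_linear L" "expands f t al be ga"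
shows "expands (%s. L (f s)) t (L al) (L be) (L ga)"
proof -
interpret bounded_linear L by fact
show ?thesis
 using has_vector_derivative[OF assms(2)[unfolded expands_def]]
 by (simp add: expands_def diff scaleR)
qed

lemma expands_lipschitz:
assumes "expands f t al be ga"
shows "EX L>=0. EX d>0. ALL s. abs (s - t) < d --> norm (f s - f t) <= L * abs (s - t)"
proof -
let ?F = "%s. f s - J1 s *R be - J2 s *R ga"
obtain d where d: "d > 0" "!!s. abs (s - t) < d ==> norm (?F s - ?F t - (s - t) *R al) <= 1 * abs (s - t)"
 using has_vector_derivative_bound[OF assms[unfolded expands_def], of 1] by auto
let ?L = "1 + norm al + Kb * norm be + Kb^2 * norm ga"
have "norm (f s - f t) <= ?L * abs (s - t)" if "abs (s - t) < d" for s
proof -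
 have "f s - f t = ((?F s - ?F t - (s - t) *R al) + (s - t) *R al) + ((J1 s - J1 t) *R be + (J2 s - J2 t) *R ga)"
  by (simp add: algebra_simps)
 also have "norm ... <= (1 * abs (s - t) + abs (s - t) * norm al) + (Kb * abs (s - t) * norm be + Kb^2 * abs (s - t) * norm ga)"
  by (intro order_trans[OF norm_triangle_ineq] add_mono d(2) that)
   (auto intro!: mult_right_mono J1_lipschitz J2_lipschitz)
 also have "... = ?L * abs (s - t)" by (simp add: algebra_simps)
 finally show ?thesis .
qed
moreover have "0 <= ?L" using Kb_nonneg by simp
ultimately show ?thesis using d(1) by blast
qed

text \<open>Both factors satisfy a Lipschitz bound at \<open>t\<close>, since \<open>J1\<close> and
  \<open>J2\<close> are Lipschitz. The product of the two increments is therefore O((s - t)^2), and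
  the product rule holds coefficient by coefficient.\<close>

lemma expands_bilinear:
assumes pr: "bounded_bilinear pr" and f: "expands f t al be ga" and g: "expands g t al' be' ga'"
shows "expands (%s. pr (f s) (g s)) t (pr (f t) al' + pr al (g t)) (pr (f t) be' + pr be (g t)) (pr (f t) ga' + pr ga (g t))"
proof -
interpret pr: bounded_bilinear pr by fact
obtain K where K: "K > 0" "!!a b. norm (pr a b) <= norm a * norm b * K" using pr.pos_bounded by blast
obtain L d where L: "L >= 0" "d > 0" "!!s. abs (s - t) < d ==> norm (f s - f t) <= L * abs (s - t)"
 using expands_lipschitz[OF f] by blast
obtain L' d' where L': "L' >= 0" "d' > 0" "!!s. abs (s - t) < d' ==> norm (g s - g t) <= L' * abs (s - t)"
 using expands_lipschitz[OF g] by blast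
have q: "((%s. pr (f s - f t) (g s - g t)) has_vector_derivative 0) (at t)"
proof (rule has_vector_derivative_zeroI)
 fix e :: real assume "e > 0"
 let ?M = "L * L' * K + 1"
 have M: "?M > 0" using L(1) L'(1) K(1) by (simp add: add_nonneg_pos)
 show "EX d>0. ALL s. abs (s - t) < d --> norm (pr (f s - f t) (g s - g t) - pr (f t - f t) (g t - g t)) <= e * abs (s - t)"
 proof (intro exI[of _ "min (min d d') (e / ?M)"] conjI allI impI)
  fix s assume s: "abs (s - t) < min (min d d') (e / ?M)"
  have "norm (pr (f s - f t) (g s - g t)) <= (L * abs (s - t)) * (L' * abs (s - t)) * K"
   by (rule order_trans[OF K(2)], intro mult_right_mono mult_mono)
    (use s L L' K in auto)
  also have "... <= (?M * abs (s - t)) * abs (s - t)"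
  proof -
   have "(L * x) * (L' * x) * K <= (?M * x) * x" for x :: real by (simp add: algebra_simps)
   thus ?thesis .
  qed
  also have "... <= e * abs (s - t)"
   using s M by (intro mult_right_mono) (auto simp: field_simps)
  finally show "norm (pr (f s - f t) (g s - g t) - pr (f t - f t) (g t - g t)) <= e * abs (s - t)"
   by (simp add: pr.zero_left)
 qed (use L L' M `e > 0` in auto)
qed
have "((%s. pr (f t) (g s - J1 s *R be' - J2 s *R ga') + pr (f s - J1 s *R be - J2 s *R ga) (g t)
   + pr (f s - f t) (g s - g t) - pr (f t) (g t)) has_vector_derivative (pr (f t) al' + pr al (g t) + 0 - 0)) (at t)"
 by (intro has_vector_derivative_diff has_vector_derivative_add q has_vector_derivative_const
   bounded_linear.has_vector_derivative[OF pr.bounded_linear_right g[unfolded expands_def]]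
   bounded_linear.has_vector_derivative[OF pr.bounded_linear_left f[unfolded expands_def]])
moreover have "(%s. pr (f t) (g s - J1 s *R be' - J2 s *R ga') + pr (f s - J1 s *R be - J2 s *R ga) (g t)
   + pr (f s - f t) (g s - g t) - pr (f t) (g t))
  = (%s. pr (f s) (g s) - J1 s *R (pr (f t) be' + pr be (g t)) - J2 s *R (pr (f t) ga' + pr ga (g t)))"
 by (rule ext) (simp add: pr.diff_left pr.diff_right pr.add_left pr.add_right pr.scaleR_left pr.scaleR_right algebra_simps)
ultimately show ?thesis unfolding expands_def by simp
qed

lemmas expands_mult = expands_bilinear[OF bounded_bilinear_mult]

lemma expands_compose_J1:
assumes "(F has_vector_derivative F') (at (J1 t))"
shows "expands (%s. F (J1 s)) t 0 F' 0"
unfolding expands_def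
proof (simp, rule has_vector_derivative_zeroI)
fix e :: real assume e: "e > 0"
define e' where "e' = e / (Kb + 1)"
have e': "e' > 0" using e Kb_nonneg by (simp add: e'_def)
obtain d where d: "d > 0" "!!y. abs (y - J1 t) < d ==> norm (F y - F (J1 t) - (y - J1 t) *R F') <= e' * abs (y - J1 t)"
 using has_vector_derivative_bound[OF assms e'] by blast
show "EX d>0. ALL s. abs (s - t) < d --> norm (F (J1 s) - J1 s *R F' - (F (J1 t) - J1 t *R F')) <= e * abs (s - t)"
proof (intro exI[of _ "d / (Kb + 1)"] conjI allI impI)
 fix s assume s: "abs (s - t) < d / (Kb + 1)"
 have le: "abs (J1 s - J1 t) <= (Kb + 1) * abs (s - t)" using J1_lipschitz[of s t] by (simp add: algebra_simps)
 also have "... < d" using s Kb_nonneg by (simp add: field_simps)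
 finally have "norm (F (J1 s) - F (J1 t) - (J1 s - J1 t) *R F') <= e' * abs (J1 s - J1 t)" by (rule d(2))
 also have "... <= e' * ((Kb + 1) * abs (s - t))" using le e' by (intro mult_left_mono) auto
 also have "... = e * abs (s - t)" using Kb_nonneg by (simp add: e'_def)
 finally show "norm (F (J1 s) - J1 s *R F' - (F (J1 t) - J1 t *R F')) <= e * abs (s - t)"
  by (simp add: algebra_simps)
qed (use d Kb_nonneg in auto)
qed

text \<open>Hill's equation as a first-order system, in a form that holds at every time: the only
  term in the derivative of \<open>X'\<close> is \<open>- X\<close> at \<open>k^2\<close>.\<close>

definition hsol :: "(real => 'a::real_normed_field) => (real => 'a) => bool" where
"hsol X X' \<longleftrightarrow> (ALL t. expands X t (X' t) 0 0 & expands X' t 0 0 (- X t))"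

lemma hsol_wronskian:
assumes "hsol X X'" "hsol Y Y'"
shows "X t * Y' t - X' t * Y t = X s * Y' s - X' s * Y s"
proof -
have "((%t. X t * Y' t - X' t * Y t) has_vector_derivative 0) (at t)" for t
proof (rule expands_zero)
 have X: "expands X t (X' t) 0 0" "expands X' t 0 0 (- X t)" and Y: "expands Y t (Y' t) 0 0" "expands Y' t 0 0 (- Y t)"
  using assms by (auto simp: hsol_def)
 have "expands (%t. X t * Y' t + - (X' t * Y t)) t (X t * 0 + X' t * Y' t + - (X' t * Y' t + 0 * Y t))
   (X t * 0 + 0 * Y' t + - (X' t * 0 + 0 * Y t)) (X t * (- Y t) + 0 * Y' t + - (X' t * 0 + (- X t) * Y t))"
  by (intro expands_add expands_mult expands_linear[OF bounded_linear_minus[OF bounded_linear_ident]] X Y)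
 thus "expands (%t. X t * Y' t - X' t * Y t) t 0 0 0" by simp
qed
thus ?thesis by (rule vector_derivative_zero_constant)
qed

lemma hsol_combination:
assumes "hsol X X'" "hsol Y Y'"
shows "hsol (%t. a * X t + b * Y t) (%t. a * X' t + b * Y' t)"
unfolding hsol_def
proof (intro allI conjI)
fix t
have X: "expands X t (X' t) 0 0" "expands X' t 0 0 (- X t)" and Y: "expands Y t (Y' t) 0 0" "expands Y' t 0 0 (- Y t)"
 using assms by (auto simp: hsol_def)
show "expands (%t. a * X t + b * Y t) t (a * X' t + b * Y' t) 0 0"
 using expands_add[OF expands_linear[OF bounded_linear_mult_right X(1), of a] expands_linear[OF bounded_linear_mult_right Y(1), of b]] by simp
show "expands (%t. a * X' t + b * Y' t) t 0 0 (- (a * X t + b * Y t))"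
 using expands_add[OF expands_linear[OF bounded_linear_mult_right X(2), of a] expands_linear[OF bounded_linear_mult_right Y(2), of b]] by simp
qed

lemma hsol_of_real:
assumes "hsol X X'"
shows "hsol (%t. of_real (X t) :: 'a::real_normed_field) (%t. of_real (X' t))"
unfolding hsol_def
proof (intro allI conjI)
fix t
have X: "expands X t (X' t) 0 0" "expands X' t 0 0 (- X t)" using assms by (auto simp: hsol_def)
show "expands (%t. of_real (X t) :: 'a) t (of_real (X' t)) 0 0"
 using expands_linear[OF bounded_linear_of_real X(1)] by simp
show "expands (%t. of_real (X' t) :: 'a) t 0 0 (- of_real (X t))"
 using expands_linear[OF bounded_linear_of_real X(2)] by simp
qed

text \<open>With \<open>z t\<close> frozen, the increment of \<open>deriv z + J2 * z t\<close> is
  the integral of \<open>k^2 * (z t - z s)\<close> in \<open>s\<close>. Here \<open>k^2\<close> is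
  bounded almost everywhere and \<open>z\<close> is continuous, so the increment is of smaller order
  than the length of the interval.\<close>

lemma hill_solution_hsol:
assumes "hill_solution k z"
shows "hsol z (deriv z)"
unfolding hsol_def
proof (intro allI conjI)
fix t
have dz: "(z has_real_derivative deriv z t) (at t)" for t
 using assms DERIV_deriv_iff_real_differentiable by (auto simp: hill_solution_def)
thus "expands z t (deriv z t) 0 0"
 by (intro expands_derivative) (simp add: has_real_derivative_iff_has_vector_derivative)
have cz: "isCont z t" using dz DERIV_isCont by blast
have int: "((%s. - (k s)\<^sup>2 * z s) has_integral (deriv z b - deriv z a)) {a..b}" if "a <= b" for a b
 using has_ae_derivative_has_integral[OF _ that] assms by (auto simp: hill_solution_def)
show "expands (deriv z) t 0 0 (- z t)"
 unfolding expands_def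
proof (simp, rule has_vector_derivative_zeroI)
 fix e :: real assume e: "e > 0"
 define e' where "e' = e / (Kb^2 + 1)"
 have e': "e' > 0" using e by (simp add: e'_def add_nonneg_pos)
 obtain d where d: "d > 0" "!!s. abs (s - t) < d ==> (abs (z s - z t)) < e'"
  using cz e' unfolding continuous_at_eps_delta by (auto simp: dist_real_def)
 have main: "abs ((deriv z b + J2 b * z t) - (deriv z a + J2 a * z t)) <= e * (b - a)"
  if ab: "a <= b" and near: "!!s. s : {a..b} ==> (abs (s - t)) < d" for a b
 proof -
  have "((%s. - (k s)\<^sup>2 * z s + (k s)^2 * z t) has_integral ((deriv z b - deriv z a) + (J2 b - J2 a) * z t)) {a..b}"
   by (intro has_integral_add int ab has_integral_mult_left J2_diff)
  moreover have "AE s in lebesgue. s : {a..b} --> norm (- (k s)\<^sup>2 * z s + (k s)^2 * z t) <= Kb^2 * e'"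
   using k2_bound
  proof eventually_elim
   case (elim s)
   show ?case
   proof
    assume "s : {a..b}"
    hence "abs (z s - z t) <= e'" using d(2) near by (simp add: less_imp_le)
    have "- (k s)\<^sup>2 * z s + (k s)^2 * z t = (k s)^2 * (z t - z s)" by (simp add: algebra_simps)
    also have "norm ... = abs ((k s)^2) * abs (z s - z t)" by (simp add: abs_mult abs_minus_commute)
    also have "... <= Kb^2 * e'" by (intro mult_mono elim \<open>\<bar>z s - z t\<bar> <= e'\<close>) auto
    finally show "norm (- (k s)\<^sup>2 * z s + (k s)^2 * z t) <= Kb^2 * e'" .
   qed
  qed
  ultimately have "norm ((deriv z b - deriv z a) + (J2 b - J2 a) * z t) <= (Kb^2 * e') * (b - a)"
   using e' by (intro ae_bounded_has_integral ab) auto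
  also have "... <= e * (b - a)"
  proof (rule mult_right_mono)
   have "Kb^2 * e' <= (Kb^2 + 1) * e'" using e' by (simp add: algebra_simps)
   also have "... = e" unfolding e'_def by (simp add: add_nonneg_eq_0_iff)
   finally show "Kb^2 * e' <= e" .
  qed (use ab in simp)
  finally show ?thesis by (simp add: algebra_simps)
 qed
 show "EX d>0. ALL s. abs (s - t) < d --> norm (deriv z s + J2 s * z t - (deriv z t + J2 t * z t)) <= e * abs (s - t)"
 proof (intro exI[of _ d] conjI allI impI)
  fix s assume s: "abs (s - t) < d"
  show "norm (deriv z s + J2 s * z t - (deriv z t + J2 t * z t)) <= e * abs (s - t)"
  proof (cases "t <= s")
   case True
   thus ?thesis using main[OF True] s by auto
  next
   case False
   hence st: "s <= t" by simp
   have "abs (deriv z t + J2 t * z t - (deriv z s + J2 s * z t)) <= e * (t - s)"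
    by (rule main[OF st]) (use s st in auto)
   thus ?thesis using st by (simp add: abs_minus_commute)
  qed
 qed (rule d)
qed
qed

end

section \<open>Floquet theory of Hill's equation\<close>

locale periodic_field = bounded_field +
fixes T :: real and z1 z2 :: "real => real"
assumes T_pos: "0 < T" and k_periodic: "AE t in lebesgue. k (t + T) = k t"
 and z1: "hill_solution k z1" "z1 0 = 1" "deriv z1 0 = 0"
 and z2: "hill_solution k z2" "z2 0 = 0" "deriv z2 0 = 1"
begin

abbreviation "z1' \<equiv> deriv z1"
abbreviation "z2' \<equiv> deriv z2"

lemmas hsol_z1 = hill_solution_hsol[OF z1(1)]
lemmas hsol_z2 = hill_solution_hsol[OF z2(1)]

lemma shifted_integral:
assumes f: "AE t in lebesgue. f (t + T) = f t" and ab: "a <= b"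
 and i: "(f has_integral I) {a + T..b + T}"
shows "(f has_integral (I::real)) {a..b}"
proof -
obtain N where N: "negligible N" "{t. \<not> f (t + T) = f t} <= N"
 using f unfolding eventually_ae_filter_negligible by blast
have "((%x. f (1 *R x + T)) has_integral (1 / abs 1 ^ DIM(real)) *R I) ((%x. (1 / 1) *R x + - ((1 / 1) *R T)) ` cbox (a + T) (b + T))"
 by (rule has_integral_affinity) (use i in "simp_all add: cbox_interval")
moreover have "(%x. (1 / 1) *R x + - ((1 / 1) *R T)) ` cbox (a + T) (b + T) = {a..b}"
 by (simp add: cbox_interval image_add_atLeastAtMost[of "-T", simplified add.commute[of "- T"]])
ultimately have "((%x. f (x + T)) has_integral I) {a..b}" by simp
moreover have "f (x + T) = f x" if "x \<notin> N" for x using N(2) that by blast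
ultimately show ?thesis by (intro has_integral_spike[OF N(1), of "{a..b}" f "%x. f (x + T)"]) auto
qed

lemma J1_shift: "J1 (s + T) - J1 (t + T) = J1 s - J1 t"
proof (induction t s rule: linorder_wlog)
case (le t s)
have "(k has_integral (J1 (s + T) - J1 (t + T))) {t..s}"
 by (rule shifted_integral[OF k_periodic le]) (rule J1_diff, use le in simp)
thus ?case using J1_diff[OF le] by (rule has_integral_unique)
qed simp

lemma J2_shift: "J2 (s + T) - J2 (t + T) = J2 s - J2 t"
proof (induction t s rule: linorder_wlog)
case (le t s)
have "AE t in lebesgue. (k (t + T))^2 = (k t)^2" using k_periodic by eventually_elim simp
hence "((%t. (k t)^2) has_integral (J2 (s + T) - J2 (t + T))) {t..s}"
 by (rule shifted_integral[OF _ le]) (rule J2_diff, use le in simp)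
thus ?case using J2_diff[OF le] by (rule has_integral_unique)
qed simp

lemma expands_shift:
assumes "expands f (t + T) al be ga"
shows "expands (%s. f (s + T)) t al be ga"
proof -
have "((%s. s + T) has_vector_derivative 1) (at t)"
 by (auto intro!: derivative_eq_intros)
from vector_diff_chain_at[OF this assms[unfolded expands_def]]
have "((%s. f (s + T) - J1 (s + T) *R be - J2 (s + T) *R ga) has_vector_derivative al) (at t)"
 by (simp add: o_def)
hence "((%s. f (s + T) - J1 (s + T) *R be - J2 (s + T) *R ga
  + ((J1 (t + T) - J1 t) *R be + (J2 (t + T) - J2 t) *R ga)) has_vector_derivative al + 0) (at t)"
 by (intro has_vector_derivative_add has_vector_derivative_const)
moreover have "(%s. f (s + T) - J1 (s + T) *R be - J2 (s + T) *R ga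
  + ((J1 (t + T) - J1 t) *R be + (J2 (t + T) - J2 t) *R ga)) = (%s. f (s + T) - J1 s *R be - J2 s *R ga)"
proof
 fix s
 have "J1 (s + T) = J1 s + (J1 (t + T) - J1 t)" "J2 (s + T) = J2 s + (J2 (t + T) - J2 t)"
  using J1_shift[of s t] J2_shift[of s t] by simp_all
 thus "f (s + T) - J1 (s + T) *R be - J2 (s + T) *R ga
  + ((J1 (t + T) - J1 t) *R be + (J2 (t + T) - J2 t) *R ga) = f (s + T) - J1 s *R be - J2 s *R ga"
  by (simp add: scaleR_add_left)
qed
ultimately show ?thesis unfolding expands_def by simp
qed

lemma hsol_shift: "hsol X X' ==> hsol (%t. X (t + T)) (%t. X' (t + T))"
unfolding hsol_def by (simp add: expands_shift)

lemma wronskian_z: "z1 t * z2' t - z1' t * z2 t = 1"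
using hsol_wronskian[OF hsol_z1 hsol_z2, of t 0] z1 z2 by simp

text \<open>The fundamental solutions with data at time \<open>s\<close>: \<open>zeta\<close>
  vanishes there with slope 1, \<open>cosol\<close> equals 1 there with slope 0. No normalising
  factor occurs because the Wronskian of \<open>z1\<close> and \<open>z2\<close> is 1.\<close>

definition zeta :: "real => real => real" where "zeta t s = z1 s * z2 t - z2 s * z1 t"
definition zeta' :: "real => real => real" where "zeta' t s = z1 s * z2' t - z2 s * z1' t"
definition cosol :: "real => real => real" where "cosol t s = z2' s * z1 t - z1' s * z2 t"
definition cosol' :: "real => real => real" where "cosol' t s = z2' s * z1' t - z1' s * z2' t"

lemma hsol_zeta: "hsol (%t. zeta t s) (%t. zeta' t s)"
using hsol_combination[OF hsol_z2 hsol_z1, of "z1 s" "- z2 s"] by (simp add: zeta_def zeta'_def)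

lemma hsol_cosol: "hsol (%t. cosol t s) (%t. cosol' t s)"
using hsol_combination[OF hsol_z1 hsol_z2, of "z2' s" "- z1' s"] by (simp add: cosol_def cosol'_def)

lemma zeta_diag [simp]: "zeta s s = 0" "zeta' s s = 1" "cosol s s = 1" "cosol' s s = 0"
using wronskian_z[of s] by (simp_all add: zeta_def zeta'_def cosol_def cosol'_def algebra_simps)

lemma zeta_0 [simp]: "zeta t 0 = z2 t" by (simp add: zeta_def z1 z2)

lemma zeta_antisym: "zeta s t = - zeta t s" by (simp add: zeta_def)

text \<open>The Wronskians of \<open>f\<close> with \<open>z1\<close> and \<open>z2\<close> are
  constant in time, and \<open>f\<close> and \<open>f'\<close> are linear combinations of them;
  evaluating them at \<open>s\<close> gives the formula.\<close>

lemma hsol_representation: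
fixes f f' :: "real => real"
assumes f: "hsol f f'"
shows "f t = f s * cosol t s + f' s * zeta t s" "f' t = f s * cosol' t s + f' s * zeta' t s"
proof -
have 1: "f t * z1' t - f' t * z1 t = f s * z1' s - f' s * z1 s" by (rule hsol_wronskian[OF f hsol_z1])
have 2: "f t * z2' t - f' t * z2 t = f s * z2' s - f' s * z2 s" by (rule hsol_wronskian[OF f hsol_z2])
have "f t = f t * (z1 t * z2' t - z1' t * z2 t)" by (simp add: wronskian_z)
also have "... = z1 t * (f t * z2' t - f' t * z2 t) - z2 t * (f t * z1' t - f' t * z1 t)" by (simp add: algebra_simps)
also have "... = f s * cosol t s + f' s * zeta t s"
 unfolding 1 2 by (simp add: cosol_def zeta_def algebra_simps)
finally show "f t = f s * cosol t s + f' s * zeta t s" .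
have "f' t = f' t * (z1 t * z2' t - z1' t * z2 t)" by (simp add: wronskian_z)
also have "... = z1' t * (f t * z2' t - f' t * z2 t) - z2' t * (f t * z1' t - f' t * z1 t)" by (simp add: algebra_simps)
also have "... = f s * cosol' t s + f' s * zeta' t s"
 unfolding 1 2 by (simp add: cosol'_def zeta'_def algebra_simps)
finally show "f' t = f s * cosol' t s + f' s * zeta' t s" .
qed

lemma zeta_periodic: "zeta (t + T) (s + T) = zeta t s" "zeta' (t + T) (s + T) = zeta' t s"
using hsol_representation[OF hsol_shift[OF hsol_zeta[of "s + T"]], of t s] by simp_all

lemma cosol_periodic: "cosol (t + T) (s + T) = cosol t s" "cosol' (t + T) (s + T) = cosol' t s"
using hsol_representation[OF hsol_shift[OF hsol_cosol[of "s + T"]], of t s] by simp_all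

lemma hsol_derivative:
fixes X X' :: "real => real"
shows "hsol X X' ==> (X has_real_derivative X' t) (at t)"
by (auto simp: hsol_def expands_def has_real_derivative_iff_has_vector_derivative)

definition trM :: real where "trM = z1 T + z2' T"

text \<open>Cayley-Hamilton for the monodromy matrix: \<open>trM\<close> is its trace, and its
  determinant is the Wronskian 1.\<close>

lemma z2_recursion: "z2 (t + T + T) = trM * z2 (t + T) - z2 t"
proof -
have a: "z1 (t + T) = z1 T * z1 t + z1' T * z2 t" for t
 using hsol_representation(1)[OF hsol_shift[OF hsol_z1], of t 0] by (simp add: cosol_def zeta_def z1 z2)
have b: "z2 (t + T) = z2 T * z1 t + z2' T * z2 t" for t
 using hsol_representation(1)[OF hsol_shift[OF hsol_z2], of t 0] by (simp add: cosol_def zeta_def z1 z2)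
have "z2 (t + T + T) = z2 T * z1 (t + T) + z2' T * z2 (t + T)" by (rule b)
also have "... = z1 T * (z2 T * z1 t) + z2 T * z1' T * z2 t + z2' T * z2 (t + T)"
 unfolding a by (simp add: algebra_simps)
also have "z2 T * z1 t = z2 (t + T) - z2' T * z2 t" using b[of t] by simp
finally have "z2 (t + T + T) = trM * z2 (t + T) - (z1 T * z2' T - z1' T * z2 T) * z2 t"
 by (simp add: trM_def algebra_simps)
thus ?thesis by (simp add: wronskian_z)
qed

end

locale hyperbolic_field = periodic_field +
fixes ka c0 :: real
assumes ka_pos: "0 < ka" and c0_pos: "0 < c0"
 and growth: "\<forall>\<^sub>F N in sequentially. c0 * exp (ka * real N) <= abs (z2 (real N * T))"
begin

text \<open>For a trace of modulus at most 2 the recursion conserves a positive semidefinite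
  quadratic form in consecutive values. This allows at most linear growth of
  \<open>z2 (N * T)\<close>, against the assumed exponential growth.\<close>

lemma trM_gt: "2 < abs trM"
proof (rule ccontr)
assume "\<not> 2 < abs trM"
hence tr: "trM^2 <= 4" using abs_le_square_iff[of trM 2] by simp
define y where "y N = z2 (real N * T)" for N
have rec: "y (Suc (Suc N)) = trM * y (Suc N) - y N" for N
 using z2_recursion[of "real N * T"] by (simp add: y_def algebra_simps)
have y0: "y 0 = 0" by (simp add: y_def z2)
have inv: "(y (Suc N))^2 - trM * y (Suc N) * y N + (y N)^2 = (y 1)^2" for N
proof (induction N)
 case (Suc N)
 have "(y (Suc (Suc N)))^2 - trM * y (Suc (Suc N)) * y (Suc N) + (y (Suc N))^2
   = (y (Suc N))^2 - trM * y (Suc N) * y N + (y N)^2"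
  unfolding rec by (simp add: p2es algebra_simps)
 thus ?case using Suc by simp
qed (simp add: y0)
have step: "abs (y (Suc N)) <= abs (y N) + abs (y 1)" for N
proof -
 have "(y (Suc N) - trM / 2 * y N)^2 + (1 - trM^2 / 4) * (y N)^2 = (y 1)^2"
  using inv[of N] by (simp add: p2es algebra_simps)
 moreover have "0 <= (1 - trM^2 / 4) * (y N)^2" using tr by (intro mult_nonneg_nonneg) auto
 ultimately have "(y (Suc N) - trM / 2 * y N)^2 <= (y 1)^2" by linarith
 hence "abs (y (Suc N) - trM / 2 * y N) <= abs (y 1)" by (simp add: abs_le_square_iff)
 moreover have "abs (trM / 2 * y N) <= 1 * abs (y N)"
  unfolding abs_mult using \<open>\<not> 2 < abs trM\<close> by (intro mult_right_mono) auto
 ultimately show ?thesis by linarith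
qed
have lin: "abs (y N) <= real N * abs (y 1)" for N
proof (induction N)
 case (Suc N) thus ?case using step[of N] by (simp add: algebra_simps)
qed (simp add: y0)
have "((%N. real N * abs (y 1) / exp (ka * real N)) ---> 0) sequentially"
 using ka_pos by real_asymp
hence "\<forall>\<^sub>F N in sequentially. real N * abs (y 1) / exp (ka * real N) < c0"
 using c0_pos by (rule order_tendstoD(2))
with growth have "\<forall>\<^sub>F N::nat in sequentially. False"
proof eventually_elim
 case (elim N)
 have "c0 * exp (ka * real N) <= real N * abs (y 1)" using elim(1) lin[of N] by (simp add: y_def)
 thus ?case using elim(2) by (simp add: divide_less_eq)
qed
thus False by simp
qed

text \<open>The root of larger modulus of \<open>x^2 - trM * x + 1\<close>: the sign makes the two
  summands add up. The other root is \<open>1 / lam\<close>.\<close>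

definition lam :: real where "lam = (trM + sgn trM * sqrt (trM^2 - 4)) / 2"

lemma lam: "abs lam > 1" "lam + 1 / lam = trM"
proof -
have t: "trM^2 > 4" using trM_gt abs_le_square_iff[of trM 2] by (simp add: not_le[symmetric])
define r where "r = sqrt (trM^2 - 4)"
have r: "r > 0" "r^2 = trM^2 - 4" using t by (auto simp: r_def)
have "abs lam = (abs trM + r) / 2"
 using trM_gt r by (cases "trM > 0") (auto simp: lam_def r_def[symmetric] sgn_if)
thus gt: "abs lam > 1" using trM_gt r by simp
define sg where "sg = sgn trM"
have s: "sg * sg = 1" using trM_gt by (auto simp: sg_def sgn_if)
have l: "lam = (trM + sg * r) / 2" by (simp add: lam_def r_def sg_def)
have "lam * lam - trM * lam + 1 = ((sg * sg) * r^2 - trM^2 + 4) / 4"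
 unfolding l by (simp add: p2es field_simps)
hence "lam * lam - trM * lam + 1 = 0" using r(2) s by simp
moreover have "lam ~= 0" using gt by auto
ultimately show "lam + 1 / lam = trM" by (simp add: field_simps)
qed

text \<open>Subtracting \<open>1 / lam\<close> times \<open>z2\<close> from its translate removes
  the component of \<open>z2\<close> with multiplier \<open>1 / lam\<close>. Thus \<open>fu\<close>
  is the Floquet solution with multiplier \<open>lam\<close>, and \<open>fv\<close> is the one with
  \<open>1 / lam\<close>.\<close>

definition fu :: "real => real" where "fu t = z2 (t + T) - 1 / lam * z2 t"
definition fv :: "real => real" where "fv t = z2 (t + T) - lam * z2 t"
definition fu' :: "real => real" where "fu' t = z2' (t + T) - 1 / lam * z2' t"
definition fv' :: "real => real" where "fv' t = z2' (t + T) - lam * z2' t"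

lemma lam_nonzero: "lam ~= 0" using lam(1) by auto

lemma hsol_fu: "hsol fu fu'" and hsol_fv: "hsol fv fv'"
using hsol_combination[OF hsol_shift[OF hsol_z2] hsol_z2, of 1 "- 1 / lam"]
 hsol_combination[OF hsol_shift[OF hsol_z2] hsol_z2, of 1 "- lam"]
by (simp_all add: fu_def[abs_def] fu'_def[abs_def] fv_def[abs_def] fv'_def[abs_def])

lemma fu_shift: "fu (t + T) = lam * fu t"
unfolding fu_def z2_recursion lam(2)[symmetric] using lam_nonzero by (simp add: algebra_simps)

lemma fv_shift: "fv (t + T) = 1 / lam * fv t"
unfolding fv_def z2_recursion lam(2)[symmetric] using lam_nonzero by (simp add: algebra_simps)

lemma fu_shift_n: "fu (t + real n * T) = lam ^ n * fu t"
proof (induction n)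
case (Suc n)
have e: "t + real (Suc n) * T = t + real n * T + T" by (simp add: algebra_simps)
show ?case unfolding e fu_shift Suc by simp
qed simp

lemma fv_shift_n: "fv (t + real n * T) = (1 / lam) ^ n * fv t"
proof (induction n)
case (Suc n)
have e: "t + real (Suc n) * T = t + real n * T + T" by (simp add: algebra_simps)
show ?case unfolding e fv_shift Suc by simp
qed simp

lemma z2_T_nonzero: "z2 T ~= 0"
proof
assume z: "z2 T = 0"
have "z2 (real N * T) = 0 & z2 (real (Suc N) * T) = 0" for N
proof (induction N)
 case (Suc N)
 thus ?case using z2_recursion[of "real N * T"] by (simp add: algebra_simps)
qed (use z z2 in auto)
with growth have "\<forall>\<^sub>F N in sequentially. c0 * exp (ka * real N) <= 0" by (auto elim: eventually_mono)
then obtain N :: nat where "c0 * exp (ka * real N) <= 0" by (auto simp: eventually_sequentially)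
thus False using c0_pos by (simp add: mult_le_0_iff)
qed

lemma fu_0: "fu 0 = z2 T" "fv 0 = z2 T" by (simp_all add: fu_def fv_def z2)

definition wuv :: real where "wuv = z2 T * (lam - 1 / lam)"

lemma wuv_eq: "fu' t * fv t - fv' t * fu t = wuv"
proof -
have "fu t * fv' t - fu' t * fv t = fu 0 * fv' 0 - fu' 0 * fv 0" by (rule hsol_wronskian[OF hsol_fu hsol_fv])
also have "... = - wuv" by (simp add: fu_0 fu'_def fv'_def z2 wuv_def algebra_simps)
finally show ?thesis by (simp add: algebra_simps)
qed

lemma wuv_nonzero: "wuv ~= 0"
proof -
have "lam ~= 1 / lam"
proof
 assume "lam = 1 / lam"
 hence "abs lam * abs lam = 1" using lam_nonzero by (simp add: field_simps abs_mult[symmetric])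
 moreover have "1 * 1 < abs lam * abs lam" using lam(1) by (intro mult_strict_mono) auto
 ultimately show False by simp
qed
thus ?thesis using z2_T_nonzero by (simp add: wuv_def)
qed

lemma zeta_fu_fv: "zeta t s = (fu t * fv s - fv t * fu s) / wuv"
proof -
have h: "hsol (%t. fv s * fu t + (- fu s) * fv t) (%t. fv s * fu' t + (- fu s) * fv' t)"
 by (rule hsol_combination[OF hsol_fu hsol_fv])
have "fv s * fu t + (- fu s) * fv t = wuv * zeta t s"
proof -
 have "fv s * fu t + (- fu s) * fv t = (fv s * fu s + (- fu s) * fv s) * cosol t s + (fv s * fu' s + (- fu s) * fv' s) * zeta t s"
  by (rule hsol_representation(1)[OF h])
 also have "... = (fu' s * fv s - fv' s * fu s) * zeta t s" by (simp add: algebra_simps)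
 finally show ?thesis by (simp only: wuv_eq)
qed
thus ?thesis using wuv_nonzero by (simp add: field_simps)
qed

text \<open>For large \<open>n\<close> the term with \<open>lam ^ n\<close> dominates unless
  \<open>fu t\<close> or \<open>fv s\<close> is small, so the zeros of the two Floquet solutions are
  the only obstruction to exponential growth.\<close>

lemma zeta_shift_n: "zeta (t + real n * T) s = (lam ^ n * fu t * fv s - (1 / lam) ^ n * fv t * fu s) / wuv"
unfolding zeta_fu_fv fu_shift_n fv_shift_n by simp

lemma zeta_unshift_n: "zeta (t - real n * T) s = ((1 / lam) ^ n * fu t * fv s - lam ^ n * fv t * fu s) / wuv"
proof -
have "fu t = lam ^ n * fu (t - real n * T)" "fv t = (1 / lam) ^ n * fv (t - real n * T)"
 using fu_shift_n[of "t - real n * T" n] fv_shift_n[of "t - real n * T" n] by simp_all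
hence "fu (t - real n * T) = (1 / lam) ^ n * fu t" "fv (t - real n * T) = lam ^ n * fv t"
 using lam_nonzero by (simp_all add: power_one_over field_simps)
thus ?thesis unfolding zeta_fu_fv by simp
qed

end

section \<open>Negative powers near simple zeros, and decay in the number of periods\<close>

lemma integrable_on_abs_powr:
fixes p :: real
assumes a: "a > -1" and T: "0 <= T"
shows "(%t. abs (t - p) powr a) integrable_on {0..T}"
proof -
define L where "L = abs p + T + 1"
have L: "0 <= L" using T by (simp add: L_def)
have 0: "(%t. t powr a) integrable_on cbox 0 L"
 using integrable_on_powr_from_0[OF a L] by (simp add: cbox_interval)
have "(%t. (1 *R t + (- p)) powr a) integrable_on ((%x. (1 / 1) *R x + - ((1 / 1) *R (- p))) ` cbox 0 L)"
 by (rule integrable_affinity[OF 0]) simp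
hence "(%t. (t - p) powr a) integrable_on {p..p + L}"
 by (simp add: cbox_interval image_add_atLeastAtMost[of p 0 L, simplified add.commute[of p]] add.commute)
hence r: "(%t. abs (t - p) powr a) integrable_on {p..p + L}" by (rule integrable_eq) auto
have "(%t. ((-1) *R t + p) powr a) integrable_on ((%x. (1 / (-1)) *R x + - ((1 / (-1)) *R p)) ` cbox 0 L)"
 by (rule integrable_affinity[OF 0]) simp
moreover have "((%x. (1 / (-1)) *R x + - ((1 / (-1)) *R p)) ` cbox 0 L) = {p - L..p}"
 by (simp add: cbox_interval image_diff_atLeastAtMost)
ultimately have "(%t. (p - t) powr a) integrable_on {p - L..p}" by simp
hence l: "(%t. abs (t - p) powr a) integrable_on {p - L..p}"
 by (rule integrable_eq) auto
have "(%t. abs (t - p) powr a) integrable_on {p - L..p + L}"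
 by (rule Henstock_Kurzweil_Integration.integrable_combine[OF _ _ l r]) (use L in auto)
thus ?thesis
 by (rule integrable_on_subinterval) (auto simp: L_def)
qed

text \<open>A local linear lower bound about every point of the interval, made uniform by
  compactness. The set \<open>P\<close> may contain points where \<open>f\<close> does not vanish;
  their bounds are just as good.\<close>

lemma simple_zeros_lower_bound:
fixes f f' :: "real => real"
assumes d: "!!t. (f has_real_derivative f' t) (at t)" and nz: "!!t. f t = 0 ==> f' t ~= 0"
shows "EX P c. finite P & 0 < c & (ALL t:{0..T}. EX p:P. c * abs (t - p) <= abs (f t))"
proof -
have loc: "EX e c. 0 < e & 0 < c & (ALL t. abs (t - t0) < e --> c * abs (t - t0) <= abs (f t))" for t0
proof (cases "f t0 = 0")
 case True
 have f': "f' t0 ~= 0" using nz True by blast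
 have "(f has_vector_derivative f' t0) (at t0)" using d by (simp add: has_real_derivative_iff_has_vector_derivative)
 from has_vector_derivative_bound[OF this, of "abs (f' t0) / 2"] f'
 obtain e where e: "e > 0" "!!t. abs (t - t0) < e ==> (abs (f t - (t - t0) * f' t0)) <= abs (f' t0) / 2 * abs (t - t0)"
  using True by auto
 have "abs (f' t0) / 2 * abs (t - t0) <= abs (f t)" if "abs (t - t0) < e" for t
 proof -
  have "abs ((t - t0) * f' t0) = abs (f' t0) * abs (t - t0)" by (simp add: abs_mult)
  thus ?thesis using e(2)[OF that] by linarith
 qed
 thus ?thesis using e(1) f' by (intro exI[of _ e] exI[of _ "abs (f' t0) / 2"]) auto
next
 case False
 have "isCont f t0" using d DERIV_isCont by blast
 then obtain e where e: "e > 0" "!!t. abs (t - t0) < e ==> (abs (f t - f t0)) < abs (f t0) / 2"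
  using False unfolding continuous_at_eps_delta dist_real_def by (metis half_gt_zero zero_less_abs_iff)
 \<comment> \<open>Away from zeros the bound is given the same shape, with \<open>t0\<close> in the
   role of the zero, by shrinking the radius to at most 1.\<close>
 have "abs (f t0) / 2 * abs (t - t0) <= abs (f t)" if "abs (t - t0) < min e 1" for t
 proof -
  have "abs (f t0) / 2 * abs (t - t0) <= abs (f t0) / 2 * 1" using that by (intro mult_left_mono) auto
  thus ?thesis using e(2)[of t] that by linarith
 qed
 thus ?thesis using e(1) False by (intro exI[of _ "min e 1"] exI[of _ "abs (f t0) / 2"]) auto
qed
then obtain e c where ec: "!!t0. 0 < e t0" "!!t0. 0 < c t0"
 "!!t0 t. abs (t - t0) < e t0 ==> c t0 * abs (t - t0) <= abs (f t)"
 by metis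
have "compact {0..T}" by simp
moreover have "{0..T} <= (\<Union>t0\<in>{0..T}. ball t0 (e t0))" using ec(1) by force
ultimately obtain P where P: "P <= {0..T}" "finite P" "{0..T} <= (\<Union>t0\<in>P. ball t0 (e t0))"
 by (rule compactE_image[OF _ open_ball])
define c' where "c' = Min (insert 1 (c ` P))"
have c': "0 < c'" using P(2) ec(2) by (auto simp: c'_def)
have "EX p:P. c' * abs (t - p) <= abs (f t)" if tT: "t : {0..T}" for t
proof -
 obtain p where p: "p : P" "t : ball p (e p)" using P(3) tT by blast
 have "c' <= c p" using p P(2) by (simp add: c'_def)
 hence "c' * abs (t - p) <= c p * abs (t - p)" by (intro mult_right_mono) auto
 also have "... <= abs (f t)" using p(2) by (intro ec(3)) (simp add: dist_real_def abs_minus_commute)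
 finally show ?thesis using p(1) by blast
qed
thus ?thesis using P(2) c' by blast
qed

text \<open>The distance to the nearest point of \<open>P\<close> is handled by summing the powers
  of all distances. Each summand is integrable because the exponent lies below 1, which is where
  \<open>2 / p < 1\<close> enters later.\<close>

lemma negative_power_integrable:
fixes f f' :: "real => real"
assumes d: "!!t. (f has_real_derivative f' t) (at t)" and nz: "!!t. f t = 0 ==> f' t ~= 0"
 and e: "0 < xep" "xep < 1" and T: "0 <= T"
shows "EX P g. finite P & g integrable_on {0..T} & (ALL t. 0 <= g t) &
 (ALL t:{0..T} - P. f t ~= 0 & abs (f t) powr - xep <= g t)"
proof -
obtain P c where P: "finite P" "0 < c" "!!t. t : {0..T} ==> EX p:P. c * abs (t - p) <= abs (f t)"
 using simple_zeros_lower_bound[of f f' T] d nz by blast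
define g where "g t = (SUM p:P. c powr - xep * abs (t - p) powr - xep)" for t
have "g integrable_on {0..T}" unfolding g_def
 by (intro integrable_sum integrable_on_mult_right integrable_on_abs_powr P(1) T) (use e in auto)
moreover have "0 <= g t" for t by (simp add: g_def sum_nonneg)
moreover have "f t ~= 0 & abs (f t) powr - xep <= g t" if t: "t : {0..T} - P" for t
proof -
 obtain p where p: "p : P" "c * abs (t - p) <= abs (f t)" using P(3) t by blast
 have "t ~= p" using p(1) t by blast
 hence pos: "0 < c * abs (t - p)" using P(2) by (intro mult_pos_pos) auto
 have "abs (f t) powr - xep <= (c * abs (t - p)) powr - xep"
  by (rule powr_mono2') (use e pos p in auto)
 also have "... = c powr - xep * abs (t - p) powr - xep" using P(2) by (simp add: powr_mult)
 also have "... <= g t" unfolding g_def by (rule member_le_sum[OF p(1) _ P(1)]) auto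
 finally show ?thesis using pos p(2) by auto
qed
ultimately show ?thesis using P(1) by blast
qed

lemma integral_le_off_finite:
fixes h g :: "real => real"
assumes "h integrable_on S" "g integrable_on S" "finite P" "!!t. t : S - P ==> h t <= g t"
shows "integral S h <= integral S g"
proof -
define g' where "g' t = (if t : P then h t else g t)" for t
have g': "(g' has_integral integral S g) S"
 by (rule has_integral_spike_finite[OF assms(3) _ integrable_integral[OF assms(2)]]) (auto simp: g'_def)
have "(h has_integral integral S h) S" using assms(1) by (rule integrable_integral)
thus ?thesis using g' by (rule has_integral_le) (use assms(4) in "auto simp: g'_def")
qed

text \<open>A decay factor that stays bounded at zeros of \<open>z\<close>: it joins the trivial
  bound 1 for small \<open>z\<close> with a negative power for large \<open>z\<close>.\<close>

definition damp :: "real => real => real" where "damp xep z = (max 1 (abs z)) powr - xep"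

lemma damp_nonneg: "0 <= damp xep z" by (simp add: damp_def)

lemma damp_continuous: "continuous_on UNIV (damp xep)"
unfolding damp_def by (intro continuous_intros) auto

text \<open>\<open>A\<close> stands for the growing Floquet term, \<open>B\<close> for the decaying
  one, \<open>W\<close> for the Wronskian. If \<open>A >= 2 * B\<close>, the growing term wins up to
  a factor 2; otherwise \<open>A\<close> is bounded and the trivial bound 1 suffices.\<close>

lemma damp_bound:
assumes "0 < xep" "0 < A" "0 < W" "0 <= B" "A - B <= abs z * W"
shows "damp xep z <= (2 * W + 2 * B) powr xep * A powr - xep"
proof -
define y where "y = A / (2 * W + 2 * B)"
have pos: "0 < 2 * W + 2 * B" using assms by simp
have y: "0 < y" using assms pos by (simp add: y_def)
have "A <= max 1 (abs z) * (2 * W + 2 * B)"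
proof (cases "A >= 2 * B")
 case True
 have "A <= abs z * (2 * W)" using assms(5) True by simp
 also have "... <= max 1 (abs z) * (2 * W + 2 * B)" using assms by (intro mult_mono) auto
 finally show ?thesis .
next
 case False
 have "A <= 1 * (2 * W + 2 * B)" using False assms by simp
 also have "... <= max 1 (abs z) * (2 * W + 2 * B)" using pos by (intro mult_right_mono) auto
 finally show ?thesis .
qed
hence "y <= max 1 (abs z)" using pos by (simp add: y_def pos_divide_le_eq)
hence "damp xep z <= y powr - xep"
 unfolding damp_def using assms(1) y by (intro powr_mono2') auto
also have "... = (2 * W + 2 * B) powr xep * A powr - xep"
 using pos assms by (simp add: y_def powr_divide powr_minus field_simps)
finally show ?thesis .
qed

context hyperbolic_field
begin

lemma fu_derivative: "(fu has_real_derivative fu' t) (at t)" and fv_derivative: "(fv has_real_derivative fv' t) (at t)"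
using hsol_derivative hsol_fu hsol_fv by auto

lemma fu_simple: "fu t = 0 ==> fu' t ~= 0" and fv_simple: "fv t = 0 ==> fv' t ~= 0"
using wuv_eq[of t] wuv_nonzero by auto

lemma fu_continuous: "continuous_on S fu" and fv_continuous: "continuous_on S fv"
using fu_derivative fv_derivative
by (meson DERIV_continuous_on has_field_derivative_at_within)+

lemma z12_continuous: "continuous_on S z1" "continuous_on S z2"
using hsol_derivative[OF hsol_z1] hsol_derivative[OF hsol_z2]
by (meson DERIV_continuous_on has_field_derivative_at_within)+

lemma zeta_continuous: "continuous_on S (%p. zeta (fst p) (snd p))"
unfolding zeta_def
by (intro continuous_intros continuous_on_compose2[OF z12_continuous(1)[of UNIV]]
  continuous_on_compose2[OF z12_continuous(2)[of UNIV]]) auto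

lemma fu_fv_bound: "EX B>=0. ALL t:{0..T}. abs (fu t) <= B & abs (fv t) <= B"
proof -
have "bounded (fu ` {0..T})" "bounded (fv ` {0..T})"
 by (auto intro!: compact_imp_bounded compact_continuous_image fu_continuous fv_continuous)
then obtain B1 B2 where "ALL t:{0..T}. abs (fu t) <= B1" "ALL t:{0..T}. abs (fv t) <= B2"
 by (auto simp: bounded_iff)
thus ?thesis by (intro exI[of _ "max 0 (max B1 B2)"]) (auto simp: le_max_iff_disj)
qed

lemma lam_powr: "(abs lam ^ n * x) powr - xep = (abs lam powr - xep) ^ n * x powr - xep" if "0 <= x"
proof -
have "(abs lam ^ n) powr - xep = (abs lam powr - xep) ^ n"
 using lam_nonzero by (simp add: powr_realpow[symmetric] powr_powr powr_power mult.commute)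
thus ?thesis using that by (simp add: powr_mult)
qed

lemma rate: "0 < xep ==> 0 < abs lam powr - xep & abs lam powr - xep < 1"
using lam(1) gr_one_powr[of "abs lam" xep] by (auto simp: powr_minus inverse_less_1_iff)

lemma inv_lam_power: "abs ((1 / lam) ^ n) <= 1"
using lam(1) by (simp add: power_abs power_le_one)

lemma damp_decay_point: "0 < xep ==> EX C>=0. ALL n. damp xep (zeta (real n * T) 0) <= C * (abs lam powr - xep) ^ n"
proof -
assume e: "0 < xep"
let ?g = "abs (z2 T * z2 T)"
have g: "?g > 0" using z2_T_nonzero by (simp only: zero_less_abs_iff mult_eq_0_iff) simp
have "damp xep (zeta (real n * T) 0) <= (2 * abs wuv + 2 * ?g) powr xep * ((abs lam powr - xep) ^ n * ?g powr - xep)" for n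
proof -
 have z: "zeta (real n * T) 0 * wuv = lam ^ n * (z2 T * z2 T) - (1 / lam) ^ n * (z2 T * z2 T)"
  using zeta_shift_n[of 0 n 0] wuv_nonzero by (simp add: fu_0 mult.assoc)
 have "abs ((1 / lam) ^ n * (z2 T * z2 T)) <= 1 * ?g"
  unfolding abs_mult[of "(1 / lam) ^ n"] by (intro mult_right_mono inv_lam_power) auto
 moreover have "abs (lam ^ n * (z2 T * z2 T)) = abs lam ^ n * ?g" by (simp add: abs_mult power_abs)
 ultimately have "abs lam ^ n * ?g - ?g <= abs (zeta (real n * T) 0 * wuv)" unfolding z by linarith
 hence "damp xep (zeta (real n * T) 0) <= (2 * abs wuv + 2 * ?g) powr xep * (abs lam ^ n * ?g) powr - xep"
  using e g lam_nonzero wuv_nonzero by (intro damp_bound) (auto simp: abs_mult)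
 thus ?thesis by (simp only: lam_powr abs_ge_zero)
qed
thus ?thesis
 by (intro exI[of _ "(2 * abs wuv + 2 * ?g) powr xep * ?g powr - xep"]) (auto simp: mult_ac)
qed

lemma continuous_damp_zeta: "continuous_on S (%p. damp xep (zeta (fst p + a) (snd p)))"
proof -
have "continuous_on S (%p. zeta (fst (fst p + a, snd p)) (snd (fst p + a, snd p)))"
 by (intro continuous_on_compose2[OF zeta_continuous[of UNIV], where f="%p. (fst p + a, snd p)"] continuous_intros) auto
thus ?thesis by (intro continuous_on_compose2[OF damp_continuous]) auto
qed

lemma continuous_damp_zeta1: "continuous_on S (%t. damp xep (zeta (t + a) s))"
using continuous_on_compose2[OF continuous_damp_zeta[of UNIV xep a] continuous_on_Pair[OF continuous_on_id continuous_on_const[of S s]]]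
by simp

lemma continuous_damp_zeta2: "continuous_on S (%s. damp xep (zeta t s))"
using continuous_on_compose2[OF continuous_damp_zeta[of UNIV xep 0] continuous_on_Pair[OF continuous_on_const[of S t] continuous_on_id]]
by simp

lemma continuous_damp_integral: "continuous_on {0..T} (%t. itg T (%s. damp xep (zeta (t + a) s)))"
proof -
have "continuous_on ({0..T} \<times> cbox 0 T) (%(t, s). damp xep (zeta (t + a) s))"
 using continuous_damp_zeta[of "{0..T} \<times> cbox 0 T" xep a] by (simp add: case_prod_beta)
hence "continuous_on {0..T} (%t. integral (cbox 0 T) (%s. damp xep (zeta (t + a) s)))"
 by (rule integral_continuous_on_param)
thus ?thesis by (simp add: cbox_interval)
qed

text \<open>With one time fixed at 0 the coefficient of the growing term is \<open>fu t\<close> for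
  forward translates and \<open>fv t\<close> for backward ones, each times \<open>z2 T\<close>,
  which is not 0. Both directions occur, since later the first or the second argument of
  \<open>zeta\<close> is moved.\<close>

lemma damp_decay_single:
assumes e: "0 < xep" "xep < 1"
shows "EX C>=0. ALL n. itg T (%t. damp xep (zeta (t + real n * T) 0)) <= C * (abs lam powr - xep) ^ n"
 "EX C>=0. ALL n. itg T (%t. damp xep (zeta (t - real n * T) 0)) <= C * (abs lam powr - xep) ^ n"
proof -
obtain B where B: "B >= 0" "!!t. t : {0..T} ==> (abs (fu t)) <= B" "!!t. t : {0..T} ==> (abs (fv t)) <= B"
 using fu_fv_bound by blast
let ?g = "abs (z2 T)" and ?r = "abs lam powr - xep"
have g: "?g > 0" using z2_T_nonzero by simp
have gen: "EX C>=0. ALL n. itg T (%t. damp xep (h n t)) <= C * ?r ^ n"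
 if f: "!!t. (f has_real_derivative f' t) (at t)" "!!t. f t = 0 ==> f' t ~= 0"
  and hc: "!!n. continuous_on {0..T} (%t. damp xep (h n t))"
  and hb: "!!n t. t : {0..T} ==> (abs lam) ^ n * (abs (f t) * ?g) - B * ?g <= abs (h n t) * abs wuv" for f f' h
proof -
 obtain P G where G: "finite P" "G integrable_on {0..T}" "!!t. 0 <= G t"
  "!!t. t : {0..T} - P ==> f t ~= 0 & abs (f t) powr - xep <= G t"
  using negative_power_integrable[of f f' xep T, OF f e] T_pos by auto
 define K where "K = (2 * abs wuv + 2 * (B * ?g)) powr xep * ?g powr - xep"
 have K: "0 <= K" by (simp add: K_def)
 have "itg T (%t. damp xep (h n t)) <= itg T (%t. K * ?r ^ n * G t)" for n
 proof (rule integral_le_off_finite[OF _ _ G(1)])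
  fix t assume t: "t : {0..T} - P"
  have "damp xep (h n t) <= (2 * abs wuv + 2 * (B * ?g)) powr xep * (abs lam ^ n * (abs (f t) * ?g)) powr - xep"
   using e(1) g G(4)[OF t] lam_nonzero wuv_nonzero B(1) hb[of t n] t by (intro damp_bound) auto
  also have "... = K * ?r ^ n * abs (f t) powr - xep"
   by (subst lam_powr) (use g in "auto simp: K_def powr_mult")
  also have "... <= K * ?r ^ n * G t" using G(4)[OF t] K by (intro mult_left_mono) auto
  finally show "damp xep (h n t) <= K * ?r ^ n * G t" .
 next
  show "(%t. damp xep (h n t)) integrable_on {0..T}" by (intro ici hc)
 qed (intro integrable_on_mult_right G(2))
 also have "itg T (%t. K * ?r ^ n * G t) = (K * itg T G) * ?r ^ n" for n
  by (simp add: mult_ac)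
 finally show ?thesis using K G(2,3) by (intro exI[of _ "K * itg T G"]) (auto intro!: mult_nonneg_nonneg integral_nonneg)
qed
have small: "abs ((1 / lam) ^ n * x * z2 T) <= B * ?g" if "abs x <= B" for x n
proof -
 have "abs ((1 / lam) ^ n) * abs x <= 1 * B" using inv_lam_power that by (intro mult_mono) auto
 thus ?thesis by (simp add: abs_mult mult_right_mono)
qed
show "EX C>=0. ALL n. itg T (%t. damp xep (zeta (t + real n * T) 0)) <= C * ?r ^ n"
proof (rule gen[of fu fu'])
 fix n t assume t: "t : {0..T}"
 have z: "zeta (t + real n * T) 0 * wuv = lam ^ n * fu t * z2 T - (1 / lam) ^ n * fv t * z2 T"
  using zeta_shift_n[of t n 0] wuv_nonzero by (simp add: fu_0)
 have "abs (lam ^ n * fu t * z2 T) = abs lam ^ n * (abs (fu t) * ?g)" by (simp add: abs_mult power_abs)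
 thus "abs lam ^ n * (abs (fu t) * ?g) - B * ?g <= abs (zeta (t + real n * T) 0) * abs wuv"
  using small[OF B(3)[OF t], of n] z unfolding abs_mult[symmetric] by linarith
qed (intro fu_derivative fu_simple continuous_damp_zeta1 | assumption)+
show "EX C>=0. ALL n. itg T (%t. damp xep (zeta (t - real n * T) 0)) <= C * ?r ^ n"
proof (rule gen[of fv fv'])
 fix n t assume t: "t : {0..T}"
 have z: "zeta (t - real n * T) 0 * wuv = (1 / lam) ^ n * fu t * z2 T - lam ^ n * fv t * z2 T"
  using zeta_unshift_n[of t n 0] wuv_nonzero by (simp add: fu_0)
 have "abs (lam ^ n * fv t * z2 T) = abs lam ^ n * (abs (fv t) * ?g)" by (simp add: abs_mult power_abs)
 thus "abs lam ^ n * (abs (fv t) * ?g) - B * ?g <= abs (zeta (t - real n * T) 0) * abs wuv"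
  using small[OF B(2)[OF t], of n] z unfolding abs_mult[symmetric] by linarith
next
 show "continuous_on {0..T} (%t. damp xep (zeta (t - real n * T) 0))" for n
  using continuous_damp_zeta1[of "{0..T}" xep "- real n * T" 0] by simp
qed (intro fv_derivative fv_simple | assumption)+
qed

text \<open>The growing coefficient is the product \<open>fu t * fv s\<close>, so its negative power
  factors and the two integrals separate.\<close>

lemma damp_decay_double:
assumes e: "0 < xep" "xep < 1"
shows "EX C>=0. ALL n. itg T (%t. itg T (%s. damp xep (zeta (t + real n * T) s))) <= C * (abs lam powr - xep) ^ n"
proof -
obtain B where B: "B >= 0" "!!t. t : {0..T} ==> (abs (fu t)) <= B" "!!t. t : {0..T} ==> (abs (fv t)) <= B"
 using fu_fv_bound by blast
let ?r = "abs lam powr - xep"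
obtain P G where G: "finite P" "G integrable_on {0..T}" "!!t. 0 <= G t"
  "!!t. t : {0..T} - P ==> fu t ~= 0 & abs (fu t) powr - xep <= G t"
 using negative_power_integrable[of fu fu' xep T, OF fu_derivative fu_simple e] T_pos by auto
obtain Q H where H: "finite Q" "H integrable_on {0..T}" "!!t. 0 <= H t"
  "!!t. t : {0..T} - Q ==> fv t ~= 0 & abs (fv t) powr - xep <= H t"
 using negative_power_integrable[of fv fv' xep T, OF fv_derivative fv_simple e] T_pos by auto
define K where "K = (2 * abs wuv + 2 * (B * B)) powr xep"
have K: "0 <= K" by (simp add: K_def)
have pt: "damp xep (zeta (t + real n * T) s) <= K * ?r ^ n * G t * H s"
 if t: "t : {0..T} - P" and s: "s : {0..T} - Q" for t s n
proof -
 have z: "zeta (t + real n * T) s * wuv = lam ^ n * fu t * fv s - (1 / lam) ^ n * fv t * fu s"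
  using zeta_shift_n[of t n s] wuv_nonzero by simp
 have "abs ((1 / lam) ^ n * fv t * fu s) <= 1 * B * B"
  unfolding abs_mult using B t s by (intro mult_mono inv_lam_power) auto
 moreover have "abs (lam ^ n * fu t * fv s) = abs lam ^ n * (abs (fu t) * abs (fv s))" by (simp add: abs_mult power_abs)
 ultimately have hb: "abs lam ^ n * (abs (fu t) * abs (fv s)) - B * B <= abs (zeta (t + real n * T) s) * abs wuv"
  using z unfolding abs_mult[symmetric] by linarith
 have "damp xep (zeta (t + real n * T) s) <= K * (abs lam ^ n * (abs (fu t) * abs (fv s))) powr - xep"
  unfolding K_def using e(1) G(4)[OF t] H(4)[OF s] lam_nonzero wuv_nonzero B(1) hb by (intro damp_bound) auto
 also have "... = K * ?r ^ n * (abs (fu t) powr - xep * abs (fv s) powr - xep)"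
  by (subst lam_powr) (auto simp: powr_mult)
 also have "... <= K * ?r ^ n * (G t * H s)"
  using G(3)[of t] G(4)[OF t] H(4)[OF s] K by (intro mult_left_mono mult_mono) auto
 finally show ?thesis by (simp add: mult.assoc)
qed
have inner: "itg T (%s. damp xep (zeta (t + real n * T) s)) <= (K * ?r ^ n * itg T H) * G t"
 if t: "t : {0..T} - P" for t n
proof -
 have "itg T (%s. damp xep (zeta (t + real n * T) s)) <= itg T (%s. K * ?r ^ n * G t * H s)"
  by (rule integral_le_off_finite[OF _ _ H(1) pt[OF t]])
   (intro ici continuous_damp_zeta2 integrable_on_mult_right H(2) | assumption)+
 thus ?thesis by (simp add: mult_ac)
qed
have "itg T (%t. itg T (%s. damp xep (zeta (t + real n * T) s)))
  <= itg T (%t. (K * ?r ^ n * itg T H) * G t)" for n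
 by (rule integral_le_off_finite[OF _ _ G(1) inner])
  (intro ici continuous_damp_integral integrable_on_mult_right G(2) | assumption)+
hence "itg T (%t. itg T (%s. damp xep (zeta (t + real n * T) s)))
  <= (K * itg T H * itg T G) * ?r ^ n" for n
 by (simp add: mult_ac)
thus ?thesis using K G(2,3) H(2,3)
 by (intro exI[of _ "K * itg T H * itg T G"]) (auto intro!: mult_nonneg_nonneg integral_nonneg)
qed

end

text \<open>A hat of half-width \<open>1 / (j + 1)\<close> about 0. Applied to \<open>zeta\<close>
  it marks the times where the dispersive bound is useless; off it, \<open>1 / |zeta|\<close> costs
  at most a factor \<open>j + 1\<close>.\<close>

definition cutoff :: "nat => real => real" where "cutoff j z = max 0 (1 - real (Suc j) * abs z)"

lemma cutoff_range: "0 <= cutoff j z" "cutoff j z <= 1"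
by (auto simp: cutoff_def)

lemma cutoff_continuous: "continuous_on UNIV (cutoff j)"
unfolding cutoff_def by (intro continuous_intros)

lemma cutoff_outside: "cutoff j z < 1 ==> z ~= 0" by (auto simp: cutoff_def)

lemma cutoff_inverse_bound: "(1 - cutoff j z) / abs z <= real (Suc j)"
proof (cases "z = 0")
case False
have "1 - cutoff j z <= real (Suc j) * abs z" by (auto simp: cutoff_def)
thus ?thesis using False by (simp add: pos_divide_le_eq)
qed simp

lemma cutoff_tendsto: "(%j. cutoff j z) ----> (if z = 0 then 1 else 0)"
proof (cases "z = 0")
case False
obtain N :: nat where N: "1 / abs z < real N" using reals_Archimedean2 by blast
have "cutoff j z = 0" if "j >= N" for j
proof -
 have "1 < real N * abs z" using N False by (simp add: field_simps)
 also have "... <= real (Suc j) * abs z" using that by (intro mult_right_mono) auto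
 finally show ?thesis by (simp add: cutoff_def)
qed
hence "\<forall>\<^sub>F j in sequentially. cutoff j z = 0" unfolding eventually_sequentially by blast
hence "(%j. cutoff j z) ----> 0" by (rule tendsto_eventually)
thus ?thesis using False by simp
qed (simp add: cutoff_def)

context hyperbolic_field
begin

text \<open>The Wronskian with \<open>cosol\<close> equals 1, so the zeros in the second time are
  simple, and compactness leaves finitely many.\<close>

lemma zeta_zeros_finite: "finite {s:{0..T}. zeta t s = 0}"
proof -
have nz: "zeta' s t ~= 0" if "zeta s t = 0" for s
proof
 assume "zeta' s t = 0"
 hence "cosol s t * zeta' s t - cosol' s t * zeta s t = 0" using that by simp
 moreover have "cosol s t * zeta' s t - cosol' s t * zeta s t = cosol t t * zeta' t t - cosol' t t * zeta t t"
  by (rule hsol_wronskian[OF hsol_cosol hsol_zeta])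
 ultimately show False by simp
qed
obtain P c where P: "finite P" "0 < c" "ALL s:{0..T}. EX p:P. c * abs (s - p) <= abs (zeta s t)"
 using simple_zeros_lower_bound[of "%s. zeta s t" "%s. zeta' s t" T] hsol_derivative[OF hsol_zeta] nz by blast
have "{s:{0..T}. zeta t s = 0} <= P"
proof
 fix s assume "s : {s:{0..T}. zeta t s = 0}"
 hence s: "s : {0..T}" "zeta s t = 0" using zeta_antisym[of s t] by auto
 obtain p where p: "p : P" "c * abs (s - p) <= abs (zeta s t)" using P(3) s(1) by blast
 hence "c * abs (s - p) <= 0" using s(2) by simp
 hence "s = p" using P(2) by (simp add: mult_le_0_iff)
 thus "s : P" using p(1) by simp
qed
thus ?thesis using P(1) finite_subset by blast
qed

lemma continuous_cutoff_zeta: "continuous_on S (%p. cutoff j (zeta (fst p + a) (snd p)))"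
proof -
have "continuous_on S (%p. zeta (fst (fst p + a, snd p)) (snd (fst p + a, snd p)))"
 by (intro continuous_on_compose2[OF zeta_continuous[of UNIV], where f="%p. (fst p + a, snd p)"] continuous_intros) auto
thus ?thesis by (intro continuous_on_compose2[OF cutoff_continuous]) auto
qed

lemma continuous_cutoff_zeta2: "continuous_on S (%s. cutoff j (zeta t s))"
using continuous_on_compose2[OF continuous_cutoff_zeta[of UNIV j 0] continuous_on_Pair[OF continuous_on_const[of S t] continuous_on_id]]
by simp

lemma continuous_cutoff_integral: "continuous_on {0..T} (%t. itg T (%s. cutoff j (zeta (t + a) s)))"
proof -
have "continuous_on ({0..T} \<times> cbox 0 T) (%(t, s). cutoff j (zeta (t + a) s))"
 using continuous_cutoff_zeta[of "{0..T} \<times> cbox 0 T" j a] by (simp add: case_prod_beta)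
hence "continuous_on {0..T} (%t. integral (cbox 0 T) (%s. cutoff j (zeta (t + a) s)))"
 by (rule integral_continuous_on_param)
thus ?thesis by (simp add: cbox_interval)
qed

lemma cutoff_double_integral:
"(%j. itg T (%t. itg T (%s. cutoff j (zeta (t + a) s)))) ----> 0"
proof -
have inner: "(%j. itg T (%s. cutoff j (zeta t s))) ----> 0" for t
proof -
 have "(%j. itg T (%s. cutoff j (zeta t s))) ----> itg T (%s. if zeta t s = 0 then 1 else 0)"
  by (rule dominated_convergence(2)[where h="%s. 1"])
   (auto simp: cutoff_range cutoff_tendsto intro!: ici continuous_cutoff_zeta2)
 also have "itg T (%s. if zeta t s = 0 then 1 else 0) = itg T (%s. 0::real)"
  by (rule integral_spike[OF negligible_finite[OF zeta_zeros_finite[of t]]]) auto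
 finally show ?thesis by simp
qed
have rng: "0 <= itg T (%s. cutoff j (zeta t s))" "itg T (%s. cutoff j (zeta t s)) <= T" for t j
proof -
 have i: "(%s. cutoff j (zeta t s)) integrable_on {0..T}"
  by (intro ici continuous_cutoff_zeta2)
 show "0 <= itg T (%s. cutoff j (zeta t s))" by (intro integral_nonneg i) (simp add: cutoff_range)
 have "itg T (%s. cutoff j (zeta t s)) <= itg T (%s. 1)"
  by (intro integral_le i) (auto simp: cutoff_range)
 thus "itg T (%s. cutoff j (zeta t s)) <= T" using T_pos by simp
qed
have "(%j. itg T (%t. itg T (%s. cutoff j (zeta (t + a) s)))) ----> itg T (%t. 0)"
 by (rule dominated_convergence(2)[where h="%s. T"])
  (use rng inner in "auto intro!: ici continuous_cutoff_integral")
thus ?thesis by simp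
qed

end

section \<open>Smooth functions, test functions and the expansion of the Hamiltonian\<close>

lemma poly_div_exp_tendsto: "((%u::real. u ^ n * poly p u / exp u) ---> 0) at_top"
proof (induction p arbitrary: n)
case (pCons a p)
have "((%u::real. a * (u ^ n / exp u) + u ^ Suc n * poly p u / exp u) ---> a * 0 + 0) at_top"
 by (intro tendsto_intros tendsto_power_div_exp_0 pCons.IH)
thus ?case by (simp add: field_simps)
qed simp

text \<open>With \<open>u = 1 / x\<close>, differentiating \<open>p(u) * exp (- u)\<close> in x
  gives \<open>u^2 * (p - p') (u) * exp (- u)\<close>. So \<open>bump k\<close> is the k-th
  derivative of the standard function \<open>exp (- 1 / x)\<close> cut off at 0.\<close>

fun bump_poly :: "nat => real poly" where
"bump_poly 0 = 1"
| "bump_poly (Suc k) = [:0, 0, 1:] * (bump_poly k - pderiv (bump_poly k))"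

definition bump :: "nat => real => real" where
"bump k x = (if x > 0 then poly (bump_poly k) (1 / x) * exp (- (1 / x)) else 0)"

lemma bump_derivative: "(bump k has_real_derivative bump (Suc k) x) (at x)"
proof (cases "x > 0")
case True
let ?f = "%x. poly (bump_poly k) (1 / x) * exp (- (1 / x))"
have "(?f has_real_derivative
  poly (pderiv (bump_poly k)) (1 / x) * (- (1 / x^2)) * exp (- (1 / x)) + poly (bump_poly k) (1 / x) * (exp (- (1 / x)) * (1 / x^2))) (at x)"
 using True by (auto intro!: derivative_eq_intros DERIV_chain2[OF poly_DERIV] simp: p2es)
also have "poly (pderiv (bump_poly k)) (1 / x) * (- (1 / x^2)) * exp (- (1 / x)) + poly (bump_poly k) (1 / x) * (exp (- (1 / x)) * (1 / x^2))
  = bump (Suc k) x"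
 using True by (simp add: bump_def p2es algebra_simps)
finally show ?thesis
proof (rule has_field_derivative_transform_within_open)
 show "open ({0<..} :: real set)" "x : {0<..}" using True by auto
qed (auto simp: bump_def)
next
case False
show ?thesis
proof (cases "x < 0")
 case True
 have "((%x. 0) has_real_derivative bump (Suc k) x) (at x)" using True by (simp add: bump_def)
 thus ?thesis
 proof (rule has_field_derivative_transform_within_open)
  show "open ({..<0} :: real set)" "x : {..<0}" using True by auto
 qed (auto simp: bump_def)
next
 case F2: False
 with False have x: "x = 0" by simp
 have r: "((%h. bump k h / h) ---> 0) (at_right 0)"
 proof -
  have "((%u::real. u ^ 1 * poly (bump_poly k) u / exp u) ---> 0) at_top" by (rule poly_div_exp_tendsto)
  hence "((%h. (inverse h) ^ 1 * poly (bump_poly k) (inverse h) / exp (inverse h)) ---> 0) (at_right 0)"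
   by (rule filterlim_compose[OF _ filterlim_inverse_at_top_right])
  moreover have "\<forall>\<^sub>F h in at_right 0. (inverse h) ^ 1 * poly (bump_poly k) (inverse h) / exp (inverse h) = bump k h / h"
   unfolding eventually_at_filter
   by (rule always_eventually) (auto simp: bump_def exp_minus field_simps)
  ultimately show ?thesis by (rule Lim_transform_eventually)
 qed
 have l: "((%h. bump k h / h) ---> 0) (at_left 0)"
 proof (rule tendsto_eventually)
  show "\<forall>\<^sub>F h in at_left 0. bump k h / h = 0"
   unfolding eventually_at_filter by (rule always_eventually) (auto simp: bump_def)
 qed
 have "((%h. bump k h / h) ---> 0) (at 0)" using l r by (simp add: filterlim_split_at)
 thus ?thesis unfolding x by (simp add: DERIV_def bump_def)
qed
qed

lemma bump_zero: "x <= 0 ==> bump k x = 0" by (simp add: bump_def)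

lemma bump_continuous: "continuous_on S (bump k)"
using bump_derivative by (meson DERIV_continuous_on has_field_derivative_at_within)

lemma bump_bounded: "EX C. ALL x<=1. abs (bump k x) <= C"
proof -
have "bounded (bump k ` {0..1})" by (intro compact_imp_bounded compact_continuous_image bump_continuous) auto
then obtain C where "ALL x:{0..1}. abs (bump k x) <= C" by (auto simp: bounded_iff)
hence "abs (bump k x) <= max 0 C" if "x <= 1" for x
 using that bump_zero[of x k] by (cases "x <= 0") (auto simp: le_max_iff_disj)
thus ?thesis by blast
qed

text \<open>A syntactic class containing the functions at hand and closed under partial derivatives.
  Smoothness of every order then follows by a single induction.\<close>

inductive smooth_fun :: "(real^2 => complex) => bool" where
smooth_const: "smooth_fun (%x. c)"
| smooth_coord: "smooth_fun (%x. of_real (x $ j))"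
| smooth_add: "smooth_fun f ==> smooth_fun g ==> smooth_fun (%x. f x + g x)"
| smooth_mult: "smooth_fun f ==> smooth_fun g ==> smooth_fun (%x. f x * g x)"
| smooth_exp: "smooth_fun f ==> smooth_fun (%x. exp (f x))"
| smooth_bump: "smooth_fun (%x. of_real (bump k (1 - c * (x \<bullet> x))))"

lemma partial_deriv_eq: "(f has_derivative D) (at x) ==> partial_deriv j f x = D (axis j 1)"
unfolding partial_deriv_def by (metis frechet_derivative_at)

lemma coord_has_derivative: "((%x::real^2. cor (x $ j)) has_derivative (%h. cor (h $ j))) (at x)"
by (intro bounded_linear.has_derivative[OF bounded_linear_of_real] bounded_linear.has_derivative[OF bounded_linear_vec_nth] has_derivative_ident)

lemma bump_comp_has_derivative:
"((%x::real^2. cor (bump k (1 - c * (x \<bullet> x)))) has_derivative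
  (%h. cor (bump (Suc k) (1 - c * (x \<bullet> x)) * (- c * (2 * (x \<bullet> h)))))) (at x)"
proof -
have "((%x::real^2. 1 - c * (x \<bullet> x)) has_derivative (%h. - c * (2 * (x \<bullet> h)))) (at x)"
 by (auto intro!: derivative_eq_intros simp: inner_commute algebra_simps)
from has_derivative_compose[OF this bump_derivative[unfolded has_field_derivative_def]]
have "((%x::real^2. bump k (1 - c * (x \<bullet> x))) has_derivative (%h. bump (Suc k) (1 - c * (x \<bullet> x)) * (- c * (2 * (x \<bullet> h))))) (at x)"
 by simp
thus ?thesis by (intro bounded_linear.has_derivative[OF bounded_linear_of_real])
qed

lemma smooth_fun_derivative:
assumes "smooth_fun f"
shows "EX D. (ALL x. (f has_derivative D x) (at x)) & (ALL j. smooth_fun (%x. D x (axis j 1)))"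
using assms
proof induction
case (smooth_const c)
show ?case by (intro exI[of _ "%x h. 0"]) (auto intro: smooth_fun.smooth_const)
next
case (smooth_coord j)
show ?case
 by (intro exI[of _ "%x h. cor (h $ j)"]) (auto intro: smooth_fun.smooth_const coord_has_derivative)
next
case (smooth_add f g)
then obtain D E where D: "!!x. (f has_derivative D x) (at x)" "!!j. smooth_fun (%x. D x (axis j 1))"
 and E: "!!x. (g has_derivative E x) (at x)" "!!j. smooth_fun (%x. E x (axis j 1))" by blast
show ?case
 by (intro exI[of _ "%x h. D x h + E x h"] conjI allI has_derivative_add D E smooth_fun.smooth_add)
next
case (smooth_mult f g)
then obtain D E where D: "!!x. (f has_derivative D x) (at x)" "!!j. smooth_fun (%x. D x (axis j 1))"
 and E: "!!x. (g has_derivative E x) (at x)" "!!j. smooth_fun (%x. E x (axis j 1))" by blast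
show ?case
 by (intro exI[of _ "%x h. f x * E x h + D x h * g x"] conjI allI has_derivative_mult D E
   smooth_fun.smooth_add smooth_fun.smooth_mult smooth_mult.hyps)
next
case (smooth_exp f)
then obtain D where D: "!!x. (f has_derivative D x) (at x)" "!!j. smooth_fun (%x. D x (axis j 1))" by blast
have "((%x. exp (f x)) has_derivative (%h. exp (f x) * D x h)) (at x)" for x
 using has_derivative_compose[OF D(1) DERIV_exp[unfolded has_field_derivative_def]] by simp
thus ?case
 by (intro exI[of _ "%x h. exp (f x) * D x h"] conjI allI smooth_fun.smooth_mult smooth_fun.smooth_exp smooth_exp.hyps D)
next
case (smooth_bump k c)
have sm: "smooth_fun (%x. cor (bump (Suc k) (1 - c * (x \<bullet> x))) * (cor (- 2 * c) * cor (x $ j)))" for j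
 by (intro smooth_fun.smooth_mult smooth_fun.smooth_const smooth_fun.smooth_coord smooth_fun.smooth_bump)
show ?case
proof (intro exI[of _ "%x h. cor (bump (Suc k) (1 - c * (x \<bullet> x)) * (- c * (2 * (x \<bullet> h))))"] conjI allI bump_comp_has_derivative)
 fix j
 have "(%x::real^2. cor (bump (Suc k) (1 - c * (x \<bullet> x)) * (- c * (2 * (x \<bullet> axis j 1)))))
   = (%x. cor (bump (Suc k) (1 - c * (x \<bullet> x))) * (cor (- 2 * c) * cor (x $ j)))"
  by (auto simp: inner_axis mult_ac)
 thus "smooth_fun (%x. cor (bump (Suc k) (1 - c * (x \<bullet> x)) * (- c * (2 * (x \<bullet> axis j 1)))))"
  using sm[of j] by simp
qed
qed

lemma smooth_fun_differentiable: "smooth_fun f ==> f differentiable (at x)"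
using smooth_fun_derivative differentiable_def by metis

lemma smooth_fun_partial: assumes "smooth_fun f" shows "smooth_fun (partial_deriv j f)"
proof -
obtain D where D: "!!x. (f has_derivative D x) (at x)" "!!j. smooth_fun (%x. D x (axis j 1))"
 using smooth_fun_derivative[OF assms] by blast
have "partial_deriv j f = (%x. D x (axis j 1))" by (rule ext, rule partial_deriv_eq, rule D)
thus ?thesis using D(2) by simp
qed

lemma smooth_fun_continuous: "smooth_fun f ==> continuous_on S f"
by (meson continuous_at_imp_continuous_on differentiable_imp_continuous_within smooth_fun_differentiable)

lemma smooth_fun_C_k: "smooth_fun f ==> C_k k f"
by (induction k arbitrary: f) (auto intro: smooth_fun_continuous smooth_fun_differentiable smooth_fun_partial)

lemma partial_deriv_add:
"smooth_fun f ==> smooth_fun g ==> partial_deriv j (%x. f x + g x) x = partial_deriv j f x + partial_deriv j g x"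
unfolding partial_deriv_def
by (subst frechet_derivative_at[OF has_derivative_add, symmetric])
 (auto intro!: smooth_fun_differentiable simp: frechet_derivative_works[symmetric])

lemma partial_deriv_mult:
"smooth_fun f ==> smooth_fun g ==> partial_deriv j (%x. f x * g x) x = f x * partial_deriv j g x + partial_deriv j f x * g x"
unfolding partial_deriv_def
by (subst frechet_derivative_at[OF has_derivative_mult, symmetric])
 (auto intro!: smooth_fun_differentiable simp: frechet_derivative_works[symmetric])

lemma partial_deriv_const: "partial_deriv j (%x. c) x = 0"
by (rule partial_deriv_eq[OF has_derivative_const])

lemma partial_deriv_coord: "partial_deriv j (%x. cor (x $ i)) x = of_bool (i = j)"
by (subst partial_deriv_eq[OF coord_has_derivative]) (auto simp: axis_def)

lemma partial_deriv_exp: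
assumes "smooth_fun f"
shows "partial_deriv j (%x. exp (f x)) x = exp (f x) * partial_deriv j f x"
proof -
have D: "(f has_derivative frechet_derivative f (at x)) (at x)"
 using smooth_fun_differentiable[OF assms] frechet_derivative_works by blast
have "((%x. exp (f x)) has_derivative (%h. exp (f x) * frechet_derivative f (at x) h)) (at x)"
 using has_derivative_compose[OF D DERIV_exp[unfolded has_field_derivative_def]] by simp
from partial_deriv_eq[OF this] show ?thesis by (simp add: partial_deriv_def)
qed

lemma partial_deriv_bump:
"partial_deriv j (%x. cor (bump k (1 - c * (x \<bullet> x)))) x
  = cor (bump (Suc k) (1 - c * (x \<bullet> x))) * (cor (- 2 * c) * cor (x $ j))"
by (subst partial_deriv_eq[OF bump_comp_has_derivative]) (auto simp: inner_axis mult_ac)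

lemma smooth_test_function:
assumes "smooth_fun f" "bounded {x. f x ~= 0}"
shows "test_function f"
using assms smooth_fun_C_k by (simp add: test_function_def)

text \<open>The expansion \<open>H\<^sub>0(t) = D\<^sub>0 + k(t) D\<^sub>1 + k(t)^2 D\<^sub>2\<close> with \<open>k = qB / 2m\<close>.\<close>

definition kinD0 :: "real => (real^2 => complex) => real^2 => complex" where
"kinD0 m xph x = of_real (- 1 / (2 * m)) * (partial_deriv 1 (partial_deriv 1 xph) x + partial_deriv 2 (partial_deriv 2 xph) x)"

text \<open>Minus the angular momentum \<open>x1 * p2 - x2 * p1\<close>.\<close>

definition kinD1 :: "(real^2 => complex) => real^2 => complex" where
"kinD1 xph x = \<i> * (of_real (x $ 1) * partial_deriv 2 xph x - of_real (x $ 2) * partial_deriv 1 xph x)"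

definition kinD2 :: "real => (real^2 => complex) => real^2 => complex" where
"kinD2 m xph x = of_real (m / 2 * (x \<bullet> x)) * xph x"

text \<open>The component \<open>a j\<close> of the potential does not depend on the j-th coordinate
  (\<open>pa\<close>), so expanding the square leaves only twice the product with the derivative,
  and the terms sort by powers of \<open>k\<close>.\<close>

lemma free_hamiltonian_expansion:
assumes "smooth_fun xph" "m ~= 0"
shows "free_hamiltonian m q B t xph x =
 kinD0 m xph x + of_real (q * B t / (2 * m)) * kinD1 xph x + of_real ((q * B t / (2 * m))^2) * kinD2 m xph x"
proof -
define b where "b = q * B t / 2"
define a :: "2 => real^2 => complex" where
 "a j x = (if j = 1 then of_real (- b) * of_real (x $ 2) else of_real b * of_real (x $ 1))" for j x
have two: "j = 1 | j = 2" for j :: 2 by (rule exhaust_2)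
have n12: "(1::2) ~= 2" by simp
have A: "of_real (q * vector_potential B t x $ j) = a j x" for j x
 using two[of j] by (auto simp: vector_potential_def a_def b_def)
have km: "kinetic_momentum q B t j ps = (%x. (- \<i>) * partial_deriv j ps x + (- 1) * (a j x * ps x))" for j ps
 by (rule ext) (simp add: kinetic_momentum_def A[symmetric])
have sa: "smooth_fun (a j)" for j
proof (cases "j = 1")
 case True
 hence e: "a j = (%x. of_real (- b) * of_real (x $ 2))" by (auto simp: a_def fun_eq_iff)
 show ?thesis unfolding e by (intro smooth_mult smooth_const smooth_coord)
next
 case False
 hence e: "a j = (%x. of_real b * of_real (x $ 1))" by (auto simp: a_def fun_eq_iff)
 show ?thesis unfolding e by (intro smooth_mult smooth_const smooth_coord)
qed
have pa: "partial_deriv j (a j) x = 0" for j x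
proof (cases "j = 1")
 case True
 hence e: "a j = (%x. of_real (- b) * of_real (x $ 2))" by (auto simp: a_def fun_eq_iff)
 show ?thesis
  unfolding e partial_deriv_mult[OF smooth_const smooth_coord] partial_deriv_const partial_deriv_coord
  using True by simp
next
 case False
 hence e: "a j = (%x. of_real b * of_real (x $ 1))" by (auto simp: a_def fun_eq_iff)
 show ?thesis
  unfolding e partial_deriv_mult[OF smooth_const smooth_coord] partial_deriv_const partial_deriv_coord
  using False by simp
qed
have sp: "smooth_fun (partial_deriv j xph)" for j by (rule smooth_fun_partial[OF assms(1)])
have pk: "partial_deriv j (kinetic_momentum q B t j xph) x
  = (- \<i>) * partial_deriv j (partial_deriv j xph) x - a j x * partial_deriv j xph x" for j
 unfolding km
 by (subst partial_deriv_add partial_deriv_mult,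
   (intro smooth_add smooth_mult smooth_const sp sa assms(1) smooth_fun_partial)+)+
  (simp add: partial_deriv_const pa)
have kk: "kinetic_momentum q B t j (kinetic_momentum q B t j xph) x
  = - partial_deriv j (partial_deriv j xph) x + 2 * \<i> * a j x * partial_deriv j xph x + (a j x)^2 * xph x" for j
proof -
 have "kinetic_momentum q B t j (kinetic_momentum q B t j xph) x
  = (- \<i>) * partial_deriv j (kinetic_momentum q B t j xph) x + (- 1) * (a j x * kinetic_momentum q B t j xph x)"
  by (simp only: km[of j "kinetic_momentum q B t j xph"])
 also have "kinetic_momentum q B t j xph x = (- \<i>) * partial_deriv j xph x + (- 1) * (a j x * xph x)"
  by (simp only: km[of j xph])
 finally show ?thesis unfolding pk by (simp add: algebra_simps p2es)
qed
have xx: "x \<bullet> x = (x $ 1)^2 + (x $ 2)^2"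
 by (simp add: inner_vec_def UNIV_2 p2es)
have k: "q * B t / (2 * m) = b / m" by (simp add: b_def)
show ?thesis
 unfolding free_hamiltonian_def kk kinD0_def kinD1_def kinD2_def xx k
 using assms(2) n12 by (simp add: UNIV_2 a_def field_simps p2es)
qed

section \<open>Gaussians in \<open>L2\<close> and their approximation by test functions\<close>

lemma integrable_gauss:
assumes "0 < e"
shows "integrable lborel (%x::real^2. exp (- e * (x \<bullet> x)))"
proof -
define s where "s = sqrt (1 / (2 * e))"
have s: "s > 0" "2 * s^2 = 1 / e" using assms by (auto simp: s_def)
have "integrable lborel (%y. sqrt (2 * pi * s^2) * normal_density 0 s y)"
 using integrable_normal_density[OF s(1)] by simp
moreover have "(%y. sqrt (2 * pi * s^2) * normal_density 0 s y) = (%y. exp (- e * y^2))"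
 using s assms by (auto simp: normal_density_def fun_eq_iff)
ultimately have "integrable lborel (%y. exp (- e * y^2))" by simp
hence "(\<integral>\<^sup>+y. ennreal (norm (exp (- e * y^2))) \<partial>lborel) < \<infinity>"
 by (simp add: integrable_iff_bounded)
hence fin: "(\<integral>\<^sup>+y. ennreal (exp (- e * y^2)) \<partial>lborel) < \<infinity>" by simp
have "(\<integral>\<^sup>+x. ennreal (norm (exp (- e * ((x::real^2) \<bullet> x)))) \<partial>lborel)
  = (\<integral>\<^sup>+x. (\<Prod>b\<in>Basis. ennreal (exp (- e * ((x::real^2) \<bullet> b)^2))) \<partial>lborel)"
proof (intro nn_integral_cong)
 fix x :: "real^2"
 have "x \<bullet> x = (SUM b:Basis. (x \<bullet> b)^2)"
  by (subst euclidean_inner) (simp add: p2es)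
 hence "exp (- e * (x \<bullet> x)) = (\<Prod>b\<in>Basis. exp (- e * (x \<bullet> b)^2))"
  by (simp add: exp_sum[symmetric] sum_distrib_left sum_negf)
 thus "ennreal (norm (exp (- e * (x \<bullet> x)))) = (\<Prod>b\<in>Basis. ennreal (exp (- e * (x \<bullet> b)^2)))"
  by (simp add: prod_ennreal abs_prod)
qed
also have "... = (\<Prod>b\<in>(Basis::(real^2) set). \<integral>\<^sup>+y. ennreal (exp (- e * y^2)) \<partial>lborel)"
 by (rule nn_integral_lborel_prod) auto
also have "... < \<infinity>" using fin by (simp add: power_less_top_ennreal)
finally show ?thesis by (simp add: integrable_iff_bounded)
qed

lemma power_le_exp: "0 <= s ==> 0 < de ==> s ^ n <= (real n / de) ^ n * exp (de * s)"
proof (cases "n = 0")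
case False
assume s: "0 <= s" "0 < de"
have "s * de / n <= exp (de * s / n)" 
 using exp_ge_add_one_self[of "s * de / n"] unfolding mult.commute[of de s] by linarith
hence "(s * de / n) ^ n <= exp (de * s / n) ^ n" using s by (intro power_mono) auto
also have "... = exp (de * s)" using False by (simp add: exp_of_nat_mult[symmetric])
finally have "s ^ n * (de / n) ^ n <= exp (de * s)" by (simp add: pmd[symmetric])
hence "s ^ n * (de / n) ^ n * (n / de) ^ n <= exp (de * s) * (n / de) ^ n" using s by (intro mult_right_mono) auto
moreover have "(de / n) ^ n * (n / de) ^ n = 1" using s False by (simp add: pmd[symmetric])
ultimately have "s ^ n <= exp (de * s) * (n / de) ^ n" unfolding mult.assoc[of "s ^ n"] by simp
thus ?thesis by (simp only: mult.commute)
qed simp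

text \<open>A family of envelopes closed under squaring: polynomial factors, a linear exponent from
  complex \<open>b\<close> and \<open>c\<close>, and Gaussian decay.\<close>

definition gweight :: "nat => real => real => real^2 => real" where
"gweight n be e x = (1 + x \<bullet> x) ^ n * exp (be * norm x - e * (x \<bullet> x))"

lemma gweight_nonneg: "0 <= gweight n be e x" by (simp add: gweight_def)

lemma gweight_continuous: "continuous_on S (gweight n be e)"
unfolding gweight_def by (intro continuous_intros)

text \<open>Half of \<open>e\<close> absorbs the linear exponent by completing the square, a quarter
  absorbs the polynomial, and a quarter remains as decay.\<close>

lemma gweight_bound:
assumes "0 <= be" "0 < e"
shows "EX C>=0. ALL x. gweight n be e x <= C * exp (- (e / 4) * (x \<bullet> x))"
proof -
let ?C = "(real n / (e / 4)) ^ n * exp (e / 4) * exp (be^2 / (2 * e))"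
have "gweight n be e x <= ?C * exp (- (e / 4) * (x \<bullet> x))" for x :: "real^2"
proof -
 let ?r = "norm x"
 have xx: "x \<bullet> x = ?r^2" by (simp add: power2_norm_eq_inner)
 have "0 <= (?r - be / e)^2 * (e / 2)" using assms by simp
 also have "... = e / 2 * ?r^2 + be^2 / (2 * e) - be * ?r"
  using assms by (simp add: p2es field_simps)
 finally have 1: "be * ?r <= e / 2 * ?r^2 + be^2 / (2 * e)" by simp
 have "gweight n be e x <= ((real n / (e / 4)) ^ n * exp (e / 4 * (1 + ?r^2))) * exp (e / 2 * ?r^2 + be^2 / (2 * e) - e * ?r^2)"
  unfolding gweight_def xx using assms 1 by (intro mult_mono power_le_exp) auto
 also have "... = (real n / (e / 4)) ^ n * exp (e / 4 * (1 + ?r^2) + (e / 2 * ?r^2 + be^2 / (2 * e) - e * ?r^2))"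
  by (simp add: exp_add mult.assoc)
 also have "e / 4 * (1 + ?r^2) + (e / 2 * ?r^2 + be^2 / (2 * e) - e * ?r^2) = e / 4 + be^2 / (2 * e) + - (e / 4) * ?r^2"
  by (simp add: field_simps)
 also have "(real n / (e / 4)) ^ n * exp (e / 4 + be^2 / (2 * e) + - (e / 4) * ?r^2) = ?C * exp (- (e / 4) * (x \<bullet> x))"
  unfolding xx exp_add by simp
 finally show ?thesis .
qed
thus ?thesis using assms by (intro exI[of _ ?C]) auto
qed

lemma gweight_integrable:
assumes "0 <= be" "0 < e"
shows "integrable lborel (gweight n be e)"
proof -
obtain C where C: "C >= 0" "!!x. gweight n be e x <= C * exp (- (e / 4) * (x \<bullet> x))"
 using gweight_bound[OF assms] by blast
show ?thesis
proof (rule int_bound)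
 show "integrable lborel (%x::real^2. C * exp (- (e / 4) * (x \<bullet> x)))"
  using integrable_gauss[of "e / 4"] assms by (intro integrable_mult_right) auto
 show "gweight n be e : bmf lborel"
  using bmci[OF gweight_continuous] by simp
 show "AE x in lborel. norm (gweight n be e x) <= norm (C * exp (- (e / 4) * (x \<bullet> x)))"
  using C gweight_nonneg by (intro always_eventually allI) (simp add: abs_mult)
qed
qed

lemma gweight_square: "(gweight n be e x)^2 = gweight (2 * n) (2 * be) (2 * e) x"
unfolding gweight_def pmd
by (simp add: power_mult[symmetric] mult.commute exp_double[symmetric] algebra_simps)

lemma gweight_square_integrable:
assumes "0 <= be" "0 < e"
shows "integrable lborel (%x. (K * gweight n be e x)^2)"
unfolding pmd gweight_square
using gweight_integrable[of "2 * be" "2 * e" "2 * n"] assms by auto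

lemma square_integrable_gweight:
assumes "0 <= be" "0 < e" "f : bmf borel" "!!x. cmod (f x) <= K * gweight n be e x"
shows "sqint f" "integrable lborel f"
proof -
show "sqint f"
 unfolding square_integrable_def
proof
 show "integrable lborel (%x. (cmod (f x))^2)"
 proof (rule int_bound[OF gweight_square_integrable[OF assms(1,2)]])
  show "AE x in lborel. norm ((cmod (f x))^2) <= norm ((K * gweight n be e x)^2)"
   using assms(4) by (intro always_eventually allI) (simp add: power_mono)
 qed (use assms(3) in measurable)
qed (use assms(3) in simp)
show "integrable lborel f"
proof (rule int_bound)
 show "integrable lborel (%x. K * gweight n be e x)"
  by (intro integrable_mult_right gweight_integrable assms)
 show "AE x in lborel. norm (f x) <= norm (K * gweight n be e x)"
  using assms(4) by (intro always_eventually allI) (simp add: order_trans[OF _ abs_ge_self])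
qed (use assms(3) in simp)
qed

lemma norm_to_L2_mono:
assumes "sqint f" "sqint g" "!!x. cmod (f x) <= c * cmod (g x)" "0 <= c"
shows "norm (to_L2 f) <= c * norm (to_L2 g)"
proof (rule power2_le_imp_le)
have "(norm (to_L2 f))^2 = (LINT x|lborel. (cmod (f x))^2)" by (rule norm_to_L2_sq[OF assms(1)])
also have "... <= (LINT x|lborel. c^2 * (cmod (g x))^2)"
proof (rule integral_mono)
 show "(cmod (f x))^2 <= c^2 * (cmod (g x))^2" for x
  using power_mono[OF assms(3)[of x], of 2] by (simp add: pmd)
qed (use assms in "auto simp: square_integrable_def")
also have "... = (c * norm (to_L2 g))^2" by (simp add: norm_to_L2_sq[OF assms(2)] pmd)
finally show "(norm (to_L2 f))^2 <= (c * norm (to_L2 g))^2" .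
qed (use assms(4) in simp)

definition gss :: "complex => complex => complex => real^2 => complex" where
"gss a b c x = exp (a * of_real (x \<bullet> x) + b * of_real (x $ 1) + c * of_real (x $ 2))"

lemma inner_2: "x \<bullet> x = (x $ 1)^2 + (x $ 2)^2" for x :: "real^2"
by (simp add: inner_vec_def UNIV_2 p2es)

lemma coord_le_q: "abs (x $ j) <= 1 + x \<bullet> x" for x :: "real^2"
proof -
have "abs (x $ j) <= norm x" by (rule component_le_norm_cart)
also have "... <= 1 + (norm x)^2" 
 using sum_squares_bound[of 1 "norm x"] norm_ge_zero[of x] by (simp del: norm_ge_zero)
finally show ?thesis by (simp add: power2_norm_eq_inner)
qed

lemma gss_bound: "cmod (gss a b c x) <= gweight 0 (cmod b + cmod c) (- Re a) x"
proof -
have "Re z * x $ j <= cmod z * norm x" for z j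
proof -
 have "Re z * x $ j <= abs (Re z) * abs (x $ j)" by (metis abs_ge_self abs_mult)
 also have "... <= cmod z * norm x" by (intro mult_mono abs_Re_le_cmod component_le_norm_cart) auto
 finally show ?thesis .
qed
from this[of b 1] this[of c 2]
show ?thesis unfolding gss_def gweight_def norm_exp_eq_Re by (simp add: algebra_simps)
qed

lemma gss_smooth: "smooth_fun (gss a b c)"
proof -
have e: "gss a b c = (%x. exp ((a * (of_real (x $ 1) * of_real (x $ 1) + of_real (x $ 2) * of_real (x $ 2)) + b * of_real (x $ 1)) + c * of_real (x $ 2)))"
 by (rule ext) (simp add: gss_def inner_2 p2es)
show ?thesis unfolding e by (intro smooth_exp smooth_add smooth_mult smooth_const smooth_coord)
qed

lemma smooth_measurable: "smooth_fun f ==> f : bmf borel"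
by (intro bmci smooth_fun_continuous)

lemma poly_gss_square_integrable:
assumes "Re a < 0" "f : bmf borel" "!!x. cmod (f x) <= K * (1 + x \<bullet> x) ^ n * cmod (gss a b c x)" "0 <= K"
shows "sqint f" "integrable lborel f"
proof -
have "cmod (f x) <= K * gweight n (cmod b + cmod c) (- Re a) x" for x
proof -
 have "cmod (f x) <= K * (1 + x \<bullet> x) ^ n * gweight 0 (cmod b + cmod c) (- Re a) x"
  by (rule order_trans[OF assms(3)], intro mult_left_mono gss_bound) (use assms(4) in auto)
 thus ?thesis by (simp add: gweight_def mult.assoc)
qed
thus "sqint f" "integrable lborel f"
 using square_integrable_gweight[of "cmod b + cmod c" "- Re a" f K n] assms by auto
qed

lemma gss_square_integrable: "Re a < 0 ==> sqint (gss a b c)"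
by (rule poly_gss_square_integrable(1)[where K=1 and n=0]) (auto intro: smooth_measurable gss_smooth)

lemma poly_gss_mult_square_integrable:
assumes "Re a < 0" "smooth_fun p" "!!x. cmod (p x) <= K * (1 + x \<bullet> x) ^ n" "0 <= K"
shows "sqint (%x. p x * gss a b c x)"
proof (rule poly_gss_square_integrable(1)[OF assms(1) _ _ assms(4)])
show "(%x. p x * gss a b c x) : bmf borel"
 by (intro smooth_measurable smooth_mult assms gss_smooth)
show "cmod (p x * gss a b c x) <= K * (1 + x \<bullet> x) ^ n * cmod (gss a b c x)" for x
 unfolding norm_mult by (intro mult_right_mono assms) auto
qed

lemma smooth_inner: "smooth_fun (%x. of_real (x \<bullet> x))"
proof -
have e: "(%x::real^2. cor (x \<bullet> x)) = (%x. of_real (x $ 1) * of_real (x $ 1) + of_real (x $ 2) * of_real (x $ 2))"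
 by (rule ext) (simp add: inner_2 p2es)
show ?thesis unfolding e by (intro smooth_add smooth_mult smooth_coord)
qed

lemma sq_gss_moments:
assumes "Re a < 0"
shows "sqint (%x. of_real (x \<bullet> x) * gss a b c x)" "sqint (%x. of_real (x $ j) * gss a b c x)"
by (rule poly_gss_mult_square_integrable[OF assms, where K=1 and n=1];
  auto intro!: smooth_inner smooth_coord simp: coord_le_q)+

text \<open>The Gaussian with changed parameters is the old one times the exponential of a quadratic
  polynomial. Its second-order remainder costs a factor growing like
  \<open>exp (et * |x|^2)\<close>; with \<open>et\<close> half the decay rate, a square-integrable
  majorant remains.\<close>

lemma gss_taylor:
assumes a: "Re a < 0"
shows "EX K>=0. EX et>0. ALL a' b' c'. cmod (a' - a) + cmod (b' - b) + cmod (c' - c) <= et -->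
  Re a' < 0 &
  norm (to_L2 (gss a' b' c') - to_L2 (gss a b c)
   - ((a' - a) *C to_L2 (%x. of_real (x \<bullet> x) * gss a b c x)
    + (b' - b) *C to_L2 (%x. of_real (x $ 1) * gss a b c x)
    + (c' - c) *C to_L2 (%x. of_real (x $ 2) * gss a b c x)))
  <= K * (cmod (a' - a) + cmod (b' - b) + cmod (c' - c))^2"
proof -
define e where "e = - Re a"
define et where "et = e / 2"
have e: "e > 0" "et > 0" using a by (auto simp: e_def et_def)
let ?be = "cmod b + cmod c"
define G where "G x = cor (exp et * gweight 2 ?be et x)" for x
have Gm: "G : bmf borel"
 unfolding G_def by (intro bmci continuous_intros gweight_continuous)
have sG: "sqint G"
 by (rule square_integrable_gweight(1)[OF _ e(2) Gm, where K="exp et" and n=2 and be="?be"])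
  (auto simp: G_def norm_mult gweight_nonneg simp del: of_real_mult)
show ?thesis
proof (rule exI[of _ "norm (to_L2 G)"], rule conjI, rule norm_ge_zero, rule exI[of _ et], rule conjI, rule e, intro conjI allI impI)
 fix a' b' c'
 let ?D = "cmod (a' - a) + cmod (b' - b) + cmod (c' - c)"
 assume D: "?D <= et"
 have "abs (Re (a' - a)) <= et" using abs_Re_le_cmod[of "a' - a"] D norm_ge_zero[of "b' - b"] norm_ge_zero[of "c' - c"] by linarith
 thus a': "Re a' < 0" using e by (simp add: et_def e_def abs_le_iff)
 let ?w = "%x::real^2. (a' - a) * of_real (x \<bullet> x) + (b' - b) * of_real (x $ 1) + (c' - c) * of_real (x $ 2)"
 let ?g = "gss a b c"
 let ?f = "%x. gss a' b' c' x - ?g x - ((a' - a) * (of_real (x \<bullet> x) * ?g x) + (b' - b) * (of_real (x $ 1) * ?g x) + (c' - c) * (of_real (x $ 2) * ?g x))"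
 note sq = gss_square_integrable[OF a] gss_square_integrable[OF a'] sq_gss_moments[OF a]
 have L: "to_L2 (gss a' b' c') - to_L2 ?g
   - ((a' - a) *C to_L2 (%x. of_real (x \<bullet> x) * ?g x) + (b' - b) *C to_L2 (%x. of_real (x $ 1) * ?g x)
    + (c' - c) *C to_L2 (%x. of_real (x $ 2) * ?g x)) = to_L2 ?f"
  by (simp only: to_L2_scale to_L2_add to_L2_diff sq square_integrable_scale square_integrable_add square_integrable_diff)
 have sf: "sqint ?f"
  by (intro square_integrable_diff square_integrable_add square_integrable_scale sq)
 have "norm (to_L2 ?f) <= ?D^2 * norm (to_L2 G)"
 proof (rule norm_to_L2_mono[OF sf sG])
  fix x :: "real^2"
  let ?q = "1 + x \<bullet> x"
  have w: "cmod (?w x) <= ?D * ?q"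
  proof -
   have "cmod (?w x) <= cmod (a' - a) * abs (x \<bullet> x) + cmod (b' - b) * abs (x $ 1) + cmod (c' - c) * abs (x $ 2)"
    by (intro order_trans[OF norm_triangle_ineq] add_mono) (auto simp: norm_mult)
   also have "... <= cmod (a' - a) * ?q + cmod (b' - b) * ?q + cmod (c' - c) * ?q"
    by (intro add_mono mult_left_mono coord_le_q) auto
   finally show ?thesis by (simp add: algebra_simps)
  qed
  have "gss a' b' c' x = ?g x * exp (?w x)"
   unfolding gss_def exp_add[symmetric] by (simp add: algebra_simps)
  hence "?f x = ?g x * (exp (?w x) - (1 + ?w x))" by (simp add: algebra_simps)
  hence "cmod (?f x) = cmod (?g x) * cmod (exp (?w x) - (1 + ?w x))" by (simp only: norm_mult)
  also have "cmod (exp (?w x) - (1 + ?w x)) <= exp (abs (Re (?w x))) * (cmod (?w x))^2"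
   using Taylor_exp[of "?w x" 1] by (simp add: numeral_2_eq_2)
  also have "... <= exp (et * ?q) * (?D * ?q)^2"
  proof (intro mult_mono power_mono w)
   have "abs (Re (?w x)) <= ?D * ?q" using abs_Re_le_cmod w order_trans by blast
   also have "... <= et * ?q" using D by (intro mult_right_mono) auto
   finally show "exp (abs (Re (?w x))) <= exp (et * ?q)" by simp
  qed auto
  also have "cmod (?g x) * (exp (et * ?q) * (?D * ?q)^2) <= gweight 0 ?be e x * (exp (et * ?q) * (?D * ?q)^2)"
   using gss_bound[of a b c x] by (intro mult_right_mono) (auto simp: e_def)
  also have "... = ?D^2 * (exp et * gweight 2 ?be et x)"
  proof -
   have "exp (?be * norm x - e * (x \<bullet> x)) * exp (et * ?q) = exp et * exp (?be * norm x - et * (x \<bullet> x))"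
    unfolding exp_add[symmetric] by (simp add: et_def algebra_simps)
   thus ?thesis by (simp add: gweight_def pmd)
  qed
  also have "... = ?D^2 * cmod (G x)"
   by (simp add: G_def norm_mult gweight_nonneg del: of_real_mult)
  finally show "cmod (?f x) <= ?D^2 * cmod (G x)" by (simp add: mult_left_mono)
 qed auto
 thus "norm (to_L2 (gss a' b' c') - to_L2 (gss a b c)
   - ((a' - a) *C to_L2 (%x. of_real (x \<bullet> x) * gss a b c x)
    + (b' - b) *C to_L2 (%x. of_real (x $ 1) * gss a b c x)
    + (c' - c) *C to_L2 (%x. of_real (x $ 2) * gss a b c x))) <= norm (to_L2 G) * ?D^2"
  unfolding L by (simp add: mult.commute)
qed
qed

lemma gss_dominated:
assumes a: "Re a < 0" and r: "!!n. smooth_fun (r n)" "!!n x. cmod (r n x) <= K * (1 + x \<bullet> x) ^ 2"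
 and l: "!!x. (%n. r n x) ----> R x"
shows "sqint (%x. r n x * gss a b c x)"
 "(%n. to_L2 (%x. r n x * gss a b c x)) ----> to_L2 (%x. R x * gss a b c x)"
proof -
have K: "0 <= K" using order_trans[OF norm_ge_zero r(2)[of 0 0]] by simp
have m: "(%x. r n x * gss a b c x) : bmf lborel" for n
 using smooth_measurable[OF smooth_mult[OF r(1) gss_smooth]] by simp
have l': "(%n. r n x * gss a b c x) ----> R x * gss a b c x" for x
 by (intro tendsto_intros l)
have bd: "cmod (r n x * gss a b c x) <= K * gweight 2 (cmod b + cmod c) (- Re a) x" for n x
proof -
 have "cmod (r n x * gss a b c x) <= (K * (1 + x \<bullet> x) ^ 2) * gweight 0 (cmod b + cmod c) (- Re a) x"
  unfolding norm_mult by (intro mult_mono r(2) gss_bound) (use K in auto)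
 thus ?thesis by (simp add: gweight_def mult.assoc)
qed
have g: "integrable lborel (%x. (K * gweight 2 (cmod b + cmod c) (- Re a) x)^2)"
 using a by (intro gweight_square_integrable) auto
have mF: "(%x. R x * gss a b c x) : bmf lborel"
 using borel_measurable_LIMSEQ_metric[OF m l'] by simp
have m': "(%x. r k x * gss a b c x) : bmf lborel" for k by (rule m)
have "AE x in lborel. cmod (r k x * gss a b c x) <= K * gweight 2 (cmod b + cmod c) (- Re a) x" for k using bd by simp
moreover have "AE x in lborel. (%n. r n x * gss a b c x) ----> R x * gss a b c x" using l' by simp
ultimately show "sqint (%x. r n x * gss a b c x)"
 "(%n. to_L2 (%x. r n x * gss a b c x)) ----> to_L2 (%x. R x * gss a b c x)"
 using L2_dominated_convergence(2,3)[where f="%n x. r n x * gss a b c x", OF g m' mF] by blast+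
qed

lemma gss_partial:
"partial_deriv j (gss a b c) x = (2 * a * of_real (x $ j) + (if j = 1 then b else c)) * gss a b c x"
proof -
let ?f = "%x::real^2. a * (of_real (x $ 1) * of_real (x $ 1) + of_real (x $ 2) * of_real (x $ 2)) + b * of_real (x $ 1) + c * of_real (x $ 2)"
have e: "gss a b c = (%x. exp (?f x))"
 by (rule ext) (simp add: gss_def inner_2 p2es)
have sf: "smooth_fun ?f" by (intro smooth_add smooth_mult smooth_const smooth_coord)
have two: "j = 1 | j = 2" by (rule exhaust_2)
have "partial_deriv j ?f x = 2 * a * of_real (x $ j) + (if j = 1 then b else c)"
 using two
 by (subst partial_deriv_add partial_deriv_mult, (intro smooth_add smooth_mult smooth_const smooth_coord)+)+
  (auto simp: partial_deriv_const partial_deriv_coord)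
thus ?thesis unfolding e using partial_deriv_exp[OF sf] by (simp add: mult.commute)
qed

text \<open>The factor \<open>exp 1\<close> compensates \<open>bump 0 1 = exp (- 1)\<close>, so that
  the Gaussian itself is recovered as \<open>s\<close> tends to 0.\<close>

definition cutoff_gss :: "real => complex => complex => complex => real^2 => complex" where
"cutoff_gss s a b c x = of_real (exp 1) * of_real (bump 0 (1 - s * (x \<bullet> x))) * gss a b c x"

definition bump_term :: "nat => real => real^2 => complex" where
"bump_term k s x = of_real (exp 1) * of_real (bump k (1 - s * (x \<bullet> x)))"

lemma bump_term_smooth: "smooth_fun (bump_term k s)"
unfolding bump_term_def by (intro smooth_mult smooth_const smooth_bump)

lemma bump_term_partial: "partial_deriv j (bump_term k s) x = bump_term (Suc k) s x * of_real (- 2 * s) * of_real (x $ j)"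
unfolding bump_term_def
by (simp add: partial_deriv_mult[OF smooth_const smooth_bump] partial_deriv_const partial_deriv_bump)

lemma bump_term_bounded: "EX C. ALL s>=0. ALL x. cmod (bump_term k s x) <= C"
proof -
obtain C where "ALL x<=1. abs (bump k x) <= C" using bump_bounded by blast
hence "ALL s>=0. ALL x. cmod (bump_term k s x) <= exp 1 * C"
 unfolding bump_term_def norm_mult by (auto intro!: mult_left_mono)
thus ?thesis by blast
qed

lemma bump_term_tendsto: "s ----> 0 ==> (%n. bump_term k (s n) x) ----> bump_term k 0 x"
unfolding bump_term_def
by (intro tendsto_mult tendsto_const tendsto_of_real isCont_tendsto_compose[OF DERIV_isCont[OF bump_derivative]] tendsto_diff)

lemma bump_term_0: "bump_term 0 0 x = 1"
by (simp add: bump_term_def bump_def exp_minus flip: of_real_mult exp_add)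

lemma cutoff_gss_partials:
fixes s a b c
defines "l \<equiv> %j (x::real^2). 2 * a * of_real (x $ j) + (if j = 1 then b else c)"
shows "partial_deriv j (cutoff_gss s a b c) = (%x. (bump_term 0 s x * l j x + of_real (- 2 * s) * (bump_term 1 s x * of_real (x $ j))) * gss a b c x)"
 "partial_deriv j (partial_deriv j (cutoff_gss s a b c)) = (%x.
   (bump_term 0 s x * (l j x * l j x + 2 * a) + of_real (- 4 * s) * (bump_term 1 s x * (of_real (x $ j) * l j x))
  + (of_real (4 * s^2) * (bump_term 2 s x * (of_real (x $ j) * of_real (x $ j))) + of_real (- 2 * s) * bump_term 1 s x)) * gss a b c x)"
proof -
have e: "cutoff_gss s a b c = (%x. bump_term 0 s x * gss a b c x)"
 by (rule ext) (simp add: cutoff_gss_def bump_term_def)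
have sl: "smooth_fun (l j)" unfolding l_def by (intro smooth_add smooth_mult smooth_const smooth_coord)
have pl: "partial_deriv j (l j) x = 2 * a" for x
 unfolding l_def
 by (subst partial_deriv_add partial_deriv_mult, (intro smooth_add smooth_mult smooth_const smooth_coord)+)+
  (auto simp: partial_deriv_const partial_deriv_coord)
have pg: "partial_deriv j (gss a b c) x = l j x * gss a b c x" for x by (simp add: gss_partial l_def)
show 1: "partial_deriv j (cutoff_gss s a b c) = (%x. (bump_term 0 s x * l j x + of_real (- 2 * s) * (bump_term 1 s x * of_real (x $ j))) * gss a b c x)"
 unfolding e by (rule ext) (simp add: partial_deriv_mult[OF bump_term_smooth gss_smooth] bump_term_partial pg algebra_simps)
have sx: "smooth_fun (%x. bump_term 1 s x * of_real (x $ j))" by (intro smooth_mult bump_term_smooth smooth_coord)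
note sm = smooth_mult[OF bump_term_smooth sl] smooth_mult[OF smooth_const sx]
show "partial_deriv j (partial_deriv j (cutoff_gss s a b c)) = (%x.
   (bump_term 0 s x * (l j x * l j x + 2 * a) + of_real (- 4 * s) * (bump_term 1 s x * (of_real (x $ j) * l j x))
  + (of_real (4 * s^2) * (bump_term 2 s x * (of_real (x $ j) * of_real (x $ j))) + of_real (- 2 * s) * bump_term 1 s x)) * gss a b c x)"
 unfolding 1
 unfolding partial_deriv_mult[OF smooth_add[OF sm] gss_smooth] partial_deriv_add[OF sm] pg pl
   partial_deriv_mult[OF bump_term_smooth sl] partial_deriv_mult[OF smooth_const sx] partial_deriv_mult[OF bump_term_smooth smooth_coord]
   partial_deriv_const partial_deriv_coord bump_term_partial
 by (rule ext) (simp add: eval_nat_numeral algebra_simps)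
qed

lemma cutoff_gss_smooth: "smooth_fun (cutoff_gss s a b c)"
unfolding cutoff_gss_def by (intro smooth_mult smooth_const smooth_bump gss_smooth)

lemma cutoff_gss_test_function:
assumes "0 < s"
shows "test_function (cutoff_gss s a b c)"
proof (rule smooth_test_function[OF cutoff_gss_smooth])
have "norm x <= sqrt (1 / s)" if "cutoff_gss s a b c x ~= 0" for x
proof -
 have "\<not> 1 - s * (x \<bullet> x) <= 0" using that bump_zero[of "1 - s * (x \<bullet> x)" 0] by (auto simp: cutoff_gss_def)
 hence "x \<bullet> x <= 1 / s" using assms by (simp add: field_simps)
 thus ?thesis by (simp add: norm_eq_sqrt_inner)
qed
thus "bounded {x. cutoff_gss s a b c x ~= 0}" by (auto simp: bounded_iff)
qed

definition momq :: "complex => complex => complex => L2" where "momq a b c = to_L2 (%x. of_real (x \<bullet> x) * gss a b c x)"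
definition momx :: "2 => complex => complex => complex => L2" where "momx j a b c = to_L2 (%x. of_real (x $ j) * gss a b c x)"
definition mom0 :: "complex => complex => complex => L2" where "mom0 a b c = to_L2 (gss a b c)"

definition gaussD0 :: "real => complex => complex => complex => L2" where
"gaussD0 m a b c = of_real (- 1 / (2 * m)) *C (((4 * a^2) *C momq a b c + (4 * a * b) *C momx 1 a b c)
  + ((4 * a * c) *C momx 2 a b c + (b^2 + c^2 + 4 * a) *C mom0 a b c))"
definition gaussD1 :: "complex => complex => complex => L2" where
"gaussD1 a b c = (\<i> * c) *C momx 1 a b c + (- \<i> * b) *C momx 2 a b c"
definition gaussD2 :: "real => complex => complex => complex => L2" where
"gaussD2 m a b c = of_real (m / 2) *C momq a b c"

text \<open>Smooth families with pointwise limits and polynomial bounds form an algebra, which provides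
the dominating functions.\<close>

definition tame :: "nat => (nat => real^2 => complex) => (real^2 => complex) => bool" where
"tame k r R \<longleftrightarrow> (ALL n. smooth_fun (r n)) & (ALL x. (%n. r n x) ----> R x) &
  (EX K>=0. ALL n x. cmod (r n x) <= K * (1 + x \<bullet> x) ^ k)"

lemma tameE:
assumes "tame k r R"
obtains K where "0 <= K" "!!n x. cmod (r n x) <= K * (1 + x \<bullet> x) ^ k" "!!n. smooth_fun (r n)" "!!x. (%n. r n x) ----> R x"
proof -
obtain K where K: "0 <= K & (ALL n x. cmod (r n x) <= K * (1 + x \<bullet> x) ^ k)" using assms unfolding tame_def by blast
show thesis by (rule that[of K]) (use K assms in "auto simp: tame_def")
qed

lemma tame_add:
assumes "tame k r R" "tame k s S" shows "tame k (%n x. r n x + s n x) (%x. R x + S x)"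
proof -
obtain K where K: "0 <= K" "!!n x. cmod (r n x) <= K * (1 + x \<bullet> x) ^ k" "!!n. smooth_fun (r n)" "!!x. (%n. r n x) ----> R x"
 by (rule tameE[OF assms(1)]) blast
obtain L where L: "0 <= L" "!!n x. cmod (s n x) <= L * (1 + x \<bullet> x) ^ k" "!!n. smooth_fun (s n)" "!!x. (%n. s n x) ----> S x"
 by (rule tameE[OF assms(2)]) blast
have "cmod (r n x + s n x) <= (K + L) * (1 + x \<bullet> x) ^ k" for n x
 using norm_triangle_ineq[of "r n x" "s n x"] K(2)[of n x] L(2)[of n x] by (simp add: distrib_right)
thus ?thesis unfolding tame_def using K L by (auto intro!: smooth_add tendsto_add exI[of _ "K + L"])
qed

lemma tame_mult:
assumes "tame k r R" "tame l s S" shows "tame (k + l) (%n x. r n x * s n x) (%x. R x * S x)"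
proof -
obtain K where K: "0 <= K" "!!n x. cmod (r n x) <= K * (1 + x \<bullet> x) ^ k" "!!n. smooth_fun (r n)" "!!x. (%n. r n x) ----> R x"
 by (rule tameE[OF assms(1)]) blast
obtain L where L: "0 <= L" "!!n x. cmod (s n x) <= L * (1 + x \<bullet> x) ^ l" "!!n. smooth_fun (s n)" "!!x. (%n. s n x) ----> S x"
 by (rule tameE[OF assms(2)]) blast
have "cmod (r n x) * cmod (s n x) <= (K * (1 + x \<bullet> x) ^ k) * (L * (1 + x \<bullet> x) ^ l)" for n x
 by (intro mult_mono K(2) L(2)) (use K(1) in auto)
hence "cmod (r n x * s n x) <= K * L * (1 + x \<bullet> x) ^ (k + l)" for n x by (simp add: norm_mult power_add mult_ac)
thus ?thesis unfolding tame_def using K L by (auto intro!: smooth_mult tendsto_mult exI[of _ "K * L"])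
qed

lemma tame_mono: assumes "tame k r R" "k <= l" shows "tame l r R"
proof -
obtain K where K: "0 <= K" "!!n x. cmod (r n x) <= K * (1 + x \<bullet> x) ^ k" "!!n. smooth_fun (r n)" "!!x. (%n. r n x) ----> R x"
 by (rule tameE[OF assms(1)]) blast
have "cmod (r n x) <= K * (1 + x \<bullet> x) ^ l" for n x
 by (rule order_trans[OF K(2)], intro mult_left_mono power_increasing assms) (use K in auto)
thus ?thesis unfolding tame_def using K by blast
qed

lemma tame_basic:
shows "tame 0 (%n x. z) (%x. z)" "tame 1 (%n x. of_real (x $ j)) (%x. of_real (x $ j))"
 "tame 1 (%n x. of_real (x \<bullet> x)) (%x. of_real (x \<bullet> x))"
proof -
show "tame 0 (%n x. z) (%x. z)" unfolding tame_def by (auto intro!: smooth_const exI[of _ "cmod z"])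
qed (auto simp: tame_def coord_le_q intro!: smooth_coord smooth_inner exI[of _ 1])

lemma tame_scalar: assumes "y ----> z" shows "tame 0 (%n x. y n) (%x. z)"
proof -
obtain C where C: "!!n. cmod (y n) <= C" using convergent_imp_bounded[OF assms] by (auto simp: bounded_iff)
have "0 <= C" by (rule order_trans[OF norm_ge_zero C[of 0]])
thus ?thesis unfolding tame_def using C assms by (auto intro: smooth_const)
qed

lemma tame_bump: assumes "!!n. 0 <= s n" "s ----> 0" shows "tame 0 (%n. bump_term k (s n)) (bump_term k 0)"
proof -
obtain C where C: "ALL s>=0. ALL x. cmod (bump_term k s x) <= C" using bump_term_bounded by blast
have "0 <= C" by (rule order_trans[OF norm_ge_zero C[rule_format, of 0 0]]) simp
thus ?thesis unfolding tame_def using C assms bump_term_smooth bump_term_tendsto by auto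
qed

text \<open>The propagator equation is given only on test functions, and Gaussians are not compactly
  supported. Convergence must hold for the three operators of the expansion along one and the same
  sequence, so that the equation can pass to the limit.\<close>

lemma gauss_core_approximation:
assumes a: "Re a < 0"
shows "EX xph. (ALL n. smooth_fun (xph n) & test_function (xph n) & sqint (xph n)
   & sqint (kinD0 m (xph n)) & sqint (kinD1 (xph n)) & sqint (kinD2 m (xph n)))
  & (%n. to_L2 (xph n)) ----> mom0 a b c & (%n. to_L2 (kinD0 m (xph n))) ----> gaussD0 m a b c
  & (%n. to_L2 (kinD1 (xph n))) ----> gaussD1 a b c & (%n. to_L2 (kinD2 m (xph n))) ----> gaussD2 m a b c"
proof -
define s where "s n = inverse (real (Suc n))" for n
have s0: "0 < s n" "0 <= s n" for n by (auto simp: s_def)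
have sl: "s ----> 0" unfolding s_def by (rule LIMSEQ_inverse_real_of_nat)
note bt = tame_bump[of s, OF s0(2) sl]
define xph where "xph n = cutoff_gss (s n) a b c" for n
define l where "l j x = 2 * a * of_real (x $ j) + (if j = 1 then b else c)" for j and x :: "real^2"
have l: "tame 1 (%n. l j) (l j)" for j
 unfolding l_def using tame_mult[OF tame_basic(1) tame_basic(2)] by (intro tame_add tame_mono[OF tame_basic(1)]) simp_all
note P = cutoff_gss_partials[where a=a and b=b and c=c, folded l_def]
define r2 where "r2 n j x = bump_term 0 (s n) x * (l j x * l j x + 2 * a) + of_real (- 4 * s n) * (bump_term 1 (s n) x * (of_real (x $ j) * l j x))
  + (of_real (4 * (s n)^2) * (bump_term 2 (s n) x * (of_real (x $ j) * of_real (x $ j))) + of_real (- 2 * s n) * bump_term 1 (s n) x)" for n j and x :: "real^2"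
define r1 where "r1 n j x = bump_term 0 (s n) x * l j x + of_real (- 2 * s n) * (bump_term 1 (s n) x * of_real (x $ j))" for n j and x :: "real^2"
have sc: "tame 0 (%n x. of_real (- 4 * s n)) (%x. of_real (- 4 * 0))" "tame 0 (%n x. of_real (- 2 * s n)) (%x. of_real (- 2 * 0))"
 "tame 0 (%n x. of_real (4 * (s n)^2)) (%x. of_real (4 * 0^2))"
 by (intro tame_scalar tendsto_intros sl)+
have r2: "tame 2 (%n. r2 n j) (%x. l j x * l j x + 2 * a)" for j
proof -
 have "tame 2 (%n x. l j x * l j x + 2 * a) (%x. l j x * l j x + 2 * a)"
  by (rule tame_add[OF tame_mult[OF l l, unfolded one_add_one] tame_mono[OF tame_basic(1)]]) simp
 note 1 = tame_mult[OF bt[of 0] this]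
 note 2 = tame_mult[OF sc(1) tame_mult[OF bt[of 1] tame_mult[OF tame_basic(2)[of j] l[of j]]]]
 note 3 = tame_mult[OF sc(3) tame_mult[OF bt[of 2] tame_mult[OF tame_basic(2)[of j] tame_basic(2)[of j]]]]
 note 4 = tame_mono[OF tame_mult[OF sc(2) bt[of 1]], of 2]
 show ?thesis using tame_add[OF tame_add[OF 1[unfolded add_0] 2[unfolded add_0 one_add_one]] tame_add[OF 3[unfolded add_0 one_add_one] 4], folded r2_def]
  by (simp add: bump_term_0)
qed
have r1: "tame 1 (%n. r1 n j) (l j)" for j
 using tame_add[OF tame_mult[OF bt[of 0] l[of j]] tame_mult[OF sc(2) tame_mult[OF bt[of 1] tame_basic(2)[of j]], unfolded add_0[of "0 + 1"]], unfolded add_0, folded r1_def]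
 by (simp add: bump_term_0)
have G: "sqint (%x. r n x * gss a b c x)" "(%n. to_L2 (%x. r n x * gss a b c x)) ----> to_L2 (%x. R x * gss a b c x)"
 if "tame 2 r R" for r R n
 by (rule tameE[OF that], rule gss_dominated[OF a]; assumption)+
have P2: "partial_deriv j (partial_deriv j (xph n)) = (%x. r2 n j x * gss a b c x)" "partial_deriv j (xph n) = (%x. r1 n j x * gss a b c x)" for n j
 unfolding xph_def P(2) r2_def by (rule refl) (unfold P(1) r1_def, rule refl)
have e3: "xph n = (%x. bump_term 0 (s n) x * gss a b c x)" for n
 by (rule ext) (simp add: xph_def cutoff_gss_def bump_term_def)
have e0: "kinD0 m (xph n) = (%x. of_real (- 1 / (2 * m)) * (r2 n 1 x + r2 n 2 x) * gss a b c x)" for n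
 by (rule ext) (simp add: kinD0_def P2(1) algebra_simps)
have e1: "kinD1 (xph n) = (%x. \<i> * (of_real (x $ 1) * r1 n 2 x + (- 1) * (of_real (x $ 2) * r1 n 1 x)) * gss a b c x)" for n
 by (rule ext) (simp add: kinD1_def P2(2) algebra_simps)
have e2: "kinD2 m (xph n) = (%x. of_real (m / 2) * (of_real (x \<bullet> x) * bump_term 0 (s n) x) * gss a b c x)" for n
 by (rule ext) (simp add: kinD2_def e3)
note c1 = tame_basic(1) and cx = tame_basic(2)
have t3: "tame 2 (%n. bump_term 0 (s n)) (%x. 1)" using tame_mono[OF bt[of 0], of 2] by (simp add: bump_term_0[abs_def])
have t0: "tame 2 (%n x. of_real (- 1 / (2 * m)) * (r2 n 1 x + r2 n 2 x)) (%x. of_real (- 1 / (2 * m)) * ((l 1 x * l 1 x + 2 * a) + (l 2 x * l 2 x + 2 * a)))"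
 using tame_mult[OF c1 tame_add[OF r2 r2]] unfolding add_0 .
have t1: "tame 2 (%n x. \<i> * (of_real (x $ 1) * r1 n 2 x + (- 1) * (of_real (x $ 2) * r1 n 1 x))) (%x. \<i> * (of_real (x $ 1) * l 2 x + (- 1) * (of_real (x $ 2) * l 1 x)))"
 using tame_mult[OF c1 tame_add[OF tame_mult[OF cx r1] tame_mult[OF c1 tame_mult[OF cx r1], unfolded add_0]]] unfolding add_0 one_add_one .
have t2: "tame 2 (%n x. of_real (m / 2) * (of_real (x \<bullet> x) * bump_term 0 (s n) x)) (%x. of_real (m / 2) * (of_real (x \<bullet> x) * 1))"
 by (rule tame_mono[OF tame_mult[OF c1 tame_mult[OF tame_basic(3) bt[of 0]]], of 2, unfolded bump_term_0]) simp
note sq = gss_square_integrable[OF a] sq_gss_moments[OF a]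
note L = to_L2_scale to_L2_add sq square_integrable_scale square_integrable_add
have D: "mom0 a b c = to_L2 (%x. 1 * gss a b c x)"
  "gaussD0 m a b c = to_L2 (%x. of_real (- 1 / (2 * m)) * ((l 1 x * l 1 x + 2 * a) + (l 2 x * l 2 x + 2 * a)) * gss a b c x)"
  "gaussD1 a b c = to_L2 (%x. \<i> * (of_real (x $ 1) * l 2 x + (- 1) * (of_real (x $ 2) * l 1 x)) * gss a b c x)"
  "gaussD2 m a b c = to_L2 (%x. of_real (m / 2) * (of_real (x \<bullet> x) * 1) * gss a b c x)"
 unfolding gaussD0_def gaussD1_def gaussD2_def momq_def momx_def mom0_def
 by (simp_all only: L) (rule arg_cong[where f=to_L2], rule ext, simp add: l_def inner_2 p2es field_simps)+
have "smooth_fun (xph n)" "test_function (xph n)" for n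
 unfolding xph_def using cutoff_gss_smooth cutoff_gss_test_function[OF s0(1)] by auto
thus ?thesis
 using G[OF t0, folded e0 D] G[OF t1, folded e1 D] G[OF t2, folded e2 D] G[OF t3, folded e3 D] by (intro exI[of _ xph]) blast
qed

section \<open>Expansion of the propagator along Gaussians\<close>

locale schrodinger_flow = hyperbolic_field +
fixes m q Vb :: real and B :: "real => real" and V :: "real^2 => real" and U :: "real => real => L2 => L2"
assumes m_pos: "0 < m" and k_eq: "!!t. k t = q * B t / (2 * m)"
 and V_continuous: "continuous_on UNIV V" and V_bounded: "!!x. abs (V x) <= Vb"
 and propagator: "propagator (hamiltonian m q B V) U"
begin

definition "Vop = mulop (%x. of_real (V x))"

lemma bdd_borel_V: "bdd_borel (%x. of_real (V x))"
unfolding bdd_borel_def bounded_iff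
using V_bounded by (auto intro!: bmci continuous_intros V_continuous)

lemma Vop_linear: "complex_linear Vop" and Vop_bounded_linear: "bounded_linear Vop"
unfolding Vop_def by (intro complex_linear_mulop bounded_linear_mulop bdd_borel_V)+

lemma U_unitary: "unitary (U t s)" and U_comp: "U t r (U r s f) = U t s f" and U_id: "U s s f = f"
and U_continuous: "continuous_on UNIV (%p. U (fst p) (snd p) f)"
using propagator unfolding propagator_def by (auto simp: fun_eq_iff case_prod_beta')

lemmas U_lin = clinD[OF unitary_clin[OF U_unitary]]

lemma U_tendsto:
assumes "(t ---> t0) F" "(s ---> s0) F" shows "((%x. U (t x) (s x) f) ---> U t0 s0 f) F"
using continuous_on_tendsto_compose[OF U_continuous tendsto_Pair[OF assms]] by simp

text \<open>The equation in the second time argument is integrated over \<open>{a..b}\<close> and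
  compared with its integrand frozen at \<open>s\<close>, where only \<open>k\<close> and
  \<open>k^2\<close> still vary and integrate to increments of \<open>J1\<close> and
  \<open>J2\<close>. The bounds \<open>e0\<close>, \<open>e1\<close>, \<open>e2\<close> measure the
  oscillation of the propagator.\<close>

lemma test_function_estimate:
assumes xph: "smooth_fun xph" "test_function xph" "sqint xph" "sqint (kinD0 m xph)"
  "sqint (kinD1 xph)" "sqint (kinD2 m xph)"
 and ab: "a <= b"
 and e: "!!r. r : {a..b} ==> norm (U ta r (to_L2 (kinD0 m xph) + Vop (to_L2 xph)) - U ta s (to_L2 (kinD0 m xph) + Vop (to_L2 xph))) <= e0"
  "!!r. r : {a..b} ==> norm (U ta r (to_L2 (kinD1 xph)) - U ta s (to_L2 (kinD1 xph))) <= e1"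
  "!!r. r : {a..b} ==> norm (U ta r (to_L2 (kinD2 m xph)) - U ta s (to_L2 (kinD2 m xph))) <= e2"
shows "norm (U ta b (to_L2 xph) - U ta a (to_L2 xph) - \<i> *C ((b - a) *R U ta s (to_L2 (kinD0 m xph) + Vop (to_L2 xph))
  + (J1 b - J1 a) *R U ta s (to_L2 (kinD1 xph)) + (J2 b - J2 a) *R U ta s (to_L2 (kinD2 m xph)))) <= (e0 + Kb * e1 + Kb^2 * e2) * (b - a)"
proof -
define w0 where "w0 = to_L2 (kinD0 m xph) + Vop (to_L2 xph)"
define w1 where "w1 = to_L2 (kinD1 xph)"
define w2 where "w2 = to_L2 (kinD2 m xph)"
note e = e[folded w0_def w1_def w2_def]
have H: "to_L2 (hamiltonian m q B V r xph) = w0 + k r *R w1 + (k r)^2 *R w2" for r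
proof -
 have Vs: "sqint (%x. of_real (V x) * xph x)" by (rule square_integrable_bdd[OF bdd_borel_V xph(3)])
 have "hamiltonian m q B V r xph = (%x. (kinD0 m xph x + of_real (V x) * xph x) + of_real (k r) * kinD1 xph x + of_real ((k r)^2) * kinD2 m xph x)"
  using m_pos by (auto simp: hamiltonian_def free_hamiltonian_expansion[OF xph(1)] k_eq)
 thus ?thesis
  unfolding w0_def w1_def w2_def Vop_def scaleR_L2_eq
  by (simp only: mulop_to_L2[OF bdd_borel_V xph(3)] to_L2_scale to_L2_add xph Vs square_integrable_scale square_integrable_add)
qed
note lin = U_lin
have UH: "\<i> *C U ta r (to_L2 (hamiltonian m q B V r xph)) = \<i> *C (U ta r w0 + k r *R U ta r w1 + (k r)^2 *R U ta r w2)" for r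
 by (simp add: H lin)
have "has_ae_derivative (%s. U ta s (to_L2 xph)) (%s. \<i> *C U ta s (to_L2 (hamiltonian m q B V s xph)))"
 using propagator xph(2) by (auto simp: propagator_def)
from has_ae_derivative_has_integral[OF this ab]
have 1: "((%r. \<i> *C (U ta r w0 + k r *R U ta r w1 + (k r)^2 *R U ta r w2)) has_integral (U ta b (to_L2 xph) - U ta a (to_L2 xph))) {a..b}"
 unfolding UH .
have "((%r. U ta s w0 + k r *R U ta s w1 + (k r)^2 *R U ta s w2) has_integral
  ((b - a) *R U ta s w0 + (J1 b - J1 a) *R U ta s w1 + (J2 b - J2 a) *R U ta s w2)) {a..b}"
 using has_integral_const_real[of "U ta s w0" a b] ab
 by (intro has_integral_add has_integral_scaleR_left J1_diff J2_diff ab) auto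
from has_integral_linear[OF this bounded_bilinear.bounded_linear_right[OF scaleC.bounded_bilinear_axioms, of \<i>]]
have 2: "((%r. \<i> *C (U ta s w0 + k r *R U ta s w1 + (k r)^2 *R U ta s w2)) has_integral
  (\<i> *C ((b - a) *R U ta s w0 + (J1 b - J1 a) *R U ta s w1 + (J2 b - J2 a) *R U ta s w2))) {a..b}"
 by (simp add: o_def)
have e0: "0 <= e0" "0 <= e1" "0 <= e2" using e[of a] ab norm_ge_zero order_trans by (metis atLeastAtMost_iff order_refl)+
show ?thesis
 unfolding w0_def[symmetric] w1_def[symmetric] w2_def[symmetric]
proof (rule ae_bounded_has_integral[OF has_integral_diff[OF 1 2] ab])
 show "AE r in lebesgue. r : {a..b} --> norm (\<i> *C (U ta r w0 + k r *R U ta r w1 + (k r)^2 *R U ta r w2)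
   - \<i> *C (U ta s w0 + k r *R U ta s w1 + (k r)^2 *R U ta s w2)) <= e0 + Kb * e1 + Kb^2 * e2"
  using k_bound
 proof eventually_elim
  case (elim r)
  show ?case
  proof
   assume r: "r : {a..b}"
   have k2: "(k r)^2 <= Kb^2" using elim by (metis abs_ge_zero power2_abs power_mono)
   have "\<i> *C (U ta r w0 + k r *R U ta r w1 + (k r)^2 *R U ta r w2) - \<i> *C (U ta s w0 + k r *R U ta s w1 + (k r)^2 *R U ta s w2)
    = \<i> *C ((U ta r w0 - U ta s w0) + k r *R (U ta r w1 - U ta s w1) + (k r)^2 *R (U ta r w2 - U ta s w2))"
    unfolding scaleC.diff_right[symmetric] by (simp add: algebra_simps)
   also have "norm ... = norm ((U ta r w0 - U ta s w0) + k r *R (U ta r w1 - U ta s w1) + (k r)^2 *R (U ta r w2 - U ta s w2))"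
    by (simp add: norm_scaleC)
   also have "... <= norm (U ta r w0 - U ta s w0) + norm (k r *R (U ta r w1 - U ta s w1)) + norm ((k r)^2 *R (U ta r w2 - U ta s w2))"
    by (intro order_trans[OF norm_triangle_ineq] add_mono order_refl) 
   also have "... <= e0 + Kb * e1 + Kb^2 * e2"
    unfolding norm_scaleR using e[OF r] elim k2 e0 Kb_nonneg by (intro add_mono mult_mono) auto
   finally show "norm (\<i> *C (U ta r w0 + k r *R U ta r w1 + (k r)^2 *R U ta r w2) - \<i> *C (U ta s w0 + k r *R U ta s w1 + (k r)^2 *R U ta s w2))
    <= e0 + Kb * e1 + Kb^2 * e2" .
  qed
 qed
 show "0 <= e0 + Kb * e1 + Kb^2 * e2" using e0 Kb_nonneg by simp
qed
qed

lemma gauss_estimate: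
fixes a b c :: complex
assumes Re: "Re a < 0" and xy: "x <= y"
defines "w0 \<equiv> gaussD0 m a b c + Vop (mom0 a b c)" and "w1 \<equiv> gaussD1 a b c" and "w2 \<equiv> gaussD2 m a b c"
assumes e: "!!r. r : {x..y} ==> norm (U ta r w0 - U ta s w0) <= e0"
  "!!r. r : {x..y} ==> norm (U ta r w1 - U ta s w1) <= e1" "!!r. r : {x..y} ==> norm (U ta r w2 - U ta s w2) <= e2"
shows "norm (U ta y (mom0 a b c) - U ta x (mom0 a b c) - \<i> *C ((y - x) *R U ta s w0
  + (J1 y - J1 x) *R U ta s w1 + (J2 y - J2 x) *R U ta s w2)) <= (e0 + Kb * e1 + Kb^2 * e2) * (y - x)"
proof -
obtain xph where xph: "!!n. smooth_fun (xph n)" "!!n. test_function (xph n)" "!!n. sqint (xph n)"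
  "!!n. sqint (kinD0 m (xph n))" "!!n. sqint (kinD1 (xph n))" "!!n. sqint (kinD2 m (xph n))"
 and l: "(%n. to_L2 (xph n)) ----> mom0 a b c" "(%n. to_L2 (kinD0 m (xph n))) ----> gaussD0 m a b c"
  "(%n. to_L2 (kinD1 (xph n))) ----> w1" "(%n. to_L2 (kinD2 m (xph n))) ----> w2"
 using gauss_core_approximation[OF Re] unfolding w1_def w2_def by metis
define v0 where "v0 n = to_L2 (kinD0 m (xph n)) + Vop (to_L2 (xph n))" for n
have l0: "v0 ----> w0" unfolding v0_def w0_def by (intro tendsto_add l bounded_linear.tendsto[OF Vop_bounded_linear])
note lin = U_lin
have tri: "norm (U ta r v - U ta s v) <= e + 2 * norm (v - w)" if "norm (U ta r w - U ta s w) <= e" for r v w e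
proof -
 have "U ta r v - U ta s v = (U ta r w - U ta s w) + (U ta r (v - w) - U ta s (v - w))" by (simp add: lin)
 also have "norm ... <= norm (U ta r w - U ta s w) + (norm (U ta r (v - w)) + norm (U ta s (v - w)))"
  by (intro order_trans[OF norm_triangle_ineq] add_mono norm_triangle_ineq4 order_refl)
 finally show ?thesis using that by (simp add: unitary_norm[OF U_unitary])
qed
let ?L = "%n. norm (U ta y (to_L2 (xph n)) - U ta x (to_L2 (xph n)) - \<i> *C ((y - x) *R U ta s (v0 n)
  + (J1 y - J1 x) *R U ta s (to_L2 (kinD1 (xph n))) + (J2 y - J2 x) *R U ta s (to_L2 (kinD2 m (xph n)))))"
let ?R = "%n. ((e0 + 2 * norm (v0 n - w0)) + Kb * (e1 + 2 * norm (to_L2 (kinD1 (xph n)) - w1)) + Kb^2 * (e2 + 2 * norm (to_L2 (kinD2 m (xph n)) - w2))) * (y - x)"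
have le: "?L n <= ?R n" for n
 unfolding v0_def by (rule test_function_estimate[OF xph xy]; rule tri; rule e; assumption)
have ul: "(%n. U ta t (v n)) ----> U ta t v'" if "v ----> v'" for v v' t
 by (rule bounded_linear.tendsto[OF bounded_linear_unitary[OF U_unitary] that])
have "?L ----> norm (U ta y (mom0 a b c) - U ta x (mom0 a b c) - \<i> *C ((y - x) *R U ta s w0
  + (J1 y - J1 x) *R U ta s w1 + (J2 y - J2 x) *R U ta s w2))"
 by (intro tendsto_norm tendsto_diff scaleC.tendsto tendsto_const tendsto_add tendsto_scaleR ul l l0)
moreover have "?R ----> ((e0 + 2 * norm (w0 - w0)) + Kb * (e1 + 2 * norm (w1 - w1)) + Kb^2 * (e2 + 2 * norm (w2 - w2))) * (y - x)"
 by (intro tendsto_intros l l0)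
ultimately show ?thesis using LIMSEQ_le le by fastforce
qed

text \<open>Strong continuity makes the oscillation bounds of \<open>gauss_estimate\<close> as small
  as desired near \<open>t\<close>.\<close>

lemma expands_U_gauss:
fixes a b c :: complex
assumes Re: "Re a < 0"
defines "w0 \<equiv> gaussD0 m a b c + Vop (mom0 a b c)" and "w1 \<equiv> gaussD1 a b c" and "w2 \<equiv> gaussD2 m a b c"
shows "expands (%s. U ta s (mom0 a b c)) t (\<i> *C U ta t w0) (\<i> *C U ta t w1) (\<i> *C U ta t w2)"
proof -
let ?h = "%s. U ta s (mom0 a b c) - J1 s *R \<i> *C U ta t w1 - J2 s *R \<i> *C U ta t w2 - s *R \<i> *C U ta t w0"
have "(?h has_vector_derivative 0) (at t)"
proof (rule has_vector_derivative_zeroI)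
 fix e :: real assume "e > 0"
 define e' where "e' = e / (1 + Kb + Kb^2)"
 have K: "0 < 1 + Kb + Kb^2" using Kb_nonneg by (simp add: add_pos_nonneg)
 hence "e' * (1 + Kb + Kb^2) = e" by (simp add: e'_def)
 moreover have "e' > 0" using `e > 0` K by (simp add: e'_def)
 ultimately have e': "e' > 0" "e' + Kb * e' + Kb^2 * e' = e" by (simp_all add: algebra_simps)
 have ex: "EX d>0. ALL r. abs (r - t) < d --> norm (U ta r w - U ta t w) <= e'" for w
 proof -
  have "((%r. U ta r w) ---> U ta t w) (at t)" by (intro U_tendsto tendsto_intros)
  then obtain d where "d > 0" "!!r. r ~= t ==> dist r t < d ==> dist (U ta r w) (U ta t w) < e'"
   using e'(1) unfolding tendsto_iff eventually_at by blast
  hence "norm (U ta r w - U ta t w) <= e'" if "abs (r - t) < d" for r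
   using that e'(1) by (cases "r = t") (auto simp: dist_norm less_imp_le)
  thus ?thesis using `d > 0` by blast
 qed
 obtain d0 d1 d2 where d: "d0 > 0" "d1 > 0" "d2 > 0"
  "!!r. abs (r - t) < d0 ==> norm (U ta r w0 - U ta t w0) <= e'"
  "!!r. abs (r - t) < d1 ==> norm (U ta r w1 - U ta t w1) <= e'" "!!r. abs (r - t) < d2 ==> norm (U ta r w2 - U ta t w2) <= e'"
  using ex[of w0] ex[of w1] ex[of w2] by blast
 let ?d = "min d0 (min d1 d2)"
 have main: "norm (?h y - ?h x) <= e * (y - x)" if "x <= y" "abs (x - t) < ?d" "abs (y - t) < ?d" for x y
 proof -
  have r: "abs (r - t) < d0" "abs (r - t) < d1" "abs (r - t) < d2" if "r : {x..y}" for r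
   using that \<open>\<bar>x - t\<bar> < ?d\<close> \<open>\<bar>y - t\<bar> < ?d\<close> by auto
  have "norm (U ta y (mom0 a b c) - U ta x (mom0 a b c) - \<i> *C ((y - x) *R U ta t w0
   + (J1 y - J1 x) *R U ta t w1 + (J2 y - J2 x) *R U ta t w2)) <= (e' + Kb * e' + Kb^2 * e') * (y - x)"
   using gauss_estimate[OF Re that(1)] d r unfolding w0_def w1_def w2_def by blast
  thus ?thesis unfolding e'(2) scaleC.add_right scaleC.scaleR_right by (simp add: algebra_simps)
 qed
 show "EX d>0. ALL s. abs (s - t) < d --> norm (?h s - ?h t) <= e * abs (s - t)"
 proof (intro exI[of _ ?d] conjI allI impI)
  show "?d > 0" using d by simp
  fix s assume s: "abs (s - t) < ?d"
  show "norm (?h s - ?h t) <= e * abs (s - t)"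
  proof (cases "s <= t")
   case True
   have "norm (?h t - ?h s) <= e * (t - s)" using main[OF True s] d by auto
   thus ?thesis using True by (simp only: norm_minus_commute[of "?h s"]) simp
  next
   case False
   thus ?thesis using main[of t s] s d by auto
  qed
 qed
qed
moreover have "((%s. s *R \<i> *C U ta t w0) has_vector_derivative \<i> *C U ta t w0) (at t)"
 by (auto intro!: derivative_eq_intros)
ultimately have "((%s. ?h s + s *R \<i> *C U ta t w0) has_vector_derivative 0 + \<i> *C U ta t w0) (at t)"
 by (rule has_vector_derivative_add)
thus ?thesis by (simp add: expands_def)
qed

lemma expands_strong:
assumes W: "!!s. unitary (W s)" "!!f. ((%s. W s f) ---> W t f) (at t)"
 and ps: "expands ps t al be ga" and c: "expands (%s. W s (ps t)) t al' be' ga'"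
shows "expands (%s. W s (ps s)) t (W t al + al') (W t be + be') (W t ga + ga')"
proof -
note lin = clinD[OF unitary_clin[OF W(1)]]
let ?e = "%s. ps s - ps t - (J1 s - J1 t) *R be - (J2 s - J2 t) *R ga - (s - t) *R al"
\<comment> \<open>What remains after \<open>W s\<close> is replaced by \<open>W t\<close> on the
  three coefficient vectors of \<open>ps\<close>: small by strong continuity times Lipschitz
  increments, plus the expansion error \<open>?e\<close>, whose norm \<open>W s\<close>
  preserves.\<close>
let ?d = "%s. (s - t) *R (W s al - W t al) + (J1 s - J1 t) *R (W s be - W t be) + (J2 s - J2 t) *R (W s ga - W t ga) + W s (?e s)"
have 1: "(?d has_vector_derivative 0) (at t)"
proof (rule has_vector_derivative_zeroI)
 fix e :: real assume "e > 0"
 define e' where "e' = e / (2 + Kb + Kb^2)"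
 have K: "0 < 2 + Kb + Kb^2" using Kb_nonneg by (simp add: add_pos_nonneg)
 hence "e' * (2 + Kb + Kb^2) = e" by (simp add: e'_def)
 moreover have "e' > 0" using `e > 0` K by (simp add: e'_def)
 ultimately have e': "e' > 0" "e' + Kb * e' + Kb^2 * e' + e' = e" by (simp_all add: algebra_simps)
 have "\<forall>\<^sub>F s in at t. norm (W s f - W t f) < e'" for f
  using tendstoD[OF W(2) e'(1)] by (simp add: dist_norm)
 hence "\<forall>\<^sub>F s in at t. norm (W s al - W t al) < e' & norm (W s be - W t be) < e' & norm (W s ga - W t ga) < e'"
  by (intro eventually_conj)
 then obtain d1 where d1: "d1 > 0" "!!s. s ~= t ==> (abs (s - t)) < d1 ==> norm (W s al - W t al) < e' & norm (W s be - W t be) < e' & norm (W s ga - W t ga) < e'"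
  unfolding eventually_at dist_real_def by blast
 obtain d2 where d2: "d2 > 0" "!!s. abs (s - t) < d2 ==> norm (?e s) <= e' * abs (s - t)"
 proof -
  obtain d where d: "d > 0" "!!s. abs (s - t) < d ==> norm (ps s - J1 s *R be - J2 s *R ga - (ps t - J1 t *R be - J2 t *R ga) - (s - t) *R al) <= e' * abs (s - t)"
   using has_vector_derivative_bound[OF ps[unfolded expands_def] e'(1)] by blast
  have "?e s = ps s - J1 s *R be - J2 s *R ga - (ps t - J1 t *R be - J2 t *R ga) - (s - t) *R al" for s
   by (simp add: algebra_simps)
  with d that show ?thesis by metis
 qed
 show "EX d>0. ALL s. abs (s - t) < d --> norm (?d s - ?d t) <= e * abs (s - t)"
 proof (intro exI[of _ "min d1 d2"] conjI allI impI)
  show "0 < min d1 d2" using d1 d2 by simp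
  fix s assume s: "abs (s - t) < min d1 d2"
  have "?d t = 0" by (simp add: lin)
  show "norm (?d s - ?d t) <= e * abs (s - t)"
  proof (cases "s = t")
   case False
   hence n: "norm (W s al - W t al) <= e'" "norm (W s be - W t be) <= e'" "norm (W s ga - W t ga) <= e'"
    using d1(2)[of s] s by auto
   have "norm (?d s) <= abs (s - t) * e' + (Kb * abs (s - t)) * e' + (Kb^2 * abs (s - t)) * e' + e' * abs (s - t)"
    using d2(2)[of s] s Kb_nonneg J1_lipschitz[of s t] J2_lipschitz[of s t]
    by (intro order_trans[OF norm_triangle_ineq] add_mono) (auto simp: unitary_norm[OF W(1)] intro!: mult_mono n)
   also have "... = (e' + Kb * e' + Kb^2 * e' + e') * abs (s - t)" by (simp add: algebra_simps)
   finally show ?thesis unfolding e'(2) `?d t = 0` by simp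
  qed simp
 qed
qed
have 2: "expands (%s. s *R W t al + J1 s *R W t be + J2 s *R W t ga) t (W t al) (W t be) (W t ga)"
 unfolding expands_def by (auto intro!: derivative_eq_intros simp: algebra_simps)
have "expands (%s. (?d s + (s *R W t al + J1 s *R W t be + J2 s *R W t ga)) + W s (ps t)) t (0 + W t al + al') (0 + W t be + be') (0 + W t ga + ga')"
 by (intro expands_add c 2 expands_derivative[OF 1])
moreover have "(%s. (?d s + (s *R W t al + J1 s *R W t be + J2 s *R W t ga)) + W s (ps t))
  = (%s. W s (ps s) + (t *R W t al + J1 t *R W t be + J2 t *R W t ga))"
 by (rule ext) (simp add: lin algebra_simps)
ultimately have "expands (%s. W s (ps s) + (t *R W t al + J1 t *R W t be + J2 t *R W t ga)) t (W t al + al') (W t be + be') (W t ga + ga')"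
 by simp
from expands_add[OF this expands_derivative[OF has_vector_derivative_const[of "- (t *R W t al + J1 t *R W t be + J2 t *R W t ga)"]]]
show ?thesis by simp
qed

end

lemma gauss_taylor:
assumes "Re a < 0"
shows "EX K et. 0 <= K & 0 < et & (ALL a' b' c'. cmod (a' - a) + cmod (b' - b) + cmod (c' - c) <= et -->
  norm (mom0 a' b' c' - mom0 a b c - ((a' - a) *C momq a b c + (b' - b) *C momx 1 a b c + (c' - c) *C momx 2 a b c))
  <= K * (cmod (a' - a) + cmod (b' - b) + cmod (c' - c))^2)"
unfolding momq_def momx_def mom0_def using gss_taylor[OF assms, of b c] by blast

context bounded_field begin

lemma expands_cong_approx:
assumes G: "expands G t al be ga" and d: "0 < d" "0 <= K"
 and a: "!!s. abs (s - t) < d ==> norm (F s - F t - (G s - G t)) <= K * (s - t)^2"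
shows "expands F t al be ga"
proof -
have "((%s. F s - G s) has_vector_derivative 0) (at t)"
proof (rule has_vector_derivative_zeroI)
 fix e :: real assume e: "e > 0"
 let ?d = "min d (e / (K + 1))"
 show "EX d>0. ALL s. abs (s - t) < d --> norm (F s - G s - (F t - G t)) <= e * abs (s - t)"
 proof (intro exI[of _ ?d] conjI allI impI)
  show "?d > 0" using d e by simp
  fix s assume s: "abs (s - t) < ?d"
  have "norm (F s - G s - (F t - G t)) <= K * (s - t)^2" using a[of s] s by (simp add: algebra_simps)
  also have "... <= (K + 1) * (s - t)^2" by (intro mult_right_mono) auto
  also have "... = (K + 1) * abs (s - t) * abs (s - t)" by (simp add: p2es mult.assoc)
  also have "... <= e * abs (s - t)"
   using s d by (intro mult_right_mono) (auto simp: field_simps)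
  finally show "norm (F s - G s - (F t - G t)) <= e * abs (s - t)" .
 qed
qed
from expands_add[OF expands_derivative[OF this] G] show ?thesis by simp
qed

lemma expands_compose_field:
fixes f :: "real => 'a::real_normed_field"
assumes F: "(F has_field_derivative D) (at (f t))" and f: "expands f t al be ga"
shows "expands (%s. F (f s)) t (D * al) (D * be) (D * ga)"
proof -
obtain L d where L: "L >= 0" "d > 0" "!!s. abs (s - t) < d ==> norm (f s - f t) <= L * abs (s - t)"
 using expands_lipschitz[OF f] by blast
have "((%s. F (f s) - D * f s) has_vector_derivative 0) (at t)"
proof (rule has_vector_derivative_zeroI)
 fix e :: real assume e: "e > 0"
 define e' where "e' = e / (L + 1)"
 have e': "e' > 0" using e L by (simp add: e'_def)
 obtain d' where d': "d' > 0" "!!y. norm (y - f t) < d' ==> norm (F y - F (f t) - D * (y - f t)) <= e' * norm (y - f t)"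
  using F e' unfolding has_field_derivative_def has_derivative_at_alt by blast
 let ?d = "min d (d' / (L + 1))"
 show "EX d>0. ALL s. abs (s - t) < d --> norm (F (f s) - D * f s - (F (f t) - D * f t)) <= e * abs (s - t)"
 proof (intro exI[of _ ?d] conjI allI impI)
  show "?d > 0" using L d' by simp
  fix s assume s: "abs (s - t) < ?d"
  have n: "norm (f s - f t) <= L * abs (s - t)" using L(3) s by simp
  have "(L + 1) * abs (s - t) < d'" using s L(1) by (simp add: field_simps)
  hence "norm (f s - f t) < d'" using n by (simp add: distrib_right)
  from d'(2)[OF this] have "norm (F (f s) - D * f s - (F (f t) - D * f t)) <= e' * norm (f s - f t)"
   by (simp add: algebra_simps)
  also have "... <= e' * ((L + 1) * abs (s - t))" using n e' by (intro mult_left_mono) (auto simp: distrib_right)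
  also have "... = e * abs (s - t)" using L by (simp add: e'_def)
  finally show "norm (F (f s) - D * f s - (F (f t) - D * f t)) <= e * abs (s - t)" .
 qed
qed
from expands_add[OF expands_derivative[OF this] expands_linear[OF bounded_linear_mult_right f, of D]] show ?thesis by simp
qed

text \<open>The parameters have Lipschitz increments at \<open>t\<close>, so the quadratic Taylor
  error is O((s - t)^2), and the linear part carries the expansions of \<open>a\<close>,
  \<open>b\<close>, \<open>c\<close> to the three moment vectors.\<close>

lemma expands_gauss:
assumes a: "Re (a t) < 0" and ea: "expands a t a0 a1 a2" and eb: "expands b t b0 b1 b2" and ec: "expands c t c0 c1 c2"
defines "M \<equiv> %x y z. x *C momq (a t) (b t) (c t) + y *C momx 1 (a t) (b t) (c t) + z *C momx 2 (a t) (b t) (c t)"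
shows "expands (%s. mom0 (a s) (b s) (c s)) t (M a0 b0 c0) (M a1 b1 c1) (M a2 b2 c2)"
proof -
obtain L1 d1 where L1: "L1 >= 0" "d1 > 0" "!!s. abs (s - t) < d1 ==> norm (a s - a t) <= L1 * abs (s - t)" using expands_lipschitz[OF ea] by blast
obtain L2 d2 where L2: "L2 >= 0" "d2 > 0" "!!s. abs (s - t) < d2 ==> norm (b s - b t) <= L2 * abs (s - t)" using expands_lipschitz[OF eb] by blast
obtain L3 d3 where L3: "L3 >= 0" "d3 > 0" "!!s. abs (s - t) < d3 ==> norm (c s - c t) <= L3 * abs (s - t)" using expands_lipschitz[OF ec] by blast
obtain K et where K: "0 <= K" "0 < et" and K': "ALL a' b' c'. cmod (a' - a t) + cmod (b' - b t) + cmod (c' - c t) <= et -->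
  norm (mom0 a' b' c' - mom0 (a t) (b t) (c t) - M (a' - a t) (b' - b t) (c' - c t))
  <= K * (cmod (a' - a t) + cmod (b' - b t) + cmod (c' - c t))^2"
 unfolding M_def using gauss_taylor[OF a, of "b t" "c t"] by (elim exE conjE)
let ?L = "L1 + L2 + L3"
let ?d = "min (min d1 d2) (min d3 (et / (?L + 1)))"
have lin: "bounded_linear (%z. z *C F)" for F by (rule scaleC.bounded_linear_left)
show ?thesis
proof (rule expands_cong_approx)
 show "expands (%s. M (a s) (b s) (c s)) t (M a0 b0 c0) (M a1 b1 c1) (M a2 b2 c2)"
  unfolding M_def by (intro expands_add expands_linear[OF lin] ea eb ec)
 show "0 < ?d" "0 <= K * ?L^2" using L1 L2 L3 K by auto
 fix s assume s: "abs (s - t) < ?d"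
 let ?D = "cmod (a s - a t) + cmod (b s - b t) + cmod (c s - c t)"
 have D: "?D <= ?L * abs (s - t)" using L1(3)[of s] L2(3)[of s] L3(3)[of s] s by (simp add: algebra_simps)
 have "abs (s - t) * (?L + 1) < et" using s L1 L2 L3 by (simp add: field_simps)
 hence "?D <= et" using D by (simp add: algebra_simps) 
 from K'[rule_format, OF this] have "norm (mom0 (a s) (b s) (c s) - mom0 (a t) (b t) (c t) - M (a s - a t) (b s - b t) (c s - c t)) <= K * ?D^2" .
 then
 have "norm (mom0 (a s) (b s) (c s) - mom0 (a t) (b t) (c t) - (M (a s) (b s) (c s) - M (a t) (b t) (c t))) <= K * ?D^2"
  by (simp add: M_def scaleC.diff_left algebra_simps)
 also have "... <= K * (?L * abs (s - t))^2" using D K(1) by (intro mult_left_mono power_mono) auto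
 finally show "norm (mom0 (a s) (b s) (c s) - mom0 (a t) (b t) (c t) - (M (a s) (b s) (c s) - M (a t) (b t) (c t))) <= K * ?L^2 * (s - t)^2"
  by (simp add: pmd mult.assoc)
qed
qed

end

section \<open>Explicit Gaussian orbits of the free evolution\<close>

definition n0 :: real where "n0 = (LINT z|lborel. exp (- (1 / 2) * ((z::real^2) \<bullet> z)))"

lemma n0_pos: "0 < n0"
proof -
have "0 <= n0" unfolding n0_def by (intro integral_nonneg_AE) auto
moreover have "n0 ~= 0"
proof
 assume "n0 = 0"
 hence "AE z in (lborel :: (real^2) measure). exp (- (1 / 2) * (z \<bullet> z)) = 0"
  unfolding n0_def by (subst (asm) integral_nonneg_eq_0_iff_AE) (use integrable_gauss[of "1 / 2"] in auto)
 hence "AE z in (lborel :: (real^2) measure). False" by eventually_elim simp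
 thus False by (simp add: eventually_False ae_filter_eq_bot_iff)
qed
ultimately show ?thesis by simp
qed

context schrodinger_flow begin

text \<open>Ansatz for the free solution that starts at time \<open>s\<close> as a Gaussian of
  variance \<open>sg\<close> about \<open>y\<close>. The Riccati equation for the quadratic
  coefficient is linearised by \<open>oa = \<i> * (m / 2) * oX' / oX\<close> with \<open>oX\<close>
  a complex solution of Hill's equation; the Larmor rotation \<open>oR\<close> by the angle
  \<open>J1\<close> takes care of the angular momentum term; \<open>oe\<close> and \<open>op\<close>
  collect phase and amplitude.\<close>

definition oX :: "real => real => real => complex" where
"oX s sg t = of_real (cosol t s) + \<i> * of_real (1 / (m * sg)) * of_real (zeta t s)"
definition oX' :: "real => real => real => complex" where
"oX' s sg t = of_real (cosol' t s) + \<i> * of_real (1 / (m * sg)) * of_real (zeta' t s)"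
definition oR :: "real => real^2 => real => real^2" where
"oR s y t = vector [y $ 1 * cos (J1 t - J1 s) + y $ 2 * sin (J1 t - J1 s), - y $ 1 * sin (J1 t - J1 s) + y $ 2 * cos (J1 t - J1 s)]"
definition oa :: "real => real => real => complex" where
"oa s sg t = \<i> * of_real (m / 2) * (oX' s sg t * inverse (oX s sg t))"
definition ob :: "real => real => real^2 => 2 => real => complex" where
"ob s sg y j t = of_real (1 / sg) * (of_real (oR s y t $ j) * inverse (oX s sg t))"
definition oe :: "real => real => real^2 => real => complex" where
"oe s sg y t = of_real (- (y \<bullet> y) / (2 * sg)) + \<i> * of_real ((y \<bullet> y) / (2 * m * sg^2)) * (of_real (zeta t s) * inverse (oX s sg t))"
definition op :: "real => real => real^2 => real => complex" where
"op s sg y t = of_real (1 / (n0 * sg)) * (exp (oe s sg y t) * inverse (oX s sg t))"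
definition orbit :: "real => real => real^2 => real => L2" where
"orbit s sg y t = op s sg y t *C mom0 (oa s sg t) (ob s sg y 1 t) (ob s sg y 2 t)"

lemma cz_wronskian: "cosol t s * zeta' t s - cosol' t s * zeta t s = 1"
using hsol_wronskian[OF hsol_cosol[of s] hsol_zeta[of s], of t s] by simp

lemma oX_hsol: "hsol (oX s sg) (oX' s sg)"
using hsol_combination[OF hsol_of_real[OF hsol_cosol] hsol_of_real[OF hsol_zeta], of 1 s "\<i> * of_real (1 / (m * sg))" s]
by (simp add: oX_def[abs_def] oX'_def[abs_def])

lemma oX_nonzero: "0 < sg ==> oX s sg t ~= 0"
using cz_wronskian[of t s] m_pos by (auto simp: oX_def complex_eq_iff)

lemma oX_norm: "(cmod (oX s sg t))^2 = (cosol t s)^2 + (zeta t s / (m * sg))^2"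
by (simp add: cmod_power2 oX_def)

lemma oX_wronskian: "oX s sg t * of_real (zeta' t s) - oX' s sg t * of_real (zeta t s) = 1"
proof -
have "cor (cosol t s * zeta' t s - cosol' t s * zeta t s) = 1" unfolding cz_wronskian by simp
thus ?thesis by (simp add: oX_def oX'_def algebra_simps)
qed

lemma oR_norm: "oR s y t \<bullet> oR s y t = y \<bullet> y"
proof -
define S where "S = sin (J1 t - J1 s)"
define C where "C = cos (J1 t - J1 s)"
have "oR s y t \<bullet> oR s y t = (y \<bullet> y) * (S^2 + C^2)"
 by (simp add: inner_2 oR_def S_def[symmetric] C_def[symmetric] p2es algebra_simps)
thus ?thesis by (simp add: S_def C_def)
qed

lemma oa_Re:
assumes "0 < sg"
shows "Re (oa s sg t) = - (1 / (2 * sg * (cmod (oX s sg t))^2))"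
proof -
have X: "(cmod (oX s sg t))^2 ~= 0" using oX_nonzero[OF assms] by simp
have "oX' s sg t * inverse (oX s sg t) = oX' s sg t * cnj (oX s sg t) / of_real ((cmod (oX s sg t))^2)"
 by (metis complex_div_cnj divide_inverse)
hence "Re (oa s sg t) = - (m / 2 * (Im (oX' s sg t * cnj (oX s sg t)) / (cmod (oX s sg t))^2))"
 by (simp add: oa_def)
also have "Im (oX' s sg t * cnj (oX s sg t)) = (cosol t s * zeta' t s - cosol' t s * zeta t s) / (m * sg)"
 using m_pos assms by (simp add: oX_def oX'_def field_simps)
finally show ?thesis using m_pos assms X by (simp add: cz_wronskian field_simps)
qed

lemma oa_neg: "0 < sg ==> Re (oa s sg t) < 0"
unfolding oa_Re using oX_nonzero[of sg] by simp

lemma expands_inverse_oX: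
assumes "0 < sg"
shows "expands (%t. inverse (oX s sg t)) t (- (inverse (oX s sg t))\<^sup>2 * oX' s sg t) 0 0"
proof -
have "expands (%t. inverse (oX s sg t)) t (- (inverse (oX s sg t) ^ Suc (Suc 0)) * oX' s sg t) (- (inverse (oX s sg t) ^ Suc (Suc 0)) * 0) (- (inverse (oX s sg t) ^ Suc (Suc 0)) * 0)"
 using oX_hsol[of s sg]
 by (intro expands_compose_field DERIV_inverse oX_nonzero assms) (simp add: hsol_def)
thus ?thesis by (simp add: numeral_2_eq_2)
qed

lemma expands_oR:
"expands (%t. cor (oR s y t $ 1)) t 0 (of_real (oR s y t $ 2)) 0"
"expands (%t. cor (oR s y t $ 2)) t 0 (- of_real (oR s y t $ 1)) 0"
proof -
let ?F = "%r. y $ 1 * cos (r - J1 s) + y $ 2 * sin (r - J1 s)" and ?G = "%r. - y $ 1 * sin (r - J1 s) + y $ 2 * cos (r - J1 s)"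
have "(?F has_real_derivative ?G (J1 t)) (at (J1 t))" "(?G has_real_derivative - ?F (J1 t)) (at (J1 t))"
 by (auto intro!: derivative_eq_intros)
hence "((%r. cor (?F r)) has_vector_derivative cor (?G (J1 t))) (at (J1 t))"
 "((%r. cor (?G r)) has_vector_derivative cor (- ?F (J1 t))) (at (J1 t))"
 by (simp_all only: has_vector_derivative_of_real has_real_derivative_iff_has_vector_derivative)
from this[THEN expands_compose_J1]
show "expands (%t. cor (oR s y t $ 1)) t 0 (of_real (oR s y t $ 2)) 0"
 "expands (%t. cor (oR s y t $ 2)) t 0 (- of_real (oR s y t $ 1)) 0"
 by (simp_all add: oR_def)
qed

text \<open>The free equation \<open>\<i> * psi' = H0 * psi\<close>, verified separately for the
  coefficients of 1, \<open>k\<close> and \<open>k^2\<close>. They come from the motion of the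
  width, the rotation of the centre, and the \<open>k^2\<close> term of Hill's equation.\<close>

lemma expands_orbit:
fixes s sg y t
assumes sg: "0 < sg"
defines "a \<equiv> oa s sg t" and "b \<equiv> ob s sg y 1 t" and "c \<equiv> ob s sg y 2 t" and "p \<equiv> op s sg y t"
shows "expands (orbit s sg y) t (- \<i> *C p *C gaussD0 m a b c) (- \<i> *C p *C gaussD1 a b c) (- \<i> *C p *C gaussD2 m a b c)"
proof -
define X where "X = oX s sg t"
define X' where "X' = oX' s sg t"
define iX where "iX = inverse X"
define Y where "Y = cor (zeta t s)"
define Y' where "Y' = cor (zeta' t s)"
define r where "r j = cor (oR s y t $ j)" for j
define w where "w = \<i> * cor ((y \<bullet> y) / (2 * m * sg^2))"
have X0: "X ~= 0" unfolding X_def by (rule oX_nonzero[OF sg])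
have iX: "X * iX = 1" using X0 by (simp add: iX_def)
have W: "X * Y' - X' * Y = 1" unfolding X_def X'_def Y_def Y'_def by (rule oX_wronskian)
have eX: "expands (%t. oX' s sg t) t 0 0 (- X)" using oX_hsol[of s sg] by (simp add: hsol_def X_def)
note eiX = expands_inverse_oX[OF sg, of s t, folded X_def X'_def iX_def]
have eY: "expands (%t. cor (zeta t s)) t Y' 0 0"
 using hsol_of_real[OF hsol_zeta[of s], where ?'a=complex] by (simp add: hsol_def Y'_def)
have bl: "bounded_linear (%x. z * x)" for z :: complex by (rule bounded_linear_mult_right)
have ea: "expands (oa s sg) t (- \<i> * of_real (m / 2) * (X' * iX)^2) 0 (- \<i> * of_real (m / 2))"
 unfolding oa_def
 using expands_linear[OF bl expands_mult[OF eX eiX], of "\<i> * of_real (m / 2)"] iX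
 by (simp add: p2es X_def[symmetric] X'_def[symmetric] iX_def[symmetric] algebra_simps)
have eb: "expands (ob s sg y 1) t (- b * (X' * iX)) c 0"
 unfolding ob_def[abs_def]
 using expands_linear[OF bl expands_mult[OF expands_oR(1) eiX], of "of_real (1 / sg)" s y]
 by (simp add: b_def c_def ob_def p2es X_def[symmetric] X'_def[symmetric] iX_def[symmetric] algebra_simps)
have ec: "expands (ob s sg y 2) t (- c * (X' * iX)) (- b) 0"
 unfolding ob_def[abs_def]
 using expands_linear[OF bl expands_mult[OF expands_oR(2) eiX], of "of_real (1 / sg)" s y]
 by (simp add: b_def c_def ob_def p2es X_def[symmetric] X'_def[symmetric] iX_def[symmetric] algebra_simps)
have "expands (oe s sg y) t (0 + w * (Y * (- iX\<^sup>2 * X') + Y' * iX)) (0 + w * (Y * 0 + 0 * iX)) (0 + w * (Y * 0 + 0 * iX))"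
 unfolding oe_def[abs_def] w_def[symmetric] iX_def X_def Y_def
 by (intro expands_add expands_derivative[OF has_vector_derivative_const] expands_linear[OF bl] expands_mult eY eiX[unfolded X_def iX_def])
moreover have "Y * (- iX\<^sup>2 * X') + Y' * iX = iX^2"
proof -
 have "Y * (- iX\<^sup>2 * X') + Y' * iX = iX^2 * (X * Y' - X' * Y) + Y' * iX * (1 - X * iX)"
  by (simp add: p2es algebra_simps)
 thus ?thesis by (simp add: W iX)
qed
ultimately have eo: "expands (oe s sg y) t (w * iX^2) 0 0" by simp
note ee = expands_compose_field[OF DERIV_exp eo, simplified]
have ep: "expands (op s sg y) t (p * (w * iX^2 - X' * iX)) 0 0"
 unfolding op_def[abs_def]
 using expands_linear[OF bl expands_mult[OF ee eiX], of "of_real (1 / (n0 * sg))"]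
 by (simp add: p_def op_def p2es X_def[symmetric] X'_def[symmetric] iX_def[symmetric] algebra_simps diff_divide_distrib)
have w: "w * iX^2 = \<i> * of_real (1 / (2 * m)) * (b^2 + c^2)"
proof -
 have "b^2 + c^2 = of_real (1 / sg^2) * of_real (oR s y t \<bullet> oR s y t) * iX^2"
  unfolding inner_2 b_def c_def ob_def X_def[symmetric] iX_def[symmetric]
  by (simp add: p2es algebra_simps)
 thus ?thesis unfolding oR_norm w_def using m_pos by (simp add: field_simps)
qed
have a: "a = \<i> * of_real (m / 2) * (X' * iX)" by (simp add: a_def oa_def X_def X'_def iX_def)
have "1 / (2 * m) * (m / 2) = 1 / 4" using m_pos by simp
hence m2: "of_real (1 / (2 * m)) * cor (m / 2) = of_real (1 / 4)" by (simp only: of_real_mult[symmetric])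
have XX: "X' * iX = - 4 * \<i> * of_real (1 / (2 * m)) * a"
proof -
 have "- 4 * \<i> * of_real (1 / (2 * m)) * a = 4 * (of_real (1 / (2 * m)) * of_real (m / 2)) * (X' * iX)"
  by (simp add: a algebra_simps)
 thus ?thesis unfolding m2 by simp
qed
let ?Q = "momq a b c" and ?X1 = "momx 1 a b c" and ?X2 = "momx 2 a b c" and ?G = "mom0 a b c"
let ?M = "%x y z. x *C ?Q + y *C ?X1 + z *C ?X2"
have eG: "expands (%t. mom0 (oa s sg t) (ob s sg y 1 t) (ob s sg y 2 t)) t
 (?M (- \<i> * of_real (m / 2) * (X' * iX)^2) (- b * (X' * iX)) (- c * (X' * iX))) (?M 0 c (- b)) (?M (- \<i> * of_real (m / 2)) 0 0)"
 using expands_gauss[OF oa_neg[OF sg] ea eb ec] by (simp add: a_def b_def c_def)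
from expands_bilinear[OF scaleC.bounded_bilinear_axioms ep eG]
have E: "expands (orbit s sg y) t (p *C ?M (- \<i> * of_real (m / 2) * (X' * iX)^2) (- b * (X' * iX)) (- c * (X' * iX)) + (p * (w * iX^2 - X' * iX)) *C ?G)
  (p *C ?M 0 c (- b)) (p *C ?M (- \<i> * of_real (m / 2)) 0 0)"
 by (simp add: orbit_def[abs_def] p_def a_def b_def c_def scaleC.zero_left)
have q: "- \<i> * of_real (m / 2) * (X' * iX)^2 = \<i> * of_real (1 / (2 * m)) * (4 * a^2)"
proof -
 have "\<i> * of_real (1 / (2 * m)) * (4 * a^2) = - \<i> * of_real (m / 2) * (X' * iX)^2 * (4 * (of_real (1 / (2 * m)) * of_real (m / 2)))"
  by (simp add: a p2es algebra_simps)
 thus ?thesis unfolding m2 by simp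
qed
have "p *C ?M (- \<i> * of_real (m / 2) * (X' * iX)^2) (- b * (X' * iX)) (- c * (X' * iX)) + (p * (w * iX^2 - X' * iX)) *C ?G
  = - \<i> *C p *C gaussD0 m a b c"
 unfolding gaussD0_def q
 unfolding w XX scaleC_add_right scaleC_scaleC
 by (simp add: algebra_simps scaleC_add_left[symmetric])
moreover have "p *C ?M 0 c (- b) = - \<i> *C p *C gaussD1 a b c"
 unfolding gaussD1_def scaleC_add_right scaleC_scaleC by (simp add: scaleC.zero_left algebra_simps)
moreover have "p *C ?M (- \<i> * of_real (m / 2)) 0 0 = - \<i> *C p *C gaussD2 m a b c"
 unfolding gaussD2_def scaleC_add_right scaleC_scaleC by (simp add: scaleC.zero_left algebra_simps)
ultimately show ?thesis using E by simp
qed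

text \<open>The contributions of the free Hamiltonian from the propagator and from the orbit are
  opposite, including their \<open>k\<close> and \<open>k^2\<close> parts. Only \<open>V\<close>
  survives, so an ordinary derivative exists at every time.\<close>

lemma U_orbit_derivative:
assumes "0 < sg"
shows "((%r. U ta r (orbit s sg y r)) has_vector_derivative (\<i> *C U ta t (Vop (orbit s sg y t)))) (at t)"
proof (rule expands_zero)
let ?a = "oa s sg t" and ?b = "ob s sg y 1 t" and ?c = "ob s sg y 2 t" and ?p = "op s sg y t"
note lin = U_lin
have c: "expands (%r. U ta r (orbit s sg y t)) t (?p *C \<i> *C U ta t (gaussD0 m ?a ?b ?c + Vop (mom0 ?a ?b ?c)))
  (?p *C \<i> *C U ta t (gaussD1 ?a ?b ?c)) (?p *C \<i> *C U ta t (gaussD2 m ?a ?b ?c))"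
 unfolding orbit_def lin(2) by (rule expands_linear[OF scaleC.bounded_linear_right expands_U_gauss[OF oa_neg[OF assms]]])
from expands_strong[OF U_unitary _ expands_orbit[OF assms] this]
show "expands (%r. U ta r (orbit s sg y r)) t (\<i> *C U ta t (Vop (orbit s sg y t))) 0 0"
 by (simp add: U_tendsto tendsto_ident_at orbit_def lin clinD[OF Vop_linear] scaleC_add_right scaleC.minus_left algebra_simps)
qed

text \<open>Transported to time 0 by the full propagator, the orbits are differentiable, and the two
  terms with \<open>V\<close> cancel by symmetry. As that propagator is unitary, the products of the
  free orbits themselves are constant.\<close>

lemma orbit_gram:
assumes "0 < sg" "0 < sg'"
shows "cinner (orbit s sg y t) (orbit s' sg' y' t) = cinner (orbit s sg y t') (orbit s' sg' y' t')"
proof -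
let ?f = "%t. U 0 t (orbit s sg y t)" and ?g = "%t. U 0 t (orbit s' sg' y' t)"
have "((%t. cinner (?f t) (?g t)) has_vector_derivative 0) (at t)" for t
proof -
 have "((%t. cinner (?f t) (?g t)) has_vector_derivative (cinner (?f t) (\<i> *C U 0 t (Vop (orbit s' sg' y' t))) + cinner (\<i> *C U 0 t (Vop (orbit s sg y t))) (?g t))) (at t)"
  by (intro cinner.has_vector_derivative U_orbit_derivative assms)
 also have "cinner (?f t) (\<i> *C U 0 t (Vop (orbit s' sg' y' t))) + cinner (\<i> *C U 0 t (Vop (orbit s sg y t))) (?g t) = 0"
  by (simp add: unitary_cinner[OF U_unitary] Vop_def mulop_cinner[OF bdd_borel_V])
 finally show ?thesis .
qed
hence "cinner (?f t) (?g t) = cinner (?f t') (?g t')" by (rule vector_derivative_zero_constant)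
thus ?thesis by (simp add: unitary_cinner[OF U_unitary])
qed

end

section \<open>Smoothing by Gaussian densities\<close>

lemma lebesgue_integral_affine:
fixes f :: "real^2 => 'b::{banach, second_countable_topology}"
assumes [measurable]: "f : bmf borel" and r: "0 < r"
shows "(LINT x|lborel. f x) = r^2 *R (LINT z|lborel. f (y + r *R z))"
proof -
have L: "lborel = density (distr lborel borel (%z. y + r *R z)) (%_. ennreal (r^2))"
 using lborel_affine[of r y] r by simp
have "(LINT x|lborel. f x) = (LINT x|distr lborel borel (%z. y + r *R z). r^2 *R f x)"
 by (subst L, subst integral_density) auto
also have "... = (LINT z|lborel. r^2 *R f (y + r *R z))" by (subst integral_distr) auto
finally show ?thesis by simp
qed

lemma norm_lebesgue_integral_le:
fixes f :: "_ => 'b::{banach, second_countable_topology}"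
assumes "integrable M g" "!!x. norm (f x) <= g x"
shows "norm (integral\<^sup>L M f) <= integral\<^sup>L M g"
by (rule order_trans[OF integral_norm_bound integral_mono'[OF assms(1)]], rule assms(2), rule order_trans[OF norm_ge_zero assms(2)])

text \<open>The Gaussian probability density of variance \<open>r^2\<close> about \<open>y\<close>;
  by \<open>orbit_initial\<close> it is the initial vector of an orbit.\<close>

definition gker :: "real => real^2 => real^2 => real" where
"gker r y x = exp (- (1 / (2 * r^2)) * ((x - y) \<bullet> (x - y))) / (n0 * r^2)"

lemma gker_nonneg: "0 <= gker r y x" using n0_pos by (simp add: gker_def)

lemma gker_commute: "gker r y x = gker r x y"
by (simp add: gker_def dot_square_norm norm_minus_commute)

lemma gker_measurable_pair [measurable]: "(%p. gker r (fst p) (snd p)) : borel_measurable (lborel \<Otimes>\<^sub>M lborel)"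
unfolding gker_def by measurable

lemma gker_measurable [measurable]: "gker r y : bmf borel"
unfolding gker_def by measurable

lemma gker_affine: "0 < r ==> r^2 * gker r y (y + r *R z) = gker 1 0 z"
by (simp add: gker_def p2es)

lemma gker_1_integrable: "integrable lborel (gker 1 0)" "(LINT z|lborel. gker 1 0 z) = 1"
proof -
have g: "gker 1 0 = (%z. exp (- (1 / 2) * (z \<bullet> z)) / n0)" by (simp add: gker_def fun_eq_iff)
show "integrable lborel (gker 1 0)" unfolding g using integrable_gauss[of "1 / 2"] by simp
show "(LINT z|lborel. gker 1 0 z) = 1" unfolding g using n0_pos by (simp add: n0_def)
qed

lemma gker_integral:
assumes "0 < r"
shows "integrable lborel (gker r y)" "(LINT x|lborel. gker r y x) = 1"
proof -
show 1: "(LINT x|lborel. gker r y x) = 1"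
 using lebesgue_integral_affine[OF gker_measurable assms, of r y y] gker_1_integrable(2)
 by (simp flip: integral_mult_right_zero add: gker_affine[OF assms])
thus "integrable lborel (gker r y)" using not_integrable_integral_eq by force
qed

lemma gker_nn_integral: "0 < r ==> (\<integral>\<^sup>+x. ennreal (gker r y x) \<partial>lborel) = 1"
using nn_integral_eq_integral[OF gker_integral(1), of r y] gker_integral(2)[of r y] gker_nonneg by simp

lemma gker_square_integrable:
assumes "0 < r"
shows "sqint (%x. of_real (gker r y x))" "norm (to_L2 (%x. of_real (gker r y x))) <= sqrt (1 / (n0 * r^2))"
proof -
have b: "(gker r y x)^2 <= 1 / (n0 * r^2) * gker r y x" for x
proof -
 have "gker r y x <= 1 / (n0 * r^2)" using n0_pos assms by (simp add: gker_def divide_right_mono)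
 thus ?thesis unfolding p2es using gker_nonneg by (intro mult_right_mono)
qed
have i: "integrable lborel (%x. (gker r y x)^2)"
proof (rule int_bound)
 show "integrable lborel (%x. 1 / (n0 * r^2) * gker r y x)" using gker_integral(1)[OF assms] by simp
 show "AE x in lborel. norm ((gker r y x)^2) <= norm (1 / (n0 * r^2) * gker r y x)"
  using b by (intro always_eventually allI) (simp only: real_norm_def, metis abs_ge_self abs_of_nonneg order_trans zero_le_power2)
qed measurable
show s: "sqint (%x. of_real (gker r y x))" unfolding square_integrable_def using i by simp
have "(norm (to_L2 (%x. of_real (gker r y x))))^2 = (LINT x|lborel. (gker r y x)^2)"
 using norm_to_L2_sq[OF s] by simp
also have "... <= (LINT x|lborel. 1 / (n0 * r^2) * gker r y x)"
 using b i gker_integral(1)[OF assms] by (intro integral_mono) auto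
also have "... = 1 / (n0 * r^2)" using gker_integral(2)[OF assms] by simp
finally show "norm (to_L2 (%x. of_real (gker r y x))) <= sqrt (1 / (n0 * r^2))" by (rule real_le_rsqrt)
qed

text \<open>The conjugate makes this the inner product of \<open>f\<close> with the density at
  \<open>y\<close>, the quantity on which unitary maps can act.\<close>

definition smear :: "real => (real^2 => complex) => real^2 => complex" where
"smear r f y = (LINT x|lborel. cnj (f x) * of_real (gker r y x))"

lemma borel_measurable_cnj: "f : bmf M ==> (%x. cnj (f x)) : bmf M"
by (rule measurable_compose[of f M borel cnj borel]) (auto intro!: bmci continuous_intros)

lemma smear_measurable:
assumes f: "f : bmf borel" shows "smear r f : bmf borel"
proof -
have [measurable]: "(%x. cnj (f x)) : bmf borel" using f by (rule borel_measurable_cnj)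
have "(%y. LINT x|lborel. cnj (f x) * of_real (gker r y x)) : bmf lborel"
 by (rule lborel.borel_measurable_lebesgue_integral) (simp add: case_prod_beta', measurable)
thus ?thesis unfolding smear_def[abs_def] by simp
qed

lemma smear_cinner: "0 < r ==> sqint f ==> smear r f y = cinner (to_L2 f) (to_L2 (%x. of_real (gker r y x)))"
by (simp add: smear_def cinner_to_L2 gker_square_integrable)

lemma smear_integrable:
assumes r: "0 < r" and f: "sqint f" and h: "integrable lborel h"
shows "integrable lborel (%y. h y * smear r f y)"
proof (rule int_bound)
show "integrable lborel (%y. (norm (to_L2 f) * sqrt (1 / (n0 * r^2))) *R h y)" using h by simp
have [measurable]: "smear r f : bmf borel" "h : bmf borel"
 using smear_measurable f h by (auto simp: square_integrable_def)
show "(%y. h y * smear r f y) : bmf lborel" by measurable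
have "cmod (smear r f y) <= norm (to_L2 f) * sqrt (1 / (n0 * r^2))" for y
 unfolding smear_cinner[OF r f]
 by (rule order_trans[OF cinner_Cauchy_Schwarz]) (intro mult_left_mono gker_square_integrable r norm_ge_zero)
thus "AE y in lborel. norm (h y * smear r f y) <= norm ((norm (to_L2 f) * sqrt (1 / (n0 * r^2))) *R h y)"
 using n0_pos by (auto simp: norm_mult abs_mult mult.commute[of "cmod (h _)"] intro!: always_eventually mult_right_mono)
qed

text \<open>Young's inequality; minimising over \<open>l\<close> would give the product of the norms.\<close>

lemma smear_young:
assumes r: "0 < r" and f: "sqint f" and h: "sqint h" and l: "0 < l"
shows "cmod (LINT y|lborel. h y * smear r f y) <= l * (norm (to_L2 h))^2 + (norm (to_L2 f))^2 / l"
proof -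
have [measurable]: "f : bmf borel" "h : bmf borel" "smear r f : bmf borel"
 using f h smear_measurable by (auto simp: square_integrable_def)
let ?g = "%y x. ennreal (gker r y x)"
have ab: "ennreal (a * b) <= ennreal (l * a^2) + ennreal (b^2 / l)" if "0 <= a" "0 <= b" for a b
proof -
 have "0 <= (l * a - b)^2 / l" using l by simp
 also have "... = l * a^2 + b^2 / l - 2 * (a * b)" using l by (simp add: p2es field_simps)
 finally have "a * b <= l * a^2 + b^2 / l" using that by (smt (verit) mult_nonneg_nonneg)
 thus ?thesis using l by (simp flip: ennreal_plus add: ennreal_leI)
qed
have "ennreal (cmod (LINT y|lborel. h y * smear r f y)) <= (\<integral>\<^sup>+y. ennreal (cmod (h y * smear r f y)) \<partial>lborel)"
 by (cases "integrable lborel (%y. h y * smear r f y)") (simp_all add: integral_norm_bound_ennreal not_integrable_integral_eq)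
also have "... <= (\<integral>\<^sup>+y. \<integral>\<^sup>+x. ennreal (l * (cmod (h y))^2) * ?g y x + ennreal ((cmod (f x))^2 / l) * ?g y x \<partial>lborel \<partial>lborel)"
proof (rule nn_integral_mono)
 fix y
 have [measurable]: "(%x. cnj (f x)) : bmf borel" by (rule borel_measurable_cnj) simp
 have "ennreal (cmod (smear r f y)) <= (\<integral>\<^sup>+x. ennreal (cmod (cnj (f x) * of_real (gker r y x))) \<partial>lborel)"
  unfolding smear_def
  by (intro integral_norm_bound_ennreal square_integrable_mult f gker_square_integrable r)
 hence "ennreal (cmod (h y * smear r f y)) <= ennreal (cmod (h y)) * (\<integral>\<^sup>+x. ennreal (cmod (cnj (f x) * of_real (gker r y x))) \<partial>lborel)"
  by (simp add: norm_mult ennreal_mult mult_left_mono)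
 also have "... = (\<integral>\<^sup>+x. ennreal (cmod (h y) * cmod (f x)) * ?g y x \<partial>lborel)"
  using gker_nonneg by (subst nn_integral_cmult[symmetric]) (auto simp: norm_mult ennreal_mult' mult.assoc)
 also have "... <= (\<integral>\<^sup>+x. (ennreal (l * (cmod (h y))^2) + ennreal ((cmod (f x))^2 / l)) * ?g y x \<partial>lborel)"
  by (intro nn_integral_mono mult_right_mono ab) auto
 finally show "ennreal (cmod (h y * smear r f y)) <= (\<integral>\<^sup>+x. ennreal (l * (cmod (h y))^2) * ?g y x + ennreal ((cmod (f x))^2 / l) * ?g y x \<partial>lborel)"
  by (simp only: distrib_right)
qed
also have "... = (\<integral>\<^sup>+y. \<integral>\<^sup>+x. ennreal (l * (cmod (h y))^2) * ?g y x \<partial>lborel \<partial>lborel) + (\<integral>\<^sup>+y. \<integral>\<^sup>+x. ennreal ((cmod (f x))^2 / l) * ?g y x \<partial>lborel \<partial>lborel)"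
proof -
 have m: "(%y. \<integral>\<^sup>+x. ennreal (l * (cmod (h y))^2) * ?g y x \<partial>lborel) : bmf lborel"
  "(%y. \<integral>\<^sup>+x. ennreal ((cmod (f x))^2 / l) * ?g y x \<partial>lborel) : bmf lborel"
  by (rule lborel.borel_measurable_nn_integral; simp add: case_prod_beta'; measurable)+
 show ?thesis
  by (subst nn_integral_add[OF m, symmetric]) (auto intro!: nn_integral_cong nn_integral_add)
qed
also have "(\<integral>\<^sup>+y. \<integral>\<^sup>+x. ennreal ((cmod (f x))^2 / l) * ?g y x \<partial>lborel \<partial>lborel) = (\<integral>\<^sup>+x. \<integral>\<^sup>+y. ennreal ((cmod (f x))^2 / l) * ?g y x \<partial>lborel \<partial>lborel)"
 by (rule lborel_pair.Fubini'[symmetric]) (simp add: case_prod_beta', measurable)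
also have "... = (\<integral>\<^sup>+x. ennreal ((cmod (f x))^2 / l) \<partial>lborel)"
 by (subst gker_commute, subst nn_integral_cmult) (auto simp: gker_nn_integral[OF r])
also have "(\<integral>\<^sup>+y. \<integral>\<^sup>+x. ennreal (l * (cmod (h y))^2) * ?g y x \<partial>lborel \<partial>lborel) = (\<integral>\<^sup>+y. ennreal (l * (cmod (h y))^2) \<partial>lborel)"
 by (subst nn_integral_cmult) (auto simp: gker_nn_integral[OF r])
also have "(\<integral>\<^sup>+y. ennreal (l * (cmod (h y))^2) \<partial>lborel) + (\<integral>\<^sup>+x. ennreal ((cmod (f x))^2 / l) \<partial>lborel) = ennreal (l * (norm (to_L2 h))^2 + (norm (to_L2 f))^2 / l)"
 using f h l by (simp add: nn_integral_eq_integral square_integrable_def norm_to_L2_sq)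
finally show ?thesis using l by (subst (asm) ennreal_le_iff) auto
qed

lemma smear_tendsto_bounded:
assumes f: "sqint f" "continuous_on UNIV f" "bounded (range f)" and h: "integrable lborel h" and r: "!!n. 0 < r n" "r ----> 0"
shows "(%n. LINT y|lborel. h y * smear (r n) f y) ----> (LINT y|lborel. h y * cnj (f y))"
proof -
obtain C where C: "!!x. cmod (f x) <= C" using f(3) by (auto simp: bounded_iff)
have fm[measurable]: "f : bmf borel" using f(2) by (rule bmci)
have cm[measurable]: "(%x. cnj (f x)) : bmf borel" by (rule borel_measurable_cnj) simp
have sub: "smear r f y = (LINT z|lborel. cnj (f (y + r *R z)) * of_real (gker 1 0 z))" if "0 < r" for r y
proof -
 have "smear r f y = r^2 *R (LINT z|lborel. cnj (f (y + r *R z)) * of_real (gker r y (y + r *R z)))"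
  unfolding smear_def by (rule lebesgue_integral_affine[OF _ that]) measurable
 also have "... = (LINT z|lborel. cnj (f (y + r *R z)) * of_real (r^2 * gker r y (y + r *R z)))"
  by (subst integral_scaleR_right[symmetric]) (simp add: scaleR_conv_of_real mult_ac)
 finally show ?thesis unfolding gker_affine[OF that] .
qed
have bd: "cmod (smear r f y) <= C" if "0 < r" for r y
proof -
 have "cmod (smear r f y) <= (LINT z|lborel. C * gker 1 0 z)"
  unfolding sub[OF that]
  by (rule norm_lebesgue_integral_le) (use gker_1_integrable gker_nonneg C in "auto simp: norm_mult intro!: mult_right_mono")
 thus ?thesis using gker_1_integrable by simp
qed
have lim: "(%n. smear (r n) f y) ----> cnj (f y)" for y
proof -
 have "(%n. LINT z|lborel. cnj (f (y + r n *R z)) * of_real (gker 1 0 z)) ----> (LINT z|lborel. cnj (f y) * of_real (gker 1 0 z))"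
 proof (rule integral_dominated_convergence[where w="%z. C * gker 1 0 z"])
  show "AE z in lborel. (%n. cnj (f (y + r n *R z)) * of_real (gker 1 0 z)) ----> cnj (f y) * of_real (gker 1 0 z)"
  proof (intro always_eventually allI)
   fix z
   have "(%n. y + r n *R z) ----> y + 0 *R z" by (intro tendsto_intros r(2))
   hence "(%n. f (y + r n *R z)) ----> f y" using continuous_on_tendsto_compose[OF f(2)] by simp
   thus "(%n. cnj (f (y + r n *R z)) * of_real (gker 1 0 z)) ----> cnj (f y) * of_real (gker 1 0 z)" by (intro tendsto_intros)
  qed
  show "AE z in lborel. norm (cnj (f (y + r n *R z)) * of_real (gker 1 0 z)) <= C * gker 1 0 z" for n
   using C gker_nonneg by (auto simp: norm_mult intro!: mult_right_mono)
 qed (use gker_1_integrable in auto)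
 thus ?thesis using gker_1_integrable(2) by (simp add: sub[OF r(1)])
qed
show ?thesis
proof (rule integral_dominated_convergence[where w="%y. C * cmod (h y)"])
 show "AE y in lborel. (%n. h y * smear (r n) f y) ----> h y * cnj (f y)" by (intro always_eventually allI tendsto_intros lim)
 show "AE y in lborel. norm (h y * smear (r n) f y) <= C * cmod (h y)" for n
  using bd[OF r(1)] by (auto simp: norm_mult mult.commute[of C] intro!: mult_left_mono)
 show "(%y. h y * smear (r n) f y) : bmf lborel" for n
  using smear_integrable[OF r(1) f(1) h] by (rule borel_measurable_integrable)
qed (use h in auto)
qed

text \<open>For bounded continuous functions this is dominated convergence. In general
  \<open>f\<close> is replaced by such a function, and \<open>smear_young\<close> bounds the
  difference uniformly in the width.\<close>

lemma smear_tendsto: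
assumes f: "sqint f" and h: "integrable lborel h" "sqint h" and r: "!!n. 0 < r n" "r ----> 0"
shows "(%n. LINT y|lborel. h y * smear (r n) f y) ----> cinner (to_L2 f) (to_L2 h)"
proof (rule LIMSEQ_I)
fix e :: real assume e: "0 < e"
\<comment> \<open>Collects the coefficients of \<open>d\<close> below: the squared norm of
  \<open>h\<close> and 1 from Young's inequality taken with \<open>l = d\<close>, and the norm of
  \<open>h\<close> from Cauchy-Schwarz.\<close>
define M where "M = (norm (to_L2 h))^2 + 1 + norm (to_L2 h)"
have M: "0 < M" by (simp add: M_def add_pos_nonneg add_nonneg_pos)
define d where "d = e / (2 * M)"
have d: "0 < d" "d * M = e / 2" using e M by (auto simp: d_def)
obtain g where g: "sqint g" "continuous_on UNIV g" "bounded (range g)" "norm (to_L2 f - to_L2 g) < d"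
 using L2_approx_bounded_continuous[OF d(1)] by blast
let ?k = "%x. f x - g x"
have k: "sqint ?k" by (rule square_integrable_diff[OF f g(1)])
have kn: "norm (to_L2 ?k) < d" using g(4) f g(1) by (simp add: to_L2_diff)
have kk: "to_L2 ?k = to_L2 f - to_L2 g" by (simp add: to_L2_diff f g(1))
have cg: "(LINT y|lborel. h y * cnj (g y)) = cinner (to_L2 g) (to_L2 h)"
 by (simp add: cinner_to_L2 g h mult.commute)
obtain N where N: "!!n. n >= N ==> norm ((LINT y|lborel. h y * smear (r n) g y) - cinner (to_L2 g) (to_L2 h)) < e / 2"
 using LIMSEQ_D[OF smear_tendsto_bounded[OF g(1-3) h(1) r], of "e / 2"] e unfolding cg by auto
have "norm ((LINT y|lborel. h y * smear (r n) f y) - cinner (to_L2 f) (to_L2 h)) < e" if n: "n >= N" for n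
proof -
 have sm: "smear (r n) f y = smear (r n) g y + smear (r n) ?k y" for y
  unfolding smear_cinner[OF r(1) f] smear_cinner[OF r(1) g(1)] smear_cinner[OF r(1) k] kk by (simp add: cinner.diff_left)
 have "(LINT y|lborel. h y * smear (r n) f y) = (LINT y|lborel. h y * smear (r n) g y) + (LINT y|lborel. h y * smear (r n) ?k y)"
  unfolding sm distrib_left by (intro Bochner_Integration.integral_add smear_integrable r g(1) h k)
 moreover have "cinner (to_L2 f) (to_L2 h) = cinner (to_L2 g) (to_L2 h) + cinner (to_L2 ?k) (to_L2 h)"
  unfolding kk by (simp add: cinner.diff_left)
 ultimately have "norm ((LINT y|lborel. h y * smear (r n) f y) - cinner (to_L2 f) (to_L2 h))
   = norm (((LINT y|lborel. h y * smear (r n) g y) - cinner (to_L2 g) (to_L2 h)) + (LINT y|lborel. h y * smear (r n) ?k y) - cinner (to_L2 ?k) (to_L2 h))"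
  by (intro arg_cong[where f=norm]) simp
 also have "... <= norm ((LINT y|lborel. h y * smear (r n) g y) - cinner (to_L2 g) (to_L2 h)) + norm (LINT y|lborel. h y * smear (r n) ?k y) + norm (cinner (to_L2 ?k) (to_L2 h))"
  by (intro order_trans[OF norm_triangle_ineq4] add_mono norm_triangle_ineq order_refl)
 also have "... < e / 2 + (d * (norm (to_L2 h))^2 + d) + d * norm (to_L2 h)"
 proof (intro add_less_le_mono N n add_mono)
  have "norm (LINT y|lborel. h y * smear (r n) ?k y) <= d * (norm (to_L2 h))^2 + (norm (to_L2 ?k))^2 / d"
   by (rule smear_young[OF r(1) k h(2) d(1)])
  also have "(norm (to_L2 ?k))^2 / d <= d" using power_mono[of "norm (to_L2 ?k)" d 2] kn d(1) by (simp add: field_simps p2es)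
  finally show "norm (LINT y|lborel. h y * smear (r n) ?k y) <= d * (norm (to_L2 h))^2 + d" by simp
  show "norm (cinner (to_L2 ?k) (to_L2 h)) <= d * norm (to_L2 h)"
   by (rule order_trans[OF cinner_Cauchy_Schwarz]) (use kn in "intro mult_right_mono; simp")
 qed
 also have "... = e" using d(2) by (simp add: M_def algebra_simps)
 finally show ?thesis .
qed
thus "EX N. ALL n>=N. norm ((LINT y|lborel. h y * smear (r n) f y) - cinner (to_L2 f) (to_L2 h)) < e" by blast
qed

lemma L1_dense:
assumes "!!h. sqint h ==> integrable lborel h ==> cinner F (to_L2 h) = 0"
shows "F = 0"
proof -
obtain f where f: "sqint f" "F = to_L2 f" by (metis obtain_rep)
have fm[measurable]: "f : bmf borel" using f(1) by (simp add: square_integrable_def)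
let ?h = "%n::nat. %x. indicator (cball 0 (real n)) x *R f x"
have l: "AE x in lborel. (%n. ?h n x) ----> f x"
proof (rule always_eventually, rule allI, rule tendsto_eventually)
 fix x :: "real^2"
 obtain N where N: "norm x <= real N" using real_arch_simple by blast
 show "\<forall>\<^sub>F n in sequentially. ?h n x = f x"
  using eventually_ge_at_top[of N] by eventually_elim (use N in "auto simp: indicator_def")
qed
have L: "sqint (?h n)" "(%n. to_L2 (?h n)) ----> F" for n
 unfolding f(2) using f(1) l
 by (intro L2_dominated_convergence(2,3)[where g="%x. cmod (f x)" and f="?h" and F=f]; auto simp: square_integrable_def indicator_def)+
have "integrable lborel (?h n)" for n
proof (rule int_bound)
 show "integrable lborel (%x. (cmod (f x))^2 + indicator (cball 0 (real n)) x)"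
  using f(1) by (auto simp: square_integrable_def intro!: integrable_real_indicator emeasure_lborel_cball_finite)
 have "a <= a^2 + 1" for a :: real using zero_le_power2[of "a - 1/2"] by (simp add: p2es algebra_simps)
 thus "AE x in lborel. norm (?h n x) <= norm ((cmod (f x))^2 + indicator (cball 0 (real n)) x :: real)"
  by (auto simp: indicator_def)
qed (use L(1)[of n] in "simp add: square_integrable_def")
hence "cinner F (to_L2 (?h n)) = 0" for n by (intro assms L)
moreover have "(%n. cinner F (to_L2 (?h n))) ----> cinner F F" by (intro cinner.tendsto L tendsto_const)
ultimately have "cinner F F = 0" using LIMSEQ_unique[OF _ tendsto_const] by simp
thus ?thesis by (rule cinner_eq_zeroI)
qed

lemma unitary_tendsto:
assumes "!!x. unitary (W x)" "unitary W0" "((%x. W x f0) ---> W0 f0) F" "(f ---> f0) F"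
shows "((%x. W x (f x)) ---> W0 f0) F"
proof -
have "((%x. W x (f x - f0)) ---> 0) F"
 using tendsto_norm_zero[OF LIM_zero[OF assms(4)]] by (intro tendsto_norm_zero_cancel[where f="%x. W x (f x - f0)"]) (simp add: unitary_norm assms(1))
from tendsto_add[OF this assms(3)]
show ?thesis by (simp add: clinD[OF unitary_clin[OF assms(1)]])
qed

lemma total_eq:
assumes u: "total u" and A: "bounded_linear A" "!!c f. A (c *C f) = c *C A f" and B: "bounded_linear B" "!!c f. B (c *C f) = c *C B f"
 and e: "!!i. A (u i) = B (u i)"
shows "A f = (B f :: L2)"
using u
proof (induction f rule: total_induct)
case closed
show ?case by (intro closed_Collect_eq linear_continuous_on A B)
next
case (add f g)
thus ?case using A(1) B(1) by (simp add: linear_add bounded_linear.linear)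
qed (use A B e in auto)

section \<open>The free propagator and its dispersive estimate\<close>

context schrodinger_flow begin

lemma oR_diag: "oR s y s = y"
by (simp add: oR_def vec_eq_iff forall_2)

definition ofun :: "real => real => real^2 => real => real^2 => complex" where
"ofun s sg y t x = op s sg y t * gss (oa s sg t) (ob s sg y 1 t) (ob s sg y 2 t) x"

lemma orbit_ofun:
assumes "0 < sg"
shows "sqint (ofun s sg y t)" "orbit s sg y t = to_L2 (ofun s sg y t)"
unfolding ofun_def[abs_def] orbit_def mom0_def
using gss_square_integrable[OF oa_neg[OF assms, of s t]] by (simp_all add: to_L2_scale square_integrable_scale)

lemma orbit_initial:
assumes r: "0 < r"
shows "orbit s (r^2) y s = to_L2 (%x. of_real (gker r y x))"
proof -
have s: "0 < r^2" using r by simp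
have X: "oX s (r^2) s = 1" "oX' s (r^2) s = \<i> * of_real (1 / (m * r^2))" by (simp_all add: oX_def oX'_def)
have "ofun s (r^2) y s x = of_real (gker r y x)" for x
proof -
 have m: "\<i> * cor (m / 2) * (\<i> * of_real (1 / (m * r^2))) = of_real (- 1 / (2 * r^2))"
  using m_pos r by (simp add: field_simps)
 have "ofun s (r^2) y s x = of_real (1 / (n0 * r^2)) * exp (of_real (- (y \<bullet> y) / (2 * r^2)) + (of_real (- 1 / (2 * r^2)) * of_real (x \<bullet> x)
   + of_real (1 / r^2) * of_real (y $ 1) * of_real (x $ 1) + of_real (1 / r^2) * of_real (y $ 2) * of_real (x $ 2)))"
 proof -
  have 1: "oe s (r^2) y s = of_real (- (y \<bullet> y) / (2 * r^2))" by (simp add: oe_def)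
  have 2: "oa s (r^2) s = of_real (- 1 / (2 * r^2))" unfolding oa_def X inverse_1 mult_1_right by (rule m)
  have 3: "ob s (r^2) y j s = of_real (1 / r^2) * of_real (y $ j)" for j by (simp add: ob_def X oR_diag)
  show ?thesis unfolding ofun_def op_def gss_def 1 2 3 X by (simp only: exp_add inverse_1 mult_1_right mult.assoc)
 qed
 also have "... = of_real (1 / (n0 * r^2) * exp (- (y \<bullet> y) / (2 * r^2) + (- 1 / (2 * r^2) * (x \<bullet> x) + 1 / r^2 * y $ 1 * x $ 1 + 1 / r^2 * y $ 2 * x $ 2)))"
  by (simp only: exp_of_real[symmetric] of_real_add of_real_mult)
 also have "- (y \<bullet> y) / (2 * r^2) + (- 1 / (2 * r^2) * (x \<bullet> x) + 1 / r^2 * y $ 1 * x $ 1 + 1 / r^2 * y $ 2 * x $ 2) = - (1 / (2 * r^2)) * ((x - y) \<bullet> (x - y))"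
  using r by (simp add: inner_2 p2es field_simps)
 finally show ?thesis by (simp add: gker_def)
qed
hence "ofun s (r^2) y s = (%x. of_real (gker r y x))" by (rule ext)
thus ?thesis unfolding orbit_ofun(2)[OF s] by simp
qed

text \<open>The modulus of an orbit is a Gaussian centred at the classical trajectory.\<close>

lemma ofun_bound:
assumes sg: "0 < sg" and z: "zeta t s ~= 0"
shows "cmod (ofun s sg y t x) <= m / (n0 * abs (zeta t s))"
proof -
define X where "X = oX s sg t"
define C where "C = cosol t s"
define w where "w = zeta t s / (m * sg)"
define D where "D = C^2 + w^2"
define Y where "Y = oR s y t"
have w: "w ~= 0" using z m_pos sg by (simp add: w_def)
have D: "0 < D" using w by (simp add: D_def add_nonneg_pos)
have Xn: "(cmod X)^2 = D" unfolding X_def oX_norm by (simp add: D_def C_def w_def)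
have Xc: "Re X = C" "Im X = w" by (simp_all add: X_def oX_def C_def w_def)
have a: "Re (oa s sg t) = - (1 / (2 * sg * D))" unfolding oa_Re[OF sg] X_def[symmetric] Xn ..
have b: "Re (ob s sg y j t) = 1 / sg * (Y $ j * (C / D))" for j
 unfolding ob_def X_def[symmetric] Y_def[symmetric] by (simp add: Xc D_def mult.commute)
have e: "Re (oe s sg y t) = - (Y \<bullet> Y) / (2 * sg) * (C^2 / D)"
proof -
 have "Re (oe s sg y t) = - (y \<bullet> y) / (2 * sg) + (y \<bullet> y) / (2 * m * sg^2) * (zeta t s * (w / D))"
  unfolding oe_def X_def[symmetric] by (simp add: Xc D_def)
 also have "zeta t s = m * sg * w" using m_pos sg by (simp add: w_def)
 also have "m * sg * w * (w / D) = m * sg * (1 - C^2 / D)"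
 proof -
  have "w * w = D - C^2" by (simp add: D_def p2es)
  hence "w * (w / D) = 1 - C^2 / D" using D by (simp add: diff_divide_distrib)
  thus ?thesis by (simp only: mult.assoc)
 qed
 also have "- (y \<bullet> y) / (2 * sg) + (y \<bullet> y) / (2 * m * sg^2) * (m * sg * (1 - C^2 / D)) = - (y \<bullet> y) / (2 * sg) * (C^2 / D)"
  using m_pos sg by (simp add: field_simps p2es)
 finally show ?thesis unfolding Y_def oR_norm .
qed
have "Re (oe s sg y t) + (Re (oa s sg t) * (x \<bullet> x) + Re (ob s sg y 1 t) * x $ 1 + Re (ob s sg y 2 t) * x $ 2)
  = - ((x $ 1 - C * Y $ 1)^2 + (x $ 2 - C * Y $ 2)^2) / (2 * sg * D)"
 unfolding a b e inner_2 using sg D by (simp add: field_simps p2es)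
also have "... <= 0" using sg D by (simp add: divide_nonpos_nonneg)
finally have neg: "exp (Re (oe s sg y t) + (Re (oa s sg t) * (x \<bullet> x) + Re (ob s sg y 1 t) * x $ 1 + Re (ob s sg y 2 t) * x $ 2)) <= 1" by simp
have "abs w <= cmod X" using abs_Im_le_cmod[of X] Xc by simp
hence inv: "inverse (cmod X) <= inverse (abs w)" using w by (intro le_imp_inverse_le) auto
have "cmod (ofun s sg y t x) = 1 / (n0 * sg) * inverse (cmod X) * exp (Re (oe s sg y t) + (Re (oa s sg t) * (x \<bullet> x) + Re (ob s sg y 1 t) * x $ 1 + Re (ob s sg y 2 t) * x $ 2))"
 using n0_pos sg by (simp add: ofun_def op_def gss_def norm_mult norm_inverse norm_exp_eq_Re X_def exp_add norm_divide)
also have "... <= 1 / (n0 * sg) * inverse (abs w) * 1"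
 using n0_pos sg inv neg by (intro mult_mono) auto
also have "... = m / (n0 * abs (zeta t s))" using n0_pos sg m_pos z by (simp add: w_def abs_mult field_simps)
finally show ?thesis .
qed

definition gfam :: "real => real \<times> real \<times> (real^2) => L2" where
"gfam t i = orbit (fst i) ((exp (fst (snd i)))^2) (snd (snd i)) t"

lemma smear_orbit:
assumes "0 < r" "sqint f"
shows "smear r f y = cinner (to_L2 f) (orbit s (r^2) y s)"
by (simp add: orbit_initial[OF assms(1)] smear_cinner[OF assms])

lemma exp_minus_nat: "0 < exp (- real n)" "(%n. exp (- real n)) ----> 0"
by (simp, real_asymp)

lemma orbit_approx:
assumes "integrable lborel h" "sqint h"
shows "(%n. LINT y|lborel. h y * cinner F (orbit s ((exp (- real n))^2) y s)) ----> cinner F (to_L2 h)"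
proof -
obtain f where f: "sqint f" "F = to_L2 f" by (metis obtain_rep)
show ?thesis using smear_tendsto[OF f(1) assms exp_minus_nat] unfolding smear_orbit[OF exp_minus_nat(1) f(1), of _ _ s] f(2) .
qed

lemma total_gfam: "total (gfam t)"
unfolding total_def
proof (intro allI impI)
fix F assume F: "ALL i. cinner (gfam t i) F = 0"
have "cinner F (orbit t ((exp (- real n))^2) y t) = 0" for n y
proof -
 have "cinner (gfam t (t, - real n, y)) F = 0" using F by blast
 thus ?thesis by (subst cinner_commute) (simp add: gfam_def)
qed
hence "cinner F (to_L2 h) = 0" if "integrable lborel h" "sqint h" for h
 using LIMSEQ_unique[OF orbit_approx[OF that, of F t]] by simp
thus "F = 0" by (rule L1_dense)
qed

text \<open>A unitary map exists because the Gram matrix of \<open>gfam t\<close> does not depend on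
  \<open>t\<close>, and it is unique because \<open>gfam\<close> is total; the laws of a propagator
  follow from uniqueness.\<close>

definition U0 :: "real => real => L2 => L2" where
"U0 t s = (SOME W. unitary W & (ALL i. W (gfam s i) = gfam t i))"

lemma U0_props: "unitary (U0 t s) & (ALL i. U0 t s (gfam s i) = gfam t i)"
proof -
have "EX W. unitary W & (ALL i. W (gfam s i) = gfam t i)"
 by (rule gram_unitary[OF total_gfam total_gfam]) (simp add: gfam_def orbit_gram[of _ _ _ _ s _ _ t])
thus ?thesis unfolding U0_def by (rule someI_ex)
qed

lemmas U0_unitary = U0_props[THEN conjunct1]
lemmas U0_gfam = U0_props[THEN conjunct2, rule_format]

lemmas U0_lin = clinD[OF unitary_clin[OF U0_unitary]]

lemma U0_orbit: assumes "0 < r" shows "U0 t s (orbit s' (r^2) y s) = orbit s' (r^2) y t"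
using U0_gfam[of t s "(s', ln r, y)"] assms by (simp add: gfam_def)

lemma U0_unique:
assumes "unitary W" "!!i. W (gfam s i) = gfam t i" shows "W f = U0 t s f"
by (rule total_eq[OF total_gfam[of s]])
 (auto simp: assms U0_gfam bounded_linear_unitary U0_unitary clinD(2)[OF unitary_clin])

lemma unitary_comp: "unitary W ==> unitary W' ==> unitary (%f. W (W' f))"
unfolding unitary_def complex_linear_def using comp_surj[of W' W] by (auto simp: o_def)

lemma unitary_id: "unitary (%f. f)"
by (auto simp: unitary_def complex_linear_def)

lemma U0_comp: "U0 t r (U0 r s f) = U0 t s f"
by (rule U0_unique[OF unitary_comp[OF U0_unitary U0_unitary]]) (simp add: U0_gfam)

lemma U0_id: "U0 s s f = f"
by (rule U0_unique[OF unitary_id, symmetric]) simp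

lemma U0_adjoint: "cinner f (U0 t s g) = cinner (U0 s t f) g"
using unitary_cinner[OF U0_unitary[of s t], of f "U0 t s g"] by (simp add: U0_comp U0_id)

lemma orbit_shift: "orbit (s + T) sg y (t + T) = orbit s sg y t"
proof -
have X: "oX (s + T) sg (t + T) = oX s sg t" "oX' (s + T) sg (t + T) = oX' s sg t" "oR (s + T) y (t + T) = oR s y t"
 by (simp_all add: oX_def oX'_def cosol_periodic zeta_periodic oR_def J1_shift)
show ?thesis by (simp add: orbit_def op_def oe_def oa_def ob_def X zeta_periodic)
qed

lemma U0_periodic: "U0 (t + T) (s + T) f = U0 t s f"
proof (rule U0_unique[OF U0_unitary])
fix i :: "real \<times> real \<times> (real^2)"
have sh: "gfam (r + T) (fst i + T, snd i) = gfam r i" for r unfolding gfam_def by (simp add: orbit_shift)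
show "U0 (t + T) (s + T) (gfam s i) = gfam t i"
 using U0_gfam[of "t + T" "s + T" "(fst i + T, snd i)"] unfolding sh .
qed

lemma U0_shift_n: "U0 (t + real n * T) (real n * T) f = U0 t 0 f"
proof (induction n)
case (Suc n)
have e: "real (Suc n) * T = real n * T + T" by (simp add: algebra_simps)
show ?case unfolding e add.assoc[symmetric] U0_periodic by (rule Suc)
qed simp

lemma U0_power: "(U0 T 0 ^^ n) f = U0 (real n * T) 0 f"
proof (induction n)
case (Suc n)
have "(U0 T 0 ^^ Suc n) f = U0 (T + real n * T) (real n * T) (U0 (real n * T) 0 f)" unfolding U0_shift_n using Suc by simp
thus ?case unfolding U0_comp by (simp add: algebra_simps)
qed (simp add: U0_id)

lemma orbit_continuous: "0 < sg ==> continuous_on UNIV (orbit s sg y)"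
proof -
assume sg: "0 < sg"
have "isCont (orbit s sg y) t" for t
proof -
 obtain L d where L: "d > 0" "!!r. abs (r - t) < d ==> norm (orbit s sg y r - orbit s sg y t) <= L * abs (r - t)"
  using expands_lipschitz[OF expands_orbit[OF sg]] by blast
 have "((%r. L * abs (r - t)) ---> L * abs (t - t)) (at t)" by (intro tendsto_intros)
 hence "((%r. L * abs (r - t)) ---> 0) (at t)" by simp
 moreover have "\<forall>\<^sub>F r in at t. norm (orbit s sg y r - orbit s sg y t) <= L * abs (r - t)"
  unfolding eventually_at dist_real_def using L by blast
 ultimately have "((%r. orbit s sg y r - orbit s sg y t) ---> 0) (at t)"
  by (rule Lim_null_comparison[rotated])
 thus ?thesis unfolding isCont_def by (simp add: LIM_zero_iff)
qed
thus ?thesis by (simp add: continuous_on_eq_continuous_at)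
qed

text \<open>True for orbits, hence for all vectors: the maps being isometric, a convergent sequence
  of vectors gives uniform convergence in time.\<close>

lemma U0_continuous_time: "continuous_on UNIV (%t. U0 t s f)"
using total_gfam[of s]
proof (induction f rule: total_induct)
case closed
show ?case
 unfolding closed_sequential_limits
proof (intro allI impI)
 fix x l assume x: "(ALL n. x n : {f. continuous_on UNIV (%t. U0 t s f)}) & x ----> l"
 have "uniform_limit UNIV (%n t. U0 t s (x n)) (%t. U0 t s l) sequentially"
 proof (rule uniform_limitI)
  fix e :: real assume "0 < e"
  hence "\<forall>\<^sub>F n in sequentially. dist (x n) l < e" using x tendstoD by blast
  moreover have "dist (U0 t s (x n)) (U0 t s l) = dist (x n) l" for t n
   by (simp add: dist_norm unitary_norm[OF U0_unitary] flip: U0_lin(5))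
  ultimately show "\<forall>\<^sub>F n in sequentially. ALL t:UNIV. dist (U0 t s (x n)) (U0 t s l) < e" by simp
 qed
 hence "continuous_on UNIV (%t. U0 t s l)"
  by (rule uniform_limit_theorem[rotated]) (use x in auto)
 thus "l : {f. continuous_on UNIV (%t. U0 t s f)}" by simp
qed
next
case (add f g)
thus ?case by (simp add: U0_lin continuous_on_add)
next
case (scale c f)
thus ?case by (simp add: U0_lin scaleC.continuous_on)
next
case (base i)
show ?case unfolding U0_gfam unfolding gfam_def by (rule orbit_continuous) simp
qed

lemma U0_tendsto_time: "((%t. U0 t s f) ---> U0 t0 s f) (at t0 within S)"
proof -
have "isCont (%t. U0 t s f) t0" using U0_continuous_time by (simp add: continuous_on_eq_continuous_at)
thus ?thesis unfolding isCont_def by (rule tendsto_within_subset) simp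
qed

lemma U0_tendsto_inverse: "((%t. U0 0 t f) ---> U0 0 t0 f) (at t0 within S)"
proof -
have "((%t. U0 t 0 (U0 0 t0 f) - U0 t0 0 (U0 0 t0 f)) ---> 0) (at t0 within S)" by (intro LIM_zero U0_tendsto_time)
from tendsto_norm_zero[OF this] have "((%t. norm (U0 0 t (U0 t 0 (U0 0 t0 f) - U0 t0 0 (U0 0 t0 f)))) ---> 0) (at t0 within S)"
 by (simp add: unitary_norm[OF U0_unitary])
hence "((%t. norm (U0 0 t0 f - U0 0 t f)) ---> 0) (at t0 within S)"
 by (simp add: U0_comp U0_id U0_lin)
hence "((%t. norm (U0 0 t f - U0 0 t0 f)) ---> 0) (at t0 within S)" by (simp add: norm_minus_commute)
thus ?thesis by (simp add: tendsto_norm_zero_iff LIM_zero_iff)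
qed

lemma continuous_on_U0:
assumes "continuous_on S f" "continuous_on S p"
shows "continuous_on S (%x. U0 (p x) 0 (f x))" "continuous_on S (%x. U0 0 (p x) (f x))"
proof -
have c: "continuous_on UNIV (%t. U0 0 t f)" for f unfolding continuous_on_def using U0_tendsto_inverse by blast
have l: "(f ---> f a) (at a within S)" "(p ---> p a) (at a within S)" if "a : S" for a
 using assms that by (simp_all add: continuous_on_def)
have 1: "((%x. U0 (p x) 0 (f a)) ---> U0 (p a) 0 (f a)) (at a within S)" "((%x. U0 0 (p x) (f a)) ---> U0 0 (p a) (f a)) (at a within S)" if "a : S" for a
 by (rule continuous_on_tendsto_compose[OF U0_continuous_time l(2)[OF that]]; simp)
  (rule continuous_on_tendsto_compose[OF c l(2)[OF that]]; simp)
show "continuous_on S (%x. U0 (p x) 0 (f x))" unfolding continuous_on_def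
 by (rule ballI, rule unitary_tendsto[OF U0_unitary U0_unitary 1(1) l(1)])
show "continuous_on S (%x. U0 0 (p x) (f x))" unfolding continuous_on_def
 by (rule ballI, rule unitary_tendsto[OF U0_unitary U0_unitary 1(2) l(1)])
qed

lemma continuous_on_U:
assumes "continuous_on S f" "continuous_on S p" "continuous_on S p'"
shows "continuous_on S (%x. U (p x) (p' x) (f x))"
unfolding continuous_on_def
proof
fix a assume "a : S"
hence l: "(f ---> f a) (at a within S)" "(p ---> p a) (at a within S)" "(p' ---> p' a) (at a within S)"
 using assms by (simp_all add: continuous_on_def)
show "((%x. U (p x) (p' x) (f x)) ---> U (p a) (p' a) (f a)) (at a within S)"
 by (rule unitary_tendsto[OF U_unitary U_unitary U_tendsto[OF l(2,3)] l(1)])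
qed

text \<open>The function \<open>h\<close> is approximated by superpositions of Gaussian densities.
  Each of them evolves into a function bounded by \<open>m / (n0 * |zeta|)\<close>, whatever its
  width and centre, so no integral kernel has to be identified.\<close>

lemma U0_dispersive:
assumes f: "sqint f" "integrable lborel f" and h: "sqint h" "integrable lborel h" and z: "zeta t s ~= 0"
shows "cmod (cinner (to_L2 f) (U0 t s (to_L2 h))) <= m / (n0 * abs (zeta t s)) * (LINT x|lborel. cmod (f x)) * (LINT x|lborel. cmod (h x))"
proof -
let ?K = "m / (n0 * abs (zeta t s))"
let ?G = "%n y. orbit s ((exp (- real n))^2) y s"
have b: "cmod (cinner (U0 s t (to_L2 f)) (?G n y)) <= ?K * (LINT x|lborel. cmod (f x))" for n y
proof -
 have e: "0 < (exp (- real n))^2" by simp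
 let ?o = "ofun s ((exp (- real n))^2) y t"
 have "cinner (U0 s t (to_L2 f)) (?G n y) = cinner (to_L2 f) (orbit s ((exp (- real n))^2) y t)"
  unfolding U0_adjoint[symmetric] by (subst U0_orbit) auto
 also have "... = (LINT x|lborel. cnj (f x) * ?o x)" unfolding orbit_ofun(2)[OF e] by (rule cinner_to_L2[OF f(1) orbit_ofun(1)[OF e]])
 also have "cmod ... <= (LINT x|lborel. ?K * cmod (f x))"
  by (rule norm_lebesgue_integral_le) (use f in simp, unfold norm_mult complex_mod_cnj mult.commute[of ?K], rule mult_left_mono[OF ofun_bound[OF e z] norm_ge_zero])
 finally show ?thesis by simp
qed
have "cmod (LINT y|lborel. h y * cinner (U0 s t (to_L2 f)) (?G n y)) <= ?K * (LINT x|lborel. cmod (f x)) * (LINT x|lborel. cmod (h x))" for n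
proof -
 have "cmod (LINT y|lborel. h y * cinner (U0 s t (to_L2 f)) (?G n y)) <= (LINT y|lborel. (?K * (LINT x|lborel. cmod (f x))) * cmod (h y))"
  by (rule norm_lebesgue_integral_le) (use h in simp, unfold norm_mult mult.commute[of "cmod (h _)"], rule mult_right_mono[OF b norm_ge_zero])
 thus ?thesis by simp
qed
hence "cmod (cinner (U0 s t (to_L2 f)) (to_L2 h)) <= ?K * (LINT x|lborel. cmod (f x)) * (LINT x|lborel. cmod (h x))"
 using LIMSEQ_le_const2[OF tendsto_norm[OF orbit_approx[OF h(2,1), of "U0 s t (to_L2 f)" s]]] by blast
thus ?thesis by (simp add: U0_adjoint)
qed

end

section \<open>Weights, interpolated decay and Duhamel's formula\<close>

lemma integral_complex_linear:
fixes a b :: real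
assumes K: "!!r. complex_linear (K r)" "!!f. continuous_on {a..b} (%r. K r f)"
shows "complex_linear (%f. integral {a..b} (%r. K r f))"
unfolding complex_linear_def
proof (intro conjI allI)
note i = ici[OF K(2)]
show "integral {a..b} (%r. K r (f + g)) = integral {a..b} (%r. K r f) + integral {a..b} (%r. K r g)" for f g
 unfolding clinD(1)[OF K(1)] by (intro integral_add i)
show "integral {a..b} (%r. K r (c *C f)) = c *C integral {a..b} (%r. K r f)" for c f
 unfolding clinD(2)[OF K(1)] using integral_linear[OF i[of f] scaleC.bounded_linear_right[of c]] by (simp add: o_def)
qed

lemma integral_cinner:
"continuous_on {a..b} F ==> cinner h (integral {a..b} F) = integral {a..b} (%r. cinner h (F r))"
"continuous_on {a..b} F ==> cinner (integral {a..b} F) h = integral {a..b} (%r. cinner (F r) h)" for F :: "real => L2"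
using integral_linear[OF ici cinner.bounded_linear_right, of a b F h]
 integral_linear[OF ici cinner.bounded_linear_left, of a b F h] by (simp_all add: o_def)

lemma norm_integral_le_integral:
fixes F :: "real => 'b::banach"
assumes "continuous_on {a..b} F" "continuous_on {a..b} g" "!!r. r : {a..b} ==> norm (F r) <= g r"
shows "norm (integral {a..b} F) <= integral {a..b} g"
by (intro integral_norm_bound_integral ici assms)

lemma integral_Cauchy_Schwarz:
fixes f g :: "real => real"
assumes f: "continuous_on {a..b} f" and g: "continuous_on {a..b} g"
shows "(integral {a..b} (%r. f r * g r))^2 <= integral {a..b} (%r. (f r)^2) * integral {a..b} (%r. (g r)^2)" (is "?D^2 <= ?A * ?C")
proof -
have i: "(%r. (f r)^2) integrable_on {a..b}" "(%r. (g r)^2) integrable_on {a..b}" "(%r. f r * g r) integrable_on {a..b}"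
 by (intro ici continuous_intros f g)+
have q: "0 <= t^2 * ?A - 2 * t * ?D + ?C" for t
proof -
 have "0 <= integral {a..b} (%r. (t * f r - g r)^2)" by (intro integral_nonneg ici continuous_intros f g) auto
 also have "(%r. (t * f r - g r)^2) = (%r. t^2 * (f r)^2 - 2 * t * (f r * g r) + (g r)^2)"
  by (rule ext) (simp add: p2es algebra_simps)
 also have "integral {a..b} ... = t^2 * ?A - 2 * t * ?D + ?C"
  by (intro integral_unique has_integral_add has_integral_diff has_integral_mult_right integrable_integral i)
 finally show ?thesis .
qed
have A: "0 <= ?A" by (intro integral_nonneg i) auto
show ?thesis
proof (cases "?A = 0")
 case True
 have "?D = 0"
 proof (rule ccontr)
  assume "?D ~= 0"
  thus False using q[of "(?C + 1) / (2 * ?D)"] True by (simp add: field_simps)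
 qed
 thus ?thesis using True by simp
next
 case False
 hence "0 < ?A" using A by simp
 with q[of "?D / ?A"] have "?D^2 / ?A <= ?C" by (simp add: p2es field_simps)
 thus ?thesis using `0 < ?A` by (simp add: field_simps)
qed
qed

definition mw :: "(real^2 => real) => L2 => L2" where "mw w = mulop (%x. of_real (w x))"

definition bweight :: "real => (real^2 => real) => bool" where
"bweight M w \<longleftrightarrow> w : bmf borel & (ALL x. abs (w x) <= M)"

lemma bweight_bdd: "bweight M w ==> bdd_borel (%x. of_real (w x))"
unfolding bdd_borel_def bweight_def bounded_iff by (auto intro!: measurable_compose[OF _ borel_measurable_of_real])

lemma bweight_nonneg: "bweight M w ==> 0 <= M"
unfolding bweight_def by (meson abs_ge_zero order_trans)

lemma mw_norm: "bweight M w ==> norm (mw w F) <= M * norm F"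
unfolding mw_def by (rule norm_mulop_le[OF bweight_bdd]) (auto simp: bweight_def)

lemma mw_linear: "bweight M w ==> complex_linear (mw w)" and mw_bounded_linear: "bweight M w ==> bounded_linear (mw w)"
unfolding mw_def by (blast intro: complex_linear_mulop bounded_linear_mulop bweight_bdd)+

lemma mw_cinner: "bweight M w ==> cinner (mw w F) G = cinner F (mw w G)"
unfolding mw_def using mulop_cinner[OF bweight_bdd] by simp

lemma mw_mw: "bweight M w ==> bweight M' w' ==> mw w (mw w' F) = mw (%x. w x * w' x) F"
unfolding mw_def by (simp add: mulop_mulop bweight_bdd)

lemma continuous_on_mw: "bweight M w ==> continuous_on S f ==> continuous_on S (%x. mw w (f x))"
by (rule bounded_linear.continuous_on[OF mw_bounded_linear])

text \<open>Splitting at level \<open>de\<close>: where \<open>w > de\<close> one has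
  \<open>w^2 <= de^(2 - p) * w^p\<close>, so the large part of an L^p weight is square integrable,
  while the small part is bounded by \<open>de\<close>.\<close>

definition big :: "real => (real^2 => real) => real^2 => real" where "big de w x = (if de < w x then w x else 0)"
definition small :: "real => (real^2 => real) => real^2 => real" where "small de w x = (if de < w x then 0 else w x)"

locale Lp_weight =
fixes p M :: real and w :: "real^2 => real"
assumes p: "2 < p" and w: "bweight M w" and w_nonneg: "!!x. 0 <= w x" and w_Lp: "integrable lborel (%x. w x powr p)"
begin

definition "Np = (LINT x|lborel. w x powr p)"

lemma big_bweight: "bweight M (big de w)" and small_bweight: "0 <= de ==> bweight de (small de w)"
proof -
have [measurable]: "w : bmf borel" using w by (simp add: bweight_def)
show "bweight M (big de w)" using w bweight_nonneg[OF w] unfolding bweight_def big_def[abs_def] by auto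
show "bweight de (small de w)" if "0 <= de" using that w_nonneg unfolding bweight_def small_def[abs_def] by auto
qed

lemma big_small: "0 <= de ==> mw w F = mw (big de w) F + mw (small de w) F"
proof -
assume d: "0 <= de"
obtain f where f: "sqint f" "F = to_L2 f" by (metis obtain_rep)
have "(%x. of_real (w x) * f x) = (%x. of_real (big de w x) * f x + of_real (small de w x) * f x)"
 by (rule ext) (simp add: big_def small_def)
thus ?thesis unfolding mw_def f(2)
 using f(1) bweight_bdd[OF w] bweight_bdd[OF big_bweight[of de]] bweight_bdd[OF small_bweight[OF d]]
 by (simp add: mulop_to_L2 to_L2_add square_integrable_bdd)
qed

lemma big_L2:
assumes d: "0 < de"
shows "sqint (%x. of_real (big de w x))" "norm (to_L2 (%x. of_real (big de w x))) <= sqrt (de powr (2 - p) * Np)"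
proof -
have [measurable]: "big de w : bmf borel" using big_bweight by (simp add: bweight_def)
have b: "(big de w x)^2 <= de powr (2 - p) * w x powr p" for x
proof (cases "de < w x")
 case True
 hence "(w x)^2 = w x powr (2 - p) * w x powr p" using d by (simp add: powr_add[symmetric] powr_numeral)
 also have "... <= de powr (2 - p) * w x powr p" using True d p by (intro mult_right_mono powr_mono2') auto
 finally show ?thesis using True by (simp add: big_def)
qed (simp add: big_def)
have i: "integrable lborel (%x. de powr (2 - p) * w x powr p)" using w_Lp by simp
have i2: "integrable lborel (%x. (big de w x)^2)"
 by (rule int_bound[OF i]) (use b in auto)
show s: "sqint (%x. of_real (big de w x))" unfolding square_integrable_def using i2 by simp
have "(norm (to_L2 (%x. cor (big de w x))))^2 = (LINT x|lborel. (big de w x)^2)" using norm_to_L2_sq[OF s] by simp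
also have "... <= de powr (2 - p) * Np" using integral_mono[OF i2 i b] by (simp add: Np_def)
finally show "norm (to_L2 (%x. cor (big de w x))) <= sqrt (de powr (2 - p) * Np)" by (rule real_le_rsqrt)
qed

end

lemma square_weight_L1:
assumes w: "bweight M w" "sqint (%x. of_real (w x))" and f: "sqint f"
shows "mw w (to_L2 f) = to_L2 (%x. of_real (w x) * f x)" "sqint (%x. of_real (w x) * f x)" "integrable lborel (%x. of_real (w x) * f x)"
 "(LINT x|lborel. cmod (of_real (w x) * f x)) <= norm (to_L2 (%x. of_real (w x))) * norm (to_L2 f)"
proof -
note [simp] = bweight_bdd[OF w(1)]
show "mw w (to_L2 f) = to_L2 (%x. of_real (w x) * f x)" using f by (simp add: mw_def mulop_to_L2)
show "sqint (%x. of_real (w x) * f x)" using f by (simp add: square_integrable_bdd)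
show i: "integrable lborel (%x. of_real (w x) * f x)" using square_integrable_mult[OF w(2) f] by simp
have ab: "sqint (%x. cor (cmod (g x)))" "norm (to_L2 (%x. cor (cmod (g x)))) = norm (to_L2 g)" if g: "sqint g" for g
proof -
 have [measurable]: "g : bmf lborel" using g by (simp add: square_integrable_def)
 show s: "sqint (%x. cor (cmod (g x)))" using g by (simp add: square_integrable_def)
 hence "(norm (to_L2 (%x. cor (cmod (g x)))))^2 = (norm (to_L2 g))^2" using g by (simp add: norm_to_L2_sq)
 thus "norm (to_L2 (%x. cor (cmod (g x)))) = norm (to_L2 g)" by simp
qed
have "cor (LINT x|lborel. cmod (of_real (w x) * f x)) = cinner (to_L2 (%x. of_real (cmod (of_real (w x))))) (to_L2 (%x. of_real (cmod (f x))))"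
 unfolding cinner_to_L2[OF ab(1)[OF w(2)] ab(1)[OF f]] integral_complex_of_real[symmetric] by (simp add: norm_mult)
hence "(LINT x|lborel. cmod (of_real (w x) * f x)) <= cmod (cinner (to_L2 (%x. of_real (cmod (of_real (w x))))) (to_L2 (%x. of_real (cmod (f x)))))"
 by (metis abs_ge_self norm_of_real)
also have "... <= norm (to_L2 (%x. of_real (w x))) * norm (to_L2 f)"
 by (rule order_trans[OF cinner_Cauchy_Schwarz]) (use ab(2)[OF w(2)] ab(2)[OF f] in simp)
finally show "(LINT x|lborel. cmod (of_real (w x) * f x)) <= norm (to_L2 (%x. of_real (w x))) * norm (to_L2 f)" .
qed

context schrodinger_flow begin

lemma weighted_dispersive:
assumes f: "sqint f" "integrable lborel f" and b: "bweight M b" "sqint (%x. of_real (b x))" and z: "zeta t s ~= 0"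
shows "cmod (cinner (to_L2 f) (U0 t s (mw b H))) <= m / (n0 * abs (zeta t s)) * (LINT x|lborel. cmod (f x)) * (norm (to_L2 (%x. of_real (b x))) * norm H)"
proof -
obtain h where h: "sqint h" "H = to_L2 h" by (metis obtain_rep)
note L = square_weight_L1[OF b h(1)]
show ?thesis unfolding h(2) L(1)
 by (rule order_trans[OF U0_dispersive[OF f L(2,3) z]], rule mult_left_mono[OF L(4)]) (use m_pos n0_pos in "simp add: mult_nonneg_nonneg")
qed

text \<open>Interpolation by hand. Both weights are split at a level depending on
  \<open>zeta\<close>: every term with a small part gains the level itself, and the term with two
  large parts, square integrable, is covered by the dispersive estimate.\<close>

lemma weighted_decay:
assumes "Lp_weight p M1 w1" "Lp_weight p M2 w2"
shows "EX C>=0. ALL t s F H. cmod (cinner F (mw w1 (U0 t s (mw w2 H)))) <= C * damp (1 / p) (zeta t s) * (norm F * norm H)"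
proof -
interpret a: Lp_weight p M1 w1 by fact
interpret b: Lp_weight p M2 w2 by fact
note M = bweight_nonneg[OF a.w] bweight_nonneg[OF b.w]
have N: "0 <= a.Np" "0 <= b.Np" unfolding a.Np_def b.Np_def by (intro integral_nonneg_AE; simp)+
define D where "D = m / n0 * sqrt (a.Np * b.Np)"
define C where "C = M1 * M2 + M1 + M2 + D"
have D: "0 <= D" using m_pos n0_pos N by (simp add: D_def)
have C: "0 <= C" using M D by (simp add: C_def)
have "cmod (cinner F (mw w1 (U0 t s (mw w2 H)))) <= C * damp (1 / p) (zeta t s) * (norm F * norm H)" for t s F H
proof -
 let ?P = "norm F * norm H" and ?z = "abs (zeta t s)"
 have gen: "cmod (cinner F (mw u (U0 t s (mw v H)))) <= K * L * ?P" if uv: "bweight K u" "bweight L v" for u v K L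
 proof -
  have "norm (mw u (U0 t s (mw v H))) <= K * (L * norm H)"
   using mw_norm[OF uv(2), of H] bweight_nonneg[OF uv(1)]
   by (intro order_trans[OF mw_norm[OF uv(1)]] mult_left_mono) (simp_all add: unitary_norm[OF U0_unitary])
  thus ?thesis
   by (intro order_trans[OF cinner_Cauchy_Schwarz]) (use mult_left_mono[of _ _ "norm F"] in "fastforce simp: mult_ac")
 qed
 show ?thesis
 proof (cases "?z < 1")
  case True
  hence "damp (1 / p) (zeta t s) = 1" by (simp add: damp_def max_def)
  moreover have "M1 * M2 * ?P <= C * ?P" using M D by (intro mult_right_mono) (auto simp: C_def)
  ultimately show ?thesis using gen[OF a.w b.w] by simp
 next
  case False
  \<comment> \<open>With this level the large-large term is of order
    \<open>|zeta|^-1 * de^(2 - p) = |zeta|^(-2 / p)\<close>, at most \<open>de\<close> because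
    \<open>|zeta| >= 1\<close>.\<close>
  define de where "de = ?z powr - (1 / p)"
  have d: "0 < de" "damp (1 / p) (zeta t s) = de" and z: "zeta t s ~= 0" using False by (auto simp: de_def damp_def max_def)
  note bw = a.big_bweight[of de] a.small_bweight[of de] b.big_bweight[of de] b.small_bweight[of de]
  note lin = U0_lin(1) clinD(1)[OF mw_linear[OF a.big_bweight]]
  have bb: "cmod (cinner F (mw (big de w1) (U0 t s (mw (big de w2) H)))) <= de * D * ?P"
  proof -
   obtain f where f: "sqint f" "F = to_L2 f" by (metis obtain_rep)
   note L = square_weight_L1[OF bw(1) a.big_L2(1)[OF d(1)] f(1)]
   let ?A = "norm (to_L2 (%x. cor (big de w1 x)))" and ?B = "norm (to_L2 (%x. cor (big de w2 x)))"
   have "cmod (cinner F (mw (big de w1) (U0 t s (mw (big de w2) H)))) = cmod (cinner (mw (big de w1) F) (U0 t s (mw (big de w2) H)))"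
    by (simp add: mw_cinner[OF bw(1)])
   also have "... <= m / (n0 * ?z) * (LINT x|lborel. cmod (of_real (big de w1 x) * f x)) * (?B * norm H)"
    unfolding f(2) L(1) by (rule weighted_dispersive[OF L(2,3) bw(3) b.big_L2(1)[OF d(1)] z])
   also have "... <= m / (n0 * ?z) * (?A * norm F) * (?B * norm H)"
    unfolding f(2) using m_pos n0_pos by (intro mult_right_mono mult_left_mono L(4)) auto
   also have "... = m / (n0 * ?z) * (?A * ?B) * ?P" by simp
   also have "... <= m / (n0 * ?z) * (sqrt (de powr (2 - p) * a.Np) * sqrt (de powr (2 - p) * b.Np)) * ?P"
    using m_pos n0_pos N by (intro mult_right_mono mult_left_mono mult_mono a.big_L2(2) b.big_L2(2) d(1)) auto
   also have "sqrt (de powr (2 - p) * a.Np) * sqrt (de powr (2 - p) * b.Np) = de powr (2 - p) * sqrt (a.Np * b.Np)"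
    by (simp add: real_sqrt_mult mult_ac)
   also have "m / (n0 * ?z) * (de powr (2 - p) * sqrt (a.Np * b.Np)) * ?P = (1 / ?z * de powr (2 - p)) * D * ?P"
    by (simp add: D_def mult_ac)
   also have "... <= de * D * ?P"
   proof (intro mult_right_mono D)
    have "1 / ?z = ?z powr - 1" using z by (simp add: powr_minus divide_inverse)
    hence "1 / ?z * de powr (2 - p) = ?z powr (- 1 + - (1 / p) * (2 - p))"
     unfolding de_def powr_powr powr_add by simp
    also have "... <= ?z powr - (1 / p)" using False a.p by (intro powr_mono) (auto simp: field_simps)
    finally show "1 / ?z * de powr (2 - p) <= de" by (simp add: de_def)
   qed auto
   finally show ?thesis .
  qed
  have "cinner F (mw w1 (U0 t s (mw w2 H))) = cinner F (mw (small de w1) (U0 t s (mw w2 H)))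
    + cinner F (mw (big de w1) (U0 t s (mw (small de w2) H))) + cinner F (mw (big de w1) (U0 t s (mw (big de w2) H)))"
  proof -
   have 1: "mw w1 (U0 t s (mw w2 H)) = mw (big de w1) (U0 t s (mw w2 H)) + mw (small de w1) (U0 t s (mw w2 H))"
    by (rule a.big_small) (use d in simp)
   have 2: "mw (big de w1) (U0 t s (mw w2 H)) = mw (big de w1) (U0 t s (mw (big de w2) H)) + mw (big de w1) (U0 t s (mw (small de w2) H))"
    using b.big_small[of de H] d by (simp add: lin)
   show ?thesis unfolding 1 2 by (simp add: cinner.add_right)
  qed
  also have "cmod ... <= de * M2 * ?P + M1 * de * ?P + de * D * ?P"
   by (intro order_trans[OF norm_triangle_ineq] add_mono bb gen[OF bw(2) b.w] gen[OF bw(1,4)] less_imp_le[OF d(1)])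
  also have "... = (M1 + M2 + D) * de * ?P" by (simp add: algebra_simps)
  also have "... <= C * de * ?P" using M d(1) by (intro mult_right_mono) (auto simp: C_def)
  finally show ?thesis unfolding d(2) .
 qed
qed
thus ?thesis using C by blast
qed

lemma Vop_continuous: "continuous_on S f ==> continuous_on S (%x. Vop (f x))"
by (rule bounded_linear.continuous_on[OF Vop_bounded_linear])

lemma Vop_cinner: "cinner (Vop F) G = cinner F (Vop G)"
by (simp add: Vop_def mulop_cinner[OF bdd_borel_V])

text \<open>On \<open>gfam\<close> the integrand is the derivative in r of
  \<open>U 0 r (U0 r 0 f)\<close>, so the fundamental theorem applies. Both sides are bounded
  operators, and totality does the rest.\<close>

lemma duhamel:
assumes b: "0 <= b"
shows "U 0 b (U0 b 0 f) - f = integral {0..b} (%r. \<i> *C U 0 r (Vop (U0 r 0 f)))"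
proof -
note lin = U0_lin U_lin
have c: "continuous_on S (%r. \<i> *C U 0 r (Vop (U0 r 0 f)))" for f S
 by (intro scaleC.continuous_on continuous_on_const continuous_on_U Vop_continuous continuous_on_U0 continuous_on_id)
have cl: "complex_linear (%f. \<i> *C U 0 r (Vop (U0 r 0 f)))" for r
 unfolding complex_linear_def by (simp add: lin clinD[OF Vop_linear] scaleC_add_right mult.commute)
have cL: "complex_linear (%f. integral {0..b} (%r. \<i> *C U 0 r (Vop (U0 r 0 f))))" by (rule integral_complex_linear[OF cl c])
have V: "norm (Vop f) <= Vb * norm f" for f
 unfolding Vop_def by (rule norm_mulop_le[OF bdd_borel_V]) (simp add: V_bounded)
have cA: "complex_linear (%f. U 0 b (U0 b 0 f) - f)"
 unfolding complex_linear_def by (simp add: lin scaleC.diff_right algebra_simps)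
show ?thesis
proof (rule total_eq[OF total_gfam[of 0], where A="%f. U 0 b (U0 b 0 f) - f" and B="%f. integral {0..b} (%r. \<i> *C U 0 r (Vop (U0 r 0 f)))"])
 have "norm (U 0 b (U0 b 0 f) - f) <= 2 * norm f" for f
  using norm_triangle_ineq4[of "U 0 b (U0 b 0 f)" f] by (simp add: unitary_norm[OF U_unitary] unitary_norm[OF U0_unitary])
 thus "bounded_linear (%f. U 0 b (U0 b 0 f) - f)" by (rule bounded_linearI_complex[OF cA])
 have "norm (integral {0..b} (%r. \<i> *C U 0 r (Vop (U0 r 0 f)))) <= (Vb * b) * norm f" for f
 proof -
  have "norm (integral {0..b} (%r. \<i> *C U 0 r (Vop (U0 r 0 f)))) <= (Vb * norm f) * (b - 0)"
   using V by (intro integral_bound b c) (simp add: norm_scaleC unitary_norm[OF U_unitary], metis unitary_norm[OF U0_unitary])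
  thus ?thesis by (simp add: mult_ac)
 qed
 thus "bounded_linear (%f. integral {0..b} (%r. \<i> *C U 0 r (Vop (U0 r 0 f))))" by (rule bounded_linearI_complex[OF cL])
 show "U 0 b (U0 b 0 (c *C f)) - c *C f = c *C (U 0 b (U0 b 0 f) - f)" for c f by (rule clinD(2)[OF cA])
 show "integral {0..b} (%r. \<i> *C U 0 r (Vop (U0 r 0 (c *C f)))) = c *C integral {0..b} (%r. \<i> *C U 0 r (Vop (U0 r 0 f)))" for c f
  by (rule clinD(2)[OF cL])
 fix i
 have "((%r. \<i> *C U 0 r (Vop (gfam r i))) has_integral (U 0 b (gfam b i) - U 0 0 (gfam 0 i))) {0..b}"
  by (rule fundamental_theorem_of_calculus[OF b]) (auto simp: gfam_def intro!: has_vector_derivative_at_within U_orbit_derivative)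
 thus "U 0 b (U0 b 0 (gfam 0 i)) - gfam 0 i = integral {0..b} (%r. \<i> *C U 0 r (Vop (U0 r 0 (gfam 0 i))))"
  by (simp add: U0_gfam U_id integral_unique)
qed
qed

text \<open>The deviation from 1 of the one-period wave operator: with S and S0 the two monodromy
  operators, \<open>S = S0 (1 + Aop)\<close>.\<close>

definition "Aop f = U0 0 T (U T 0 f) - f"

lemma Aop_linear: "complex_linear Aop"
unfolding Aop_def complex_linear_def
by (simp add: U0_lin U_lin scaleC.diff_right algebra_simps)

lemma U_adjoint: "cinner f (U t s g) = cinner (U s t f) g"
using unitary_cinner[OF U_unitary[of s t], of f "U t s g"] by (simp add: U_comp U_id)

text \<open>The adjoint of \<open>duhamel\<close>. The perturbed propagator now acts first, so that
  a weight can be placed between it and the free one on either side.\<close>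

lemma Aop_duhamel: "Aop f = itg T (%r. - \<i> *C U0 0 r (Vop (U r 0 f)))"
proof (rule cinner_extI)
fix h
have c: "continuous_on S (%r. \<i> *C U 0 r (Vop (U0 r 0 h)))" "continuous_on S (%r. - \<i> *C U0 0 r (Vop (U r 0 f)))" for S
 by (intro scaleC.continuous_on continuous_on_const continuous_on_U Vop_continuous continuous_on_U0 continuous_on_id)+
have "cinner h (Aop f) = cinner (U 0 T (U0 T 0 h) - h) f"
 by (simp add: Aop_def U0_adjoint U_adjoint cinner.diff_left cinner.diff_right)
also have "... = itg T (%r. cinner (\<i> *C U 0 r (Vop (U0 r 0 h))) f)"
 using T_pos by (simp add: duhamel integral_cinner(2)[OF c(1)])
also have "... = itg T (%r. cinner h (- \<i> *C U0 0 r (Vop (U r 0 f))))"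
 by (simp add: U0_adjoint Vop_cinner U_adjoint[symmetric])
finally show "cinner h (Aop f) = cinner h (itg T (%r. - \<i> *C U0 0 r (Vop (U r 0 f))))"
 by (simp add: integral_cinner(1)[OF c(2)])
qed

end

lemma damp_square: "(damp xep z)^2 = damp (2 * xep) z"
by (simp add: damp_def p2es powr_add[symmetric])

lemma damp_sqrt: "sqrt (damp (2 / p) z) = damp (1 / p) z"
by (rule real_sqrt_unique) (simp_all add: damp_square damp_nonneg)

section \<open>The weighted seminorm and the decay of T_n\<close>

locale schrodinger_Lp = schrodinger_flow +
fixes p :: real
assumes p: "2 < p" and V_Lp: "integrable lborel (%x. sqrt (abs (V x)) powr p)"
begin

definition "rho x = sqrt (abs (V x))"
definition "Mr = sqrt Vb"

lemma V_measurable [measurable]: "V : bmf borel"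
by (rule bmci[OF V_continuous])

lemma rho_weight: "Lp_weight p Mr rho"
using p V_Lp V_bounded by unfold_locales (auto simp: bweight_def rho_def[abs_def] Mr_def)

sublocale rho: Lp_weight p Mr rho by (rule rho_weight)

lemma sgn_weight: "bweight 1 (%x. sgn (V x))"
unfolding bweight_def by (auto simp: abs_sgn_eq)

lemma Mr_nonneg: "0 <= Mr" by (rule bweight_nonneg[OF rho.w])

text \<open>\<open>V\<close> is factored as the product of \<open>rho\<close> and \<open>sgn V * rho\<close>.\<close>

definition Yv :: "L2 => real => L2" where "Yv f r = - \<i> *C mw (%x. sgn (V x)) (mw rho (U r 0 f))"

lemma Vop_factor: "Vop f = mw rho (mw (%x. sgn (V x)) (mw rho f))"
proof -
have "bweight Mr (%x. sgn (V x) * rho x)"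
 using rho.w by (auto simp: bweight_def abs_mult abs_sgn_eq rho_def[abs_def] Mr_def intro: order_trans[OF _ real_sqrt_le_mono[OF V_bounded]])
hence "mw rho (mw (%x. sgn (V x)) (mw rho f)) = mw (%x. rho x * (sgn (V x) * rho x)) f"
 by (simp add: mw_mw[OF sgn_weight rho.w] mw_mw[OF rho.w])
also have "(%x. rho x * (sgn (V x) * rho x)) = V"
proof
 fix x
 have "rho x * (sgn (V x) * rho x) = sgn (V x) * (sqrt (abs (V x)) * sqrt (abs (V x)))" by (simp add: rho_def)
 also have "... = V x" by (simp add: sgn_mult_abs)
 finally show "rho x * (sgn (V x) * rho x) = V x" .
qed
finally show ?thesis by (simp add: Vop_def mw_def)
qed

lemma Yv_linear: "complex_linear (%f. Yv f r)"
unfolding Yv_def complex_linear_def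
by (simp add: U_lin clinD[OF mw_linear[OF rho.w]]
  clinD[OF mw_linear[OF sgn_weight]] scaleC_add_right mult.commute)

lemma Yv_continuous: "continuous_on S (Yv f)"
unfolding Yv_def[abs_def]
by (intro scaleC.continuous_on continuous_on_const continuous_on_mw[OF sgn_weight] continuous_on_mw[OF rho.w] continuous_on_U continuous_on_id)

lemma Yv_norm: "norm (Yv f r) <= norm (mw rho (U r 0 f))"
using mw_norm[OF sgn_weight, of "mw rho (U r 0 f)"] by (simp add: Yv_def norm_scaleC)

lemma continuous_mwU0: "bweight M w ==> continuous_on S f ==> continuous_on S (%r. U0 0 r (mw w (f r)))"
by (intro continuous_on_U0 continuous_on_mw[of M w] continuous_on_id)

lemma Aop_Yv: "Aop f = itg T (%r. U0 0 r (mw rho (Yv f r)))"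
unfolding Aop_duhamel Yv_def Vop_factor
by (simp add: U0_lin(2) clinD(2)[OF mw_linear[OF rho.w]])

definition "Rt t f = mw rho (U0 t 0 f)"

lemma Rt_continuous: "continuous_on S (%t. Rt (t + a) f)"
unfolding Rt_def by (intro continuous_on_mw[OF rho.w] continuous_on_U0 continuous_intros)

lemma Rt_linear: "complex_linear (Rt t)"
unfolding Rt_def[abs_def] complex_linear_def
by (simp add: U0_lin clinD[OF mw_linear[OF rho.w]])

text \<open>The form of the seminorm in which T_n decays, in the spirit of Kato smoothness: only the
  weighted free evolution over one period is recorded. It may be degenerate, which is why a
  semi-inner product is used.\<close>

definition "BG f h = itg T (%t. cinner (Rt t f) (Rt t h))"

lemma BG_continuous: "continuous_on S (%t. cinner (Rt t f) (Rt t h))"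
using cinner.continuous_on[OF Rt_continuous[of S 0 f] Rt_continuous[of S 0 h]] by simp

sublocale G: semi_inner_product BG
proof
have i: "(%t. cinner (Rt t x) (Rt t y)) integrable_on {0..T}" for x y by (rule ici[OF BG_continuous])
fix x y z c
show "BG x (y + z) = BG x y + BG x z" unfolding BG_def clinD[OF Rt_linear] cinner.add_right by (intro integral_add i)
show "BG x (c *C y) = c * BG x y" unfolding BG_def clinD[OF Rt_linear] by simp
show "BG y x = cnj (BG x y)" unfolding BG_def
 by (subst cinner_commute) (use integral_linear[OF i[of x y] bounded_linear_cnj] in "simp add: o_def")
have "Re (BG x x) = itg T (%t. (norm (Rt t x))^2)"
 unfolding BG_def using integral_linear[OF i[of x x] bounded_linear_Re] by (simp add: o_def norm_L2_sq)
also have "... >= 0" by (rule integral_nonneg) (auto intro!: ici continuous_intros Rt_continuous[of _ 0, simplified])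
finally show "0 <= Re (BG x x)" .
qed

abbreviation "gn \<equiv> G.seminorm"

lemma gn_square: "(gn f)^2 = itg T (%t. (norm (Rt t f))^2)"
proof -
have "(gn f)^2 = Re (BG f f)" using G.nonneg by (simp add: G.seminorm_def)
thus ?thesis
 unfolding BG_def using integral_linear[OF ici[OF BG_continuous] bounded_linear_Re, of 0 T f f]
 by (simp add: o_def norm_L2_sq)
qed

lemma continuous_norm_sq: "continuous_on S F ==> continuous_on S (%t. (norm (F t :: L2))^2)"
by (intro continuous_intros)

lemma gn_le:
assumes "continuous_on {0..T} h" "!!t. t : {0..T} ==> norm (Rt t f) <= sqrt (h t)" "itg T h <= K^2" "0 <= K" "!!t. 0 <= h t"
shows "gn f <= K"
proof (rule power2_le_imp_le[OF _ assms(4)])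
have "(gn f)^2 <= itg T h"
 unfolding gn_square
proof (rule integral_le)
 show "(norm (Rt t f))^2 <= h t" if "t : {0..T}" for t
  using power_mono[OF assms(2)[OF that], of 2] assms(5)[of t] by simp
qed (use Rt_continuous[of _ 0] assms(1) in "auto intro!: ici continuous_norm_sq")
thus "(gn f)^2 <= K^2" using assms(3) by simp
qed

definition "CY = sqrt (2 + 2 * (Mr^2 * T)^2)"

lemma CY_nonneg: "0 <= CY" by (simp add: CY_def)

text \<open>By Duhamel over a single period, the perturbed evolution differs from the free one by at
  most \<open>Mr\<close> times the integral of \<open>norm (Rt s f)\<close>. So the weighted
  perturbed evolution is controlled by the weighted free one, and \<open>CY\<close> collects the
  constants.\<close>

lemma Yv_bound: "itg T (%r. (norm (Yv f r))^2) <= (CY * gn f)^2"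
proof -
have T0: "0 <= T" using T_pos by simp
let ?I = "itg T (%s. norm (Rt s f))"
have ci: "(%s. Mr * norm (Rt s f)) integrable_on {a..b}" for a b
 by (intro ici continuous_intros Rt_continuous[of _ 0, simplified])
have I: "?I^2 <= T * (gn f)^2"
 using integral_Cauchy_Schwarz[of 0 T "%_. 1" "%s. norm (Rt s f)"] T0 Rt_continuous[of _ 0 f]
 by (simp add: gn_square continuous_on_norm)
have Y: "norm (Yv f r) <= norm (Rt r f) + Mr^2 * ?I" if r: "r : {0..T}" for r
proof -
 have lin: "U 0 r (U r 0 f - U0 r 0 f) = - (U 0 r (U0 r 0 f) - f)"
  by (simp add: U_lin U_comp U_id)
 have "norm (U r 0 f - U0 r 0 f) = norm (U 0 r (U0 r 0 f) - f)"
  using unitary_norm[OF U_unitary, of 0 r "U r 0 f - U0 r 0 f"] unfolding lin by (simp add: norm_minus_commute)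
 also have "... <= integral {0..r} (%s. Mr * norm (Rt s f))"
  unfolding duhamel[of r f, OF atLeastAtMost_iff[THEN iffD1, OF r, THEN conjunct1]]
 proof (rule norm_integral_le_integral)
  show "continuous_on {0..r} (%s. \<i> *C U 0 s (Vop (U0 s 0 f)))"
   by (intro scaleC.continuous_on continuous_on_const continuous_on_U Vop_continuous continuous_on_U0 continuous_on_id)
  show "continuous_on {0..r} (%s. Mr * norm (Rt s f))" by (intro continuous_intros Rt_continuous[of _ 0, simplified])
  show "norm (\<i> *C U 0 s (Vop (U0 s 0 f))) <= Mr * norm (Rt s f)" for s
   using order_trans[OF mw_norm[OF rho.w] mult_left_mono[OF mw_norm[OF sgn_weight] Mr_nonneg], of "Rt s f"]
   by (simp add: norm_scaleC unitary_norm[OF U_unitary] Vop_factor Rt_def)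
 qed
 also have "... <= itg T (%s. Mr * norm (Rt s f))"
  using r Mr_nonneg by (intro integral_subset_le) (auto intro: ci)
 also have "... = Mr * ?I" by simp
 finally have "norm (mw rho (U r 0 f - U0 r 0 f)) <= Mr * (Mr * ?I)"
  by (rule order_trans[OF mw_norm[OF rho.w] mult_left_mono[OF _ Mr_nonneg]])
 moreover have "mw rho (U r 0 f) = Rt r f + mw rho (U r 0 f - U0 r 0 f)"
  by (simp add: Rt_def clinD[OF mw_linear[OF rho.w]])
 ultimately show ?thesis
  using Yv_norm[of f r] norm_triangle_ineq[of "Rt r f" "mw rho (U r 0 f - U0 r 0 f)"] by (simp add: p2es mult.assoc)
qed
have "itg T (%r. (norm (Yv f r))^2) <= itg T (%r. 2 * (norm (Rt r f))^2 + 2 * (Mr^2 * ?I)^2)"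
proof (rule integral_le)
 fix r assume r: "r : {0..T}"
 have "(norm (Yv f r))^2 <= (norm (Rt r f) + Mr^2 * ?I)^2" using Y[OF r] by (intro power_mono) auto
 also have "... <= 2 * (norm (Rt r f))^2 + 2 * (Mr^2 * ?I)^2"
  using sum_squares_bound[of "norm (Rt r f)" "Mr^2 * ?I"] by (simp add: power2_sum)
 finally show "(norm (Yv f r))^2 <= 2 * (norm (Rt r f))^2 + 2 * (Mr^2 * ?I)^2" .
qed (auto intro!: ici continuous_intros Yv_continuous Rt_continuous[of _ 0, simplified])
also have "... = 2 * (gn f)^2 + T * (2 * (Mr^2 * ?I)^2)"
 unfolding gn_square using T0 
 by (subst integral_add) (auto intro!: ici continuous_intros Rt_continuous[of _ 0, simplified])
also have "... = 2 * (gn f)^2 + 2 * T * Mr ^ 4 * ?I^2" by (simp add: pmd)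
also have "... <= 2 * (gn f)^2 + 2 * T * Mr ^ 4 * (T * (gn f)^2)" using I T0 by (intro add_left_mono mult_left_mono) auto
also have "... = (CY * gn f)^2"
 by (simp add: CY_def pmd p2es[of T] distrib_right)
finally show ?thesis .
qed

text \<open>The common part of the decay estimates: \<open>Aop\<close> is written as an integral
  over one period, \<open>d\<close> is the decay of the free evolution from time r to
  \<open>ta\<close>, and Cauchy-Schwarz in r brings in \<open>Yv_bound\<close>.\<close>

lemma Aop_pairing:
assumes d: "continuous_on {0..T} d" "!!r H. r : {0..T} ==> cmod (cinner g (U0 ta r (mw rho H))) <= K * d r * norm H" and K: "0 <= K"
shows "cmod (cinner g (U0 ta 0 (Aop f))) <= K * sqrt (itg T (%r. (d r)^2)) * (CY * gn f)"
proof -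
have c: "continuous_on S (%r. U0 0 r (mw rho (Yv f r)))" for S by (intro continuous_mwU0[OF rho.w] Yv_continuous)
have cy: "continuous_on S (%r. norm (Yv f r))" for S by (intro continuous_on_norm Yv_continuous)
have eq: "cinner g (U0 ta 0 (Aop f)) = itg T (%r. cinner (U0 0 ta g) (U0 0 r (mw rho (Yv f r))))"
 unfolding U0_adjoint[of g] Aop_Yv by (rule integral_cinner(1)[OF c])
have "cmod (cinner g (U0 ta 0 (Aop f))) <= itg T (%r. K * (d r * norm (Yv f r)))"
 unfolding eq
proof (rule norm_integral_le_integral)
 show "continuous_on {0..T} (%r. cinner (U0 0 ta g) (U0 0 r (mw rho (Yv f r))))" by (intro cinner.continuous_on continuous_on_const c)
 show "continuous_on {0..T} (%r. K * (d r * norm (Yv f r)))" by (intro continuous_intros d(1) cy)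
 fix r assume r: "r : {0..T}"
 have "cinner (U0 0 ta g) (U0 0 r (mw rho (Yv f r))) = cinner g (U0 ta r (mw rho (Yv f r)))"
  unfolding U0_adjoint[of g ta 0, symmetric] U0_comp ..
 thus "norm (cinner (U0 0 ta g) (U0 0 r (mw rho (Yv f r)))) <= K * (d r * norm (Yv f r))"
  using d(2)[OF r, of "Yv f r"] by (simp only: mult.assoc)
qed
hence 1: "cmod (cinner g (U0 ta 0 (Aop f))) <= K * itg T (%r. d r * norm (Yv f r))" unfolding integral_mult_right .
have le: "itg T (%r. d r * norm (Yv f r)) <= sqrt (itg T (%r. (d r)^2)) * (CY * gn f)"
proof -
 have "(itg T (%r. d r * norm (Yv f r)))^2 <= itg T (%r. (d r)^2) * itg T (%r. (norm (Yv f r))^2)"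
  by (rule integral_Cauchy_Schwarz[OF d(1) cy])
 also have "... <= itg T (%r. (d r)^2) * (CY * gn f)^2"
  by (intro mult_left_mono Yv_bound integral_nonneg ici continuous_intros d(1)) auto
 finally have "itg T (%r. d r * norm (Yv f r)) <= sqrt (itg T (%r. (d r)^2) * (CY * gn f)^2)"
  by (rule real_le_rsqrt)
 thus ?thesis using CY_nonneg G.seminorm_nonneg[of f] by (simp add: real_sqrt_mult)
qed
show ?thesis using order_trans[OF 1 mult_left_mono[OF le K]] by (simp add: mult.assoc)
qed

definition "Tn n f = U0 (real n * T) 0 (Aop f)"

lemma Tn_linear: "complex_linear (Tn n)"
unfolding Tn_def complex_linear_def by (simp add: U0_lin clinD[OF Aop_linear])

lemma Rt_shift: "Rt t (U0 (real n * T) 0 f) = Rt (t + real n * T) f"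
unfolding Rt_def U0_shift_n[of t n, symmetric] U0_comp ..

text \<open>The growth \<open>|lam|^n\<close> of \<open>zeta\<close> raised to the decay exponent
  \<open>- 1 / p\<close>. The squared factor has exponent \<open>2 / p\<close> and rate
  \<open>rr^2\<close>, and the square root of its integral restores \<open>rr\<close>.\<close>

definition "rr = abs lam powr - (1 / p)"

lemma rr: "0 < rr" "rr < 1" "abs lam powr - (2 / p) = rr^2"
proof -
show "0 < rr" "rr < 1" using rate[of "1 / p"] p by (simp_all add: rr_def)
have "- (2 / p) = - (1 / p) + - (1 / p)" by simp
thus "abs lam powr - (2 / p) = rr^2" unfolding rr_def p2es powr_add[symmetric] by (rule arg_cong)
qed

lemma rr_sqrt: "sqrt ((rr^2) ^ n) = rr ^ n"
using rr(1) by (simp add: real_sqrt_power)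

lemma p_eps: "0 < 2 / p" "2 / p < 1" "0 < 1 / p" using p by auto

text \<open>The weight of the seminorm stands on the left of the free evolution and the factor
  \<open>rho\<close> of \<open>V\<close> on its right, so \<open>weighted_decay\<close> applies at
  \<open>zeta (t + n * T) r\<close>; integration over both times is
  \<open>damp_decay_double\<close>.\<close>

lemma Tn_decay: "EX C>=0. ALL n f. gn (Tn n f) <= C * rr ^ n * gn f"
proof -
obtain C where C: "0 <= C" "!!t s F H. cmod (cinner F (mw rho (U0 t s (mw rho H)))) <= C * damp (1 / p) (zeta t s) * (norm F * norm H)"
 using weighted_decay[OF rho_weight rho_weight] by blast
obtain D where D: "0 <= D" "!!n. itg T (%t. itg T (%s. damp (2 / p) (zeta (t + real n * T) s))) <= D * (rr^2) ^ n"
 using damp_decay_double[OF p_eps(1,2)] unfolding rr(3) by blast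
have "gn (Tn n f) <= (C * CY * sqrt D) * rr ^ n * gn f" for n f
proof -
 let ?K = "C * (CY * gn f)"
 let ?J = "%t. itg T (%s. damp (2 / p) (zeta (t + real n * T) s))"
 have K: "0 <= ?K" using C CY_nonneg G.seminorm_nonneg by simp
 have J: "0 <= ?J t" for t by (intro integral_nonneg ici continuous_damp_zeta2 damp_nonneg)
 show ?thesis
 proof (rule gn_le)
  show "continuous_on {0..T} (%t. ?K^2 * ?J t)" by (intro continuous_intros continuous_damp_integral)
  fix t assume "t : {0..T}"
  show "norm (Rt t (Tn n f)) <= sqrt (?K^2 * ?J t)"
  proof (rule norm_le_cinnerI)
   fix F
   have eq: "cinner F (Rt t (Tn n f)) = cinner (mw rho F) (U0 (t + real n * T) 0 (Aop f))"
    unfolding Tn_def Rt_shift by (simp add: Rt_def mw_cinner[OF rho.w])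
   have "cmod (cinner F (Rt t (Tn n f))) <= (C * norm F) * sqrt (itg T (%s. (damp (1 / p) (zeta (t + real n * T) s))^2)) * (CY * gn f)"
   unfolding eq
   proof (rule Aop_pairing[OF continuous_damp_zeta2])
    show "cmod (cinner (mw rho F) (U0 (t + real n * T) r (mw rho H))) <= C * norm F * damp (1 / p) (zeta (t + real n * T) r) * norm H" for r H
     using C(2)[of F "t + real n * T" r H] by (simp add: mw_cinner[OF rho.w] mult_ac)
   qed (use C in simp)
   thus "cmod (cinner F (Rt t (Tn n f))) <= sqrt (?K^2 * ?J t) * norm F"
    using K by (simp add: damp_square real_sqrt_mult mult_ac)
  qed (use J in simp)
 next
  have "itg T (%t. ?K^2 * ?J t) = ?K^2 * itg T ?J" by simp
  also have "... <= ?K^2 * (D * (rr^2) ^ n)" by (intro mult_left_mono D) auto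
  also have "... = (C * CY * sqrt D * rr ^ n * gn f)^2"
   using D(1) by (simp add: pmd power_mult[symmetric] mult.commute)
  finally show "itg T (%t. ?K^2 * ?J t) <= (C * CY * sqrt D * rr ^ n * gn f)^2" .
 qed (use J C CY_nonneg G.seminorm_nonneg D rr in auto)
qed
thus ?thesis using C CY_nonneg D by (intro exI[of _ "C * CY * sqrt D"]) auto
qed

text \<open>The three inputs of \<open>meromorphic_continuation\<close> that involve
  \<open>g\<close>. The factorisation \<open>g = mw w h\<close> provides the second weight, without
  which there would be no decay.\<close>

lemma weighted_vector_decay:
assumes w: "Lp_weight p M w" and g: "g = mw w h"
shows "EX C>=0. ALL n. gn (U0 (real n * T) 0 g) <= C * rr ^ n"
 "EX C>=0. ALL n. cmod (cinner g (U0 (real n * T) 0 g)) <= C * rr ^ n"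
 "EX C>=0. ALL n f. cmod (cinner g (Tn n f)) <= C * rr ^ n * gn f"
proof -
interpret w: Lp_weight p M w by fact
obtain C where C: "0 <= C" "!!t s F H. cmod (cinner F (mw rho (U0 t s (mw w H)))) <= C * damp (1 / p) (zeta t s) * (norm F * norm H)"
 using weighted_decay[OF rho_weight w] by blast
obtain C1 where C1: "0 <= C1" "!!t s F H. cmod (cinner F (mw w (U0 t s (mw w H)))) <= C1 * damp (1 / p) (zeta t s) * (norm F * norm H)"
 using weighted_decay[OF w w] by blast
obtain C2 where C2: "0 <= C2" "!!t s F H. cmod (cinner F (mw w (U0 t s (mw rho H)))) <= C2 * damp (1 / p) (zeta t s) * (norm F * norm H)"
 using weighted_decay[OF w rho_weight] by blast
obtain D where D: "0 <= D" "!!n. itg T (%t. damp (2 / p) (zeta (t + real n * T) 0)) <= D * (rr^2) ^ n"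
 using damp_decay_single(1)[OF p_eps(1,2)] unfolding rr(3) by blast
obtain E where E: "0 <= E" "!!n. itg T (%t. damp (2 / p) (zeta (t - real n * T) 0)) <= E * (rr^2) ^ n"
 using damp_decay_single(2)[OF p_eps(1,2)] unfolding rr(3) by blast
obtain P where P: "0 <= P" "!!n. damp (1 / p) (zeta (real n * T) 0) <= P * rr ^ n"
 using damp_decay_point[OF p_eps(3)] unfolding rr_def by blast
have "gn (U0 (real n * T) 0 g) <= (C * norm h * sqrt D) * rr ^ n" for n
proof (rule gn_le)
 let ?j = "%t. damp (2 / p) (zeta (t + real n * T) 0)"
 show "continuous_on {0..T} (%t. (C * norm h)^2 * ?j t)" by (intro continuous_intros continuous_damp_zeta1)
 fix t
 show "norm (Rt t (U0 (real n * T) 0 g)) <= sqrt ((C * norm h)^2 * ?j t)"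
 proof (rule norm_le_cinnerI)
  fix F
  have "cmod (cinner F (Rt t (U0 (real n * T) 0 g))) <= C * damp (1 / p) (zeta (t + real n * T) 0) * (norm F * norm h)"
   unfolding Rt_shift g unfolding Rt_def by (rule C)
  moreover have "sqrt ((C * norm h)^2 * ?j t) = C * norm h * damp (1 / p) (zeta (t + real n * T) 0)"
   using C by (simp add: real_sqrt_mult damp_sqrt)
  ultimately show "cmod (cinner F (Rt t (U0 (real n * T) 0 g))) <= sqrt ((C * norm h)^2 * ?j t) * norm F" by (simp add: mult_ac)
 qed (simp add: damp_nonneg)
next
 have "itg T (%t. (C * norm h)^2 * damp (2 / p) (zeta (t + real n * T) 0)) <= (C * norm h)^2 * (D * (rr^2) ^ n)"
  using mult_left_mono[OF D(2), of "(C * norm h)^2"] by simp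
 also have "... = (C * norm h * sqrt D * rr ^ n)^2" using D(1) by (simp add: pmd power_mult[symmetric] mult.commute)
 finally show "itg T (%t. (C * norm h)^2 * damp (2 / p) (zeta (t + real n * T) 0)) <= (C * norm h * sqrt D * rr ^ n)^2" .
qed (use C D rr damp_nonneg in auto)
thus "EX C>=0. ALL n. gn (U0 (real n * T) 0 g) <= C * rr ^ n" using C D by (intro exI[of _ "C * norm h * sqrt D"]) auto
have "cmod (cinner g (U0 (real n * T) 0 g)) <= (C1 * P * (norm h * norm h)) * rr ^ n" for n
proof -
 have "cmod (cinner g (U0 (real n * T) 0 g)) <= C1 * damp (1 / p) (zeta (real n * T) 0) * (norm h * norm h)"
  using C1(2)[of h "real n * T" 0 h] by (simp add: g mw_cinner[OF w.w])
 also have "... <= C1 * (P * rr ^ n) * (norm h * norm h)" using C1 by (intro mult_right_mono mult_left_mono P) auto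
 finally show ?thesis by (simp add: mult_ac)
qed
thus "EX C>=0. ALL n. cmod (cinner g (U0 (real n * T) 0 g)) <= C * rr ^ n" using C1 P by (intro exI[of _ "C1 * P * (norm h * norm h)"]) auto
\<comment> \<open>By periodicity and antisymmetry a translate of the first argument becomes a
  backward translate of the second; \<open>damp\<close> ignores the sign.\<close>
have zs: "damp (2 / p) (zeta (real n * T) r) = damp (2 / p) (zeta (r - real n * T) 0)" for n r
proof -
 have "zeta (s + real n * T) (real n * T) = zeta s 0" for s
 proof (induction n)
  case (Suc n)
  thus ?case using zeta_periodic(1)[of "s + real n * T" "real n * T"] by (simp add: algebra_simps)
 qed simp
 from this[of "r - real n * T"]
 show ?thesis using zeta_antisym[of "real n * T" r] by (simp add: damp_def)
qed
have "cmod (cinner g (Tn n f)) <= (C2 * norm h * sqrt E * CY) * rr ^ n * gn f" for n f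
proof -
 have "cmod (cinner g (Tn n f)) <= (C2 * norm h) * sqrt (itg T (%r. (damp (1 / p) (zeta (real n * T) r))^2)) * (CY * gn f)"
  unfolding Tn_def
 proof (rule Aop_pairing[OF continuous_damp_zeta2])
  show "cmod (cinner g (U0 (real n * T) r (mw rho H))) <= C2 * norm h * damp (1 / p) (zeta (real n * T) r) * norm H" for r H
   using C2(2)[of h "real n * T" r H] by (simp add: g mw_cinner[OF w.w] mult_ac)
 qed (use C2 in simp)
 also have "... <= (C2 * norm h) * sqrt (E * (rr^2) ^ n) * (CY * gn f)"
  using C2 CY_nonneg G.seminorm_nonneg E(2)[of n] by (intro mult_right_mono mult_left_mono real_sqrt_le_mono) (auto simp: damp_square zs)
 also have "... = (C2 * norm h * sqrt E * CY) * rr ^ n * gn f"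
  by (simp only: real_sqrt_mult rr_sqrt) simp
 finally show ?thesis .
qed
thus "EX C>=0. ALL n f. cmod (cinner g (Tn n f)) <= C * rr ^ n * gn f" using C2 E CY_nonneg by (intro exI[of _ "C2 * norm h * sqrt E * CY"]) auto
qed

end

text \<open>Testing against \<open>f / |f|\<close> on the part of a ball where \<open>|f| > K\<close> shows that this part is null.\<close>

lemma AE_bounded_by_duality:
assumes f: "sqint f" and K: "0 <= K"
 and d: "!!y. sqint y ==> integrable lborel y ==> cmod (cinner (to_L2 y) (to_L2 f)) <= K * (LINT x|lborel. cmod (y x))"
shows "AE x in lborel. cmod (f x) <= K"
proof -
have [measurable]: "f : bmf borel" using f by (simp add: square_integrable_def)
have "AE x in lborel. x : cball 0 (real n) --> cmod (f x) <= K" for n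
proof -
 define E where "E = {x. x : cball 0 (real n) & K < cmod (f x)}"
 define y where "y x = indicator E x *R sgn (f x)" for x
 have [measurable]: "cball (0::real^2) (real n) : sets borel" by simp
 have E[measurable]: "E : sets borel" unfolding E_def by measurable
 have "emeasure lborel E <= emeasure lborel (cball 0 (real n) :: (real^2) set)" by (rule emeasure_mono) (auto simp: E_def)
 also have "... < \<infinity>" by (rule emeasure_lborel_cball_finite)
 finally have Ef: "emeasure lborel E < \<infinity>" .
 have I: "integrable lborel (%x. indicator E x :: real)" using Ef by simp
 have nz: "f x ~= 0" if "x : E" for x using that K by (auto simp: E_def)
 have ym[measurable]: "y : bmf borel" unfolding y_def[abs_def] sgn_div_norm by measurable
 have ny: "cmod (y x) = indicator E x" for x using nz[of x] by (auto simp: y_def indicator_def norm_sgn)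
 have yi: "integrable lborel y" using integrable_norm_cancel[of lborel y] I by (simp add: ny)
 have ys: "sqint y" 
 proof -
  have "(%x. (cmod (y x))^2) = indicator E" unfolding ny by (auto simp: indicator_def)
  thus ?thesis unfolding square_integrable_def using I by simp
 qed
 have yf: "cnj (y x) * f x = cor (indicator E x * cmod (f x))" for x
 proof (cases "x : E")
  case True
  have "cnj (f x) * f x = cor (cmod (f x)) * cor (cmod (f x))"
   using complex_norm_square[of "f x"] by (simp add: p2es mult.commute)
  thus ?thesis using True nz[OF True] by (simp add: y_def sgn_div_norm scaleR_conv_of_real field_simps)
 qed (simp add: y_def)
 have i2: "integrable lborel (%x. indicator E x * cmod (f x))"
  using integrable_norm[OF square_integrable_mult[OF ys f]] unfolding yf norm_of_real abs_mult by simp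
 have "(LINT x|lborel. indicator E x * cmod (f x)) = cmod (cinner (to_L2 y) (to_L2 f))"
  unfolding cinner_to_L2[OF ys f] yf integral_complex_of_real by (simp add: integral_nonneg_AE)
 also have "... <= K * (LINT x|lborel. indicator E x)" using d[OF ys yi] by (simp add: ny)
 finally have le: "(LINT x|lborel. indicator E x * cmod (f x) - K * indicator E x) <= 0"
  using i2 I by simp
 have nn: "0 <= indicator E x * cmod (f x) - K * indicator E x" for x by (auto simp: indicator_def E_def)
 have "(LINT x|lborel. indicator E x * cmod (f x) - K * indicator E x) = 0"
  using le by (intro antisym integral_nonneg_AE) (use nn in auto)
 hence "AE x in lborel. indicator E x * cmod (f x) - K * indicator E x = 0"
  by (subst (asm) integral_nonneg_eq_0_iff_AE) (use nn i2 I in auto)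
 thus ?thesis by eventually_elim (force simp: E_def indicator_def)
qed
hence "AE x in lborel. ALL n. x : cball 0 (real n) --> cmod (f x) <= K" unfolding AE_all_countable by (rule allI)
thus ?thesis
proof eventually_elim
 case (elim x)
 obtain n :: nat where "norm x <= real n" using real_arch_simple by blast
 thus ?case using elim by (auto simp: dist_norm)
qed
qed

section \<open>Hilbert-Schmidt bounds and finite-rank approximation of T_n\<close>

text \<open>A countable dense set of coefficients: an inequality that holds almost everywhere for
  each coefficient vector then holds off one common null set.\<close>

definition rat_complex :: "complex set" where "rat_complex = (%(a, b). Complex (of_rat a) (of_rat b)) ` UNIV"

lemma rat_complex_countable: "countable rat_complex"
unfolding rat_complex_def by (intro countable_image) simp

lemma rat_complex_dense: assumes "0 < e" shows "EX c:rat_complex. cmod (c - z) <= e"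
proof -
obtain a where a: "Re z < of_rat a" "of_rat a < Re z + e / 2" using of_rat_dense[of "Re z" "Re z + e / 2"] assms by auto
obtain b where b: "Im z < of_rat b" "of_rat b < Im z + e / 2" using of_rat_dense[of "Im z" "Im z + e / 2"] assms by auto
have "cmod (Complex (of_rat a) (of_rat b) - z) <= e"
 using cmod_le[of "Complex (of_rat a) (of_rat b) - z"] a b by simp
thus ?thesis unfolding rat_complex_def by force
qed

lemma le_square_of_le_sqrt:
fixes s K :: real
assumes "0 <= s" "0 <= K" "s <= K * sqrt s" shows "s <= K^2"
proof (cases "s = 0")
case False
hence "0 < sqrt s" using assms(1) by simp
moreover have "sqrt s * sqrt s <= K * sqrt s" using assms by simp
ultimately have "sqrt s <= K" by (rule mult_right_le_imp_le[rotated])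
hence "(sqrt s)^2 <= K^2" using assms(1) by (intro power_mono) auto
thus ?thesis using assms(1) by simp
qed simp

text \<open>Coefficients tending to \<open>cnj (v i)\<close> turn the left side into the sum
  \<open>s\<close> of squares and the right side into \<open>K * sqrt s\<close>.\<close>

lemma pointwise_bound_of_dense:
assumes K: "0 <= K" and b: "!!c. c : {..<k::nat} \<rightarrow>\<^sub>E rat_complex ==> cmod (SUM i<k. c i * v i) <= K * sqrt (SUM i<k. (cmod (c i))^2)"
shows "(SUM i<k. (cmod (v i))^2) <= K^2"
proof -
define e where "e n = 1 / real (Suc n)" for n
have e: "e ----> 0" unfolding e_def using LIMSEQ_inverse_real_of_nat by (simp add: inverse_eq_divide)
have "ALL n i. EX c:rat_complex. cmod (c - cnj (v i)) <= e n" using rat_complex_dense by (simp add: e_def)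
then obtain c where c: "!!n i. c n i : rat_complex" "!!n i. cmod (c n i - cnj (v i)) <= e n" by metis
have cl: "(%n. c n i) ----> cnj (v i)" for i
proof -
 have "\<forall>\<^sub>F n in sequentially. norm (c n i - cnj (v i)) <= e n" by (rule always_eventually) (simp add: c(2))
 from Lim_null_comparison[OF this e] show ?thesis by (simp add: LIM_zero_iff)
qed
have le: "cmod (SUM i<k. c n i * v i) <= K * sqrt (SUM i<k. (cmod (c n i))^2)" for n
 using b[of "restrict (c n) {..<k}"] c(1) by simp
let ?S = "SUM i<k. (cmod (v i))^2"
have S: "0 <= ?S" by (rule sum_nonneg) simp
have "(%n. cmod (SUM i<k. c n i * v i)) ----> cmod (SUM i<k. cnj (v i) * v i)"
 by (intro tendsto_norm tendsto_sum tendsto_mult cl tendsto_const)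
moreover have "(%n. K * sqrt (SUM i<k. (cmod (c n i))^2)) ----> K * sqrt (SUM i<k. (cmod (cnj (v i)))^2)"
 by (intro tendsto_mult tendsto_const tendsto_real_sqrt tendsto_sum tendsto_power tendsto_norm cl)
ultimately have "cmod (SUM i<k. cnj (v i) * v i) <= K * sqrt (SUM i<k. (cmod (cnj (v i)))^2)"
 using LIMSEQ_le le by blast
moreover have "(SUM i<k. cnj (v i) * v i) = cor ?S"
 unfolding of_real_sum complex_norm_square by (simp add: mult.commute)
ultimately have "cmod (cor ?S) <= K * sqrt ?S" by (simp only: complex_mod_cnj)
hence "?S <= K * sqrt ?S" using S unfolding norm_of_real by simp
thus ?thesis by (rule le_square_of_le_sqrt[OF S K])
qed

lemma pointwise_square_sum_bound:
assumes h: "!!i. sqint (h i)" and K: "0 <= K"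
 and d: "!!c y. sqint y ==> integrable lborel y ==>
  cmod (cinner (to_L2 y) (SUM i<k. c i *C to_L2 (h i))) <= K * sqrt (SUM i<k. (cmod (c i))^2) * (LINT x|lborel. cmod (y x))"
shows "AE x in lborel. (SUM i<k::nat. (cmod (h i x))^2) <= K^2"
proof -
have sum: "sqint (%x. SUM i<k. c i * h i x) & (SUM i<k. c i *C to_L2 (h i)) = to_L2 (%x. SUM i<k. c i * h i x)" for c and k :: nat
proof (induction k)
 case 0
 show ?case by (simp add: square_integrable_zero zero_L2_def)
next
 case (Suc k)
 thus ?case by (simp add: h square_integrable_scale square_integrable_add to_L2_scale to_L2_add)
qed
have "AE x in lborel. cmod (SUM i<k. c i * h i x) <= K * sqrt (SUM i<k. (cmod (c i))^2)" for c
proof (rule AE_bounded_by_duality)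
 show "sqint (%x. SUM i<k. c i * h i x)" using sum by blast
 show "0 <= K * sqrt (SUM i<k. (cmod (c i))^2)" using K by (intro mult_nonneg_nonneg real_sqrt_ge_zero sum_nonneg) auto
 show "cmod (cinner (to_L2 y) (to_L2 (%x. SUM i<k. c i * h i x))) <= K * sqrt (SUM i<k. (cmod (c i))^2) * (LINT x|lborel. cmod (y x))"
  if "sqint y" "integrable lborel y" for y using d[OF that, of c] sum[where c=c and k=k] by simp
qed
moreover have "countable ({..<k} \<rightarrow>\<^sub>E rat_complex)" by (intro countable_PiE rat_complex_countable) auto
ultimately have "AE x in lborel. ALL c:{..<k} \<rightarrow>\<^sub>E rat_complex. cmod (SUM i<k. c i * h i x) <= K * sqrt (SUM i<k. (cmod (c i))^2)"
 by (simp add: AE_ball_countable)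
thus ?thesis by eventually_elim (rule pointwise_bound_of_dense[OF K], blast)
qed

text \<open>A map into bounded functions followed by multiplication with a square-integrable weight
  is Hilbert-Schmidt: by duality the images of an orthonormal system have pointwise sum of squares
  at most \<open>K^2\<close>, uniformly in their number, and this is integrated against
  \<open>w^2\<close>.\<close>

lemma weighted_square_sum:
assumes w: "bweight M w" "sqint (%x. of_real (w x))" and K: "0 <= K"
 and d: "!!c y. sqint y ==> integrable lborel y ==>
  cmod (cinner (to_L2 y) (SUM i<k::nat. c i *C H i)) <= K * sqrt (SUM i<k. (cmod (c i))^2) * (LINT x|lborel. cmod (y x))"
shows "(SUM i<k. (norm (mw w (H i)))^2) <= K^2 * (norm (to_L2 (%x. of_real (w x))))^2"
proof -
have "ALL i. EX h. sqint h & H i = to_L2 h" by (metis obtain_rep)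
then obtain h where h: "!!i. sqint (h i)" "!!i. H i = to_L2 (h i)" by metis
note sq = square_weight_L1(1,2)[OF w h(1)]
have i: "integrable lborel (%x. (w x)^2 * (cmod (h i x))^2)" for i
 using sq(2)[of i] by (simp add: square_integrable_def norm_mult pmd)
have pointwise: "AE x in lborel. (SUM i<k. (cmod (h i x))^2) <= K^2"
 by (rule pointwise_square_sum_bound[OF h(1) K]) (unfold h(2)[symmetric], rule d)
have "(SUM i<k. (norm (mw w (H i)))^2) = (SUM i<k. LINT x|lborel. (w x)^2 * (cmod (h i x))^2)"
 unfolding h(2) sq(1) norm_to_L2_sq[OF sq(2)] by (simp add: norm_mult pmd)
also have "... = (LINT x|lborel. (SUM i<k. (w x)^2 * (cmod (h i x))^2))" by (rule Bochner_Integration.integral_sum[symmetric, OF i])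
also have "... <= (LINT x|lborel. K^2 * (w x)^2)"
proof (rule integral_mono_AE)
 show "AE x in lborel. (SUM i<k. (w x)^2 * (cmod (h i x))^2) <= K^2 * (w x)^2"
  using pointwise
  by eventually_elim (simp add: sum_distrib_left[symmetric] mult.commute[of "K^2"] mult_left_mono)
qed (use i w(2) in "auto simp: square_integrable_def")
also have "... = K^2 * (norm (to_L2 (%x. of_real (w x))))^2" using norm_to_L2_sq[OF w(2)] by simp
finally show ?thesis .
qed

lemma L2_Minkowski:
fixes F G :: "real => L2"
assumes F: "continuous_on {a..b} F" and G: "continuous_on {a..b} G"
shows "sqrt (integral {a..b} (%t. (norm (F t + G t))^2)) <= sqrt (integral {a..b} (%t. (norm (F t))^2)) + sqrt (integral {a..b} (%t. (norm (G t))^2))"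
proof -
let ?I = "%f. integral {a..b} f"
let ?A = "?I (%t. (norm (F t))^2)" and ?C = "?I (%t. (norm (G t))^2)" and ?D = "?I (%t. norm (F t) * norm (G t))"
have i: "(%t. (norm (F t))^2) integrable_on {a..b}" "(%t. (norm (G t))^2) integrable_on {a..b}" "(%t. norm (F t) * norm (G t)) integrable_on {a..b}"
 by (intro ici continuous_intros F G)+
have AC: "0 <= ?A" "0 <= ?C" by (intro integral_nonneg i; simp)+
have "?I (%t. (norm (F t + G t))^2) <= ?I (%t. (norm (F t))^2 + 2 * (norm (F t) * norm (G t)) + (norm (G t))^2)"
proof (rule integral_le)
 show "(norm (F t + G t))^2 <= (norm (F t))^2 + 2 * (norm (F t) * norm (G t)) + (norm (G t))^2" for t
  using power_mono[OF norm_triangle_ineq[of "F t" "G t"] norm_ge_zero, of 2] by (simp add: power2_sum)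
qed (intro ici continuous_intros F G)+
also have "... = ?A + 2 * ?D + ?C"
 by (intro integral_unique has_integral_add has_integral_mult_right integrable_integral i)
also have "?D <= sqrt ?A * sqrt ?C"
 using real_le_rsqrt[OF integral_Cauchy_Schwarz[OF continuous_on_norm[OF F] continuous_on_norm[OF G]]] by (simp add: real_sqrt_mult)
finally have "?I (%t. (norm (F t + G t))^2) <= (sqrt ?A + sqrt ?C)^2" using AC by (simp add: power2_sum)
thus ?thesis using AC by (intro real_le_lsqrt) auto
qed

context schrodinger_Lp begin

text \<open>T_n with the times near zeros of \<open>zeta\<close> and the small values of
  \<open>rho\<close> removed. What is left maps into bounded functions by the dispersive
  estimate.\<close>

definition trunc :: "nat => real => nat => real => L2 => L2" where
"trunc j de n t f = itg T (%r. (1 - cutoff j (zeta (t + real n * T) r)) *R U0 0 r (mw (big de rho) (Yv f r)))"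

definition trunc_op :: "nat => real => nat => real => L2 => L2" where
"trunc_op j de n t f = mw (big de rho) (U0 (t + real n * T) 0 (trunc j de n t f))"

lemma trunc_integrand_continuous:
"continuous_on S (%r. (1 - cutoff j (zeta t r)) *R U0 0 r (mw (big de rho) (Yv f r)))"
by (intro continuous_on_scaleR continuous_on_diff continuous_on_const continuous_cutoff_zeta2 continuous_mwU0[OF rho.big_bweight] Yv_continuous)

lemma trunc_linear: "complex_linear (trunc j de n t)"
unfolding trunc_def[abs_def]
proof (rule integral_complex_linear[OF _ trunc_integrand_continuous])
show "complex_linear (%f. (1 - cutoff j (zeta (t + real n * T) r)) *R U0 0 r (mw (big de rho) (Yv f r)))" for r
 unfolding complex_linear_def
 by (simp add: clinD[OF Yv_linear] clinD[OF mw_linear[OF rho.big_bweight]] U0_lin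
   scaleR_L2_eq scaleC_add_right mult.commute)
qed

lemma trunc_op_continuous: "continuous_on {0..T} (%t. trunc_op j de n t f)"
proof -
let ?F = "%t r. (1 - cutoff j (zeta (t + real n * T) r)) *R U0 0 r (mw (big de rho) (Yv f r))"
have "continuous_on ({0..T} \<times> cbox 0 T) (%p. (1 - cutoff j (zeta (fst p + real n * T) (snd p))) *R U0 0 (snd p) (mw (big de rho) (Yv f (snd p))))"
 by (intro continuous_on_scaleR continuous_on_diff continuous_on_const continuous_cutoff_zeta continuous_on_U0 continuous_on_mw[OF rho.big_bweight]
   continuous_on_compose2[OF Yv_continuous[of UNIV]] continuous_on_snd continuous_on_id) auto
hence "continuous_on ({0..T} \<times> cbox 0 T) (%(t, r). ?F t r)" by (simp add: case_prod_beta)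
hence "continuous_on {0..T} (%t. integral (cbox 0 T) (?F t))" by (rule integral_continuous_on_param)
hence "continuous_on {0..T} (%t. trunc j de n t f)" by (simp add: trunc_def cbox_interval)
thus ?thesis unfolding trunc_op_def by (intro continuous_on_mw[OF rho.big_bweight] continuous_on_U0 continuous_intros)
qed

lemma Yv_L1: "itg T (%r. norm (Yv f r)) <= sqrt T * (CY * gn f)"
proof -
have "(itg T (%r. 1 * norm (Yv f r)))^2 <= itg T (%r. 1^2) * itg T (%r. (norm (Yv f r))^2)"
 by (intro integral_Cauchy_Schwarz continuous_on_const continuous_on_norm Yv_continuous)
also have "... <= T * (CY * gn f)^2" using mult_left_mono[OF Yv_bound, of T f] T_pos by simp
finally have "itg T (%r. norm (Yv f r)) <= sqrt (T * (CY * gn f)^2)" by (intro real_le_rsqrt) simp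
thus ?thesis using CY_nonneg G.seminorm_nonneg[of f] by (simp add: real_sqrt_mult)
qed

text \<open>\<open>disp\<close> is the bound into bounded functions: \<open>j + 1\<close> comes from
  \<open>cutoff_inverse_bound\<close>, and \<open>sqrt T * CY\<close> from the integral of
  \<open>Yv\<close> over a period. The large part of \<open>rho\<close> then serves as the
  square-integrable weight.\<close>

lemma trunc_Hilbert_Schmidt:
assumes de: "0 < de"
shows "EX K. ALL k f. G.orthonormal k f --> (SUM i<k. (sqrt (itg T (%t. (norm (trunc_op j de n t (f i)))^2)))^2) <= K"
proof -
let ?w = "big de rho"
let ?W = "norm (to_L2 (%x. cor (?w x)))"
define K where "K = m / n0 * real (Suc j) * ?W * (sqrt T * CY)"
note bw = rho.big_bweight[of de] rho.big_L2(1)[OF de]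
have K: "0 <= K" using m_pos n0_pos T_pos CY_nonneg by (simp add: K_def)
have disp: "cmod (cinner (to_L2 y) (U0 (t + real n * T) 0 (trunc j de n t F))) <= K * gn F * (LINT x|lborel. cmod (y x))"
 if y: "sqint y" "integrable lborel y" for y t F
proof -
 let ?ta = "t + real n * T" and ?Y1 = "LINT x|lborel. cmod (y x)"
 let ?c = "%r. 1 - cutoff j (zeta (t + real n * T) r)"
 have Y1: "0 <= ?Y1" by (rule integral_nonneg_AE) simp
 have cc: "continuous_on {0..T} (%r. cinner (U0 0 ?ta (to_L2 y)) (?c r *R U0 0 r (mw ?w (Yv F r))))"
  by (intro cinner.continuous_on continuous_on_const trunc_integrand_continuous)
 have e: "cinner (to_L2 y) (U0 ?ta 0 (trunc j de n t F)) = itg T (%r. cinner (U0 0 ?ta (to_L2 y)) (?c r *R U0 0 r (mw ?w (Yv F r))))"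
  unfolding U0_adjoint[of "to_L2 y" ?ta 0] trunc_def by (rule integral_cinner(1)[OF trunc_integrand_continuous])
 have "cmod (cinner (to_L2 y) (U0 ?ta 0 (trunc j de n t F))) <= itg T (%r. (m / n0 * real (Suc j) * ?W * ?Y1) * norm (Yv F r))"
  unfolding e
 proof (rule norm_integral_le_integral[OF cc])
  show "continuous_on {0..T} (%r. (m / n0 * real (Suc j) * ?W * ?Y1) * norm (Yv F r))" by (intro continuous_intros Yv_continuous)
  fix r
  have "cinner (U0 0 ?ta (to_L2 y)) (?c r *R U0 0 r (mw ?w (Yv F r))) = ?c r *R cinner (to_L2 y) (U0 ?ta r (mw ?w (Yv F r)))"
   unfolding cinner.scaleR_right U0_adjoint[of "to_L2 y" ?ta 0, symmetric] U0_comp ..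
  hence n: "norm (cinner (U0 0 ?ta (to_L2 y)) (?c r *R U0 0 r (mw ?w (Yv F r)))) = ?c r * cmod (cinner (to_L2 y) (U0 ?ta r (mw ?w (Yv F r))))"
   using cutoff_range(2)[of j "zeta ?ta r"] by simp
  show "norm (cinner (U0 0 ?ta (to_L2 y)) (?c r *R U0 0 r (mw ?w (Yv F r)))) <= (m / n0 * real (Suc j) * ?W * ?Y1) * norm (Yv F r)"
  proof (cases "cutoff j (zeta ?ta r) < 1")
   case True
   hence z: "zeta ?ta r ~= 0" by (rule cutoff_outside)
   have "?c r * cmod (cinner (to_L2 y) (U0 ?ta r (mw ?w (Yv F r)))) <= ?c r * (m / (n0 * abs (zeta ?ta r)) * ?Y1 * (?W * norm (Yv F r)))"
    using True by (intro mult_left_mono weighted_dispersive[OF y bw z]) auto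
   also have "... = (?c r / abs (zeta ?ta r)) * (m / n0 * ?W * ?Y1 * norm (Yv F r))" by (simp add: mult_ac)
   also have "... <= real (Suc j) * (m / n0 * ?W * ?Y1 * norm (Yv F r))"
    using m_pos n0_pos Y1 by (intro mult_right_mono cutoff_inverse_bound) auto
   finally show ?thesis unfolding n by (simp add: mult_ac)
  next
   case False
   hence "?c r = 0" using cutoff_range(2)[of j "zeta ?ta r"] by simp
   thus ?thesis unfolding n using m_pos n0_pos Y1 by simp
  qed
 qed
 also have "... = (m / n0 * real (Suc j) * ?W * ?Y1) * itg T (%r. norm (Yv F r))" by simp
 also have "... <= (m / n0 * real (Suc j) * ?W * ?Y1) * (sqrt T * (CY * gn F))"
  using m_pos n0_pos Y1 by (intro mult_left_mono Yv_L1) auto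
 also have "... = K * gn F * ?Y1" by (simp add: K_def mult_ac)
 finally show ?thesis .
qed
have "(SUM i<k. (sqrt (itg T (%t. (norm (trunc_op j de n t (f i)))^2)))^2) <= T * (K^2 * ?W^2)" if f: "G.orthonormal k f" for k f
proof -
 have i: "(%t. (norm (trunc_op j de n t (f i)))^2) integrable_on {0..T}" for i
  by (intro ici continuous_norm_sq trunc_op_continuous)
 have pt: "(SUM i<k. (norm (trunc_op j de n t (f i)))^2) <= K^2 * ?W^2" for t
  unfolding trunc_op_def
 proof (rule weighted_square_sum[OF bw K])
  fix c :: "nat => complex" and y assume y: "sqint y" "integrable lborel y"
  let ?F = "SUM i<k. c i *C f i"
  have "(SUM i<k. c i *C U0 (t + real n * T) 0 (trunc j de n t (f i))) = U0 (t + real n * T) 0 (trunc j de n t ?F)"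
   by (simp add: clinD[OF trunc_linear] U0_lin)
  moreover have "gn ?F = sqrt (SUM i<k. (cmod (c i))^2)"
   using G.orthonormal_combination[OF f, of c] G.seminorm_nonneg[of ?F] by (metis real_sqrt_abs abs_of_nonneg)
  ultimately show "cmod (cinner (to_L2 y) (SUM i<k. c i *C U0 (t + real n * T) 0 (trunc j de n t (f i)))) <= K * sqrt (SUM i<k. (cmod (c i))^2) * (LINT x|lborel. cmod (y x))"
   using disp[OF y, of t ?F] by simp
 qed
 have "(SUM i<k. (sqrt (itg T (%t. (norm (trunc_op j de n t (f i)))^2)))^2) = (SUM i<k. itg T (%t. (norm (trunc_op j de n t (f i)))^2))"
  by (intro sum.cong refl real_sqrt_pow2 integral_nonneg i) simp
 also have "... = itg T (%t. SUM i<k. (norm (trunc_op j de n t (f i)))^2)" by (rule integral_sum[symmetric]) (auto intro: i)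
 also have "... <= itg T (%t. K^2 * ?W^2)" by (intro integral_le integrable_sum i pt) auto
 also have "... = T * (K^2 * ?W^2)" using T_pos by simp
 finally show ?thesis .
qed
thus ?thesis by blast
qed

text \<open>The removed times contribute \<open>Mr^2 * cutoff\<close>, the removed small parts at
  most \<open>2 * Mr * de\<close>; squaring uses that \<open>cutoff^2 <= cutoff\<close>.\<close>

lemma trunc_error:
assumes de: "0 <= de"
shows "(norm (Rt t (Tn n f) - trunc_op j de n t f))^2
 <= (2 * Mr ^ 4 * itg T (%r. cutoff j (zeta (t + real n * T) r)) + 8 * Mr^2 * de^2 * T) * (CY * gn f)^2"
proof -
let ?ta = "t + real n * T" and ?b = "big de rho" and ?s = "small de rho"
let ?c = "%r. cutoff j (zeta (t + real n * T) r)"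
let ?d = "%r. Mr^2 * ?c r + 2 * Mr * de"
note bw = rho.w rho.big_bweight[of de] rho.small_bweight[OF de]
note Ul = unitary_clin[OF U0_unitary]
have c1: "continuous_on S (%r. U0 0 r (mw rho (Yv f r)))" for S by (intro continuous_mwU0[OF rho.w] Yv_continuous)
have pull: "mw w (U0 ?ta 0 (itg T F)) = itg T (%r. mw w (U0 ?ta 0 (F r)))" if w: "bweight M w" and F: "continuous_on {0..T} F" for M w F
 using integral_linear[OF ici[OF F] bounded_linear_compose[OF mw_bounded_linear[OF w] bounded_linear_unitary[OF U0_unitary]], of ?ta 0]
 by (simp add: o_def)
have cF: "continuous_on {0..T} (%r. mw w (U0 ?ta 0 (F r)))" if w: "bweight M w" and F: "continuous_on {0..T} F" for M w F
 by (intro continuous_on_mw[OF w] continuous_on_U0 continuous_on_const F)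
have eq: "Rt t (Tn n f) - trunc_op j de n t f = itg T (%r. mw rho (U0 ?ta 0 (U0 0 r (mw rho (Yv f r)))) - mw ?b (U0 ?ta 0 ((1 - ?c r) *R U0 0 r (mw ?b (Yv f r)))))"
 unfolding Tn_def Rt_shift trunc_op_def trunc_def Aop_Yv unfolding Rt_def pull[OF bw(1) c1] pull[OF bw(2) trunc_integrand_continuous]
 by (intro integral_diff[symmetric] ici cF[OF bw(1) c1] cF[OF bw(2) trunc_integrand_continuous])
have "norm (Rt t (Tn n f) - trunc_op j de n t f) <= itg T (%r. ?d r * norm (Yv f r))"
 unfolding eq
proof (rule norm_integral_le_integral)
 show "continuous_on {0..T} (%r. mw rho (U0 ?ta 0 (U0 0 r (mw rho (Yv f r)))) - mw ?b (U0 ?ta 0 ((1 - ?c r) *R U0 0 r (mw ?b (Yv f r)))))"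
  by (intro continuous_on_diff cF[OF bw(1) c1] cF[OF bw(2) trunc_integrand_continuous])
 show "continuous_on {0..T} (%r. ?d r * norm (Yv f r))" by (intro continuous_intros continuous_cutoff_zeta2 Yv_continuous)
 fix r
 let ?Y = "Yv f r"
 have two: "norm (mw u (U0 ?ta r (mw v ?Y))) <= K * L * norm ?Y" if "bweight K u" "bweight L v" for u v K L
  using order_trans[OF mw_norm[OF that(1)] mult_left_mono[OF _ bweight_nonneg[OF that(1)]], of "U0 ?ta r (mw v ?Y)" "L * norm ?Y"] mw_norm[OF that(2), of ?Y]
  by (simp add: unitary_norm[OF U0_unitary] mult.assoc)
 have s1: "mw rho (U0 ?ta r (mw rho ?Y)) = mw ?b (U0 ?ta r (mw rho ?Y)) + mw ?s (U0 ?ta r (mw rho ?Y))" by (rule rho.big_small[OF de])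
 have s2: "mw ?b (U0 ?ta r (mw rho ?Y)) = mw ?b (U0 ?ta r (mw ?b ?Y)) + mw ?b (U0 ?ta r (mw ?s ?Y))"
  using rho.big_small[OF de, of ?Y] by (simp add: clinD[OF Ul] clinD[OF mw_linear[OF bw(2)]])
 let ?Z = "mw rho (U0 ?ta 0 (U0 0 r (mw rho ?Y))) - mw ?b (U0 ?ta 0 ((1 - ?c r) *R U0 0 r (mw ?b ?Y)))"
 have Z: "?Z = ?c r *R mw rho (U0 ?ta r (mw rho ?Y)) + (1 - ?c r) *R (mw ?s (U0 ?ta r (mw rho ?Y)) + mw ?b (U0 ?ta r (mw ?s ?Y)))"
  unfolding clinD(6)[OF Ul] clinD(6)[OF mw_linear[OF bw(2)]] U0_comp s1 s2 by (simp add: algebra_simps)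
 have "norm ?Z <= ?c r * (Mr * Mr * norm ?Y) + 1 * (de * Mr * norm ?Y + Mr * de * norm ?Y)"
  unfolding Z
 proof (intro order_trans[OF norm_triangle_ineq] add_mono)
  show "norm (?c r *R mw rho (U0 ?ta r (mw rho ?Y))) <= ?c r * (Mr * Mr * norm ?Y)"
   using two[OF bw(1,1)] cutoff_range(1)[of j "zeta ?ta r"] by (simp add: mult_left_mono)
  have "norm (mw ?s (U0 ?ta r (mw rho ?Y)) + mw ?b (U0 ?ta r (mw ?s ?Y))) <= de * Mr * norm ?Y + Mr * de * norm ?Y"
   by (intro order_trans[OF norm_triangle_ineq] add_mono two[OF bw(3,1)] two[OF bw(2,3)])
  thus "norm ((1 - ?c r) *R (mw ?s (U0 ?ta r (mw rho ?Y)) + mw ?b (U0 ?ta r (mw ?s ?Y)))) <= 1 * (de * Mr * norm ?Y + Mr * de * norm ?Y)"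
   unfolding norm_scaleR using cutoff_range[of j "zeta ?ta r"] by (intro mult_mono) auto
 qed
 thus "norm ?Z <= ?d r * norm ?Y"
  by (simp add: p2es algebra_simps)
qed
hence "(norm (Rt t (Tn n f) - trunc_op j de n t f))^2 <= (itg T (%r. ?d r * norm (Yv f r)))^2" by (intro power_mono) auto
also have "... <= itg T (%r. (?d r)^2) * itg T (%r. (norm (Yv f r))^2)"
 by (intro integral_Cauchy_Schwarz continuous_intros continuous_cutoff_zeta2 Yv_continuous)
also have "... <= (2 * Mr ^ 4 * itg T ?c + 8 * Mr^2 * de^2 * T) * (CY * gn f)^2"
proof (intro mult_mono Yv_bound)
 have ci: "(%r. 2 * Mr ^ 4 * ?c r + 8 * Mr^2 * de^2) integrable_on {0..T}" "?c integrable_on {0..T}"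
  by (intro ici continuous_intros continuous_cutoff_zeta2)+
 have "itg T (%r. (?d r)^2) <= itg T (%r. 2 * Mr ^ 4 * ?c r + 8 * Mr^2 * de^2)"
 proof (rule integral_le[OF _ ci(1)])
  show "(%r. (?d r)^2) integrable_on {0..T}" by (intro ici continuous_intros continuous_cutoff_zeta2)
  fix r
  have "(?c r)^2 <= ?c r" using cutoff_range[of j "zeta ?ta r"] by (simp add: p2es mult_left_le)
  hence "2 * Mr ^ 4 * (?c r)^2 <= 2 * Mr ^ 4 * ?c r" by (intro mult_left_mono) auto
  moreover have "(?d r)^2 <= 2 * (Mr^2 * ?c r)^2 + 2 * (2 * Mr * de)^2"
   using sum_squares_bound[of "Mr^2 * ?c r" "2 * Mr * de"] by (simp add: power2_sum)
  ultimately show "(?d r)^2 <= 2 * Mr ^ 4 * ?c r + 8 * Mr^2 * de^2" by (simp add: pmd)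
 qed
 also have "... = 2 * Mr ^ 4 * itg T ?c + 8 * Mr^2 * de^2 * T"
  using T_pos by (subst integral_add) (auto intro!: ici continuous_intros continuous_cutoff_zeta2)
 finally show "itg T (%r. (?d r)^2) <= 2 * Mr ^ 4 * itg T ?c + 8 * Mr^2 * de^2 * T" .
 show "0 <= 2 * Mr ^ 4 * itg T ?c + 8 * Mr^2 * de^2 * T"
  using T_pos by (intro add_nonneg_nonneg mult_nonneg_nonneg integral_nonneg ci) (auto simp: cutoff_range)
qed (auto intro!: integral_nonneg ici continuous_norm_sq Yv_continuous)
finally show ?thesis .
qed

text \<open>The level \<open>de\<close> is tied to \<open>j\<close> as \<open>1 / (j + 1)\<close>,
  so one parameter makes both errors small. The truncated operator enters through the function
  \<open>?q\<close>, whose sums of squares over orthonormal systems are bounded, and Minkowski's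
  inequality adds the error.\<close>

lemma Tn_finite_rank:
assumes e: "0 < e"
shows "EX k (l :: nat => L2 => complex) xph K. (ALL i. clin_fun (l i)) & (ALL i h. cmod (l i h) <= K * gn h) &
  (ALL h. gn (Tn n h - (SUM i<k. l i h *C xph i)) <= e * gn h)"
proof -
define e' where "e' = e / 2"
have e': "0 < e'" "2 * e' = e" using e by (auto simp: e'_def)
obtain C where C: "!!n f. gn (Tn n f) <= C * rr ^ n * gn f" using Tn_decay by blast
let ?Q = "%j. itg T (%t. itg T (%r. cutoff j (zeta (t + real n * T) r)))"
let ?B = "%j de. (2 * Mr ^ 4 * ?Q j + 8 * Mr^2 * de^2 * T * T) * CY^2"
have "((%j. ?B j (inverse (real (Suc j)))) ---> (2 * Mr ^ 4 * 0 + 8 * Mr^2 * 0^2 * T * T) * CY^2) sequentially"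
 by (intro tendsto_intros cutoff_double_integral LIMSEQ_inverse_real_of_nat)
hence "\<forall>\<^sub>F j in sequentially. ?B j (inverse (real (Suc j))) < e'^2" using e' by (intro order_tendstoD(2)) auto
then obtain j where j: "?B j (inverse (real (Suc j))) < e'^2" by (auto simp: eventually_sequentially)
define de where "de = inverse (real (Suc j))"
have de: "0 < de" by (simp add: de_def)
let ?q = "%f. sqrt (itg T (%t. (norm (trunc_op j de n t f))^2))"
obtain K where K: "ALL k f. G.orthonormal k f --> (SUM i<k. (?q (f i))^2) <= K" using trunc_Hilbert_Schmidt[OF de, of j n] by blast
have q: "gn (Tn n f) <= ?q f + e' * gn f" for f
proof -
 let ?E = "%t. Rt t (Tn n f) - trunc_op j de n t f"
 have cR: "continuous_on {0..T} (%t. Rt t (Tn n f))" using Rt_continuous[of _ 0] by simp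
 have cE: "continuous_on {0..T} ?E" by (intro continuous_on_diff cR trunc_op_continuous)
 have ic: "(%t. itg T (%r. cutoff j (zeta (t + real n * T) r))) integrable_on {0..T}"
  by (rule ici[OF continuous_cutoff_integral])
 have "itg T (%t. (norm (?E t))^2) <= itg T (%t. (2 * Mr ^ 4 * itg T (%r. cutoff j (zeta (t + real n * T) r)) + 8 * Mr^2 * de^2 * T) * (CY * gn f)^2)"
  by (intro integral_le ici continuous_norm_sq cE continuous_intros continuous_cutoff_integral trunc_error less_imp_le[OF de])
 also have "... = ?B j de * (gn f)^2"
 proof -
  have c: "((%t. 8 * Mr^2 * de^2 * T) has_integral 8 * Mr^2 * de^2 * T * T) {0..T}"
   using has_integral_const_real[of "8 * Mr^2 * de^2 * T" 0 T] T_pos by (simp add: mult.commute)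
  show ?thesis
   by (subst integral_unique[OF has_integral_mult_left[OF has_integral_add[OF has_integral_mult_right[OF integrable_integral[OF ic]] c]]])
    (simp add: pmd)
 qed
 also have "... <= e'^2 * (gn f)^2" using j unfolding de_def by (intro mult_right_mono) auto
 finally have E: "sqrt (itg T (%t. (norm (?E t))^2)) <= e' * gn f"
  using e' G.seminorm_nonneg[of f] by (intro real_le_lsqrt) (auto simp: pmd)
 have "gn (Tn n f) = sqrt (itg T (%t. (norm (trunc_op j de n t f + ?E t))^2))"
  using G.seminorm_nonneg[of "Tn n f"] by (simp add: gn_square[symmetric])
 also have "... <= ?q f + sqrt (itg T (%t. (norm (?E t))^2))" by (rule L2_Minkowski[OF trunc_op_continuous cE])
 finally show ?thesis using E by simp
qed
show ?thesis
 unfolding e'(2)[symmetric]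
proof (rule G.finite_rank_approximation[OF Tn_linear C _ q _ e'(1)])
 show "0 <= ?q f" for f by (intro real_sqrt_ge_zero integral_nonneg ici continuous_norm_sq trunc_op_continuous) simp
 show "(SUM i<k. (?q (f i))^2) <= K" if "G.orthonormal k f" for k f using K that by blast
qed
qed

end

section \<open>Generating functions of Gaussian vectors, and the conclusion\<close>

lemma wsummable_geometric:
assumes "1 < R" "wsummable R f"
shows "EX C. ALL n. cmod (fps_nth f n) <= C * (1 / R) ^ n"
proof -
have "Bseq (%n. cmod (fps_nth f n) * R ^ n)"
 using assms(2) unfolding wsummable_def by (intro convergent_imp_Bseq summable_LIMSEQ_zero[THEN convergentI])
then obtain C where C: "!!n. abs (cmod (fps_nth f n) * R ^ n) <= C" by (auto simp: Bseq_def)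
have "cmod (fps_nth f n) <= C * (1 / R) ^ n" for n
 using C[of n] assms(1) by (simp add: power_divide field_simps)
thus ?thesis by blast
qed

text \<open>A Gaussian density is its square root times its square root: one factor is the weight,
  the other the vector.\<close>

lemma gker_factor:
fixes y :: "real^2"
assumes r: "0 < r" and p: "2 < p"
defines "w \<equiv> %x. sqrt (gker r y x)"
shows "Lp_weight p (sqrt (1 / (n0 * r^2))) w" "to_L2 (%x. of_real (gker r y x)) = mw w (to_L2 (%x. of_real (w x)))"
proof -
let ?c = "1 / (n0 * r^2)"
have le: "gker r y x <= ?c" for x using n0_pos r by (simp add: gker_def divide_right_mono)
have wm[measurable]: "w : bmf borel" unfolding w_def by measurable
have bw: "bweight (sqrt ?c) w" unfolding bweight_def using le gker_nonneg by (auto simp: w_def)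
have "w x powr p <= ?c powr (p / 2 - 1) * gker r y x" for x
proof -
 have "w x powr p = gker r y x powr (p / 2)" using gker_nonneg[of r y x] by (simp add: w_def powr_half_sqrt[symmetric] powr_powr)
 also have "... = gker r y x powr (p / 2 - 1 + 1)" by simp
 also have "... = gker r y x powr (p / 2 - 1) * gker r y x powr 1" by (rule powr_add)
 also have "... <= ?c powr (p / 2 - 1) * gker r y x"
  using p le gker_nonneg[of r y x] by (intro mult_mono powr_mono2) auto
 finally show ?thesis .
qed
hence i: "integrable lborel (%x. w x powr p)"
 by (intro int_bound[OF integrable_mult_right[OF gker_integral(1)[OF r, of y], of "?c powr (p / 2 - 1)"]])
  (auto intro!: always_eventually simp: abs_mult gker_nonneg)
show "Lp_weight p (sqrt ?c) w"
 using p bw i gker_nonneg by unfold_locales (auto simp: w_def)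
have s: "sqint (%x. of_real (w x))"
 unfolding square_integrable_def using gker_integral(1)[OF r, of y] gker_nonneg by (simp add: w_def)
show "to_L2 (%x. of_real (gker r y x)) = mw w (to_L2 (%x. of_real (w x)))"
 unfolding mw_def mulop_to_L2[OF bweight_bdd[OF bw] s] of_real_mult[symmetric] using gker_nonneg by (simp add: w_def)
qed

context schrodinger_Lp begin

definition gauss0 :: "real \<times> (real^2) => L2" where "gauss0 i = orbit 0 ((exp (fst i))^2) (snd i) 0"

lemma total_gauss0: "total gauss0"
unfolding total_def
proof (intro allI impI)
fix F assume F: "ALL i. cinner (gauss0 i) F = 0"
have "cinner F (orbit 0 ((exp (- real n))^2) y 0) = 0" for n y
 using F[rule_format, of "(- real n, y)"] by (subst cinner_commute) (simp add: gauss0_def)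
hence "cinner F (to_L2 h) = 0" if "integrable lborel h" "sqint h" for h
 using LIMSEQ_unique[OF orbit_approx[OF that, of F 0]] by simp
thus "F = 0" by (rule L1_dense)
qed

text \<open>Iterating \<open>S = S0 (1 + Aop)\<close> gives \<open>S^N = S0^N\<close> plus the sum
  of \<open>S0^(N - j) Aop S^j\<close> over \<open>j < N\<close>, and \<open>Tn n\<close> is
  \<open>S0^n Aop\<close>.\<close>

lemma U_power_expansion:
"(U T 0 ^^ N) g = U0 (real N * T) 0 g + (SUM j<N. Tn (N - j) ((U T 0 ^^ j) g))"
proof (induction N)
case (Suc N)
note lin = U0_lin
have step: "U0 T 0 (U0 (real n * T) 0 f) = U0 (real (Suc n) * T) 0 f" for n f
 unfolding U0_power[symmetric] by simp
let ?w = "(U T 0 ^^ N) g"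
have "(U T 0 ^^ Suc N) g = U0 T 0 ?w + U0 T 0 (Aop ?w)" by (simp add: Aop_def lin U0_comp U0_id)
also have "U0 T 0 (Aop ?w) = Tn 1 ?w" by (simp add: Tn_def)
also have "U0 T 0 ?w = U0 (real (Suc N) * T) 0 g + (SUM j<N. Tn (Suc N - j) ((U T 0 ^^ j) g))"
proof -
 have "U0 T 0 (Tn (N - j) f) = Tn (Suc N - j) f" if "j < N" for j f
  unfolding Tn_def step using that by (simp add: Suc_diff_le)
 thus ?thesis unfolding Suc lin step by (intro arg_cong2[where f="(+)"] sum.cong refl) auto
qed
finally show ?case by (simp add: add.assoc)
qed (simp add: U0_id)

lemma gauss0_generating_function:
fixes i defines "g \<equiv> gauss0 i"
shows "EX R>1. EX d. fps_nth d 0 = 1 & wsummable R d & wsummable R (d * Abs_fps (%N. cinner g ((U T 0 ^^ N) g)))"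
proof -
obtain M w h where w: "Lp_weight p M w" and g: "g = mw w h"
 using gker_factor[OF exp_gt_zero p, of "fst i" "snd i"] unfolding g_def gauss0_def orbit_initial[OF exp_gt_zero] by blast
obtain C1 where C1: "0 <= C1" "!!n f. gn (Tn n f) <= C1 * rr ^ n * gn f" using Tn_decay by blast
obtain C2 where C2: "0 <= C2" "!!n. gn (U0 (real n * T) 0 g) <= C2 * rr ^ n" using weighted_vector_decay(1)[OF w g] by blast
obtain C3 where C3: "0 <= C3" "!!n. cmod (cinner g (U0 (real n * T) 0 g)) <= C3 * rr ^ n" using weighted_vector_decay(2)[OF w g] by blast
obtain C4 where C4: "0 <= C4" "!!n f. cmod (cinner g (Tn n f)) <= C4 * rr ^ n * gn f" using weighted_vector_decay(3)[OF w g] by blast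
define C where "C = C1 + C2 + C3 + C4"
have up: "x <= C * rr ^ n" if "x <= D * rr ^ n" "D : {C1, C2, C3, C4}" for x D n
 by (rule order_trans[OF that(1) mult_right_mono]) (use that(2) C1 C2 C3 C4 rr in "auto simp: C_def")
have up': "x <= C * rr ^ n * gn f" if "x <= D * rr ^ n * gn f" "D : {C1, C2, C3, C4}" for x D n f
 by (rule order_trans[OF that(1) mult_right_mono[OF up[OF order_refl that(2)] G.seminorm_nonneg]])
\<comment> \<open>The convolution in \<open>meromorphic_continuation\<close> includes the lag 0,
  which does not occur in \<open>U_power_expansion\<close>; hence the value 0 there.\<close>
define et where "et n f = (if n = 0 then 0 else cinner g (Tn n f))" for n :: nat and f
show ?thesis
proof (rule meromorphic_continuation[where p=gn and T=Tn and r=rr and C=C and et=et and w="%N. (U T 0 ^^ N) g"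
   and b="%n. U0 (real n * T) 0 g" and al="%n. cinner g (U0 (real n * T) 0 g)"])
 show "0 <= C" using C1 C2 C3 C4 by (simp add: C_def)
 show "gn (Tn n f) <= C * rr ^ n * gn f" for n f by (rule up'[OF C1(2)]) simp
 show "gn (U0 (real n * T) 0 g) <= C * rr ^ n" for n by (rule up[OF C2(2)]) simp
 show "cmod (cinner g (U0 (real n * T) 0 g)) <= C * rr ^ n" for n by (rule up[OF C3(2)]) simp
 show "cmod (et n f) <= C * rr ^ n * gn f" for n f
  using up'[OF C4(2), of n f] order_trans[OF norm_ge_zero up'[OF C4(2), of n f]] by (auto simp: et_def)
 show "clin_fun (et n)" for n
  by (simp add: clin_fun_def et_def clinD[OF Tn_linear] cinner.add_right)
 show "cinner g ((U T 0 ^^ N) g) = cinner g (U0 (real N * T) 0 g) + (SUM j<=N. et (N - j) ((U T 0 ^^ j) g))" for N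
 proof -
  have "(SUM j<=N. et (N - j) ((U T 0 ^^ j) g)) = (SUM j<N. et (N - j) ((U T 0 ^^ j) g))"
   by (subst lessThan_Suc_atMost[symmetric], subst sum.lessThan_Suc) (simp add: et_def)
  also have "... = (SUM j<N. cinner g (Tn (N - j) ((U T 0 ^^ j) g)))" by (rule sum.cong) (auto simp: et_def)
  finally show ?thesis by (subst U_power_expansion) (simp add: cinner.add_right cinner.sum_right)
 qed
qed (rule rr G.seminorm_nonneg G.seminorm_triangle G.seminorm_scale Tn_linear Tn_finite_rank U_power_expansion | assumption)+
qed

theorem monodromy_sc_spectrum_empty: "sc_spectrum (U T 0) = {}"
proof (rule sc_spectrum_empty[OF U_unitary total_gauss0])
fix i
obtain R d where R: "1 < R" "fps_nth d 0 = 1" "wsummable R d"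
  "wsummable R (d * Abs_fps (%N. cinner (gauss0 i) ((U T 0 ^^ N) (gauss0 i))))"
 using gauss0_generating_function[of i] by blast
let ?h = "d * Abs_fps (%N. cinner (gauss0 i) ((U T 0 ^^ N) (gauss0 i)))"
obtain C1 where C1: "!!n. cmod (fps_nth d n) <= C1 * (1 / R) ^ n" using wsummable_geometric[OF R(1,3)] by blast
obtain C2 where C2: "!!n. cmod (fps_nth ?h n) <= C2 * (1 / R) ^ n" using wsummable_geometric[OF R(1,4)] by blast
have m: "C * (1 / R) ^ n <= max C1 C2 * (1 / R) ^ n" if "C : {C1, C2}" for C n
 using that R(1) by (intro mult_right_mono) auto
show "EX r C d h. 0 < r & r < 1 & d 0 ~= 0 & (ALL n. cmod (d n) <= C * r ^ n) & (ALL n. cmod (h n) <= C * r ^ n) &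
   (ALL n. h n = (SUM k<=n. d k * cinner (gauss0 i) ((U T 0 ^^ (n - k)) (gauss0 i))))"
proof (intro exI conjI allI)
 show "0 < 1 / R" "1 / R < 1" using R(1) by auto
 show "fps_nth d 0 ~= 0" using R(2) by simp
 show "cmod (fps_nth d n) <= max C1 C2 * (1 / R) ^ n" for n by (rule order_trans[OF C1 m]) simp
 show "cmod (fps_nth ?h n) <= max C1 C2 * (1 / R) ^ n" for n by (rule order_trans[OF C2 m]) simp
 show "fps_nth ?h n = (SUM k<=n. fps_nth d k * cinner (gauss0 i) ((U T 0 ^^ (n - k)) (gauss0 i)))" for n
  by (simp add: fps_mult_nth atMost_atLeast0)
qed
qed

end

theorem corollary1p8:
  fixes m q T \<kappa>\<^sub>0 \<kappa>' c\<^sub>3 C\<^sub>3 c\<^sub>4 C\<^sub>4 :: real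
    and B \<zeta>\<^sub>1 \<zeta>\<^sub>2 :: "real \<Rightarrow> real"
    and A\<^sub>1 A\<^sub>2 A\<^sub>3 A\<^sub>4 :: "int \<Rightarrow> real"
    and V :: "real^2 \<Rightarrow> real"
    and U :: "real \<Rightarrow> real \<Rightarrow> L2 \<Rightarrow> L2"
  assumes "m > 0" and "q \<noteq> 0" and "T > 0"
    and "L_infinity B" and "AE t in lebesgue. B (t + T) = B t"
    and "hill_solution (\<lambda>t. q * B t / (2 * m)) \<zeta>\<^sub>1" and "\<zeta>\<^sub>1 0 = 1" and "deriv \<zeta>\<^sub>1 0 = 0"
    and "hill_solution (\<lambda>t. q * B t / (2 * m)) \<zeta>\<^sub>2" and "\<zeta>\<^sub>2 0 = 0" and "deriv \<zeta>\<^sub>2 0 = 1"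
    and "continuous_on {0..<T} \<zeta>\<^sub>1" and "continuous_on {0..<T} (deriv \<zeta>\<^sub>1)"
    and "continuous_on {0..<T} \<zeta>\<^sub>2" and "continuous_on {0..<T} (deriv \<zeta>\<^sub>2)"
    and "\<forall>N. \<forall>t\<in>{0..<T}. \<zeta>\<^sub>1 (t + of_int N * T) = A\<^sub>1 N * \<zeta>\<^sub>1 t + A\<^sub>2 N * \<zeta>\<^sub>2 t"
    and "\<forall>N. \<forall>t\<in>{0..<T}. \<zeta>\<^sub>2 (t + of_int N * T) = A\<^sub>3 N * \<zeta>\<^sub>1 t + A\<^sub>4 N * \<zeta>\<^sub>2 t"
    and "\<kappa>\<^sub>0 > 0" and "\<kappa>' \<le> \<kappa>\<^sub>0"
    and "0 < c\<^sub>3" and "c\<^sub>3 < C\<^sub>3" and "0 < c\<^sub>4" and "c\<^sub>4 < C\<^sub>4"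
    and "\<forall>\<^sub>F N in sequentially. c\<^sub>3 * exp (\<kappa>\<^sub>0 * real N) \<le> \<bar>A\<^sub>3 (int N)\<bar> \<and>
           \<bar>A\<^sub>3 (int N)\<bar> \<le> C\<^sub>3 * exp (\<kappa>\<^sub>0 * real N)"
    and "\<forall>\<^sub>F N in sequentially. c\<^sub>4 * exp (\<kappa>' * real N) \<le> \<bar>A\<^sub>4 (int N)\<bar> \<and>
           \<bar>A\<^sub>4 (int N)\<bar> \<le> C\<^sub>4 * exp (\<kappa>' * real N)"
    and "continuous_on UNIV V" and "bounded (range V)"
    and "\<exists>p>4. in_Lp p (\<lambda>x. sqrt \<bar>V x\<bar>) \<and> in_Lp p (\<lambda>x. sgn (V x) * sqrt \<bar>V x\<bar>)"
    and "propagator (hamiltonian m q B V) U"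
  shows "sc_spectrum (U T 0) = {}"
proof -
  obtain C where C: "AE t in lebesgue. \<bar>B t\<bar> \<le> C" and Bm: "B \<in> borel_measurable lebesgue"
    using assms(4) by (auto simp: L_infinity_def)
  obtain p where p: "4 < p" "in_Lp p (\<lambda>x. sqrt \<bar>V x\<bar>)" using assms by blast
  obtain Vb where Vb: "\<And>x. \<bar>V x\<bar> \<le> Vb" using \<open>bounded (range V)\<close> by (auto simp: bounded_iff)
  interpret schrodinger_Lp "\<lambda>t. q * B t / (2 * m)" "\<bar>q / (2 * m)\<bar> * C" T \<zeta>\<^sub>1 \<zeta>\<^sub>2 \<kappa>\<^sub>0 c\<^sub>3 m q Vb B V U p
  proof unfold_locales
    show "(\<lambda>t. q * B t / (2 * m)) \<in> borel_measurable lebesgue" using Bm by measurable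
    show "AE t in lebesgue. \<bar>q * B t / (2 * m)\<bar> \<le> \<bar>q / (2 * m)\<bar> * C"
      using C
    proof eventually_elim
      case (elim t)
      have "\<bar>q * B t / (2 * m)\<bar> = \<bar>q / (2 * m)\<bar> * \<bar>B t\<bar>" by (simp add: abs_mult)
      also have "\<dots> \<le> \<bar>q / (2 * m)\<bar> * C" using elim by (intro mult_left_mono) auto
      finally show ?case .
    qed
    show "AE t in lebesgue. q * B (t + T) / (2 * m) = q * B t / (2 * m)" using assms(5) by eventually_elim simp
    show "\<forall>\<^sub>F N in sequentially. c\<^sub>3 * exp (\<kappa>\<^sub>0 * real N) \<le> \<bar>\<zeta>\<^sub>2 (real N * T)\<bar>"
      using assms(24)
    proof eventually_elim
      case (elim N)
      \<comment> \<open>At \<open>t = 0\<close> the initial values 1 and 0 reduce the translation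
        formula to \<open>\<zeta>\<^sub>2 (N * T) = A\<^sub>3 N\<close>, so the lower bound for
        \<open>A\<^sub>3\<close> is the growth that \<open>hyperbolic_field\<close> asks
        for.\<close>
      have "\<zeta>\<^sub>2 (0 + of_int (int N) * T) = A\<^sub>3 (int N) * \<zeta>\<^sub>1 0 + A\<^sub>4 (int N) * \<zeta>\<^sub>2 0" using assms(17)[THEN spec, of "int N", THEN bspec, of 0] \<open>T > 0\<close> by simp
      then show ?case using elim assms by simp
    qed
    show "integrable lborel (\<lambda>x. sqrt \<bar>V x\<bar> powr p)" using p(2) by (simp add: in_Lp_def)
  qed (use assms p Vb in auto)
  show ?thesis by (rule monodromy_sc_spectrum_empty)
qed

end
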